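(* For small groupoids $\mathcal G_1,\mathcal G_2$ let $\mathrm{C}^*_{\max}(\mathcal G_1\times\mathcal G_2)\to \mathrm{C}^*_{\max}\mathcal G_1\otimes_{\max}\mathrm{C}^*_{\max}\mathcal G_2$ be the unique $*$-functor extending $\mathcal G_1\times\mathcal G_2\to \mathrm{C}^*_{\max}\mathcal G_1\otimes_{\max}\mathrm{C}^*_{\max}\mathcal G_2$, $(g_1,g_2)\mapsto g_1\otimes g_2$. This is a natural isomorphism, and together with the canonical identification $\mathbb F\simeq\mathrm{C}^*_{\max}(1)$ (where $1$ is the trivial groupoid) it makes $\mathrm{C}^*_{\max}$ into a (strong) symmetric monoidal functor from $(\mathsf{Gpd},\times,1)$ to $(\mathsf{C}_1^*\mathsf{cat},\otimes_{\max},\mathbb F)$.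
   Context: Let $\mathbb F$ be $\mathbb R$ or $\mathbb C$. All categories have identities and all functors preserve them. An $\mathbb F$-category is a category enriched over $\mathbb F$-vector spaces. A $*$-category is an $\mathbb F$-category with an involution: maps $A(x,y)\to A(y,x)$, $a\mapsto a^*$, which are antilinear, with $(ba)^*=a^*b^*$ and $(a^* )^*=a$. A $*$-functor is an $\mathbb F$-linear functor with $F(a^* )=F(a)^*$. A $\mathrm{C}^*$-category is a $*$-category whose Hom spaces are Banach spaces, with $\|ba\|\le\|b\|\|a\|$, $\|a^*a\|=\|a\|^2$, and such that for each $a\in A(x,y)$ the element $a^*a$ of $A(x,x)$ is positive (its spectrum $\{z\in\mathbb F\mid a^*a-z1_x \text{ not invertible}\}$ lies in $[0,\infty)$). $\mathsf{C}_1^*\mathsf{cat}$ is the category of small $\mathrm{C}^*$-categories and $*$-functors. $\mathsf{Gpd}$ is the category of small (discrete) groupoids and functors. An arrow $a\in A(x,y)$ is unitary if $a^*a=1_x$ and $aa^*=1_y$. For a small groupoid $\mathcal G$, the maximal groupoid $\mathrm{C}^*$-category $\mathrm{C}^*_{\max}\mathcal G$, with $\rho_{\mathcal G}\colon\mathcal G\to\mathrm{C}^*_{\max}\mathcal G$, is the universal functor from $\mathcal G$ to a $\mathrm{C}^*$-category mapping all arrows to unitaries: any such functor into a $\mathrm{C}^*$-category factors uniquely through $\rho_{\mathcal G}$ by a $*$-functor. Concretely it is the completion of the $*$-category $\mathbb F\mathcal G$ (objects $\mathrm{ob}\,\mathcal G$, Hom spaces free on $\mathcal G(x,x')$, involution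 $(\sum z_ig_i)^*=\sum\overline{z_i}g_i^{-1}$) with respect to the supremum of the norms $\|\rho(\cdot)\|$ over all $*$-functors $\rho$ from $\mathbb F\mathcal G$ to $\mathrm{C}^*$-categories. For $*$-categories $A,B$ the algebraic tensor product $A\otimes_{\mathbb F}B$ has objects $\mathrm{ob} A\times\mathrm{ob} B$, Hom spaces $A(x,x')\otimes_{\mathbb F}B(y,y')$ and involution $(a\otimes b)^*=a^*\otimes b^*$. For small $\mathrm{C}^*$-categories $A,B$, the maximal tensor product $A\otimes_{\max}B$ is the completion of $A\otimes_{\mathbb F}B$ with respect to $\|f\|_\infty=\sup_\rho\|\rho(f)\|$ over all $*$-functors $\rho$ from $A\otimes_{\mathbb F}B$ to $\mathrm{C}^*$-categories; every $*$-functor from $A\otimes_{\mathbb F}B$ to a $\mathrm{C}^*$-category extends uniquely to it. It makes $\mathsf{C}_1^*\mathsf{cat}$ a symmetric monoidal category with unit $\mathbb F$ (the $\mathrm{C}^*$-category with one object and endomorphism algebra $\mathbb F$), with structural isomorphisms induced from those of $\otimes_{\mathbb F}$. *)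

theory Defs
  imports Complex_Main "HOL-Library.Poly_Mapping"
begin

section \<open>The scalar field\<close>

text \<open>The last axiom leaves only the real and the complex numbers, with their usual conjugation
  and absolute value.\<close>

class real_or_complex = real_normed_field +
  fixes conjg :: "'a \<Rightarrow> 'a"
  assumes conjg_real: "conjg (r *\<^sub>R 1) = r *\<^sub>R 1"
    and conjg_add: "conjg (x + y) = conjg x + conjg y"
    and conjg_mult: "conjg (x * y) = conjg x * conjg y"
    and mult_conjg: "x * conjg x = (norm x)\<^sup>2 *\<^sub>R 1"
    and real_or_complex:
      "(\<forall>x. \<exists>a. x = a *\<^sub>R 1) \<or>
       (\<exists>i. i * i = - 1 \<and> conjg i = - i \<and> (\<forall>x. \<exists>a b. x = a *\<^sub>R 1 + b *\<^sub>R i))"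

instantiation real :: real_or_complex
begin
definition conjg_real :: "real \<Rightarrow> real" where "conjg_real x = x"
instance by standard (auto simp: conjg_real_def power2_eq_square)
end

instantiation complex :: real_or_complex
begin
definition conjg_complex :: "complex \<Rightarrow> complex" where "conjg_complex = cnj"
instance
proof
  fix x :: complex
  show "x * conjg x = (norm x)\<^sup>2 *\<^sub>R 1"
    by (simp add: conjg_complex_def complex_norm_square[symmetric] scaleR_conv_of_real
        del: of_real_power)
  have "\<exists>a b. y = a *\<^sub>R 1 + b *\<^sub>R \<i>" for y
    by (rule exI[of _ "Re y"], rule exI[of _ "Im y"]) (simp add: complex_eq_iff)
  then show "(\<forall>x::complex. \<exists>a. x = a *\<^sub>R 1) \<or>
       (\<exists>i::complex. i * i = - 1 \<and> conjg i = - i \<and> (\<forall>x. \<exists>a b. x = a *\<^sub>R 1 + b *\<^sub>R i))"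
    by (intro disjI2 exI[of _ \<i>]) (simp add: conjg_complex_def)
qed (auto simp: conjg_complex_def)
end


section \<open>Categories and groupoids\<close>

text \<open>All structure is indexed by objects, so Hom sets need not be disjoint.
  \<open>Cmp C x y z g f\<close> is the composite of \<open>f \<in> Hom C x y\<close> with \<open>g \<in> Hom C y z\<close>.
  Smallness is automatic: objects and arrows form sets in some type.\<close>

record ('o, 'a) cat =
  Ob :: "'o set"
  Hom :: "'o \<Rightarrow> 'o \<Rightarrow> 'a set"
  Idt :: "'o \<Rightarrow> 'a"
  Cmp :: "'o \<Rightarrow> 'o \<Rightarrow> 'o \<Rightarrow> 'a \<Rightarrow> 'a \<Rightarrow> 'a"

locale category =
  fixes C :: "('o, 'a, 'z) cat_scheme"
  assumes id_closed: "x \<in> Ob C \<Longrightarrow> Idt C x \<in> Hom C x x"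
    and comp_closed: "\<lbrakk>x \<in> Ob C; y \<in> Ob C; z \<in> Ob C; f \<in> Hom C x y; g \<in> Hom C y z\<rbrakk>
      \<Longrightarrow> Cmp C x y z g f \<in> Hom C x z"
    and comp_id_right: "\<lbrakk>x \<in> Ob C; y \<in> Ob C; f \<in> Hom C x y\<rbrakk> \<Longrightarrow> Cmp C x x y f (Idt C x) = f"
    and comp_id_left: "\<lbrakk>x \<in> Ob C; y \<in> Ob C; f \<in> Hom C x y\<rbrakk> \<Longrightarrow> Cmp C x y y (Idt C y) f = f"
    and comp_assoc: "\<lbrakk>w \<in> Ob C; x \<in> Ob C; y \<in> Ob C; z \<in> Ob C;
        f \<in> Hom C w x; g \<in> Hom C x y; h \<in> Hom C y z\<rbrakk>
      \<Longrightarrow> Cmp C w y z h (Cmp C w x y g f) = Cmp C w x z (Cmp C x y z h g) f"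

definition is_inverse ::
    "('o, 'a, 'z) cat_scheme \<Rightarrow> 'o \<Rightarrow> 'o \<Rightarrow> 'a \<Rightarrow> 'a \<Rightarrow> bool" where
  "is_inverse C x y f g \<longleftrightarrow> g \<in> Hom C y x \<and>
     Cmp C x y x g f = Idt C x \<and> Cmp C y x y f g = Idt C y"

locale groupoid = category G for G :: "('o, 'a, 'z) cat_scheme" +
  assumes ex_inverse: "\<lbrakk>x \<in> Ob G; y \<in> Ob G; f \<in> Hom G x y\<rbrakk> \<Longrightarrow> \<exists>g. is_inverse G x y f g"

definition inverse_arr :: "('o, 'a, 'z) cat_scheme \<Rightarrow> 'o \<Rightarrow> 'o \<Rightarrow> 'a \<Rightarrow> 'a" where
  "inverse_arr C x y f = (THE g. is_inverse C x y f g)"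

record ('o, 'a, 'p, 'b) fnct =
  FOb :: "'o \<Rightarrow> 'p"
  FArr :: "'o \<Rightarrow> 'o \<Rightarrow> 'a \<Rightarrow> 'b"

definition is_functor ::
    "('o, 'a, 'y) cat_scheme \<Rightarrow> ('p, 'b, 'z) cat_scheme \<Rightarrow> ('o, 'a, 'p, 'b) fnct \<Rightarrow> bool" where
  "is_functor C D F \<longleftrightarrow>
     (\<forall>x\<in>Ob C. FOb F x \<in> Ob D) \<and>
     (\<forall>x\<in>Ob C. \<forall>y\<in>Ob C. \<forall>f\<in>Hom C x y. FArr F x y f \<in> Hom D (FOb F x) (FOb F y)) \<and>
     (\<forall>x\<in>Ob C. FArr F x x (Idt C x) = Idt D (FOb F x)) \<and>
     (\<forall>x\<in>Ob C. \<forall>y\<in>Ob C. \<forall>z\<in>Ob C. \<forall>f\<in>Hom C x y. \<forall>g\<in>Hom C y z.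
        FArr F x z (Cmp C x y z g f) =
        Cmp D (FOb F x) (FOb F y) (FOb F z) (FArr F y z g) (FArr F x y f))"

text \<open>Equality of functors on \<open>C\<close>; the underlying HOL functions are unconstrained elsewhere.\<close>

definition fun_eq ::
    "('o, 'a, 'z) cat_scheme \<Rightarrow> ('o, 'a, 'p, 'b) fnct \<Rightarrow> ('o, 'a, 'p, 'b) fnct \<Rightarrow> bool" where
  "fun_eq C F G \<longleftrightarrow>
     (\<forall>x\<in>Ob C. FOb F x = FOb G x) \<and>
     (\<forall>x\<in>Ob C. \<forall>y\<in>Ob C. \<forall>f\<in>Hom C x y. FArr F x y f = FArr G x y f)"

definition fid :: "('o, 'a, 'o, 'a) fnct" where
  "fid = \<lparr>FOb = (\<lambda>x. x), FArr = (\<lambda>x y f. f)\<rparr>"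

definition fcomp :: "('p, 'b, 'q, 'c) fnct \<Rightarrow> ('o, 'a, 'p, 'b) fnct \<Rightarrow> ('o, 'a, 'q, 'c) fnct"
    (infixr "\<circ>\<^sub>F" 55) where
  "G \<circ>\<^sub>F F = \<lparr>FOb = (\<lambda>x. FOb G (FOb F x)),
              FArr = (\<lambda>x y f. FArr G (FOb F x) (FOb F y) (FArr F x y f))\<rparr>"

definition prod_cat ::
    "('o, 'a, 'y) cat_scheme \<Rightarrow> ('p, 'b, 'z) cat_scheme \<Rightarrow> ('o \<times> 'p, 'a \<times> 'b) cat"
    (infixr "\<times>\<^sub>C" 80) where
  "C \<times>\<^sub>C D = \<lparr>Ob = Ob C \<times> Ob D,
     Hom = (\<lambda>(x, y) (x', y'). Hom C x x' \<times> Hom D y y'),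
     Idt = (\<lambda>(x, y). (Idt C x, Idt D y)),
     Cmp = (\<lambda>(x, y) (x', y') (x'', y'') (g, k) (f, h). (Cmp C x x' x'' g f, Cmp D y y' y'' k h))\<rparr>"

definition prod_fun :: "('o, 'a, 'o2, 'a2) fnct \<Rightarrow> ('p, 'b, 'p2, 'b2) fnct
      \<Rightarrow> ('o \<times> 'p, 'a \<times> 'b, 'o2 \<times> 'p2, 'a2 \<times> 'b2) fnct" (infixr "\<times>\<^sub>F" 80) where
  "F \<times>\<^sub>F G = \<lparr>FOb = (\<lambda>(x, y). (FOb F x, FOb G y)),
     FArr = (\<lambda>(x, y) (x', y') (f, g). (FArr F x x' f, FArr G y y' g))\<rparr>"

definition one_gpd :: "(unit, unit) cat" where
  "one_gpd = \<lparr>Ob = {()}, Hom = (\<lambda>_ _. {()}), Idt = (\<lambda>_. ()), Cmp = (\<lambda>_ _ _ _ _. ())\<rparr>"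

text \<open>Structural functors of the cartesian product: \<open>((C \<times> D) \<times> E) \<rightarrow> (C \<times> (D \<times> E))\<close>,
  \<open>1 \<times> C \<rightarrow> C\<close>, \<open>C \<times> 1 \<rightarrow> C\<close> and \<open>C \<times> D \<rightarrow> D \<times> C\<close>.\<close>

definition prod_assoc ::
    "(('o \<times> 'p) \<times> 'q, ('a \<times> 'b) \<times> 'c, 'o \<times> ('p \<times> 'q), 'a \<times> ('b \<times> 'c)) fnct" where
  "prod_assoc = \<lparr>FOb = (\<lambda>((x, y), z). (x, (y, z))), FArr = (\<lambda>_ _ ((f, g), h). (f, (g, h)))\<rparr>"

definition prod_lunit :: "(unit \<times> 'o, unit \<times> 'a, 'o, 'a) fnct" where
  "prod_lunit = \<lparr>FOb = snd, FArr = (\<lambda>_ _. snd)\<rparr>"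

definition prod_runit :: "('o \<times> unit, 'a \<times> unit, 'o, 'a) fnct" where
  "prod_runit = \<lparr>FOb = fst, FArr = (\<lambda>_ _. fst)\<rparr>"

definition prod_swap :: "('o \<times> 'p, 'a \<times> 'b, 'p \<times> 'o, 'b \<times> 'a) fnct" where
  "prod_swap = \<lparr>FOb = (\<lambda>(x, y). (y, x)), FArr = (\<lambda>_ _ (f, g). (g, f))\<rparr>"


section \<open>$*$-categories and C*-categories\<close>

record ('o, 'a, 'f) star_cat = "('o, 'a) cat" +
  Add :: "'o \<Rightarrow> 'o \<Rightarrow> 'a \<Rightarrow> 'a \<Rightarrow> 'a"
  Zer :: "'o \<Rightarrow> 'o \<Rightarrow> 'a"
  Scl :: "'o \<Rightarrow> 'o \<Rightarrow> 'f \<Rightarrow> 'a \<Rightarrow> 'a"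
  Str :: "'o \<Rightarrow> 'o \<Rightarrow> 'a \<Rightarrow> 'a"

record ('o, 'a, 'f) cstar_cat = "('o, 'a, 'f) star_cat" +
  Nrm :: "'o \<Rightarrow> 'o \<Rightarrow> 'a \<Rightarrow> real"

locale vect_space =
  fixes V :: "'a set" and add :: "'a \<Rightarrow> 'a \<Rightarrow> 'a" and zero :: 'a and scl :: "'f::field \<Rightarrow> 'a \<Rightarrow> 'a"
  assumes zero_closed: "zero \<in> V"
    and add_closed: "\<lbrakk>a \<in> V; b \<in> V\<rbrakk> \<Longrightarrow> add a b \<in> V"
    and scl_closed: "a \<in> V \<Longrightarrow> scl c a \<in> V"
    and add_assoc: "\<lbrakk>u \<in> V; v \<in> V; w \<in> V\<rbrakk> \<Longrightarrow> add (add u v) w = add u (add v w)"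
    and add_commute: "\<lbrakk>a \<in> V; b \<in> V\<rbrakk> \<Longrightarrow> add a b = add b a"
    and add_zero: "a \<in> V \<Longrightarrow> add a zero = a"
    and ex_neg: "a \<in> V \<Longrightarrow> \<exists>b\<in>V. add a b = zero"
    and scl_add: "\<lbrakk>a \<in> V; b \<in> V\<rbrakk> \<Longrightarrow> scl c (add a b) = add (scl c a) (scl c b)"
    and add_scl: "a \<in> V \<Longrightarrow> scl (c + d) a = add (scl c a) (scl d a)"
    and scl_scl: "a \<in> V \<Longrightarrow> scl c (scl d a) = scl (c * d) a"
    and scl_one: "a \<in> V \<Longrightarrow> scl 1 a = a"

locale star_category = category A for A :: "('o, 'a, 'f::real_or_complex, 'z) star_cat_scheme" +
  assumes hom_vect_space: "\<lbrakk>x \<in> Ob A; y \<in> Ob A\<rbrakk>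
      \<Longrightarrow> vect_space (Hom A x y) (Add A x y) (Zer A x y) (Scl A x y)"
    and comp_add_right: "\<lbrakk>x \<in> Ob A; y \<in> Ob A; z \<in> Ob A; a \<in> Hom A x y; a' \<in> Hom A x y; b \<in> Hom A y z\<rbrakk>
      \<Longrightarrow> Cmp A x y z b (Add A x y a a') = Add A x z (Cmp A x y z b a) (Cmp A x y z b a')"
    and comp_add_left: "\<lbrakk>x \<in> Ob A; y \<in> Ob A; z \<in> Ob A; a \<in> Hom A x y; b \<in> Hom A y z; b' \<in> Hom A y z\<rbrakk>
      \<Longrightarrow> Cmp A x y z (Add A y z b b') a = Add A x z (Cmp A x y z b a) (Cmp A x y z b' a)"
    and comp_scl_right: "\<lbrakk>x \<in> Ob A; y \<in> Ob A; z \<in> Ob A; a \<in> Hom A x y; b \<in> Hom A y z\<rbrakk>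
      \<Longrightarrow> Cmp A x y z b (Scl A x y c a) = Scl A x z c (Cmp A x y z b a)"
    and comp_scl_left: "\<lbrakk>x \<in> Ob A; y \<in> Ob A; z \<in> Ob A; a \<in> Hom A x y; b \<in> Hom A y z\<rbrakk>
      \<Longrightarrow> Cmp A x y z (Scl A y z c b) a = Scl A x z c (Cmp A x y z b a)"
    and star_closed: "\<lbrakk>x \<in> Ob A; y \<in> Ob A; a \<in> Hom A x y\<rbrakk> \<Longrightarrow> Str A x y a \<in> Hom A y x"
    and star_add: "\<lbrakk>x \<in> Ob A; y \<in> Ob A; a \<in> Hom A x y; b \<in> Hom A x y\<rbrakk>
      \<Longrightarrow> Str A x y (Add A x y a b) = Add A y x (Str A x y a) (Str A x y b)"
    and star_scl: "\<lbrakk>x \<in> Ob A; y \<in> Ob A; a \<in> Hom A x y\<rbrakk>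
      \<Longrightarrow> Str A x y (Scl A x y c a) = Scl A y x (conjg c) (Str A x y a)"
    and star_comp: "\<lbrakk>x \<in> Ob A; y \<in> Ob A; z \<in> Ob A; a \<in> Hom A x y; b \<in> Hom A y z\<rbrakk>
      \<Longrightarrow> Str A x z (Cmp A x y z b a) = Cmp A z y x (Str A x y a) (Str A y z b)"
    and star_star: "\<lbrakk>x \<in> Ob A; y \<in> Ob A; a \<in> Hom A x y\<rbrakk> \<Longrightarrow> Str A y x (Str A x y a) = a"

definition Sub ::
    "('o, 'a, 'f::field, 'z) star_cat_scheme \<Rightarrow> 'o \<Rightarrow> 'o \<Rightarrow> 'a \<Rightarrow> 'a \<Rightarrow> 'a" where
  "Sub A x y a b = Add A x y a (Scl A x y (- 1) b)"

definition spectrum ::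
    "('o, 'a, 'f::field, 'z) star_cat_scheme \<Rightarrow> 'o \<Rightarrow> 'a \<Rightarrow> 'f set" where
  "spectrum A x a =
     {z. \<not> (\<exists>b. is_inverse A x x (Sub A x x a (Scl A x x z (Idt A x))) b)}"

text \<open>The (semi)norm is passed separately because the sequences below are also needed for
  seminorms on $*$-categories that carry no norm of their own.\<close>

definition hom_Cauchy :: "('o, 'a, 'f::field, 'z) star_cat_scheme \<Rightarrow> ('o \<Rightarrow> 'o \<Rightarrow> 'a \<Rightarrow> real)
      \<Rightarrow> 'o \<Rightarrow> 'o \<Rightarrow> (nat \<Rightarrow> 'a) \<Rightarrow> bool" where
  "hom_Cauchy A N x y s \<longleftrightarrow> (\<forall>n. s n \<in> Hom A x y) \<and>
     (\<forall>e>0. \<exists>M. \<forall>m\<ge>M. \<forall>n\<ge>M. N x y (Sub A x y (s m) (s n)) < e)"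

locale cstar_category = star_category A
  for A :: "('o, 'a, 'f::real_or_complex, 'z) cstar_cat_scheme" +
  assumes norm_eq_zero: "\<lbrakk>x \<in> Ob A; y \<in> Ob A; a \<in> Hom A x y\<rbrakk>
      \<Longrightarrow> Nrm A x y a = 0 \<longleftrightarrow> a = Zer A x y"
    and norm_scl: "\<lbrakk>x \<in> Ob A; y \<in> Ob A; a \<in> Hom A x y\<rbrakk>
      \<Longrightarrow> Nrm A x y (Scl A x y c a) = norm c * Nrm A x y a"
    and norm_triangle: "\<lbrakk>x \<in> Ob A; y \<in> Ob A; a \<in> Hom A x y; b \<in> Hom A x y\<rbrakk>
      \<Longrightarrow> Nrm A x y (Add A x y a b) \<le> Nrm A x y a + Nrm A x y b"
    and hom_complete: "\<lbrakk>x \<in> Ob A; y \<in> Ob A; hom_Cauchy A (Nrm A) x y s\<rbrakk>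
      \<Longrightarrow> \<exists>a\<in>Hom A x y. (\<lambda>n. Nrm A x y (Sub A x y (s n) a)) \<longlonglongrightarrow> 0"
    and norm_comp: "\<lbrakk>x \<in> Ob A; y \<in> Ob A; z \<in> Ob A; a \<in> Hom A x y; b \<in> Hom A y z\<rbrakk>
      \<Longrightarrow> Nrm A x z (Cmp A x y z b a) \<le> Nrm A y z b * Nrm A x y a"
    and cstar_identity: "\<lbrakk>x \<in> Ob A; y \<in> Ob A; a \<in> Hom A x y\<rbrakk>
      \<Longrightarrow> Nrm A x x (Cmp A x y x (Str A x y a) a) = (Nrm A x y a)\<^sup>2"
    and star_comp_positive: "\<lbrakk>x \<in> Ob A; y \<in> Ob A; a \<in> Hom A x y\<rbrakk>
      \<Longrightarrow> spectrum A x (Cmp A x y x (Str A x y a) a) \<subseteq> of_real ` {0..}"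

definition star_functor :: "('o, 'a, 'f::real_or_complex, 'y) star_cat_scheme
      \<Rightarrow> ('p, 'b, 'f, 'z) star_cat_scheme \<Rightarrow> ('o, 'a, 'p, 'b) fnct \<Rightarrow> bool" where
  "star_functor A B F \<longleftrightarrow> is_functor A B F \<and>
     (\<forall>x\<in>Ob A. \<forall>y\<in>Ob A. \<forall>a\<in>Hom A x y.
        (\<forall>b\<in>Hom A x y. FArr F x y (Add A x y a b) =
             Add B (FOb F x) (FOb F y) (FArr F x y a) (FArr F x y b)) \<and>
        (\<forall>c. FArr F x y (Scl A x y c a) = Scl B (FOb F x) (FOb F y) c (FArr F x y a)) \<and>
        FArr F y x (Str A x y a) = Str B (FOb F x) (FOb F y) (FArr F x y a))"

definition unitary :: "('o, 'a, 'f, 'z) star_cat_scheme \<Rightarrow> 'o \<Rightarrow> 'o \<Rightarrow> 'a \<Rightarrow> bool" where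
  "unitary A x y a \<longleftrightarrow> a \<in> Hom A x y \<and>
     Cmp A x y x (Str A x y a) a = Idt A x \<and> Cmp A y x y a (Str A x y a) = Idt A y"

definition unitary_functor :: "('o, 'g, 'y) cat_scheme
      \<Rightarrow> ('p, 'b, 'f::real_or_complex, 'z) star_cat_scheme \<Rightarrow> ('o, 'g, 'p, 'b) fnct \<Rightarrow> bool" where
  "unitary_functor G A F \<longleftrightarrow> is_functor G A F \<and>
     (\<forall>x\<in>Ob G. \<forall>y\<in>Ob G. \<forall>g\<in>Hom G x y. unitary A (FOb F x) (FOb F y) (FArr F x y g))"

text \<open>The category of small C*-categories: its arrows, its isomorphisms, and equality of two
  parallel arrows.\<close>

definition cstar_arrow :: "('o, 'a, 'f::real_or_complex) cstar_cat \<Rightarrow> ('p, 'b, 'f) cstar_cat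
      \<Rightarrow> ('o, 'a, 'p, 'b) fnct \<Rightarrow> bool" where
  "cstar_arrow A B F \<longleftrightarrow> cstar_category A \<and> cstar_category B \<and> star_functor A B F"

definition is_inverse_functor :: "('o, 'a, 'f::real_or_complex) cstar_cat
      \<Rightarrow> ('p, 'b, 'f) cstar_cat \<Rightarrow> ('o, 'a, 'p, 'b) fnct \<Rightarrow> ('p, 'b, 'o, 'a) fnct \<Rightarrow> bool" where
  "is_inverse_functor A B F G \<longleftrightarrow>
     cstar_arrow B A G \<and> fun_eq A (G \<circ>\<^sub>F F) fid \<and> fun_eq B (F \<circ>\<^sub>F G) fid"

definition cstar_iso :: "('o, 'a, 'f::real_or_complex) cstar_cat \<Rightarrow> ('p, 'b, 'f) cstar_cat
      \<Rightarrow> ('o, 'a, 'p, 'b) fnct \<Rightarrow> bool" where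
  "cstar_iso A B F \<longleftrightarrow> cstar_arrow A B F \<and> (\<exists>G. is_inverse_functor A B F G)"

definition inverse_functor :: "('o, 'a, 'f::real_or_complex) cstar_cat
      \<Rightarrow> ('p, 'b, 'f) cstar_cat \<Rightarrow> ('o, 'a, 'p, 'b) fnct \<Rightarrow> ('p, 'b, 'o, 'a) fnct" where
  "inverse_functor A B F = (SOME G. is_inverse_functor A B F G)"

definition cstar_arrow_eq :: "('o, 'a, 'f::real_or_complex) cstar_cat \<Rightarrow> ('p, 'b, 'f) cstar_cat
      \<Rightarrow> ('o, 'a, 'p, 'b) fnct \<Rightarrow> ('o, 'a, 'p, 'b) fnct \<Rightarrow> bool" where
  "cstar_arrow_eq A B F G \<longleftrightarrow> cstar_arrow A B F \<and> cstar_arrow A B G \<and> fun_eq A F G"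


section \<open>Completion in the maximal C*-norm\<close>

text \<open>A definition cannot range over C*-categories in all types, but those with objects in
  \<open>'o\<close> and arrows in \<open>(nat \<Rightarrow> 'a) set\<close> give the same supremum.  Indeed, let \<open>F\<close> be a
  $*$-functor from \<open>A\<close> to any C*-category \<open>B\<close>, and let \<open>A'\<close> have the objects of \<open>A\<close> and as
  Hom spaces the closures of the \<open>F (A(x, y))\<close> in \<open>B(F x, F y)\<close>.  This is a C*-category through
  which \<open>F\<close> factors isometrically, and its arrows correspond to classes of sequences in
  \<open>A(x, y)\<close> that are Cauchy for the seminorm \<open>a \<mapsto> \<parallel>F a\<parallel>\<close>.  The supremum is a real one; it is
  only used for $*$-categories where it is finite.\<close>

definition max_norm :: "('o, 'a, 'f::real_or_complex, 'z) star_cat_scheme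
      \<Rightarrow> 'o \<Rightarrow> 'o \<Rightarrow> 'a \<Rightarrow> real" where
  "max_norm A x y a =
     (SUP (B, F) \<in> {(B :: ('o, (nat \<Rightarrow> 'a) set, 'f) cstar_cat, F).
                      cstar_category B \<and> star_functor A B F}.
        Nrm B (FOb F x) (FOb F y) (FArr F x y a))"

definition cauchy_class :: "('o, 'a, 'f::field, 'z) star_cat_scheme
      \<Rightarrow> ('o \<Rightarrow> 'o \<Rightarrow> 'a \<Rightarrow> real) \<Rightarrow> 'o \<Rightarrow> 'o \<Rightarrow> (nat \<Rightarrow> 'a) \<Rightarrow> (nat \<Rightarrow> 'a) set" where
  "cauchy_class A N x y s =
     {t. hom_Cauchy A N x y t \<and> (\<lambda>n. N x y (Sub A x y (s n) (t n))) \<longlonglongrightarrow> 0}"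

definition rep :: "'s set \<Rightarrow> 's" where
  "rep X = (SOME s. s \<in> X)"

definition completion :: "('o, 'a, 'f::field, 'z) star_cat_scheme
      \<Rightarrow> ('o \<Rightarrow> 'o \<Rightarrow> 'a \<Rightarrow> real) \<Rightarrow> ('o, (nat \<Rightarrow> 'a) set, 'f) cstar_cat" where
  "completion A N = \<lparr>Ob = Ob A,
     Hom = (\<lambda>x y. cauchy_class A N x y ` {s. hom_Cauchy A N x y s}),
     Idt = (\<lambda>x. cauchy_class A N x x (\<lambda>_. Idt A x)),
     Cmp = (\<lambda>x y z Y X. cauchy_class A N x z (\<lambda>n. Cmp A x y z (rep Y n) (rep X n))),
     Add = (\<lambda>x y X Y. cauchy_class A N x y (\<lambda>n. Add A x y (rep X n) (rep Y n))),
     Zer = (\<lambda>x y. cauchy_class A N x y (\<lambda>_. Zer A x y)),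
     Scl = (\<lambda>x y c X. cauchy_class A N x y (\<lambda>n. Scl A x y c (rep X n))),
     Str = (\<lambda>x y X. cauchy_class A N y x (\<lambda>n. Str A x y (rep X n))),
     Nrm = (\<lambda>x y X. lim (\<lambda>n. N x y (rep X n)))\<rparr>"

definition to_completion :: "('o, 'a, 'f::field, 'z) star_cat_scheme
      \<Rightarrow> ('o \<Rightarrow> 'o \<Rightarrow> 'a \<Rightarrow> real) \<Rightarrow> ('o, 'a, 'o, (nat \<Rightarrow> 'a) set) fnct" where
  "to_completion A N =
     \<lparr>FOb = (\<lambda>x. x), FArr = (\<lambda>x y a. cauchy_class A N x y (\<lambda>_. a))\<rparr>"


section \<open>Maximal groupoid C*-categories\<close>

text \<open>The free vector space on a set \<open>S\<close> of elements of \<open>'k\<close> consists of the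
  \<open>u :: 'k \<Rightarrow>\<^sub>0 'f\<close> with \<open>keys u \<subseteq> S\<close>.\<close>

definition pm_scale :: "'f::field \<Rightarrow> ('k \<Rightarrow>\<^sub>0 'f) \<Rightarrow> ('k \<Rightarrow>\<^sub>0 'f)" where
  "pm_scale c u = Poly_Mapping.map ((*) c) u"

definition gpd_star_cat :: "'f::real_or_complex itself \<Rightarrow> ('o, 'g, 'z) cat_scheme
      \<Rightarrow> ('o, 'g \<Rightarrow>\<^sub>0 'f, 'f) star_cat" where
  "gpd_star_cat K G = \<lparr>Ob = Ob G,
     Hom = (\<lambda>x y. {u. Poly_Mapping.keys u \<subseteq> Hom G x y}),
     Idt = (\<lambda>x. Poly_Mapping.single (Idt G x) 1),
     Cmp = (\<lambda>x y z v u. \<Sum>h\<in>Poly_Mapping.keys v. \<Sum>g\<in>Poly_Mapping.keys u.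
        Poly_Mapping.single (Cmp G x y z h g) (Poly_Mapping.lookup v h * Poly_Mapping.lookup u g)),
     Add = (\<lambda>x y. (+)),
     Zer = (\<lambda>x y. 0),
     Scl = (\<lambda>x y. pm_scale),
     Str = (\<lambda>x y u. \<Sum>g\<in>Poly_Mapping.keys u.
        Poly_Mapping.single (inverse_arr G x y g) (conjg (Poly_Mapping.lookup u g)))\<rparr>"

definition Cmax :: "'f::real_or_complex itself \<Rightarrow> ('o, 'g, 'z) cat_scheme
      \<Rightarrow> ('o, (nat \<Rightarrow> 'g \<Rightarrow>\<^sub>0 'f) set, 'f) cstar_cat" where
  "Cmax K G = completion (gpd_star_cat K G) (max_norm (gpd_star_cat K G))"

definition gpd_rho :: "'f::real_or_complex itself \<Rightarrow> ('o, 'g, 'z) cat_scheme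
      \<Rightarrow> ('o, 'g, 'o, (nat \<Rightarrow> 'g \<Rightarrow>\<^sub>0 'f) set) fnct" where
  "gpd_rho K G = to_completion (gpd_star_cat K G) (max_norm (gpd_star_cat K G)) \<circ>\<^sub>F
     \<lparr>FOb = (\<lambda>x. x), FArr = (\<lambda>x y g. Poly_Mapping.single g 1)\<rparr>"

text \<open>The $*$-functor out of \<open>Cmax K G\<close> that extends a functor \<open>F\<close> from \<open>G\<close> to \<open>B\<close> mapping all
  arrows to unitaries.  By the universal property it exists and is unique on \<open>Cmax K G\<close>.\<close>

definition Cmax_extend :: "'f::real_or_complex itself \<Rightarrow> ('o, 'g, 'z) cat_scheme
      \<Rightarrow> ('p, 'b, 'f) cstar_cat \<Rightarrow> ('o, 'g, 'p, 'b) fnct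
      \<Rightarrow> ('o, (nat \<Rightarrow> 'g \<Rightarrow>\<^sub>0 'f) set, 'p, 'b) fnct" where
  "Cmax_extend K G B F =
     (SOME \<Phi>. star_functor (Cmax K G) B \<Phi> \<and> fun_eq G (\<Phi> \<circ>\<^sub>F gpd_rho K G) F)"

definition Cmax_fun :: "'f::real_or_complex itself \<Rightarrow> ('o, 'g, 'y) cat_scheme
      \<Rightarrow> ('p, 'h, 'z) cat_scheme \<Rightarrow> ('o, 'g, 'p, 'h) fnct
      \<Rightarrow> ('o, (nat \<Rightarrow> 'g \<Rightarrow>\<^sub>0 'f) set, 'p, (nat \<Rightarrow> 'h \<Rightarrow>\<^sub>0 'f) set) fnct" where
  "Cmax_fun K G H \<phi> = Cmax_extend K G (Cmax K H) (gpd_rho K H \<circ>\<^sub>F \<phi>)"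


section \<open>Maximal tensor products\<close>

text \<open>The tensor product of \<open>A(x, x')\<close> and \<open>B(y, y')\<close> is the free vector space on
  \<open>A(x, x') \<times> B(y, y')\<close> modulo the span of the bilinearity relations.  Pairs of objects
  \<open>p = (x, y)\<close> and \<open>q = (x', y')\<close> are accessed by projections.\<close>

definition tensor_rels :: "('o, 'a, 'f::field, 'y) star_cat_scheme
      \<Rightarrow> ('p, 'b, 'f, 'z) star_cat_scheme \<Rightarrow> 'o \<times> 'p \<Rightarrow> 'o \<times> 'p \<Rightarrow> ('a \<times> 'b \<Rightarrow>\<^sub>0 'f) set" where
  "tensor_rels A B p q =
     (let V = Hom A (fst p) (fst q); W = Hom B (snd p) (snd q);
          addA = Add A (fst p) (fst q); addB = Add B (snd p) (snd q);
          sclA = Scl A (fst p) (fst q); sclB = Scl B (snd p) (snd q);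
          e = (\<lambda>a b. Poly_Mapping.single (a, b) 1)
      in {e (addA a a') b - e a b - e a' b | a a' b. a \<in> V \<and> a' \<in> V \<and> b \<in> W} \<union>
         {e a (addB b b') - e a b - e a b' | a b b'. a \<in> V \<and> b \<in> W \<and> b' \<in> W} \<union>
         {e (sclA c a) b - pm_scale c (e a b) | c a b. a \<in> V \<and> b \<in> W} \<union>
         {e a (sclB c b) - pm_scale c (e a b) | c a b. a \<in> V \<and> b \<in> W})"

definition tensor_class :: "('o, 'a, 'f::field, 'y) star_cat_scheme
      \<Rightarrow> ('p, 'b, 'f, 'z) star_cat_scheme \<Rightarrow> 'o \<times> 'p \<Rightarrow> 'o \<times> 'p
      \<Rightarrow> ('a \<times> 'b \<Rightarrow>\<^sub>0 'f) \<Rightarrow> ('a \<times> 'b \<Rightarrow>\<^sub>0 'f) set" where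
  "tensor_class A B p q u = {v. v - u \<in> module.span pm_scale (tensor_rels A B p q)}"

definition alg_tensor :: "('o, 'a, 'f::real_or_complex, 'y) star_cat_scheme
      \<Rightarrow> ('p, 'b, 'f, 'z) star_cat_scheme \<Rightarrow> ('o \<times> 'p, ('a \<times> 'b \<Rightarrow>\<^sub>0 'f) set, 'f) star_cat" where
  "alg_tensor A B = \<lparr>Ob = Ob A \<times> Ob B,
     Hom = (\<lambda>p q. tensor_class A B p q `
        {u. Poly_Mapping.keys u \<subseteq> Hom A (fst p) (fst q) \<times> Hom B (snd p) (snd q)}),
     Idt = (\<lambda>p. tensor_class A B p p (Poly_Mapping.single (Idt A (fst p), Idt B (snd p)) 1)),
     Cmp = (\<lambda>p q r V U. tensor_class A B p r
        (\<Sum>(a', b')\<in>Poly_Mapping.keys (rep V). \<Sum>(a, b)\<in>Poly_Mapping.keys (rep U).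
           Poly_Mapping.single
             (Cmp A (fst p) (fst q) (fst r) a' a, Cmp B (snd p) (snd q) (snd r) b' b)
             (Poly_Mapping.lookup (rep V) (a', b') * Poly_Mapping.lookup (rep U) (a, b)))),
     Add = (\<lambda>p q U V. tensor_class A B p q (rep U + rep V)),
     Zer = (\<lambda>p q. tensor_class A B p q 0),
     Scl = (\<lambda>p q c U. tensor_class A B p q (pm_scale c (rep U))),
     Str = (\<lambda>p q U. tensor_class A B q p
        (\<Sum>(a, b)\<in>Poly_Mapping.keys (rep U).
           Poly_Mapping.single (Str A (fst p) (fst q) a, Str B (snd p) (snd q) b)
             (conjg (Poly_Mapping.lookup (rep U) (a, b)))))\<rparr>"

definition max_tensor :: "('o, 'a, 'f::real_or_complex) cstar_cat \<Rightarrow> ('p, 'b, 'f) cstar_cat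
      \<Rightarrow> ('o \<times> 'p, (nat \<Rightarrow> ('a \<times> 'b \<Rightarrow>\<^sub>0 'f) set) set, 'f) cstar_cat"
    (infixr "\<otimes>\<^sub>m" 75) where
  "A \<otimes>\<^sub>m B = completion (alg_tensor A B) (max_norm (alg_tensor A B))"

text \<open>The functor \<open>(a, b) \<mapsto> a \<otimes> b\<close> from \<open>A \<times> B\<close>; it is bilinear and preserves involutions.\<close>

definition elem_tensor :: "('o, 'a, 'f::real_or_complex) cstar_cat \<Rightarrow> ('p, 'b, 'f) cstar_cat
      \<Rightarrow> ('o \<times> 'p, 'a \<times> 'b, 'o \<times> 'p, (nat \<Rightarrow> ('a \<times> 'b \<Rightarrow>\<^sub>0 'f) set) set) fnct" where
  "elem_tensor A B = to_completion (alg_tensor A B) (max_norm (alg_tensor A B)) \<circ>\<^sub>F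
     \<lparr>FOb = (\<lambda>p. p),
      FArr = (\<lambda>p q ab. tensor_class A B p q (Poly_Mapping.single ab 1))\<rparr>"

text \<open>The $*$-functor out of the maximal tensor product with prescribed values on the elementary
  tensors.\<close>

definition tensor_extend :: "('o, 'a, 'f::real_or_complex) cstar_cat \<Rightarrow> ('p, 'b, 'f) cstar_cat
      \<Rightarrow> ('q, 'c, 'f) cstar_cat \<Rightarrow> ('o \<times> 'p, 'a \<times> 'b, 'q, 'c) fnct
      \<Rightarrow> ('o \<times> 'p, (nat \<Rightarrow> ('a \<times> 'b \<Rightarrow>\<^sub>0 'f) set) set, 'q, 'c) fnct" where
  "tensor_extend A B C F =
     (SOME \<Phi>. star_functor (A \<otimes>\<^sub>m B) C \<Phi> \<and> fun_eq (A \<times>\<^sub>C B) (\<Phi> \<circ>\<^sub>F elem_tensor A B) F)"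

text \<open>\<open>F \<otimes> G : A \<otimes> B \<rightarrow> A' \<otimes> B'\<close> for $*$-functors \<open>F : A \<rightarrow> A'\<close> and \<open>G : B \<rightarrow> B'\<close>.\<close>

definition tensor_fun :: "('o, 'a, 'f::real_or_complex) cstar_cat \<Rightarrow> ('p, 'b, 'f) cstar_cat
      \<Rightarrow> ('o2, 'a2, 'f) cstar_cat \<Rightarrow> ('p2, 'b2, 'f) cstar_cat
      \<Rightarrow> ('o, 'a, 'o2, 'a2) fnct \<Rightarrow> ('p, 'b, 'p2, 'b2) fnct
      \<Rightarrow> ('o \<times> 'p, (nat \<Rightarrow> ('a \<times> 'b \<Rightarrow>\<^sub>0 'f) set) set,
          'o2 \<times> 'p2, (nat \<Rightarrow> ('a2 \<times> 'b2 \<Rightarrow>\<^sub>0 'f) set) set) fnct" where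
  "tensor_fun A B A' B' F G = tensor_extend A B (A' \<otimes>\<^sub>m B') (elem_tensor A' B' \<circ>\<^sub>F (F \<times>\<^sub>F G))"

definition unit_cstar :: "'f::real_or_complex itself \<Rightarrow> (unit, 'f, 'f) cstar_cat" where
  "unit_cstar K = \<lparr>Ob = {()}, Hom = (\<lambda>_ _. UNIV), Idt = (\<lambda>_. 1), Cmp = (\<lambda>_ _ _. (*)),
     Add = (\<lambda>_ _. (+)), Zer = (\<lambda>_ _. 0), Scl = (\<lambda>_ _. (*)), Str = (\<lambda>_ _. conjg),
     Nrm = (\<lambda>_ _. norm)\<rparr>"

text \<open>Structural isomorphisms of the maximal tensor product, determined by
  \<open>(a \<otimes> b) \<otimes> c \<mapsto> a \<otimes> (b \<otimes> c)\<close>, \<open>z \<otimes> a \<mapsto> z a\<close>, \<open>a \<otimes> z \<mapsto> z a\<close> and \<open>a \<otimes> b \<mapsto> b \<otimes> a\<close>.\<close>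

definition tensor_assoc :: "('o, 'a, 'f::real_or_complex) cstar_cat
      \<Rightarrow> ('p, 'b, 'f) cstar_cat \<Rightarrow> ('q, 'c, 'f) cstar_cat
      \<Rightarrow> (('o \<times> 'p) \<times> 'q,
          (nat \<Rightarrow> ((nat \<Rightarrow> ('a \<times> 'b \<Rightarrow>\<^sub>0 'f) set) set \<times> 'c \<Rightarrow>\<^sub>0 'f) set) set,
          'o \<times> ('p \<times> 'q),
          (nat \<Rightarrow> ('a \<times> (nat \<Rightarrow> ('b \<times> 'c \<Rightarrow>\<^sub>0 'f) set) set \<Rightarrow>\<^sub>0 'f) set) set) fnct" where
  "tensor_assoc A B C =
     (SOME \<Phi>. star_functor ((A \<otimes>\<^sub>m B) \<otimes>\<^sub>m C) (A \<otimes>\<^sub>m (B \<otimes>\<^sub>m C)) \<Phi> \<and>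
        fun_eq ((A \<times>\<^sub>C B) \<times>\<^sub>C C)
          (\<Phi> \<circ>\<^sub>F elem_tensor (A \<otimes>\<^sub>m B) C \<circ>\<^sub>F (elem_tensor A B \<times>\<^sub>F fid))
          (elem_tensor A (B \<otimes>\<^sub>m C) \<circ>\<^sub>F (fid \<times>\<^sub>F elem_tensor B C) \<circ>\<^sub>F prod_assoc))"

definition tensor_lunit :: "('o, 'a, 'f::real_or_complex) cstar_cat
      \<Rightarrow> (unit \<times> 'o, (nat \<Rightarrow> ('f \<times> 'a \<Rightarrow>\<^sub>0 'f) set) set, 'o, 'a) fnct" where
  "tensor_lunit A = tensor_extend (unit_cstar TYPE('f)) A A
     \<lparr>FOb = snd, FArr = (\<lambda>p q (z, a). Scl A (snd p) (snd q) z a)\<rparr>"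

definition tensor_runit :: "('o, 'a, 'f::real_or_complex) cstar_cat
      \<Rightarrow> ('o \<times> unit, (nat \<Rightarrow> ('a \<times> 'f \<Rightarrow>\<^sub>0 'f) set) set, 'o, 'a) fnct" where
  "tensor_runit A = tensor_extend A (unit_cstar TYPE('f)) A
     \<lparr>FOb = fst, FArr = (\<lambda>p q (a, z). Scl A (fst p) (fst q) z a)\<rparr>"

definition tensor_swap :: "('o, 'a, 'f::real_or_complex) cstar_cat \<Rightarrow> ('p, 'b, 'f) cstar_cat
      \<Rightarrow> ('o \<times> 'p, (nat \<Rightarrow> ('a \<times> 'b \<Rightarrow>\<^sub>0 'f) set) set,
          'p \<times> 'o, (nat \<Rightarrow> ('b \<times> 'a \<Rightarrow>\<^sub>0 'f) set) set) fnct" where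
  "tensor_swap A B = tensor_extend A B (B \<otimes>\<^sub>m A) (elem_tensor B A \<circ>\<^sub>F prod_swap)"


section \<open>The monoidal structure maps of $C^*_{max}$\<close>

text \<open>\<open>(g\<^sub>1, g\<^sub>2) \<mapsto> g\<^sub>1 \<otimes> g\<^sub>2\<close>, and the induced comparison functor
  \<open>gpd_mu K G H : Cmax K (G \<times> H) \<rightarrow> Cmax K G \<otimes> Cmax K H\<close>.\<close>

definition gpd_tensor :: "'f::real_or_complex itself \<Rightarrow> ('o, 'g) cat \<Rightarrow> ('p, 'h) cat
      \<Rightarrow> ('o \<times> 'p, 'g \<times> 'h, 'o \<times> 'p,
          (nat \<Rightarrow> ((nat \<Rightarrow> 'g \<Rightarrow>\<^sub>0 'f) set \<times> (nat \<Rightarrow> 'h \<Rightarrow>\<^sub>0 'f) set \<Rightarrow>\<^sub>0 'f) set) set) fnct" where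
  "gpd_tensor K G H = elem_tensor (Cmax K G) (Cmax K H) \<circ>\<^sub>F (gpd_rho K G \<times>\<^sub>F gpd_rho K H)"

definition gpd_mu :: "'f::real_or_complex itself \<Rightarrow> ('o, 'g) cat \<Rightarrow> ('p, 'h) cat
      \<Rightarrow> ('o \<times> 'p, (nat \<Rightarrow> 'g \<times> 'h \<Rightarrow>\<^sub>0 'f) set, 'o \<times> 'p,
          (nat \<Rightarrow> ((nat \<Rightarrow> 'g \<Rightarrow>\<^sub>0 'f) set \<times> (nat \<Rightarrow> 'h \<Rightarrow>\<^sub>0 'f) set \<Rightarrow>\<^sub>0 'f) set) set) fnct" where
  "gpd_mu K G H = Cmax_extend K (G \<times>\<^sub>C H) (Cmax K G \<otimes>\<^sub>m Cmax K H) (gpd_tensor K G H)"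

definition gpd_mu_inv :: "'f::real_or_complex itself \<Rightarrow> ('o, 'g) cat \<Rightarrow> ('p, 'h) cat
      \<Rightarrow> ('o \<times> 'p,
          (nat \<Rightarrow> ((nat \<Rightarrow> 'g \<Rightarrow>\<^sub>0 'f) set \<times> (nat \<Rightarrow> 'h \<Rightarrow>\<^sub>0 'f) set \<Rightarrow>\<^sub>0 'f) set) set,
          'o \<times> 'p, (nat \<Rightarrow> 'g \<times> 'h \<Rightarrow>\<^sub>0 'f) set) fnct" where
  "gpd_mu_inv K G H =
     inverse_functor (Cmax K (G \<times>\<^sub>C H)) (Cmax K G \<otimes>\<^sub>m Cmax K H) (gpd_mu K G H)"

text \<open>\<open>z \<mapsto> z 1\<close>, from the ground field to \<open>Cmax K 1\<close>.\<close>

definition gpd_eps :: "'f::real_or_complex itself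
      \<Rightarrow> (unit, 'f, unit, (nat \<Rightarrow> unit \<Rightarrow>\<^sub>0 'f) set) fnct" where
  "gpd_eps K = \<lparr>FOb = (\<lambda>_. ()),
     FArr = (\<lambda>_ _ z. Scl (Cmax K one_gpd) () () z (Idt (Cmax K one_gpd) ()))\<rparr>"

end

theory Submission
  imports Defs "HOL-Algebra.Subrings"
begin

text \<open>Every construction is a completion with a universal property, so a $*$-functor out of it is
  determined by its values on arrows that span a dense subspace: the images of group elements, or of
  elementary tensors.  Each coherence identity therefore reduces to a trivial one on such generators.
  The inverse of \<open>gpd_mu\<close> comes from the universal property of the maximal tensor product: the
  functors \<open>g \<mapsto> (g, 1)\<close> and \<open>h \<mapsto> (1, h)\<close> into the product groupoid extend to $*$-functors with commuting
  images.

  The analysis needed is that $*$-functors between C*-categories are contractive and that completing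
  a $*$-category for the maximal norm preserves positivity of \<open>a\<^sup>* a\<close>.  Both follow from one fact that
  holds over either scalar field: if \<open>k\<close> is self-adjoint of norm \<open>1\<close>, then \<open>1 - k\<^sup>2\<close> is not invertible.
  Positivity of \<open>a\<^sup>* a\<close> then amounts to \<open>\<parallel>r - a\<^sup>* a\<parallel> \<le> r\<close> for
  \<open>r \<ge> \<parallel>a\<parallel>\<^sup>2\<close>, an inequality that passes to suprema of norms and to completions.\<close>

text \<open>Since the scalars may be real, the usual way to the spectral radius through holomorphic
  resolvents is closed. It is replaced by an averaging argument in the manner of Rickart, written
  with real quadratic polynomials only. The C*-identity alone would not carry it: the complex
  numbers, as a real algebra with trivial involution, satisfy that identity although
  \<open>i * i + 1 = 0\<close>. This is where the positivity axiom enters. Quotients occur twice, as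
  Cauchy sequences modulo null sequences and as formal sums modulo bilinearity; one transfer lemma,
  \<open>star_category_image\<close>, serves both. Likewise the groupoid *-category and the tensor
  product before its relations are two instances of one free *-category on a category with
  involution. The functors in the statement are chosen by \<open>SOME\<close>. For each of them some
  witness is constructed; afterwards only its values on generators are used.\<close>

section \<open>Scalars\<close>

lemma conjg_of_real [simp]: "conjg (of_real r :: 'f::real_or_complex) = of_real r"
  by (simp add: of_real_def conjg_real)

lemma conjg_0 [simp]: "conjg (0 :: 'f::real_or_complex) = 0"
  using conjg_of_real[of 0] by simp

lemma conjg_1 [simp]: "conjg (1 :: 'f::real_or_complex) = 1"
  using conjg_of_real[of 1] by simp

lemma conjg_minus [simp]: "conjg (- x :: 'f::real_or_complex) = - conjg x"
proof -
  have "conjg x + conjg (- x) = 0" by (simp flip: conjg_add)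
  then show ?thesis by (simp add: eq_neg_iff_add_eq_0 add.commute)
qed

lemma conjg_diff: "conjg (x - y :: 'f::real_or_complex) = conjg x - conjg y"
  using conjg_add[of x "- y"] by simp

lemma scalar_cases:
  fixes z :: "'f::real_or_complex"
  obtains a where "z = of_real a"
  | i a b where "conjg i = - i" "i * i = (- 1 :: 'f)" "z = of_real a + of_real b * i"
  using real_or_complex[where 'a = 'f]
proof (elim disjE exE conjE)
  assume "\<forall>x::'f. \<exists>a. x = a *\<^sub>R 1"
  then obtain a where "z = a *\<^sub>R 1" by blast
  then show thesis using that(1) by (simp add: of_real_def)
next
  fix i :: 'f assume i: "i * i = - 1" "conjg i = - i" and "\<forall>x. \<exists>a b. x = a *\<^sub>R 1 + b *\<^sub>R i"
  then obtain a b where "z = a *\<^sub>R 1 + b *\<^sub>R i" by blast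
  then show thesis using that(2)[OF i(2,1), of a b] by (simp add: of_real_def)
qed

lemma conjg_conjg [simp]: "conjg (conjg x) = (x :: 'f::real_or_complex)"
  by (cases x rule: scalar_cases) (simp_all add: conjg_add conjg_diff conjg_mult)

lemma conjg_mult_self: "conjg x * x = (of_real ((norm x)\<^sup>2) :: 'f::real_or_complex)"
  using mult_conjg[of x] by (simp add: of_real_def mult.commute)

lemma norm_conjg [simp]: "norm (conjg x) = norm (x :: 'f::real_or_complex)"
proof -
  have "norm (conjg x) * norm x = (norm x)\<^sup>2"
    by (simp add: conjg_mult_self norm_power flip: norm_mult)
  then show ?thesis
    by (cases "x = 0") (simp_all add: power2_eq_square)
qed

text \<open>The second case keeps only the real polynomial (X - z)(X - conjg z) = (X - a)^2 + b^2 of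
  a nonreal z. In this form it can be applied to a self-adjoint arrow.\<close>

lemma not_nonneg_scalar_cases:
  fixes z :: "'f::real_or_complex"
  assumes "z \<notin> of_real ` {0..}"
  obtains t where "t > 0" "z = of_real (- t)"
  | a b where "b \<noteq> 0" "z + conjg z = of_real (2 * a)" "z * conjg z = of_real (a\<^sup>2 + b\<^sup>2)"
proof (cases z rule: scalar_cases)
  case (1 a)
  then have "- a > 0" using assms by (metis atLeast_iff imageI linorder_not_le neg_0_less_iff_less)
  then show ?thesis using that(1)[of "- a"] 1 by simp
next
  case (2 i a b)
  show ?thesis
  proof (cases "b = 0")
    case True
    then have "- a > 0" using assms 2
      by (metis atLeast_iff imageI linorder_not_le neg_0_less_iff_less add.right_neutral mult_zero_left of_real_0)
    then show ?thesis using that(1)[of "- a"] 2 True by simp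
  next
    case False
    have "conjg z = of_real a - of_real b * i" by (simp add: 2 conjg_add conjg_mult)
    then have "z + conjg z = of_real (2 * a)"
      and "z * conjg z = of_real a * of_real a - of_real b * of_real b * (i * i)"
      unfolding \<open>conjg z = _\<close> by (simp_all add: 2(3) algebra_simps)
    then show ?thesis using that(2)[OF False, of a] by (simp add: 2(2) power2_eq_square)
  qed
qed


section \<open>Vector spaces and seminorms on carrier sets\<close>

context vect_space begin

abbreviation sub :: "'a \<Rightarrow> 'a \<Rightarrow> 'a" where "sub a b \<equiv> add a (scl (- 1) b)"

lemma zero_add: "a \<in> V \<Longrightarrow> add zero a = a"
  by (simp add: add_commute zero_closed add_zero)

lemma add_cancel: "\<lbrakk>a \<in> V; b \<in> V; c \<in> V; add a b = add a c\<rbrakk> \<Longrightarrow> b = c"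
  using ex_neg[of a] by (metis add_assoc add_commute zero_add)

lemma scl_0: "a \<in> V \<Longrightarrow> scl 0 a = zero"
  using add_scl[of a 0 0] add_cancel[of "scl 0 a" "scl 0 a" zero]
  by (simp add: scl_closed zero_closed add_zero)

lemma scl_zero: "scl c zero = zero"
  using scl_scl[OF zero_closed, of c 0] by (simp add: scl_0 zero_closed)

lemma sub_closed: "\<lbrakk>a \<in> V; b \<in> V\<rbrakk> \<Longrightarrow> sub a b \<in> V"
  by (simp add: add_closed scl_closed)

lemma sub_self: "a \<in> V \<Longrightarrow> sub a a = zero"
  using add_scl[of a 1 "- 1"] by (simp add: scl_one scl_0)

lemma sub_eq_zero_iff: "\<lbrakk>a \<in> V; b \<in> V\<rbrakk> \<Longrightarrow> sub a b = zero \<longleftrightarrow> a = b"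
  using add_cancel[of "scl (- 1) b" a b]
  by (auto simp: sub_self scl_closed add_commute[of "scl (- 1) b"])

lemma add_4: "\<lbrakk>a \<in> V; b \<in> V; c \<in> V; d \<in> V\<rbrakk> \<Longrightarrow> add (add a b) (add c d) = add (add a c) (add b d)"
  by (simp add: add_assoc add_closed add_assoc[of b c d, symmetric] add_commute[of b c]
      add_assoc[of c b d])

lemma sub_add_sub: "\<lbrakk>a \<in> V; b \<in> V; c \<in> V\<rbrakk> \<Longrightarrow> add (sub a b) (sub b c) = sub a c"
  by (simp add: add_4[of a _ b] scl_closed add_commute[of "scl (- 1) b" "scl (- 1) c"] add_4[of a b]
      sub_self add_zero sub_closed)

lemma sub_add_cancel: "\<lbrakk>a \<in> V; b \<in> V\<rbrakk> \<Longrightarrow> add (sub a b) b = a"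
  by (simp add: add_assoc scl_closed add_commute[of _ b] sub_self add_zero)

lemma sub_add: "\<lbrakk>a \<in> V; b \<in> V; c \<in> V; d \<in> V\<rbrakk>
    \<Longrightarrow> sub (add a b) (add c d) = add (sub a c) (sub b d)"
  by (simp add: scl_add scl_closed add_4)

lemma sub_swap: "\<lbrakk>a \<in> V; b \<in> V\<rbrakk> \<Longrightarrow> scl (- 1) (sub a b) = sub b a"
  by (simp add: scl_add scl_closed scl_scl scl_one add_commute)

lemma sub_scl: "\<lbrakk>a \<in> V; b \<in> V\<rbrakk> \<Longrightarrow> sub (scl c a) (scl c b) = scl c (sub a b)"
  by (simp add: scl_add scl_closed scl_scl)

end

text \<open>The operations are explicit arguments so that one set of limit lemmas serves every Hom
  space; \<open>tends_eq_seq_lim\<close> makes the connection.\<close>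

definition seq_lim :: "('a \<Rightarrow> 'a \<Rightarrow> 'a) \<Rightarrow> ('f::field \<Rightarrow> 'a \<Rightarrow> 'a) \<Rightarrow> ('a \<Rightarrow> real) \<Rightarrow> (nat \<Rightarrow> 'a) \<Rightarrow> 'a \<Rightarrow> bool"
  where "seq_lim ad sc n s a \<longleftrightarrow> (\<lambda>i. n (ad (s i) (sc (- 1) a))) \<longlonglongrightarrow> 0"

locale seminormed_space = vect_space V add zero scl
  for V :: "'a set" and add zero and scl :: "'f::real_or_complex \<Rightarrow> 'a \<Rightarrow> 'a" +
  fixes nm :: "'a \<Rightarrow> real"
  assumes nm_scl: "a \<in> V \<Longrightarrow> nm (scl c a) = norm c * nm a"
    and nm_add: "\<lbrakk>a \<in> V; b \<in> V\<rbrakk> \<Longrightarrow> nm (add a b) \<le> nm a + nm b"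
begin

lemma nm_zero: "nm zero = 0"
  using nm_scl[OF zero_closed, of 0] by (simp add: scl_zero)

lemma nm_sub_swap: "\<lbrakk>a \<in> V; b \<in> V\<rbrakk> \<Longrightarrow> nm (sub a b) = nm (sub b a)"
  using nm_scl[of "sub a b" "- 1"] by (simp add: sub_swap sub_closed)

lemma nm_ge_0: "a \<in> V \<Longrightarrow> nm a \<ge> 0"
  using nm_add[of a "scl (- 1) a"] nm_scl[of a "- 1"] by (simp add: sub_self nm_zero scl_closed)

lemma nm_sub_triangle: "\<lbrakk>a \<in> V; b \<in> V; c \<in> V\<rbrakk> \<Longrightarrow> nm (sub a c) \<le> nm (sub a b) + nm (sub b c)"
  using nm_add[of "sub a b" "sub b c"] by (simp add: sub_add_sub sub_closed)

lemma nm_le_add_sub: "\<lbrakk>a \<in> V; b \<in> V\<rbrakk> \<Longrightarrow> nm a \<le> nm b + nm (sub a b)"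
  using nm_add[of "sub a b" b] by (simp add: sub_add_cancel sub_closed)

lemma nm_diff_le: "\<lbrakk>a \<in> V; b \<in> V\<rbrakk> \<Longrightarrow> \<bar>nm a - nm b\<bar> \<le> nm (sub a b)"
  using nm_le_add_sub[of a b] nm_le_add_sub[of b a] nm_sub_swap[of a b] by simp

abbreviation tends :: "(nat \<Rightarrow> 'a) \<Rightarrow> 'a \<Rightarrow> bool" where "tends \<equiv> seq_lim add scl nm"

lemma tends_const: "a \<in> V \<Longrightarrow> tends (\<lambda>_. a) a"
  by (simp add: seq_lim_def sub_self nm_zero)

lemma tends_nm: "\<lbrakk>\<And>i. s i \<in> V; a \<in> V; tends s a\<rbrakk> \<Longrightarrow> (\<lambda>i. nm (s i)) \<longlonglongrightarrow> nm a"
  unfolding seq_lim_def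
  by (rule LIM_zero_cancel, rule tendsto_rabs_zero_cancel,
      rule tendsto_sandwich[of "\<lambda>_. 0" _ _ "\<lambda>i. nm (sub (s i) a)"])
     (auto intro!: always_eventually simp: nm_diff_le)

lemma tends_add: "\<lbrakk>\<And>i. s i \<in> V; \<And>i. t i \<in> V; a \<in> V; b \<in> V; tends s a; tends t b\<rbrakk>
    \<Longrightarrow> tends (\<lambda>i. add (s i) (t i)) (add a b)"
  unfolding seq_lim_def
  by (rule tendsto_sandwich[of "\<lambda>_. 0" _ _ "\<lambda>i. nm (sub (s i) a) + nm (sub (t i) b)"])
     (auto intro!: always_eventually tendsto_add_zero nm_add sub_closed nm_ge_0 add_closed scl_closed
       simp only: sub_add)

lemma tends_scl: "\<lbrakk>\<And>i. s i \<in> V; a \<in> V; tends s a\<rbrakk> \<Longrightarrow> tends (\<lambda>i. scl c (s i)) (scl c a)"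
  unfolding seq_lim_def by (auto simp: sub_scl nm_scl sub_closed intro: tendsto_mult_right_zero)

end

locale normed_space = seminormed_space +
  assumes nm_eq_0: "a \<in> V \<Longrightarrow> nm a = 0 \<Longrightarrow> a = zero"
begin

lemma tends_unique:
  assumes s: "\<And>i. s i \<in> V" and ab: "a \<in> V" "b \<in> V" and t: "tends s a" "tends s b"
  shows "a = b"
proof -
  have "(\<lambda>i. nm (sub (s i) a) + nm (sub (s i) b)) \<longlonglongrightarrow> 0"
    using t tendsto_add_zero unfolding seq_lim_def by blast
  moreover have "nm (sub a b) \<le> nm (sub (s i) a) + nm (sub (s i) b)" for i
    using nm_sub_triangle[of a "s i" b] nm_sub_swap[of a "s i"] s ab by simp
  ultimately have "nm (sub a b) \<le> 0" by (intro LIMSEQ_le_const) auto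
  then show ?thesis using nm_eq_0[of "sub a b"] nm_ge_0[of "sub a b"] ab
    by (simp add: sub_closed sub_eq_zero_iff)
qed

end

section \<open>The norm of an element with real spectrum\<close>

text \<open>What the spectral argument takes from a commutative Banach algebra. Completeness appears
  only as invertibility near 1. Scalars satisfy an inequality, not an equation, because the norm of
  the unit may be 0.\<close>

locale normed_cring = cring R for R :: "('a, 'm) ring_scheme" (structure) +
  fixes nm :: "'a \<Rightarrow> real" and sc :: "real \<Rightarrow> 'a"
  assumes sc_closed [simp, intro]: "sc r \<in> carrier R"
    and sc_add: "sc (r + s) = sc r \<oplus> sc s"
    and sc_mult: "sc (r * s) = sc r \<otimes> sc s"
    and sc_1: "sc 1 = \<one>"
    and nm_ge_0: "a \<in> carrier R \<Longrightarrow> 0 \<le> nm a"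
    and nm_add: "\<lbrakk>a \<in> carrier R; b \<in> carrier R\<rbrakk> \<Longrightarrow> nm (a \<oplus> b) \<le> nm a + nm b"
    and nm_mult: "\<lbrakk>a \<in> carrier R; b \<in> carrier R\<rbrakk> \<Longrightarrow> nm (a \<otimes> b) \<le> nm a * nm b"
    and nm_sc: "nm (sc r) \<le> \<bar>r\<bar>"
    and ex_inverse_one_plus: "\<lbrakk>z \<in> carrier R; nm z < 1\<rbrakk> \<Longrightarrow> \<exists>w\<in>carrier R. (\<one> \<oplus> z) \<otimes> w = \<one>"
begin

lemma sc_0: "sc 0 = \<zero>"
  using sc_add[of 0 0] by (metis add.l_cancel_one' add_0 sc_closed)

lemma sc_minus: "sc (- r) = \<ominus> sc r"
  using minus_equality[of "sc (- r)" "sc r"] by (simp add: sc_0 flip: sc_add)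

lemma sc_diff: "sc (r - s) = sc r \<ominus> sc s"
  using sc_add[of r "- s"] by (simp add: sc_minus a_minus_def)

lemma sc_2: "sc 2 = \<one> \<oplus> \<one>"
  using sc_add[of 1 1] by (simp add: sc_1)

lemma nm_one: "nm \<one> \<le> 1"
  using nm_sc[of 1] by (simp add: sc_1)

lemma nm_uminus: "a \<in> carrier R \<Longrightarrow> nm (\<ominus> a) \<le> nm a"
proof -
  assume a: "a \<in> carrier R"
  then have "\<ominus> a = sc (- 1) \<otimes> a" by (simp add: sc_minus sc_1 l_minus)
  then show ?thesis using nm_mult[of "sc (- 1)" a] nm_sc[of "- 1"] nm_ge_0[OF a] a
    by (metis abs_minus_cancel abs_one mult_1 mult_right_mono order_trans sc_closed)
qed

lemma inverse_near_1: "\<lbrakk>z \<in> carrier R; nm z < 1\<rbrakk> \<Longrightarrow> \<exists>w\<in>carrier R. (\<one> \<ominus> z) \<otimes> w = \<one>"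
  using ex_inverse_one_plus[of "\<ominus> z"] nm_uminus[of z] by (simp add: a_minus_def)

lemma nm_minus: "\<lbrakk>a \<in> carrier R; b \<in> carrier R\<rbrakk> \<Longrightarrow> nm (a \<ominus> b) \<le> nm a + nm b"
  using nm_add[of a "\<ominus> b"] nm_uminus[of b] by (simp add: a_minus_def)

lemma nm_mult_le: "\<lbrakk>a \<in> carrier R; b \<in> carrier R; nm a \<le> r; nm b \<le> s\<rbrakk> \<Longrightarrow> nm (a \<otimes> b) \<le> r * s"
  by (rule order_trans[OF nm_mult]) (auto intro: mult_mono nm_ge_0 order_trans[OF nm_ge_0])

lemma nm_sc_mult: "a \<in> carrier R \<Longrightarrow> nm (sc r \<otimes> a) \<le> \<bar>r\<bar> * nm a"
  by (rule nm_mult_le) (auto simp: nm_sc)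

text \<open>For c in [-1, 1] and w = c + i sqrt (1 - c^2) this is (1 - w x)(1 - w' x), where w' is
  the conjugate of w, multiplied out so that only the real number c remains. The next definition is
  the real part of the factor 1 - w' x.\<close>

definition quad :: "real \<Rightarrow> 'a \<Rightarrow> 'a" where
  "quad c x = \<one> \<ominus> sc (2 * c) \<otimes> x \<oplus> x \<otimes> x"

definition lin :: "real \<Rightarrow> 'a \<Rightarrow> 'a" where
  "lin c x = \<one> \<ominus> sc c \<otimes> x"

lemma quad_eq_add: "x \<in> carrier R \<Longrightarrow> quad c x = \<one> \<oplus> sc (- 2 * c) \<otimes> x \<oplus> x \<otimes> x"
  by (simp add: quad_def sc_minus l_minus a_minus_def)

lemma quad_closed [simp, intro]: "x \<in> carrier R \<Longrightarrow> quad c x \<in> carrier R"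
  by (simp add: quad_def)

lemma lin_closed [simp, intro]: "x \<in> carrier R \<Longrightarrow> lin c x \<in> carrier R"
  by (simp add: lin_def)

lemma sc_double: "sc (2 * c) = sc c \<oplus> sc c"
  using sc_add[of c c] by simp

lemma quad_eq:
  assumes "x \<in> carrier R"
  shows "quad c x = (\<one> \<oplus> x \<otimes> x) \<ominus> sc (2 * c) \<otimes> x" "quad (- c) x = (\<one> \<oplus> x \<otimes> x) \<oplus> sc (2 * c) \<otimes> x"
  using assms sc_closed[of "2 * c"] unfolding quad_def mult_minus_right sc_minus by algebra+

text \<open>(1 - w x)(1 + w x) = 1 - w^2 x^2, and the real part of w^2 is 2 c^2 - 1 by the double
  angle formula.\<close>

lemma quad_mult_quad:
  assumes x: "x \<in> carrier R"
  shows "quad c x \<otimes> quad (- c) x = quad (2 * c\<^sup>2 - 1) (x \<otimes> x)"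
proof -
  define A where "A = \<one> \<oplus> x \<otimes> x"
  define d where "d = sc (2 * c) \<otimes> x"
  define e where "e = sc (4 * c\<^sup>2)"
  define y where "y = x \<otimes> x"
  have cl: "A \<in> carrier R" "d \<in> carrier R" "e \<in> carrier R" "y \<in> carrier R"
    using x by (simp_all add: A_def d_def e_def y_def)
  have "d \<otimes> d = (sc (2 * c) \<otimes> sc (2 * c)) \<otimes> y"
    using x sc_closed[of "2 * c"] unfolding d_def y_def by algebra
  then have dd: "d \<otimes> d = e \<otimes> y" by (simp add: e_def power2_eq_square flip: sc_mult)
  have q: "quad (2 * c\<^sup>2 - 1) y = \<one> \<ominus> (e \<ominus> (\<one> \<oplus> \<one>)) \<otimes> y \<oplus> y \<otimes> y"
    by (simp add: quad_def e_def sc_diff right_diff_distrib flip: sc_2)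
  have "quad c x \<otimes> quad (- c) x = (A \<ominus> d) \<otimes> (A \<oplus> d)"
    unfolding quad_eq(1)[OF x, of c] quad_eq(2)[OF x, of c] A_def d_def ..
  also have "\<dots> = A \<otimes> A \<ominus> e \<otimes> y"
    unfolding dd[symmetric] using cl(1,2) by algebra
  also have "\<dots> = quad (2 * c\<^sup>2 - 1) y"
    unfolding q A_def y_def[symmetric] using cl(3,4) by algebra
  finally show ?thesis by (simp add: y_def)
qed

text \<open>The numerators of 1 / (1 - w x) + 1 / (1 + w x) = 2 / (1 - w^2 x^2), after taking real
  parts.\<close>

lemma lin_mult_quad:
  assumes x: "x \<in> carrier R"
  shows "lin c x \<otimes> quad (- c) x \<oplus> lin (- c) x \<otimes> quad c x
    = lin (2 * c\<^sup>2 - 1) (x \<otimes> x) \<oplus> lin (2 * c\<^sup>2 - 1) (x \<otimes> x)"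
proof -
  define A where "A = \<one> \<oplus> x \<otimes> x"
  define b where "b = sc c \<otimes> x"
  define e where "e = sc (2 * c\<^sup>2)"
  define y where "y = x \<otimes> x"
  have cl: "A \<in> carrier R" "b \<in> carrier R" "e \<in> carrier R" "y \<in> carrier R"
    using x by (simp_all add: A_def b_def e_def y_def)
  have d: "sc (2 * c) \<otimes> x = b \<oplus> b"
    using x by (simp add: b_def sc_double l_distr)
  have "b \<otimes> (b \<oplus> b) = (sc c \<otimes> (sc c \<oplus> sc c)) \<otimes> y"
    using x sc_closed[of c] unfolding b_def y_def by algebra
  then have bb: "b \<otimes> (b \<oplus> b) = e \<otimes> y" by (simp add: e_def power2_eq_square mult.left_commute flip: sc_mult sc_double)
  have l: "lin (2 * c\<^sup>2 - 1) y = \<one> \<ominus> (e \<ominus> \<one>) \<otimes> y"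
    by (simp add: lin_def e_def sc_diff sc_1)
  have m: "lin c x = \<one> \<ominus> b" "lin (- c) x = \<one> \<oplus> b"
    using x by (simp_all add: lin_def b_def sc_minus l_minus minus_eq)
  have "lin c x \<otimes> quad (- c) x \<oplus> lin (- c) x \<otimes> quad c x
      = (A \<oplus> A) \<ominus> (b \<otimes> (b \<oplus> b) \<oplus> b \<otimes> (b \<oplus> b))"
    unfolding m quad_eq(1)[OF x, of c] quad_eq(2)[OF x, of c] d A_def[symmetric] using cl(1,2) by (algebra, simp)
  also have "\<dots> = lin (2 * c\<^sup>2 - 1) y \<oplus> lin (2 * c\<^sup>2 - 1) y"
    unfolding bb l A_def y_def[symmetric] using cl(3,4) by algebra
  finally show ?thesis by (simp add: y_def)
qed

lemma half: "a \<in> carrier R \<Longrightarrow> sc (1 / 2) \<otimes> (a \<oplus> a) = a"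
proof -
  assume a: "a \<in> carrier R"
  have "sc (1 / 2) \<otimes> (a \<oplus> a) = (sc (1 / 2) \<oplus> sc (1 / 2)) \<otimes> a"
    using a sc_closed[of "1 / 2"] by algebra
  then show ?thesis using a by (simp add: sc_1 flip: sc_add)
qed

text \<open>The two preceding identities divided by the quadratic factors. The second one stays
  doubled, so that no scalar 1/2 enters the ring computation.\<close>

lemma lin_inverse_quad_square:
  assumes "x \<in> carrier R" "u \<in> carrier R" "v \<in> carrier R"
    and u: "quad c x \<otimes> u = \<one>" and v: "quad (- c) x \<otimes> v = \<one>"
  shows "quad (2 * c\<^sup>2 - 1) (x \<otimes> x) \<otimes> (u \<otimes> v) = \<one>"
    and "lin (2 * c\<^sup>2 - 1) (x \<otimes> x) \<otimes> (u \<otimes> v) \<oplus> lin (2 * c\<^sup>2 - 1) (x \<otimes> x) \<otimes> (u \<otimes> v)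
      = lin c x \<otimes> u \<oplus> lin (- c) x \<otimes> v"
proof -
  note cl = assms(1-3) quad_closed[OF assms(1), of c] quad_closed[OF assms(1), of "- c"]
    lin_closed[OF assms(1), of c] lin_closed[OF assms(1), of "- c"]
  have "(quad c x \<otimes> quad (- c) x) \<otimes> (u \<otimes> v) = (quad c x \<otimes> u) \<otimes> (quad (- c) x \<otimes> v)"
    using cl by algebra
  then show "quad (2 * c\<^sup>2 - 1) (x \<otimes> x) \<otimes> (u \<otimes> v) = \<one>"
    by (simp add: u v quad_mult_quad assms)
  have "(lin c x \<otimes> quad (- c) x \<oplus> lin (- c) x \<otimes> quad c x) \<otimes> (u \<otimes> v)
      = (lin c x \<otimes> u) \<otimes> (quad (- c) x \<otimes> v) \<oplus> (lin (- c) x \<otimes> v) \<otimes> (quad c x \<otimes> u)"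
    using cl by algebra
  then show "lin (2 * c\<^sup>2 - 1) (x \<otimes> x) \<otimes> (u \<otimes> v) \<oplus> lin (2 * c\<^sup>2 - 1) (x \<otimes> x) \<otimes> (u \<otimes> v)
      = lin c x \<otimes> u \<oplus> lin (- c) x \<otimes> v"
    by (simp add: u v lin_mult_quad l_distr assms)
qed

text \<open>Uniform distance of the two real resolvents over the unit circle. Existence of the
  inverses is part of the relation, so that squaring can pass them on.\<close>

definition close :: "real \<Rightarrow> 'a \<Rightarrow> 'a \<Rightarrow> bool" where
  "close e x y \<longleftrightarrow> (\<forall>c\<in>{-1..1}. \<exists>u\<in>carrier R. \<exists>v\<in>carrier R.
     quad c x \<otimes> u = \<one> \<and> quad c y \<otimes> v = \<one> \<and> nm (lin c x \<otimes> u \<ominus> lin c y \<otimes> v) \<le> e)"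

lemma close_square:
  assumes x: "x \<in> carrier R" and y: "y \<in> carrier R" and "close e x y"
  shows "close e (x \<otimes> x) (y \<otimes> y)"
  unfolding close_def
proof
  fix d :: real assume d: "d \<in> {-1..1}"
  \<comment> \<open>Half-angle substitution: d = 2 c^2 - 1, and both c and - c lie in [-1, 1], where
    the assumption applies. The difference at d is the mean of the differences at c and - c.\<close>
  define c where "c = sqrt ((1 + d) / 2)"
  have c: "d = 2 * c\<^sup>2 - 1" "c \<in> {-1..1}" "- c \<in> {-1..1}"
  proof -
    have "c\<^sup>2 = (1 + d) / 2" "0 \<le> c" "c \<le> 1" using d by (simp_all add: c_def)
    then show "d = 2 * c\<^sup>2 - 1" "c \<in> {-1..1}" "- c \<in> {-1..1}" by auto
  qed
  obtain u v where uv: "u \<in> carrier R" "v \<in> carrier R" "quad c x \<otimes> u = \<one>" "quad c y \<otimes> v = \<one>"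
      and e: "nm (lin c x \<otimes> u \<ominus> lin c y \<otimes> v) \<le> e"
    using assms(3) c(2) unfolding close_def by blast
  obtain u' v' where uv': "u' \<in> carrier R" "v' \<in> carrier R"
        "quad (- c) x \<otimes> u' = \<one>" "quad (- c) y \<otimes> v' = \<one>"
      and e': "nm (lin (- c) x \<otimes> u' \<ominus> lin (- c) y \<otimes> v') \<le> e"
    using assms(3) c(3) unfolding close_def by blast
  define X where "X = lin d (x \<otimes> x) \<otimes> (u \<otimes> u')"
  define Y where "Y = lin d (y \<otimes> y) \<otimes> (v \<otimes> v')"
  have XY: "X \<in> carrier R" "Y \<in> carrier R" using x y uv uv' by (simp_all add: X_def Y_def)
  have X: "X \<oplus> X = lin c x \<otimes> u \<oplus> lin (- c) x \<otimes> u'"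
    unfolding X_def c(1) by (rule lin_inverse_quad_square) (use x uv uv' in auto)
  have Y: "Y \<oplus> Y = lin c y \<otimes> v \<oplus> lin (- c) y \<otimes> v'"
    unfolding Y_def c(1) by (rule lin_inverse_quad_square) (use y uv uv' in auto)
  have cl: "lin c x \<otimes> u \<in> carrier R" "lin (- c) x \<otimes> u' \<in> carrier R"
      "lin c y \<otimes> v \<in> carrier R" "lin (- c) y \<otimes> v' \<in> carrier R"
    using x y uv uv' by auto
  have "(X \<ominus> Y) \<oplus> (X \<ominus> Y) = (X \<oplus> X) \<ominus> (Y \<oplus> Y)" using XY by algebra
  also have "\<dots> = (lin c x \<otimes> u \<ominus> lin c y \<otimes> v) \<oplus> (lin (- c) x \<otimes> u' \<ominus> lin (- c) y \<otimes> v')"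
    unfolding X Y using cl by algebra
  finally have "nm ((X \<ominus> Y) \<oplus> (X \<ominus> Y)) \<le> e + e"
    using nm_add[of "lin c x \<otimes> u \<ominus> lin c y \<otimes> v" "lin (- c) x \<otimes> u' \<ominus> lin (- c) y \<otimes> v'"] e e' cl
    by simp
  then have "nm (X \<ominus> Y) \<le> e"
    using nm_sc_mult[of "(X \<ominus> Y) \<oplus> (X \<ominus> Y)" "1 / 2"] XY by (simp add: half)
  moreover have "quad d (x \<otimes> x) \<otimes> (u \<otimes> u') = \<one>" "quad d (y \<otimes> y) \<otimes> (v \<otimes> v') = \<one>"
    unfolding c(1) by (rule lin_inverse_quad_square; use x y uv uv' in auto)+
  ultimately show "\<exists>u\<in>carrier R. \<exists>v\<in>carrier R. quad d (x \<otimes> x) \<otimes> u = \<one> \<and> quad d (y \<otimes> y) \<otimes> v = \<one>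
      \<and> nm (lin d (x \<otimes> x) \<otimes> u \<ominus> lin d (y \<otimes> y) \<otimes> v) \<le> e"
    unfolding X_def Y_def using uv uv' by blast
qed

definition sq_iter :: "nat \<Rightarrow> 'a \<Rightarrow> 'a" where
  "sq_iter n x = ((\<lambda>x. x \<otimes> x) ^^ n) x"

lemma sq_iter_simps: "sq_iter 0 x = x" "sq_iter (Suc n) x = sq_iter n x \<otimes> sq_iter n x"
  by (simp_all add: sq_iter_def)

lemma sq_iter_closed [simp, intro]: "x \<in> carrier R \<Longrightarrow> sq_iter n x \<in> carrier R"
  by (induction n) (auto simp: sq_iter_simps)

lemma close_sq_iter:
  "\<lbrakk>x \<in> carrier R; y \<in> carrier R; close e x y\<rbrakk> \<Longrightarrow> close e (sq_iter n x) (sq_iter n y)"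
  by (induction n) (auto simp: sq_iter_simps intro: close_square)

lemma nm_sq_iter: "x \<in> carrier R \<Longrightarrow> nm (sq_iter n x) \<le> nm x ^ 2 ^ n"
  by (induction n) (auto simp: sq_iter_simps power_mult power2_eq_square mult.commute[of 2] intro: nm_mult_le)

text \<open>At c = -1 the quadratic is the perfect square (1 + x)^2, one factor of which is
  \<open>lin (- 1) x\<close>.\<close>

lemma quad_minus_1:
  assumes x: "x \<in> carrier R" and u: "u \<in> carrier R" "quad (- 1) x \<otimes> u = \<one>"
  shows "(\<one> \<oplus> x) \<otimes> (lin (- 1) x \<otimes> u) = \<one>"
proof -
  have "quad (- 1) x = (\<one> \<oplus> x) \<otimes> lin (- 1) x"
    using quad_eq(2)[OF x, of 1] x by (simp add: lin_def sc_minus sc_1 sc_2 l_minus minus_eq) algebra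
  then show ?thesis using u x by (simp add: m_assoc)
qed

text \<open>At c = -1 closeness compares p = 1 / (1 + x) with q = 1 / (1 + y). The bound 1/4 on y
  gives |q| \<le> 4/3 and |1 - q| = |y q| \<le> 1/3. Hence |1 - p| \<le> 1/3 + 1/8 = 11/24, which is
  below 1/2, and x = (1 - p)(1 + x) then forces |x| < 1.\<close>

lemma nm_less_1_of_close:
  assumes x: "x \<in> carrier R" and y: "y \<in> carrier R" and "close (1 / 8) x y" "nm y \<le> 1 / 4"
  shows "nm x < 1"
proof -
  obtain u v where uv: "u \<in> carrier R" "v \<in> carrier R" "quad (- 1) x \<otimes> u = \<one>" "quad (- 1) y \<otimes> v = \<one>"
      and e: "nm (lin (- 1) x \<otimes> u \<ominus> lin (- 1) y \<otimes> v) \<le> 1 / 8"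
    using bspec[OF assms(3)[unfolded close_def], of "- 1"] by auto
  define p where "p = lin (- 1) x \<otimes> u"
  define q where "q = lin (- 1) y \<otimes> v"
  have pq: "p \<in> carrier R" "q \<in> carrier R" using x y uv by (auto simp: p_def q_def)
  have p: "(\<one> \<oplus> x) \<otimes> p = \<one>" and q: "(\<one> \<oplus> y) \<otimes> q = \<one>"
    using uv x y by (simp_all add: p_def q_def quad_minus_1)
  have "q = (\<one> \<oplus> y) \<otimes> q \<ominus> y \<otimes> q" using y pq by algebra
  then have "q = \<one> \<ominus> y \<otimes> q" unfolding q .
  moreover have yq: "nm (y \<otimes> q) \<le> 1 / 4 * nm q" by (rule nm_mult_le) (use y pq assms in auto)
  ultimately have "nm q \<le> 1 + 1 / 4 * nm q"
    using nm_minus[of \<one> "y \<otimes> q"] nm_one y pq by simp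
  then have nq: "nm (y \<otimes> q) \<le> 1 / 3" using yq by simp
  have "\<one> \<ominus> p = (q \<ominus> p) \<oplus> ((\<one> \<oplus> y) \<otimes> q \<ominus> q)" unfolding q using pq by algebra
  also have "\<dots> = (q \<ominus> p) \<oplus> y \<otimes> q" using pq y by algebra
  finally have "nm (\<one> \<ominus> p) \<le> nm (q \<ominus> p) + nm (y \<otimes> q)" using nm_add[of "q \<ominus> p"] pq y by simp
  moreover have "q \<ominus> p = \<ominus> (p \<ominus> q)" using pq by algebra
  then have "nm (q \<ominus> p) \<le> 1 / 8" using e nm_uminus[of "p \<ominus> q"] pq by (simp add: p_def q_def)
  ultimately have "nm (\<one> \<ominus> p) \<le> 11 / 24" using nq by simp
  moreover have "x = (\<one> \<oplus> x) \<ominus> (\<one> \<oplus> x) \<otimes> p" unfolding p using x by algebra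
  then have "x = (\<one> \<ominus> p) \<otimes> (\<one> \<oplus> x)" using x pq by algebra
  moreover have "nm (\<one> \<oplus> x) \<le> 1 + nm x" using nm_add[of \<one> x] nm_one x by simp
  ultimately have "nm x \<le> 11 / 24 * (1 + nm x)"
    using nm_mult_le[of "\<one> \<ominus> p" "\<one> \<oplus> x" "11 / 24" "1 + nm x"] x pq by simp
  then show ?thesis by simp
qed

text \<open>Perturbation of an inverse with constants uniform in c. The final estimate is K (1 - t)
  + 16 K^2 (1 - t) \<le> 17 K^2 (1 - t), and 136 = 8 * 17 brings it below 1/8.\<close>

lemma close_sc_mult:
  assumes k: "k \<in> carrier R" "nm k \<le> 1" and K: "K \<ge> 1"
    and inv: "\<And>c. c \<in> {-1..1} \<Longrightarrow> \<exists>u\<in>carrier R. quad c k \<otimes> u = \<one> \<and> nm u \<le> K"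
    and t: "0 \<le> t" "t \<le> 1" "136 * K\<^sup>2 * (1 - t) \<le> 1"
  shows "close (1 / 8) k (sc t \<otimes> k)"
  unfolding close_def
proof
  fix c :: real assume c: "c \<in> {-1..1}"
  obtain u where u: "u \<in> carrier R" "quad c k \<otimes> u = \<one>" "nm u \<le> K" using inv[OF c] by blast
  define y where "y = sc t \<otimes> k"
  have y: "y \<in> carrier R" using k by (simp add: y_def)
  define E where "E = quad c k \<ominus> quad c y"
  have E: "E \<in> carrier R" using k y by (simp add: E_def)
  have "E = k \<otimes> k \<ominus> y \<otimes> y \<ominus> (sc (2 * c) \<otimes> k \<ominus> sc (2 * c) \<otimes> y)"
    unfolding E_def quad_def using k y sc_closed[of "2 * c"] by algebra
  moreover have "k \<otimes> k \<ominus> y \<otimes> y = sc (1 - t\<^sup>2) \<otimes> (k \<otimes> k)"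
    unfolding y_def sc_diff sc_1 power2_eq_square sc_mult using k sc_closed[of t] by algebra
  moreover have "sc (2 * c) \<otimes> k \<ominus> sc (2 * c) \<otimes> y = sc (2 * c * (1 - t)) \<otimes> k"
    unfolding y_def sc_diff sc_1 sc_mult[of "2 * c"] using k sc_closed[of t] sc_closed[of "2 * c"] by algebra
  ultimately have "E = sc (1 - t\<^sup>2) \<otimes> (k \<otimes> k) \<ominus> sc (2 * c * (1 - t)) \<otimes> k" by simp
  moreover have "nm (sc (1 - t\<^sup>2) \<otimes> (k \<otimes> k)) \<le> 2 * (1 - t) * (1 * 1)"
  proof (rule nm_mult_le)
    have "\<bar>1 - t\<^sup>2\<bar> = (1 - t) * (1 + t)"
      using t by (simp add: abs_of_nonneg power_le_one algebra_simps power2_eq_square mult_le_one)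
    also have "\<dots> \<le> 2 * (1 - t)" using t mult_left_mono[of "1 + t" 2 "1 - t"] by (simp add: mult.commute)
    finally show "nm (sc (1 - t\<^sup>2)) \<le> 2 * (1 - t)" using nm_sc order_trans by blast
    show "nm (k \<otimes> k) \<le> 1 * 1" by (rule nm_mult_le) (use k in auto)
  qed (use k in auto)
  moreover have "nm (sc (2 * c * (1 - t)) \<otimes> k) \<le> 2 * (1 - t) * 1"
  proof (rule nm_mult_le)
    have "\<bar>2 * c * (1 - t)\<bar> \<le> 2 * (1 - t)" using c t mult_right_mono[of "\<bar>c\<bar>" 1 "2 * (1 - t)"] by (auto simp: abs_mult mult.assoc mult.left_commute)
    then show "nm (sc (2 * c * (1 - t))) \<le> 2 * (1 - t)" using nm_sc order_trans by blast
  qed (use k in auto)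
  ultimately have nE: "nm E \<le> 4 * (1 - t)"
    using nm_minus[of "sc (1 - t\<^sup>2) \<otimes> (k \<otimes> k)" "sc (2 * c * (1 - t)) \<otimes> k"] k by simp
  have K2: "K * (1 - t) \<le> K\<^sup>2 * (1 - t)"
    using K t by (intro mult_right_mono) (auto simp: power2_eq_square)
  have "nm (u \<otimes> E) \<le> K * (4 * (1 - t))" by (rule nm_mult_le) (use u E nE in auto)
  then have uE: "nm (u \<otimes> E) \<le> 1 / 2" using t(3) K2 by (simp add: algebra_simps)
  then obtain w where w: "w \<in> carrier R" "(\<one> \<ominus> u \<otimes> E) \<otimes> w = \<one>"
    using inverse_near_1[of "u \<otimes> E"] u E by auto
  \<comment> \<open>\<open>quad c y\<close> is \<open>quad c k\<close> minus E, so its product with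
    u is 1 - u E. The Neumann inverse w of the latter turns u into an inverse of
    \<open>quad c y\<close>.\<close>
  define v where "v = u \<otimes> w"
  have v: "v \<in> carrier R" using u w by (simp add: v_def)
  have quk: "quad c k \<in> carrier R" "quad c y \<in> carrier R" using k y by auto
  have "quad c y \<otimes> v = (quad c k \<otimes> u \<ominus> u \<otimes> (quad c k \<ominus> quad c y)) \<otimes> w"
    unfolding v_def using quk u(1) w(1) by algebra
  then have qv: "quad c y \<otimes> v = \<one>" unfolding u(2) E_def[symmetric] w(2) .
  \<comment> \<open>Resolvent identity u - v = - v u E. It is used twice: |u E| \<le> 1/2 gives |v|
    \<le> 2 K, and then |u - v| is at most 8 K^2 (1 - t).\<close>
  have "u \<ominus> v = u \<otimes> (quad c y \<otimes> v) \<ominus> v \<otimes> (quad c k \<otimes> u)" using u v by (simp add: qv)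
  then have uv: "u \<ominus> v = \<ominus> (v \<otimes> (u \<otimes> E))" unfolding E_def using quk u(1) v by algebra
  have "v = u \<ominus> (u \<ominus> v)" using u v by algebra
  then have "nm v \<le> nm u + nm (u \<ominus> v)" using nm_minus[of u "u \<ominus> v"] u v by simp
  moreover have "nm (u \<ominus> v) \<le> nm v * (1 / 2)"
    unfolding uv using nm_uminus[of "v \<otimes> (u \<otimes> E)"] nm_mult_le[of v "u \<otimes> E", OF _ _ order_refl uE] u v E
    by simp
  ultimately have nv: "nm v \<le> 2 * K" using u by simp
  have "lin c k \<otimes> u \<ominus> lin c y \<otimes> v = (lin c k \<ominus> lin c y) \<otimes> u \<oplus> lin c y \<otimes> (u \<ominus> v)"
    using k y u v lin_closed[of k c] lin_closed[of y c] by algebra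
  also have "lin c k \<ominus> lin c y = sc (c * (t - 1)) \<otimes> k"
    unfolding lin_def y_def sc_mult sc_diff sc_1 using k sc_closed[of t] sc_closed[of c] by algebra
  finally have "nm (lin c k \<otimes> u \<ominus> lin c y \<otimes> v)
      \<le> nm (sc (c * (t - 1)) \<otimes> k \<otimes> u) + nm (lin c y \<otimes> (u \<ominus> v))"
    using nm_add[of "sc (c * (t - 1)) \<otimes> k \<otimes> u" "lin c y \<otimes> (u \<ominus> v)"] k y u v by simp
  moreover have "nm (sc (c * (t - 1)) \<otimes> k \<otimes> u) \<le> (1 - t) * 1 * K"
  proof (intro nm_mult_le)
    have "\<bar>c * (t - 1)\<bar> \<le> 1 - t" using c t by (auto simp: abs_mult intro!: mult_left_le_one_le)
    then show "nm (sc (c * (t - 1))) \<le> 1 - t" using nm_sc order_trans by blast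
  qed (use k u in auto)
  moreover have "nm (lin c y \<otimes> (u \<ominus> v)) \<le> (1 + 1) * (2 * K * (K * (4 * (1 - t))))"
  proof (intro nm_mult_le)
    have "nm (sc c \<otimes> y) \<le> 1 * (1 * 1)" unfolding y_def
      by (intro nm_mult_le) (use c t k nm_sc[of c] nm_sc[of t] in auto)
    then show "nm (lin c y) \<le> 1 + 1" unfolding lin_def
      using nm_minus[of \<one> "sc c \<otimes> y"] nm_one y by simp
    show "nm (u \<ominus> v) \<le> 2 * K * (K * (4 * (1 - t)))"
      unfolding uv
      using nm_uminus[of "v \<otimes> (u \<otimes> E)"] nm_mult_le[of v "u \<otimes> E" "2 * K" "K * (4 * (1 - t))"]
        nm_mult_le[of u E K "4 * (1 - t)"] u v E nE nv by simp
  qed (use y u v in auto)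
  ultimately have "nm (lin c k \<otimes> u \<ominus> lin c y \<otimes> v) \<le> K * (1 - t) + 16 * (K\<^sup>2 * (1 - t))"
    by (simp add: power2_eq_square algebra_simps)
  also have "\<dots> \<le> 1 / 8" using K2 t(3) by simp
  finally show "\<exists>u\<in>carrier R. \<exists>v\<in>carrier R. quad c k \<otimes> u = \<one> \<and> quad c (sc t \<otimes> k) \<otimes> v = \<one> \<and>
      nm (lin c k \<otimes> u \<ominus> lin c (sc t \<otimes> k) \<otimes> v) \<le> 1 / 8"
    using u v qv unfolding y_def by blast
qed

text \<open>Inverses are locally bounded in c, and [-1, 1] is compact; \<open>Bolzano\<close>
  supplies the compactness argument by bisection.\<close>

lemma nm_inverse_quad_bounded:
  assumes k: "k \<in> carrier R" "nm k \<le> 1"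
    and inv: "\<And>c. c \<in> {-1..1} \<Longrightarrow> \<exists>u\<in>carrier R. quad c k \<otimes> u = \<one>"
  shows "\<exists>K. \<forall>c\<in>{-1..1}. \<forall>u\<in>carrier R. quad c k \<otimes> u = \<one> \<longrightarrow> nm u \<le> K"
proof -
  have "(-1::real) \<le> 1" by simp
  then show ?thesis
  proof (induction rule: Bolzano)
    case (trans a b c)
    then obtain K L where "\<forall>c\<in>{a..b}. \<forall>u\<in>carrier R. quad c k \<otimes> u = \<one> \<longrightarrow> nm u \<le> K"
      "\<forall>x\<in>{b..c}. \<forall>u\<in>carrier R. quad x k \<otimes> u = \<one> \<longrightarrow> nm u \<le> L" by blast
    then have "\<forall>x\<in>{a..c}. \<forall>u\<in>carrier R. quad x k \<otimes> u = \<one> \<longrightarrow> nm u \<le> max K L"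
      by (metis atLeastAtMost_iff linorder_le_cases max.coboundedI1 max.coboundedI2)
    then show ?case by blast
  next
    case (local x)
    then obtain u where u: "u \<in> carrier R" "quad x k \<otimes> u = \<one>" using inv by auto
    \<comment> \<open>For |x - c| < d this radius gives
      \<open>nm u * (2 * \<bar>x - c\<bar>) \<le> 1 / 2\<close>. Since w - u = w u
      (\<open>quad x k\<close> - \<open>quad c k\<close>), it follows that |w| \<le> |u| + |w| /
      2.\<close>
    define d where "d = 1 / (4 * (nm u + 1))"
    have d: "d > 0" using nm_ge_0[OF u(1)] by (simp add: d_def)
    have "nm w \<le> 2 * nm u" if c: "\<bar>x - c\<bar> < d" and w: "w \<in> carrier R" "quad c k \<otimes> w = \<one>" for c w
    proof -
      have "quad x k \<ominus> quad c k = sc (2 * c - 2 * x) \<otimes> k"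
        unfolding quad_def sc_diff using k sc_closed[of "2 * x"] sc_closed[of "2 * c"] by algebra
      moreover have "w \<ominus> u = w \<otimes> (quad x k \<otimes> u) \<ominus> u \<otimes> (quad c k \<otimes> w)" using u w by simp
      then have "w \<ominus> u = w \<otimes> (u \<otimes> (quad x k \<ominus> quad c k))"
        using u(1) w(1) quad_closed[OF k(1), of c] quad_closed[OF k(1), of x] by algebra
      ultimately have wu: "w \<ominus> u = w \<otimes> (u \<otimes> (sc (2 * c - 2 * x) \<otimes> k))" by simp
      have "nm (w \<ominus> u) \<le> nm w * (nm u * (2 * \<bar>x - c\<bar> * 1))" (is ?P) unfolding wu
      proof (intro nm_mult_le order_refl)
        have "\<bar>2 * c - 2 * x\<bar> = \<bar>2 * (c - x)\<bar>" by (simp only: right_diff_distrib)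
        then have "\<bar>2 * c - 2 * x\<bar> = 2 * \<bar>x - c\<bar>" by (simp only: abs_mult abs_minus_commute[of c] abs_numeral)
        then show "nm (sc (2 * c - 2 * x)) \<le> 2 * \<bar>x - c\<bar>" using nm_sc[of "2 * c - 2 * x"] by simp
      qed (use u w k in auto)
      note P = \<open>?P\<close>
      have "nm u * (2 * \<bar>x - c\<bar>) \<le> (nm u + 1) * (2 * d)"
        using c nm_ge_0[OF u(1)] by (intro mult_mono) auto
      moreover have "(nm u + 1) * (2 * d) = 1 / 2" using nm_ge_0[OF u(1)] by (simp add: d_def)
      ultimately have "nm u * (2 * \<bar>x - c\<bar>) \<le> 1 / 2" by linarith
      then have Q: "nm w * (nm u * (2 * \<bar>x - c\<bar>)) \<le> nm w * (1 / 2)"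
        using nm_ge_0[OF w(1)] by (rule mult_left_mono)
      have "w = u \<oplus> (w \<ominus> u)" using u(1) w(1) by algebra
      then have "nm w \<le> nm u + nm (w \<ominus> u)" using nm_add[of u "w \<ominus> u"] u w by simp
      then show ?thesis using P Q by simp
    qed
    note bound = this
    show ?case
    proof (rule exI[of _ d], intro conjI allI impI d, rule exI[of _ "2 * nm u"], intro ballI impI)
      fix a b c w assume "a \<le> x \<and> x \<le> b \<and> b - a < d" "c \<in> {a..b}" "w \<in> carrier R" "quad c k \<otimes> w = \<one>"
      then show "nm w \<le> 2 * nm u" by (intro bound[of c]) auto
    qed
  qed
qed

text \<open>The function \<open>lin c x / quad c x\<close> is the real part of \<open>1 / (1 - w x)\<close> for \<open>w\<close> on the unit
  circle with real part \<open>c\<close>.  Averaging it over \<open>w\<close> and \<open>-w\<close> replaces \<open>w, x\<close> by their squares, so that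
  being close is preserved by squaring; for \<open>t < 1\<close> the iterated squares of \<open>t k\<close> tend to \<open>0\<close>, those
  of \<open>k\<close> do not.\<close>

theorem ex_not_invertible_quad:
  assumes k: "k \<in> carrier R" "\<And>n. nm (sq_iter n k) = 1"
    and inv: "\<And>c. c \<in> {-1..1} \<Longrightarrow> \<exists>u\<in>carrier R. quad c k \<otimes> u = \<one>"
  shows False
proof -
  have k1: "nm k = 1" using k(2)[of 0] by (simp add: sq_iter_simps)
  obtain K0 where K0: "\<forall>c\<in>{-1..1}. \<forall>u\<in>carrier R. quad c k \<otimes> u = \<one> \<longrightarrow> nm u \<le> K0"
    using nm_inverse_quad_bounded[OF k(1) _ inv] k1 by auto
  \<comment> \<open>The maximum with 1 meets the requirement K \<ge> 1 of
    \<open>close_sc_mult\<close>; the choice of t below makes 136 K^2 (1 - t) equal to 1.\<close>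
  define K where "K = max K0 1"
  define t where "t = 1 - 1 / (136 * K\<^sup>2)"
  have K: "K \<ge> 1" by (simp add: K_def)
  then have "K\<^sup>2 \<ge> 1" by simp
  then have "1 / (136 * K\<^sup>2) \<le> 1" by (simp add: divide_le_eq)
  then have t: "0 \<le> t" "t < 1" "136 * K\<^sup>2 * (1 - t) \<le> 1" using K by (auto simp: t_def)
  have cl: "close (1 / 8) k (sc t \<otimes> k)"
  proof (rule close_sc_mult[OF k(1) _ K])
    fix c :: real assume c: "c \<in> {-1..1}"
    then obtain u where u: "u \<in> carrier R" "quad c k \<otimes> u = \<one>" using inv by blast
    then have "nm u \<le> K" using K0 c unfolding K_def by fastforce
    then show "\<exists>u\<in>carrier R. quad c k \<otimes> u = \<one> \<and> nm u \<le> K" using u by blast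
  qed (use t k1 in auto)
  have tk: "nm (sc t \<otimes> k) \<le> t" using nm_sc_mult[OF k(1), of t] k1 t by simp
  obtain n where n: "t ^ n < 1 / 4" using real_arch_pow_inv[of "1 / 4" t] t by auto
  have "nm (sq_iter n (sc t \<otimes> k)) \<le> nm (sc t \<otimes> k) ^ 2 ^ n" by (rule nm_sq_iter) (use k in auto)
  also have "\<dots> \<le> t ^ 2 ^ n" using tk nm_ge_0[of "sc t \<otimes> k"] k by (intro power_mono) auto
  also have "\<dots> \<le> t ^ n" using t by (intro power_decreasing) auto
  finally have "nm (sq_iter n (sc t \<otimes> k)) \<le> 1 / 4" using n by simp
  then have "nm (sq_iter n k) < 1"
    using close_sq_iter[OF k(1) _ cl, of n] k(1) by (intro nm_less_1_of_close) auto
  then show False using k(2)[of n] by simp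
qed

end

section \<open>Commuting factors of units, and commutative subrings closed under inverses\<close>

context ring begin

text \<open>With w the inverse of a b, the element b w is a right inverse of a, and w b is a left
  inverse because a and b commute. A left and a right inverse coincide.\<close>

lemma Units_commuting_factor:
  assumes a: "a \<in> carrier R" and b: "b \<in> carrier R" and ab: "a \<otimes> b = b \<otimes> a" and u: "a \<otimes> b \<in> Units R"
  shows "a \<in> Units R"
proof -
  obtain w where w: "w \<in> carrier R" "w \<otimes> (a \<otimes> b) = \<one>" "(a \<otimes> b) \<otimes> w = \<one>"
    using u by (auto simp: Units_def)
  have r: "a \<otimes> (b \<otimes> w) = \<one>" using w a b by (simp add: m_assoc)
  have l: "(w \<otimes> b) \<otimes> a = \<one>" using w a b by (simp add: m_assoc ab)
  have "w \<otimes> b = (w \<otimes> b) \<otimes> (a \<otimes> (b \<otimes> w))" unfolding r using w b by simp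
  also have "\<dots> = ((w \<otimes> b) \<otimes> a) \<otimes> (b \<otimes> w)" using w a b by (simp add: m_assoc)
  also have "\<dots> = b \<otimes> w" unfolding l using w b by simp
  finally show ?thesis using r l a b w by (auto simp: Units_def)
qed

text \<open>Preferred to the subring generated by k: it is still commutative and contains k, but it
  also contains the inverses of its elements that are units of R. This is what lets
  \<open>normed_cring\<close> apply to it.\<close>

definition bicommutant :: "'a \<Rightarrow> 'a set" where
  "bicommutant k = {a \<in> carrier R. \<forall>b\<in>carrier R. k \<otimes> b = b \<otimes> k \<longrightarrow> a \<otimes> b = b \<otimes> a}"

text \<open>Since k commutes with itself, b commutes with k; therefore a commutes with b.\<close>

lemma bicommutant_commute: "\<lbrakk>k \<in> carrier R; a \<in> bicommutant k; b \<in> bicommutant k\<rbrakk> \<Longrightarrow> a \<otimes> b = b \<otimes> a"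
  unfolding bicommutant_def by (smt (verit) mem_Collect_eq)

lemma subcring_bicommutant:
  assumes k: "k \<in> carrier R" shows "subcring (bicommutant k) R"
proof (rule subcringI[OF subringI])
  fix a b assume a: "a \<in> bicommutant k" and b: "b \<in> bicommutant k"
  show "a \<otimes> b = b \<otimes> a" using bicommutant_commute[OF k a b] .
  show "a \<oplus> b \<in> bicommutant k" using a b by (simp add: bicommutant_def l_distr r_distr)
  {
    fix c assume c: "c \<in> carrier R" "k \<otimes> c = c \<otimes> k"
    have "a \<otimes> b \<otimes> c = a \<otimes> (c \<otimes> b)" using a b c by (simp add: bicommutant_def m_assoc)
    also have "\<dots> = c \<otimes> (a \<otimes> b)" using a b c by (simp add: bicommutant_def flip: m_assoc)
    finally have "a \<otimes> b \<otimes> c = c \<otimes> (a \<otimes> b)" .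
  }
  then show "a \<otimes> b \<in> bicommutant k" using a b by (simp add: bicommutant_def)
qed (auto simp: bicommutant_def l_minus r_minus)

lemma bicommutant_inverse:
  assumes a: "a \<in> bicommutant k" and w: "w \<in> carrier R" "a \<otimes> w = \<one>" "w \<otimes> a = \<one>"
  shows "w \<in> bicommutant k"
proof -
  have "w \<otimes> b = b \<otimes> w" if b: "b \<in> carrier R" "k \<otimes> b = b \<otimes> k" for b
  proof -
    have ab: "a \<in> carrier R" "a \<otimes> b = b \<otimes> a" using a b by (auto simp: bicommutant_def)
    have "w \<otimes> b = w \<otimes> b \<otimes> (a \<otimes> w)" unfolding w(2) using b w by simp
    also have "\<dots> = w \<otimes> (b \<otimes> a) \<otimes> w" using b(1) w(1) ab(1) by (simp add: m_assoc)
    also have "\<dots> = (w \<otimes> a) \<otimes> (b \<otimes> w)" unfolding ab(2)[symmetric] using b(1) w(1) ab(1) by (simp add: m_assoc)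
    also have "\<dots> = b \<otimes> w" unfolding w(3) using b w by simp
    finally show ?thesis .
  qed
  then show ?thesis using w by (simp add: bicommutant_def)
qed

end

text \<open>The endomorphism ring of one object of a complete *-category, reduced to its real
  scalars, which form central self-adjoint elements \<open>sc r\<close>. Both scalar fields are
  thereby treated at once. Completeness is represented by Neumann's criterion
  \<open>one_plus_Units\<close>.\<close>

locale normed_star_ring = ring R for R :: "('a, 'm) ring_scheme" (structure) +
  fixes nm :: "'a \<Rightarrow> real" and sc :: "real \<Rightarrow> 'a" and st :: "'a \<Rightarrow> 'a"
  assumes sc_closed [simp, intro]: "sc r \<in> carrier R"
    and sc_add: "sc (r + s) = sc r \<oplus> sc s"
    and sc_mult: "sc (r * s) = sc r \<otimes> sc s"
    and sc_1: "sc 1 = \<one>"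
    and sc_commute: "a \<in> carrier R \<Longrightarrow> sc r \<otimes> a = a \<otimes> sc r"
    and nm_ge_0: "a \<in> carrier R \<Longrightarrow> 0 \<le> nm a"
    and nm_add: "\<lbrakk>a \<in> carrier R; b \<in> carrier R\<rbrakk> \<Longrightarrow> nm (a \<oplus> b) \<le> nm a + nm b"
    and nm_mult: "\<lbrakk>a \<in> carrier R; b \<in> carrier R\<rbrakk> \<Longrightarrow> nm (a \<otimes> b) \<le> nm a * nm b"
    and nm_sc: "nm (sc r) \<le> \<bar>r\<bar>"
    and nm_sc_mult: "a \<in> carrier R \<Longrightarrow> nm (sc r \<otimes> a) = \<bar>r\<bar> * nm a"
    and one_plus_Units: "\<lbrakk>z \<in> carrier R; nm z < 1\<rbrakk> \<Longrightarrow> \<one> \<oplus> z \<in> Units R"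
    and st_closed [simp, intro]: "a \<in> carrier R \<Longrightarrow> st a \<in> carrier R"
    and st_add: "\<lbrakk>a \<in> carrier R; b \<in> carrier R\<rbrakk> \<Longrightarrow> st (a \<oplus> b) = st a \<oplus> st b"
    and st_mult: "\<lbrakk>a \<in> carrier R; b \<in> carrier R\<rbrakk> \<Longrightarrow> st (a \<otimes> b) = st b \<otimes> st a"
    and st_sc: "st (sc r) = sc r"
    and nm_st_mult: "a \<in> carrier R \<Longrightarrow> nm (st a \<otimes> a) = (nm a)\<^sup>2"
begin

lemma sc_0: "sc 0 = \<zero>"
  using sc_add[of 0 0] by (metis add.l_cancel_one' add_0 sc_closed)

lemma sc_minus: "sc (- r) = \<ominus> sc r"
  using minus_equality[of "sc (- r)" "sc r"] by (simp add: sc_0 flip: sc_add)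

lemma sc_diff: "sc (r - s) = sc r \<ominus> sc s"
  using sc_add[of r "- s"] by (simp add: sc_minus a_minus_def)

lemma minus_eq_sc: "a \<in> carrier R \<Longrightarrow> \<ominus> a = sc (- 1) \<otimes> a"
  by (simp add: sc_minus sc_1 l_minus)

lemma nm_uminus: "a \<in> carrier R \<Longrightarrow> nm (\<ominus> a) = nm a"
  by (simp add: minus_eq_sc nm_sc_mult)

lemma st_uminus: "a \<in> carrier R \<Longrightarrow> st (\<ominus> a) = \<ominus> st a"
  by (simp add: minus_eq_sc st_mult st_sc sc_commute)

lemma st_minus: "\<lbrakk>a \<in> carrier R; b \<in> carrier R\<rbrakk> \<Longrightarrow> st (a \<ominus> b) = st a \<ominus> st b"
  by (simp add: a_minus_def st_add st_uminus)

lemma sc_Units: "r \<noteq> 0 \<Longrightarrow> sc r \<in> Units R"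
  unfolding Units_def by (auto intro!: bexI[of _ "sc (inverse r)"] simp: sc_1 simp flip: sc_mult)

lemma sc_mult_Units_iff:
  assumes "a \<in> carrier R" "r \<noteq> 0" shows "sc r \<otimes> a \<in> Units R \<longleftrightarrow> a \<in> Units R"
proof
  assume "sc r \<otimes> a \<in> Units R"
  then have "sc (inverse r) \<otimes> (sc r \<otimes> a) \<in> Units R" using assms by (auto intro: Units_m_closed[OF sc_Units])
  moreover have "sc (inverse r) \<otimes> (sc r \<otimes> a) = (sc (inverse r) \<otimes> sc r) \<otimes> a"
    using assms by (simp add: m_assoc)
  then have "sc (inverse r) \<otimes> (sc r \<otimes> a) = a" using assms by (simp add: sc_1 flip: sc_mult)
  ultimately show "a \<in> Units R" by (simp only:)
qed (rule Units_m_closed[OF sc_Units[OF assms(2)]])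

lemma sc_plus_Units:
  assumes "a \<in> carrier R" "nm a < \<bar>r\<bar>" shows "sc r \<oplus> a \<in> Units R"
proof -
  have r: "r \<noteq> 0" using assms nm_ge_0[of a] by auto
  have "\<one> \<oplus> sc (inverse r) \<otimes> a \<in> Units R"
    using assms r by (intro one_plus_Units) (auto simp: nm_sc_mult field_simps)
  then have "sc r \<otimes> (\<one> \<oplus> sc (inverse r) \<otimes> a) \<in> Units R" using r by (intro Units_m_closed sc_Units)
  moreover have "sc r \<otimes> (\<one> \<oplus> sc (inverse r) \<otimes> a) = sc r \<oplus> a"
    using assms(1) r by (simp add: r_distr sc_1 flip: m_assoc sc_mult)
  ultimately show ?thesis by simp
qed

lemma sc_minus_Units: "\<lbrakk>a \<in> carrier R; nm a < \<bar>r\<bar>\<rbrakk> \<Longrightarrow> sc r \<ominus> a \<in> Units R"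
  using sc_plus_Units[of "\<ominus> a" r] by (simp add: a_minus_def nm_uminus)

end

text \<open>The form in which positivity of \<open>a\<^sup>* a\<close> reaches the ring: no negative
  number is in the spectrum of the square of a self-adjoint element.\<close>

locale positive_star_ring = normed_star_ring +
  assumes square_plus_Units: "\<lbrakk>a \<in> carrier R; st a = a; t > 0\<rbrakk> \<Longrightarrow> a \<otimes> a \<oplus> sc t \<in> Units R"
begin

text \<open>The element equals (k - c)^2 + (1 - c^2). For c^2 < 1 it is a self-adjoint square plus a
  positive scalar. For c = 1 or c = -1 it is (k - c)^2, and k - c is a commuting factor of 1 - k^2 =
  - (k - c)(k + c).\<close>

lemma quad_Units:
  assumes k: "k \<in> carrier R" "st k = k" and u: "\<one> \<ominus> k \<otimes> k \<in> Units R" and c: "c \<in> {-1..1}"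
  shows "\<one> \<oplus> sc (- 2 * c) \<otimes> k \<oplus> k \<otimes> k \<in> Units R"
proof -
  have cc: "c\<^sup>2 \<le> 1" using c by (simp add: abs_square_le_1 abs_le_iff)
  have 1: "(k \<ominus> sc c) \<otimes> (k \<ominus> sc c) = k \<otimes> k \<ominus> (sc c \<otimes> k \<oplus> k \<otimes> sc c) \<oplus> sc c \<otimes> sc c"
    using k(1) sc_closed[of c] by algebra
  have "sc c \<otimes> k \<oplus> k \<otimes> sc c = sc (2 * c) \<otimes> k"
    using sc_add[of c c] k(1) by (simp add: l_distr sc_commute[symmetric])
  then have 2: "(k \<ominus> sc c) \<otimes> (k \<ominus> sc c) = sc (c\<^sup>2) \<oplus> sc (- 2 * c) \<otimes> k \<oplus> k \<otimes> k"
    unfolding 1 using k(1) by (simp add: sc_minus l_minus power2_eq_square sc_mult a_minus_def a_ac)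
  have 3: "(k \<ominus> sc c) \<otimes> (k \<ominus> sc c) \<oplus> sc (1 - c\<^sup>2) = \<one> \<oplus> sc (- 2 * c) \<otimes> k \<oplus> k \<otimes> k"
    unfolding 2 using k(1) sc_add[of "1 - c\<^sup>2" "c\<^sup>2"] by (simp add: a_ac sc_1)
  show ?thesis
  proof (cases "c\<^sup>2 = 1")
    case False
    then have "1 - c\<^sup>2 > 0" using cc by simp
    then show ?thesis unfolding 3[symmetric] using k by (intro square_plus_Units) (auto simp: st_minus st_sc)
  next
    case True
    have "(k \<ominus> sc c) \<otimes> (\<ominus> (k \<oplus> sc c)) = sc c \<otimes> sc c \<ominus> k \<otimes> k \<oplus> (sc c \<otimes> k \<ominus> k \<otimes> sc c)"
      using k(1) sc_closed[of c] by algebra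
    also have "\<dots> = \<one> \<ominus> k \<otimes> k"
      using k(1) True by (simp add: sc_commute sc_1 power2_eq_square r_neg minus_eq flip: sc_mult)
    finally have *: "(k \<ominus> sc c) \<otimes> (\<ominus> (k \<oplus> sc c)) \<in> Units R" using u by simp
    have "(k \<ominus> sc c) \<otimes> (\<ominus> (k \<oplus> sc c)) \<ominus> (\<ominus> (k \<oplus> sc c)) \<otimes> (k \<ominus> sc c)
        = (sc c \<otimes> k \<ominus> k \<otimes> sc c) \<oplus> (sc c \<otimes> k \<ominus> k \<otimes> sc c)"
      using k(1) sc_closed[of c] by algebra
    then have "(k \<ominus> sc c) \<otimes> (\<ominus> (k \<oplus> sc c)) \<ominus> (\<ominus> (k \<oplus> sc c)) \<otimes> (k \<ominus> sc c) = \<zero>"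
      using k(1) by (simp add: sc_commute r_neg minus_eq)
    then have "k \<ominus> sc c \<in> Units R"
      using k(1) by (intro Units_commuting_factor[OF _ _ _ *]) auto
    then have "(k \<ominus> sc c) \<otimes> (k \<ominus> sc c) \<in> Units R" by simp
    then show ?thesis unfolding 2 by (simp add: True sc_1)
  qed
qed

lemma normed_cring_bicommutant:
  assumes k: "k \<in> carrier R"
  shows "normed_cring (R\<lparr>carrier := bicommutant k\<rparr>) nm sc"
proof -
  have sub: "bicommutant k \<subseteq> carrier R" by (auto simp: bicommutant_def)
  interpret Z: cring "R\<lparr>carrier := bicommutant k\<rparr>"
    using subcring_iff[OF sub] subcring_bicommutant[OF k] by simp
  show ?thesis
  proof (unfold_locales, goal_cases)
    \<comment> \<open>The Neumann axiom: an inverse exists in R, and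
      \<open>bicommutant_inverse\<close> places it in the subring.\<close>
    case (9 z)
    then have z: "z \<in> bicommutant k" "\<one> \<oplus> z \<in> Units R" using sub by (auto intro: one_plus_Units)
    then obtain w where "w \<in> carrier R" "w \<otimes> (\<one> \<oplus> z) = \<one>" "(\<one> \<oplus> z) \<otimes> w = \<one>" by (auto simp: Units_def)
    moreover have "\<one> \<oplus> z \<in> bicommutant k" using z subcringE(3,7)[OF subcring_bicommutant[OF k]] by blast
    ultimately show ?case using bicommutant_inverse[of "\<one> \<oplus> z" k w] by auto
  qed (use sub in \<open>auto simp: sc_add sc_mult sc_1 nm_sc bicommutant_def intro: nm_ge_0 nm_add nm_mult sc_commute\<close>)
qed

text \<open>For self-adjoint k the C*-identity reads |k^2| = |k|^2, so all iterated squares of k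
  have norm 1. If 1 - k^2 were a unit, \<open>quad_Units\<close> would supply every inverse that
  \<open>ex_not_invertible_quad\<close> forbids.\<close>

lemma not_Units_of_nm_1:
  assumes k: "k \<in> carrier R" "st k = k" "nm k = 1"
  shows "\<one> \<ominus> k \<otimes> k \<notin> Units R"
proof
  assume u: "\<one> \<ominus> k \<otimes> k \<in> Units R"
  interpret Z: normed_cring "R\<lparr>carrier := bicommutant k\<rparr>" nm sc
    by (rule normed_cring_bicommutant[OF k(1)])
  have kZ: "k \<in> bicommutant k" using k by (simp add: bicommutant_def)
  have it: "Z.sq_iter n k \<in> carrier R \<and> st (Z.sq_iter n k) = Z.sq_iter n k \<and> nm (Z.sq_iter n k) = 1" for n
  proof (induction n)
    case (Suc n)
    then show ?case using nm_st_mult[of "Z.sq_iter n k"] by (simp add: Z.sq_iter_simps st_mult)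
  qed (use k in \<open>simp_all add: Z.sq_iter_simps\<close>)
  show False
  proof (rule Z.ex_not_invertible_quad[of k])
    fix c :: real assume c: "c \<in> {-1..1}"
    have q: "Z.quad c k = \<one> \<oplus> sc (- 2 * c) \<otimes> k \<oplus> k \<otimes> k"
      using Z.quad_eq_add[of k c] kZ by simp
    have "Z.quad c k \<in> bicommutant k" using Z.quad_closed[of k c] kZ by simp
    moreover have "Z.quad c k \<in> Units R" unfolding q by (rule quad_Units[OF k(1,2) u c])
    ultimately show "\<exists>u\<in>carrier (R\<lparr>carrier := bicommutant k\<rparr>).
        Z.quad c k \<otimes>\<^bsub>R\<lparr>carrier := bicommutant k\<rparr>\<^esub> u = \<one>\<^bsub>R\<lparr>carrier := bicommutant k\<rparr>\<^esub>"
      using bicommutant_inverse[of "Z.quad c k" k] by (auto simp: Units_def)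
  qed (use kZ it in auto)
qed

theorem not_Units_square_nm:
  assumes k: "k \<in> carrier R" "st k = k" and m: "nm k > 0"
  shows "sc ((nm k)\<^sup>2) \<ominus> k \<otimes> k \<notin> Units R"
proof
  assume u: "sc ((nm k)\<^sup>2) \<ominus> k \<otimes> k \<in> Units R"
  define i where "i = inverse (nm k)"
  define h where "h = sc i \<otimes> k"
  have h: "h \<in> carrier R" "st h = h" "nm h = 1"
    using k m by (simp add: h_def, simp add: h_def st_mult st_sc sc_commute[OF k(1)],
      simp add: h_def i_def nm_sc_mult)
  have "h \<otimes> h = sc i \<otimes> (k \<otimes> sc i) \<otimes> k"
    unfolding h_def using k(1) by (simp add: m_assoc)
  then have "h \<otimes> h = sc (i * i) \<otimes> (k \<otimes> k)"
    unfolding sc_commute[OF k(1), symmetric] sc_mult using k(1) by (simp add: m_assoc)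
  moreover have "\<one> = sc (i * i) \<otimes> sc ((nm k)\<^sup>2)"
  proof -
    have "i * i * (nm k)\<^sup>2 = 1" using m by (simp add: i_def power2_eq_square field_simps)
    then show ?thesis by (simp add: sc_1 flip: sc_mult)
  qed
  ultimately have "\<one> \<ominus> h \<otimes> h = sc (i * i) \<otimes> (sc ((nm k)\<^sup>2) \<ominus> k \<otimes> k)"
    using k(1) by (simp add: a_minus_def r_distr r_minus)
  then have "\<one> \<ominus> h \<otimes> h \<in> Units R"
    using u k m by (simp add: sc_mult_Units_iff i_def)
  then show False using not_Units_of_nm_1[OF h] by simp
qed

text \<open>Suppose k = r - h had norm m > r. Then m - k = h + (m - r) is a unit by assumption, and
  m + k = (m + r) - h is one because |h| < m + r. So m^2 - k^2 would be a unit, against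
  \<open>not_Units_square_nm\<close>.\<close>

theorem nm_sc_minus_le:
  assumes h: "h \<in> carrier R" "st h = h" "nm h \<le> r" and pos: "\<And>t. t > 0 \<Longrightarrow> h \<oplus> sc t \<in> Units R"
  shows "nm (sc r \<ominus> h) \<le> r"
proof (rule ccontr)
  assume "\<not> nm (sc r \<ominus> h) \<le> r"
  define k where "k = sc r \<ominus> h"
  define m where "m = nm k"
  have m: "m > r" using \<open>\<not> _\<close> by (simp add: m_def k_def)
  have r: "r \<ge> 0" using nm_ge_0[OF h(1)] h(3) by simp
  have k: "k \<in> carrier R" "st k = k" using h by (auto simp: k_def st_minus st_sc)
  have "sc m \<ominus> k = h \<oplus> sc (m - r)"
    unfolding k_def sc_diff using h(1) sc_closed[of m] sc_closed[of r] by algebra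
  then have 1: "sc m \<ominus> k \<in> Units R" using pos m by simp
  have "sc m \<oplus> k = sc (m + r) \<ominus> h"
    unfolding k_def sc_add using h(1) sc_closed[of m] sc_closed[of r] by algebra
  then have 2: "sc m \<oplus> k \<in> Units R" using h m r by (simp add: sc_minus_Units)
  have "(sc m \<ominus> k) \<otimes> (sc m \<oplus> k) = (sc m \<otimes> sc m \<ominus> k \<otimes> k) \<oplus> (sc m \<otimes> k \<ominus> k \<otimes> sc m)"
    using k(1) sc_closed[of m] by algebra
  then have "(sc m \<ominus> k) \<otimes> (sc m \<oplus> k) = sc (m\<^sup>2) \<ominus> k \<otimes> k"
    using k(1) by (simp add: sc_commute[OF k(1)] r_neg minus_eq power2_eq_square sc_mult)
  then have "sc (m\<^sup>2) \<ominus> k \<otimes> k \<in> Units R" using Units_m_closed[OF 1 2] by simp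
  then show False using not_Units_square_nm[OF k] m r by (simp add: m_def)
qed

end

text \<open>If m = \<open>nm' (\<phi> h)\<close> exceeded \<open>nm h\<close>, then m^2 - h^2 would
  be a unit by Neumann's criterion, and so would its image m^2 - \<open>\<phi> h\<close>^2. This
  contradicts \<open>not_Units_square_nm\<close> in the target.\<close>

theorem selfadjoint_hom_contractive:
  assumes R: "normed_star_ring R nm sc st" and S: "positive_star_ring S nm' sc' st'"
    and \<phi>: "\<And>a. a \<in> carrier R \<Longrightarrow> \<phi> a \<in> carrier S"
      "\<And>a b. \<lbrakk>a \<in> carrier R; b \<in> carrier R\<rbrakk> \<Longrightarrow> \<phi> (a \<oplus>\<^bsub>R\<^esub> b) = \<phi> a \<oplus>\<^bsub>S\<^esub> \<phi> b"
      "\<And>a b. \<lbrakk>a \<in> carrier R; b \<in> carrier R\<rbrakk> \<Longrightarrow> \<phi> (a \<otimes>\<^bsub>R\<^esub> b) = \<phi> a \<otimes>\<^bsub>S\<^esub> \<phi> b"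
      "\<And>r. \<phi> (sc r) = sc' r"
    and h: "h \<in> carrier R" "st' (\<phi> h) = \<phi> h"
  shows "nm' (\<phi> h) \<le> nm h"
proof (rule ccontr)
  interpret R: normed_star_ring R nm sc st by (rule R)
  interpret S: positive_star_ring S nm' sc' st' by (rule S)
  assume "\<not> nm' (\<phi> h) \<le> nm h"
  define m where "m = nm' (\<phi> h)"
  have m: "nm h < m" "0 < m" using \<open>\<not> _\<close> R.nm_ge_0[OF h(1)] by (auto simp: m_def)
  have one: "\<phi> \<one>\<^bsub>R\<^esub> = \<one>\<^bsub>S\<^esub>" using \<phi>(4)[of 1] by (simp add: R.sc_1 S.sc_1)
  have "nm (h \<otimes>\<^bsub>R\<^esub> h) \<le> nm h * nm h" using R.nm_mult h by blast
  also have "\<dots> < m\<^sup>2" using m R.nm_ge_0[OF h(1)] by (simp add: power2_eq_square mult_strict_mono)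
  finally have "nm (h \<otimes>\<^bsub>R\<^esub> h) < \<bar>m\<^sup>2\<bar>" by simp
  then have "sc (m\<^sup>2) \<ominus>\<^bsub>R\<^esub> h \<otimes>\<^bsub>R\<^esub> h \<in> Units R" using h by (intro R.sc_minus_Units) auto
  then obtain w where w: "w \<in> carrier R" "w \<otimes>\<^bsub>R\<^esub> (sc (m\<^sup>2) \<ominus>\<^bsub>R\<^esub> h \<otimes>\<^bsub>R\<^esub> h) = \<one>\<^bsub>R\<^esub>"
      "(sc (m\<^sup>2) \<ominus>\<^bsub>R\<^esub> h \<otimes>\<^bsub>R\<^esub> h) \<otimes>\<^bsub>R\<^esub> w = \<one>\<^bsub>R\<^esub>" by (auto simp: Units_def)
  have "\<phi> (sc (m\<^sup>2) \<ominus>\<^bsub>R\<^esub> h \<otimes>\<^bsub>R\<^esub> h) \<in> Units S"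
    unfolding Units_def using w h by (auto simp: one \<phi>(1) simp flip: \<phi>(3) intro!: bexI[of _ "\<phi> w"])
  moreover have "\<phi> (sc (m\<^sup>2) \<ominus>\<^bsub>R\<^esub> h \<otimes>\<^bsub>R\<^esub> h) = sc' (m\<^sup>2) \<ominus>\<^bsub>S\<^esub> \<phi> h \<otimes>\<^bsub>S\<^esub> \<phi> h"
    using h \<phi> by (simp add: a_minus_def R.minus_eq_sc S.minus_eq_sc)
  ultimately show False using S.not_Units_square_nm[of "\<phi> h"] h \<phi> m by (simp add: m_def)
qed

section \<open>Norms in $*$-categories\<close>

context star_category begin

lemmas hom_zero_closed = vect_space.zero_closed[OF hom_vect_space]
  and hom_add_closed = vect_space.add_closed[OF hom_vect_space]
  and hom_scl_closed = vect_space.scl_closed[OF hom_vect_space]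
  and hom_add_assoc = vect_space.add_assoc[OF hom_vect_space]
  and hom_add_commute = vect_space.add_commute[OF hom_vect_space]
  and hom_add_zero = vect_space.add_zero[OF hom_vect_space]
  and hom_zero_add = vect_space.zero_add[OF hom_vect_space]
  and hom_scl_add = vect_space.scl_add[OF hom_vect_space]
  and hom_add_scl = vect_space.add_scl[OF hom_vect_space]
  and hom_scl_scl = vect_space.scl_scl[OF hom_vect_space]
  and hom_scl_one = vect_space.scl_one[OF hom_vect_space]
  and hom_scl_0 = vect_space.scl_0[OF hom_vect_space]
  and hom_scl_zero = vect_space.scl_zero[OF hom_vect_space]
  and hom_sub_closed = vect_space.sub_closed[OF hom_vect_space, folded Sub_def]
  and hom_sub_self = vect_space.sub_self[OF hom_vect_space, folded Sub_def]
  and hom_sub_add = vect_space.sub_add[OF hom_vect_space, folded Sub_def]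
  and hom_sub_scl = vect_space.sub_scl[OF hom_vect_space, folded Sub_def]

lemmas hom_closed = id_closed comp_closed star_closed hom_zero_closed hom_add_closed hom_scl_closed hom_sub_closed

lemma comp_sub_right: "\<lbrakk>x \<in> Ob A; y \<in> Ob A; z \<in> Ob A; a \<in> Hom A x y; a' \<in> Hom A x y; b \<in> Hom A y z\<rbrakk>
    \<Longrightarrow> Cmp A x y z b (Sub A x y a a') = Sub A x z (Cmp A x y z b a) (Cmp A x y z b a')"
  by (simp add: Sub_def comp_add_right comp_scl_right hom_closed)

lemma comp_sub_left: "\<lbrakk>x \<in> Ob A; y \<in> Ob A; z \<in> Ob A; a \<in> Hom A x y; b \<in> Hom A y z; b' \<in> Hom A y z\<rbrakk>
    \<Longrightarrow> Cmp A x y z (Sub A y z b b') a = Sub A x z (Cmp A x y z b a) (Cmp A x y z b' a)"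
  by (simp add: Sub_def comp_add_left comp_scl_left hom_closed)

lemma star_sub: "\<lbrakk>x \<in> Ob A; y \<in> Ob A; a \<in> Hom A x y; b \<in> Hom A x y\<rbrakk>
    \<Longrightarrow> Str A x y (Sub A x y a b) = Sub A y x (Str A x y a) (Str A x y b)"
  by (simp add: Sub_def star_add star_scl hom_closed)

lemma star_id:
  assumes x: "x \<in> Ob A" shows "Str A x x (Idt A x) = Idt A x"
proof -
  have i: "Idt A x \<in> Hom A x x" "Str A x x (Idt A x) \<in> Hom A x x" using x by (auto intro: hom_closed)
  have "Str A x x (Cmp A x x x (Str A x x (Idt A x)) (Idt A x))
      = Cmp A x x x (Str A x x (Idt A x)) (Str A x x (Str A x x (Idt A x)))"
    using x i by (intro star_comp)
  then show ?thesis using x i by (simp add: comp_id_right star_star)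
qed

end

text \<open>The bridge to HOL-Algebra: it makes \<open>Units\<close>, the ring locales and the
  method \<open>algebra\<close> available for endomorphisms of x.\<close>

definition end_ring :: "('o, 'a, 'f::field, 'z) star_cat_scheme \<Rightarrow> 'o \<Rightarrow> 'a ring" where
  "end_ring A x = \<lparr>carrier = Hom A x x, mult = Cmp A x x x, one = Idt A x, zero = Zer A x x, add = Add A x x\<rparr>"

definition scalar :: "('o, 'a, 'f::real_or_complex, 'z) star_cat_scheme \<Rightarrow> 'o \<Rightarrow> real \<Rightarrow> 'a" where
  "scalar A x r = Scl A x x (of_real r) (Idt A x)"

lemma end_ring_simps [simp]:
  "carrier (end_ring A x) = Hom A x x" "monoid.mult (end_ring A x) = Cmp A x x x"
  "monoid.one (end_ring A x) = Idt A x" "ring.zero (end_ring A x) = Zer A x x"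
  "ring.add (end_ring A x) = Add A x x"
  by (simp_all add: end_ring_def)

lemma Units_end_ring: "f \<in> Hom A x x \<Longrightarrow> f \<in> Units (end_ring A x) \<longleftrightarrow> (\<exists>g. is_inverse A x x f g)"
  by (auto simp: Units_def is_inverse_def)

context star_category begin

lemma ring_end_ring: "x \<in> Ob A \<Longrightarrow> ring (end_ring A x)"
proof (intro ringI abelian_groupI monoidI; simp?)
  fix a assume "x \<in> Ob A" "a \<in> Hom A x x"
  then show "\<exists>b\<in>Hom A x x. Add A x x b a = Zer A x x"
    using vect_space.ex_neg[OF hom_vect_space] hom_add_commute by metis
qed (auto simp: comp_add_left comp_add_right comp_assoc comp_id_left comp_id_right hom_zero_add
    hom_add_assoc intro: hom_closed hom_add_commute)

lemma end_ring_minus: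
  assumes "x \<in> Ob A" "a \<in> Hom A x x" "b \<in> Hom A x x"
  shows "a \<ominus>\<^bsub>end_ring A x\<^esub> b = Sub A x x a b"
proof -
  interpret ring "end_ring A x" by (rule ring_end_ring[OF assms(1)])
  have "\<ominus>\<^bsub>end_ring A x\<^esub> b = Scl A x x (- 1) b"
    using hom_sub_self[OF assms(1,1,3)] assms
    by (intro minus_equality) (auto simp: Sub_def hom_add_commute hom_scl_closed)
  then show ?thesis by (simp add: a_minus_def Sub_def)
qed

lemma scl_id_comp: "\<lbrakk>x \<in> Ob A; a \<in> Hom A x x\<rbrakk> \<Longrightarrow> Cmp A x x x (Scl A x x c (Idt A x)) a = Scl A x x c a"
  and comp_scl_id: "\<lbrakk>x \<in> Ob A; a \<in> Hom A x x\<rbrakk> \<Longrightarrow> Cmp A x x x a (Scl A x x c (Idt A x)) = Scl A x x c a"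
  by (simp_all add: comp_scl_left comp_scl_right comp_id_left comp_id_right hom_closed)

end

text \<open>A C*-seminorm. It is a parameter separate from \<open>Nrm\<close> because the maximal
  norm and the norms induced by functors live on *-categories that carry no norm of their
  own.\<close>

locale star_seminorm = star_category A for A :: "('o, 'a, 'f::real_or_complex, 'z) star_cat_scheme" +
  fixes N :: "'o \<Rightarrow> 'o \<Rightarrow> 'a \<Rightarrow> real"
  assumes N_scl: "\<lbrakk>x \<in> Ob A; y \<in> Ob A; a \<in> Hom A x y\<rbrakk> \<Longrightarrow> N x y (Scl A x y c a) = norm c * N x y a"
    and N_add: "\<lbrakk>x \<in> Ob A; y \<in> Ob A; a \<in> Hom A x y; b \<in> Hom A x y\<rbrakk>
      \<Longrightarrow> N x y (Add A x y a b) \<le> N x y a + N x y b"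
    and N_comp: "\<lbrakk>x \<in> Ob A; y \<in> Ob A; z \<in> Ob A; a \<in> Hom A x y; b \<in> Hom A y z\<rbrakk>
      \<Longrightarrow> N x z (Cmp A x y z b a) \<le> N y z b * N x y a"
    and N_star_comp: "\<lbrakk>x \<in> Ob A; y \<in> Ob A; a \<in> Hom A x y\<rbrakk>
      \<Longrightarrow> N x x (Cmp A x y x (Str A x y a) a) = (N x y a)\<^sup>2"
begin

lemma seminormed_hom: "\<lbrakk>x \<in> Ob A; y \<in> Ob A\<rbrakk>
    \<Longrightarrow> seminormed_space (Hom A x y) (Add A x y) (Zer A x y) (Scl A x y) (N x y)"
  by (intro seminormed_space.intro hom_vect_space seminormed_space_axioms.intro) (auto simp: N_scl N_add)

lemmas N_zero = seminormed_space.nm_zero[OF seminormed_hom]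
  and N_ge_0 = seminormed_space.nm_ge_0[OF seminormed_hom]
  and N_sub_swap = seminormed_space.nm_sub_swap[OF seminormed_hom, folded Sub_def]
  and N_sub_triangle = seminormed_space.nm_sub_triangle[OF seminormed_hom, folded Sub_def]
  and N_diff_le = seminormed_space.nm_diff_le[OF seminormed_hom, folded Sub_def]

lemma N_le_N_star: "\<lbrakk>x \<in> Ob A; y \<in> Ob A; a \<in> Hom A x y\<rbrakk> \<Longrightarrow> N x y a \<le> N y x (Str A x y a)"
  using N_comp[of x y x a "Str A x y a"] N_star_comp[of x y a] N_ge_0[of x y a]
    N_ge_0[of y x "Str A x y a"] star_closed[of x y a]
  by (cases "N x y a = 0") (auto simp: power2_eq_square mult_le_cancel_right)

lemma N_star: "\<lbrakk>x \<in> Ob A; y \<in> Ob A; a \<in> Hom A x y\<rbrakk> \<Longrightarrow> N y x (Str A x y a) = N x y a"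
  using N_le_N_star[of x y a] N_le_N_star[of y x "Str A x y a"] star_closed[of x y a]
  by (simp add: star_star)

text \<open>The norm of an identity equals its own square, hence is 0 or 1. The value 0 does occur,
  for instance for the zero seminorm.\<close>

lemma N_id_le: "x \<in> Ob A \<Longrightarrow> N x x (Idt A x) \<le> 1"
  using N_star_comp[of x x "Idt A x"] N_ge_0[of x x "Idt A x"]
  by (cases "N x x (Idt A x) = 0") (auto simp: id_closed star_id comp_id_left power2_eq_square)

lemma N_unitary_le:
  assumes "x \<in> Ob A" "y \<in> Ob A" "unitary A x y a" shows "N x y a \<le> 1"
proof -
  have "(N x y a)\<^sup>2 \<le> 1\<^sup>2"
    using assms N_star_comp[of x y a] N_id_le[of x] by (simp add: unitary_def)
  then show ?thesis by (rule power2_le_imp_le) simp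
qed

definition tends :: "'o \<Rightarrow> 'o \<Rightarrow> (nat \<Rightarrow> 'a) \<Rightarrow> 'a \<Rightarrow> bool" where
  "tends x y s a \<longleftrightarrow> (\<lambda>n. N x y (Sub A x y (s n) a)) \<longlonglongrightarrow> 0"

lemma tends_eq_seq_lim: "tends x y = seq_lim (Add A x y) (Scl A x y) (N x y)"
  by (intro ext) (simp add: tends_def seq_lim_def Sub_def)

lemmas tends_N = seminormed_space.tends_nm[OF seminormed_hom, folded tends_eq_seq_lim]
  and tends_add = seminormed_space.tends_add[OF seminormed_hom, folded tends_eq_seq_lim]
  and tends_scl = seminormed_space.tends_scl[OF seminormed_hom, folded tends_eq_seq_lim]
  and tends_const = seminormed_space.tends_const[OF seminormed_hom, folded tends_eq_seq_lim]

lemma tends_star: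
  assumes "x \<in> Ob A" "y \<in> Ob A" "\<And>n. s n \<in> Hom A x y" "a \<in> Hom A x y" "tends x y s a"
  shows "tends y x (\<lambda>n. Str A x y (s n)) (Str A x y a)"
  using assms by (simp add: tends_def N_star hom_closed flip: star_sub)

lemma N_comp_sub_le:
  assumes ob: "x \<in> Ob A" "y \<in> Ob A" "z \<in> Ob A"
    and h: "a \<in> Hom A x y" "a' \<in> Hom A x y" "b \<in> Hom A y z" "b' \<in> Hom A y z"
  shows "N x z (Sub A x z (Cmp A x y z b a) (Cmp A x y z b' a'))
    \<le> N y z b * N x y (Sub A x y a a') + N y z (Sub A y z b b') * N x y a'"
proof -
  have "N x z (Sub A x z (Cmp A x y z b a) (Cmp A x y z b' a'))
      \<le> N x z (Cmp A x y z b (Sub A x y a a')) + N x z (Cmp A x y z (Sub A y z b b') a')"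
    using N_sub_triangle[of x z "Cmp A x y z b a" "Cmp A x y z b a'" "Cmp A x y z b' a'"] ob h
    by (simp add: comp_sub_left comp_sub_right hom_closed)
  also have "\<dots> \<le> N y z b * N x y (Sub A x y a a') + N y z (Sub A y z b b') * N x y a'"
    using ob h by (intro add_mono N_comp hom_closed)
  finally show ?thesis .
qed

lemma tends_comp:
  assumes ob: "x \<in> Ob A" "y \<in> Ob A" "z \<in> Ob A"
    and s: "\<And>n. s n \<in> Hom A x y" "a \<in> Hom A x y" "tends x y s a"
    and t: "\<And>n. t n \<in> Hom A y z" "b \<in> Hom A y z" "tends y z t b"
  shows "tends x z (\<lambda>n. Cmp A x y z (t n) (s n)) (Cmp A x y z b a)"
  unfolding tends_def
proof (rule tendsto_sandwich[of "\<lambda>_. 0"])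
  have "(\<lambda>n. N y z (t n) * N x y (Sub A x y (s n) a) + N y z (Sub A y z (t n) b) * N x y a)
      \<longlonglongrightarrow> N y z b * 0 + 0 * N x y a"
    using s(3) t(3) unfolding tends_def by (intro tendsto_intros tends_N ob t)
  then show "(\<lambda>n. N y z (t n) * N x y (Sub A x y (s n) a) + N y z (Sub A y z (t n) b) * N x y a) \<longlonglongrightarrow> 0"
    by simp
qed (use ob s t in \<open>auto intro!: always_eventually N_comp_sub_le N_ge_0 hom_closed\<close>)

end

text \<open>A C*-category except for the positivity axiom. A completion is first shown to be of this
  kind; positivity is then obtained from a norm estimate by \<open>cstar_categoryI\<close>.\<close>

locale banach_star_category = star_seminorm A "Nrm A"
  for A :: "('o, 'a, 'f::real_or_complex, 'z) cstar_cat_scheme" +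
  assumes Nrm_eq_0: "\<lbrakk>x \<in> Ob A; y \<in> Ob A; a \<in> Hom A x y; Nrm A x y a = 0\<rbrakk> \<Longrightarrow> a = Zer A x y"
    and ex_limit: "\<lbrakk>x \<in> Ob A; y \<in> Ob A; hom_Cauchy A (Nrm A) x y s\<rbrakk> \<Longrightarrow> \<exists>a\<in>Hom A x y. tends x y s a"
begin

lemma normed_hom: "\<lbrakk>x \<in> Ob A; y \<in> Ob A\<rbrakk>
    \<Longrightarrow> normed_space (Hom A x y) (Add A x y) (Zer A x y) (Scl A x y) (Nrm A x y)"
  by (intro normed_space.intro seminormed_hom normed_space_axioms.intro) (auto simp: Nrm_eq_0)

lemmas tends_unique = normed_space.tends_unique[OF normed_hom, folded tends_eq_seq_lim]

lemma hom_Cauchy_geometric: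
  assumes ob: "x \<in> Ob A" "y \<in> Ob A" and s: "\<And>n. s n \<in> Hom A x y"
    and q: "0 \<le> q" "q < 1" and C: "\<And>n. Nrm A x y (Sub A x y (s (Suc n)) (s n)) \<le> C * q ^ n"
  shows "hom_Cauchy A (Nrm A) x y s"
  unfolding hom_Cauchy_def
proof (intro conjI allI impI)
  define D where "D = C / (1 - q)"
  have C0: "C \<ge> 0" using order_trans[OF N_ge_0 C[of 0]] ob s by (simp add: hom_closed)
  have D: "D * (1 - q) = C" "D \<ge> 0" using q C0 by (simp_all add: D_def)
  \<comment> \<open>The right-hand side is the sum of C q^i for i from m to m + k - 1 in closed
    form, which keeps the induction free of finite sums.\<close>
  have *: "Nrm A x y (Sub A x y (s (m + k)) (s m)) \<le> D * (q ^ m - q ^ (m + k))" for m k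
  proof (induction k)
    case 0 then show ?case using ob s by (simp add: hom_sub_self N_zero)
  next
    case (Suc k)
    have "Nrm A x y (Sub A x y (s (m + Suc k)) (s m)) \<le> C * q ^ (m + k) + D * (q ^ m - q ^ (m + k))"
      using N_sub_triangle[of x y "s (m + Suc k)" "s (m + k)" "s m"] ob s C[of "m + k"] Suc by simp
    also have "\<dots> = D * (q ^ m - q ^ (m + Suc k))" unfolding D(1)[symmetric] by (simp add: algebra_simps)
    finally show ?case .
  qed
  have **: "Nrm A x y (Sub A x y (s i) (s j)) \<le> D * q ^ M" if "i \<ge> M" "j \<ge> M" for i j M
  proof -
    have le: "Nrm A x y (Sub A x y (s i) (s j)) \<le> D * q ^ M" if "j \<ge> M" "i \<ge> j" for i j
    proof -
      have "D * (q ^ j - q ^ i) \<le> D * q ^ M" using that q D power_decreasing[of M j q]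
        by (intro mult_left_mono) (auto intro: order_trans[of _ "q ^ j"])
      then show ?thesis using *[of j "i - j"] that by simp
    qed
    show ?thesis
      using le[of j i] le[of i j] that N_sub_swap[of x y "s i" "s j"] ob s by (cases "i \<ge> j") auto
  qed
  fix e :: real assume e: "e > 0"
  have "(\<lambda>M. D * q ^ M) \<longlonglongrightarrow> D * 0" using q by (intro tendsto_intros LIMSEQ_realpow_zero)
  then have "eventually (\<lambda>M. D * q ^ M < e) sequentially" using e by (intro order_tendstoD) auto
  then obtain M where "D * q ^ M < e" by (auto simp: eventually_sequentially)
  then show "\<exists>M. \<forall>m\<ge>M. \<forall>n\<ge>M. Nrm A x y (Sub A x y (s m) (s n)) < e" using ** le_less_trans by blast
qed (rule s)

lemma Neumann:
  assumes x: "x \<in> Ob A" and z: "z \<in> Hom A x x" "Nrm A x x z < 1"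
  shows "\<exists>w. is_inverse A x x (Sub A x x (Idt A x) z) w"
proof -
  interpret R: ring "end_ring A x" by (rule ring_end_ring[OF x])
  \<comment> \<open>\<open>s n\<close> is the partial sum 1 + z + ... + z^(n - 1). Together with the
    mirrored recursion \<open>s_Suc'\<close>, its limit a satisfies both a = 1 + z a and a = 1 + a
    z, so that it is a two-sided inverse of 1 - z.\<close>
  define s where "s = rec_nat (Zer A x x) (\<lambda>_ a. Add A x x (Idt A x) (Cmp A x x x z a))"
  have s_Suc: "s (Suc n) = Add A x x (Idt A x) (Cmp A x x x z (s n))" for n by (simp add: s_def)
  have s: "s n \<in> Hom A x x" for n by (induction n) (simp_all add: s_def x z hom_closed)
  have s_Suc': "s (Suc n) = Add A x x (Idt A x) (Cmp A x x x (s n) z)" for n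
  proof (induction n)
    case 0 then show ?case using R.l_null[of z] R.r_null[of z] x z by (simp add: s_def)
  next
    case (Suc n)
    have "s (Suc (Suc n)) = Add A x x (Idt A x) (Cmp A x x x z (Add A x x (Idt A x) (Cmp A x x x (s n) z)))"
      by (simp add: s_Suc[of "Suc n"] Suc)
    also have "\<dots> = Add A x x (Idt A x) (Cmp A x x x (Add A x x (Idt A x) (Cmp A x x x z (s n))) z)"
      using x z s by (simp add: comp_add_left comp_add_right comp_id_left comp_id_right comp_assoc hom_closed)
    finally show ?case by (simp add: s_Suc)
  qed
  have d: "Nrm A x x (Sub A x x (s (Suc n)) (s n)) \<le> Nrm A x x z ^ n" for n
  proof (induction n)
    case 0 then show ?case using x z N_id_le[OF x] R.r_null[of z]
      by (simp add: s_def hom_add_zero hom_closed Sub_def hom_scl_zero)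
  next
    case (Suc n)
    have "Sub A x x (s (Suc (Suc n))) (s (Suc n)) = Cmp A x x x z (Sub A x x (s (Suc n)) (s n))"
      unfolding s_Suc[of "Suc n"] s_Suc[of n] using x z s
      by (simp add: hom_sub_add hom_sub_self hom_zero_add comp_sub_right hom_closed)
    then have "Nrm A x x (Sub A x x (s (Suc (Suc n))) (s (Suc n)))
        \<le> Nrm A x x z * Nrm A x x (Sub A x x (s (Suc n)) (s n))"
      using N_comp[of x x x "Sub A x x (s (Suc n)) (s n)" z] x z s by (simp add: hom_closed)
    also have "\<dots> \<le> Nrm A x x z * Nrm A x x z ^ n" using Suc N_ge_0[OF x x z(1)] by (rule mult_left_mono)
    finally show ?case by simp
  qed
  have "hom_Cauchy A (Nrm A) x x s"
    using d N_ge_0[OF x x z(1)] z(2) by (intro hom_Cauchy_geometric[of x x s "Nrm A x x z" 1]) (auto simp: x s)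
  then obtain a where a: "a \<in> Hom A x x" "tends x x s a" using ex_limit x by blast
  have sa: "tends x x (\<lambda>n. s (Suc n)) a" using a(2) unfolding tends_def by (rule LIMSEQ_Suc)
  have "tends x x (\<lambda>n. s (Suc n)) (Add A x x (Idt A x) (Cmp A x x x z a))"
    unfolding s_Suc using x z s a by (intro tends_add tends_comp tends_const hom_closed)
  then have 1: "a = Add A x x (Idt A x) (Cmp A x x x z a)"
    using tends_unique[OF x x s _ _ sa] x z a by (simp add: hom_closed)
  have "tends x x (\<lambda>n. s (Suc n)) (Add A x x (Idt A x) (Cmp A x x x a z))"
    unfolding s_Suc' using x z s a by (intro tends_add tends_comp tends_const hom_closed)
  then have 2: "a = Add A x x (Idt A x) (Cmp A x x x a z)"
    using tends_unique[OF x x s _ _ sa] x z a by (simp add: hom_closed)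
  have "Sub A x x a (Cmp A x x x z a) = Idt A x"
    by (subst 1) (use x z a in \<open>simp add: Sub_def hom_add_assoc hom_closed hom_add_zero
        hom_sub_self[unfolded Sub_def]\<close>)
  moreover have "Sub A x x a (Cmp A x x x a z) = Idt A x"
    by (subst 2) (use x z a in \<open>simp add: Sub_def hom_add_assoc hom_closed hom_add_zero
        hom_sub_self[unfolded Sub_def]\<close>)
  ultimately show ?thesis
    unfolding is_inverse_def using x z a
    by (intro exI[of _ a]) (simp add: comp_sub_left comp_sub_right comp_id_left comp_id_right hom_closed)
qed

lemma normed_star_ring_end_ring:
  assumes x: "x \<in> Ob A"
  shows "normed_star_ring (end_ring A x) (Nrm A x x) (scalar A x) (Str A x x)"
proof -
  interpret R: ring "end_ring A x" by (rule ring_end_ring[OF x])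
  have i: "Idt A x \<in> Hom A x x" using x by (rule id_closed)
  show ?thesis
  proof (unfold_locales, goal_cases)
    case (11 z)
    then have z: "z \<in> Hom A x x" "Nrm A x x z < 1" by auto
    have "\<exists>w. is_inverse A x x (Sub A x x (Idt A x) (Scl A x x (- 1) z)) w"
      using x z by (intro Neumann) (auto simp: N_scl hom_closed)
    then show ?case using x z i
      by (simp add: Units_end_ring hom_closed Sub_def hom_scl_scl hom_scl_one)
  next
    case 3 then show ?case using x i by (simp add: scalar_def scl_id_comp hom_closed hom_scl_scl)
  next
    case 9 then show ?case using x i mult_right_mono[OF N_id_le[OF x], of "\<bar>_\<bar>"]
      by (simp add: scalar_def N_scl mult.commute)
  qed (use x i in \<open>simp_all add: scalar_def hom_closed hom_add_scl hom_scl_one scl_id_comp comp_scl_id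
      N_ge_0 N_add N_comp N_scl star_add star_comp star_scl star_id N_star_comp\<close>)
qed

end

sublocale cstar_category \<subseteq> banach_star_category A
proof -
  interpret star_seminorm A "Nrm A"
    by unfold_locales (auto simp: norm_scl norm_triangle norm_comp cstar_identity)
  show "banach_star_category A"
    by unfold_locales (auto simp: norm_eq_zero tends_def intro: hom_complete)
qed

section \<open>Positivity of \<open>a\<^sup>* a\<close> as a norm estimate\<close>

context banach_star_category begin

text \<open>Let h = \<open>a\<^sup>* a\<close> and r = |a|^2. For t > 0 the element h + t = (r + t)
  - (r - h) is invertible by the estimate, which excludes negative spectral values. For a nonreal z
  with real part u and imaginary part v, the product (h - z)(h - conjg z) = (h - u)^2 + v^2 has
  again the form \<open>k\<^sup>* k\<close> plus a positive scalar, and h - z is a commuting factor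
  of it.\<close>

lemma cstar_categoryI:
  assumes bound: "\<And>x y a. \<lbrakk>x \<in> Ob A; y \<in> Ob A; a \<in> Hom A x y\<rbrakk>
    \<Longrightarrow> Nrm A x x (Sub A x x (scalar A x ((Nrm A x y a)\<^sup>2)) (Cmp A x y x (Str A x y a) a)) \<le> (Nrm A x y a)\<^sup>2"
  shows "cstar_category A"
proof unfold_locales
  have pos: "Add A x x (Cmp A x y x (Str A x y a) a) (scalar A x t) \<in> Units (end_ring A x)"
    if ob: "x \<in> Ob A" "y \<in> Ob A" and a: "a \<in> Hom A x y" and t: "t > 0" for x y a t
  proof -
    interpret R: normed_star_ring "end_ring A x" "Nrm A x x" "scalar A x" "Str A x x"
      by (rule normed_star_ring_end_ring[OF ob(1)])
    define h where "h = Cmp A x y x (Str A x y a) a"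
    define r where "r = (Nrm A x y a)\<^sup>2"
    have h: "h \<in> carrier (end_ring A x)" using ob a by (simp add: h_def hom_closed)
    have "Nrm A x x (scalar A x r \<ominus>\<^bsub>end_ring A x\<^esub> h) \<le> r"
      using bound[OF ob a] h R.sc_closed ob unfolding h_def r_def by (simp add: end_ring_minus)
    moreover have "r \<ge> 0" by (simp add: r_def)
    ultimately have "scalar A x (r + t) \<ominus>\<^bsub>end_ring A x\<^esub> (scalar A x r \<ominus>\<^bsub>end_ring A x\<^esub> h) \<in> Units (end_ring A x)"
      using t R.minus_closed[OF R.sc_closed h, of r] by (intro R.sc_minus_Units) auto
    also have "scalar A x (r + t) \<ominus>\<^bsub>end_ring A x\<^esub> (scalar A x r \<ominus>\<^bsub>end_ring A x\<^esub> h)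
        = h \<oplus>\<^bsub>end_ring A x\<^esub> scalar A x t"
      unfolding R.sc_add using h R.sc_closed[of r] R.sc_closed[of t] by algebra
    finally show ?thesis by (simp add: h_def)
  qed
  fix x y a assume ob: "x \<in> Ob A" "y \<in> Ob A" and a: "a \<in> Hom A x y"
  interpret R: normed_star_ring "end_ring A x" "Nrm A x x" "scalar A x" "Str A x x"
    by (rule normed_star_ring_end_ring[OF ob(1)])
  define h where "h = Cmp A x y x (Str A x y a) a"
  have h: "h \<in> Hom A x x" "Str A x x h = h" using ob a by (simp_all add: h_def hom_closed star_comp star_star)
  show "spectrum A x (Cmp A x y x (Str A x y a) a) \<subseteq> of_real ` {0..}"
  proof (rule subsetI, rule ccontr)
    fix z assume z: "z \<in> spectrum A x (Cmp A x y x (Str A x y a) a)" "z \<notin> of_real ` {0..}"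
    define Z where "Z = Scl A x x z (Idt A x)"
    define Z' where "Z' = Scl A x x (conjg z) (Idt A x)"
    have Z: "Z \<in> Hom A x x" "Z' \<in> Hom A x x" using ob by (simp_all add: Z_def Z'_def hom_closed)
    have nU: "h \<ominus>\<^bsub>end_ring A x\<^esub> Z \<notin> Units (end_ring A x)"
      using z(1) Z h ob
      by (subst Units_end_ring) (auto simp: spectrum_def h_def[symmetric] Z_def[symmetric] end_ring_minus hom_closed)
    from z(2) show False
    proof (cases z rule: not_nonneg_scalar_cases)
      case (1 t)
      then have "Scl A x x (- 1) Z = scalar A x t"
        using ob by (simp add: Z_def scalar_def hom_scl_scl id_closed)
      then have "h \<ominus>\<^bsub>end_ring A x\<^esub> Z = Add A x x h (scalar A x t)"
        using ob Z h by (simp add: end_ring_minus Sub_def)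
      then show False using nU pos[OF ob a 1(1)] by (simp add: h_def)
    next
      case (2 u v)
      define k where "k = h \<ominus>\<^bsub>end_ring A x\<^esub> scalar A x u"
      have k: "k \<in> Hom A x x" "Str A x x k = k"
        using h R.sc_closed[of u] R.minus_closed[of h "scalar A x u"] R.st_minus[of h "scalar A x u"]
        by (simp_all add: k_def R.st_sc)
      have cZ: "Cmp A x x x Z h = Cmp A x x x h Z" "Cmp A x x x Z' h = Cmp A x x x h Z'"
          "Cmp A x x x Z Z' = Cmp A x x x Z' Z"
        using ob h Z by (simp_all add: Z_def Z'_def scl_id_comp comp_scl_id hom_closed hom_scl_scl mult.commute)
      have sZ: "Add A x x Z Z' = scalar A x (u + u)" "Cmp A x x x Z Z' = scalar A x (u * u + v\<^sup>2)"
        using ob 2(2,3) by (simp_all add: Z_def Z'_def scalar_def scl_id_comp hom_closed hom_scl_scl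
            power2_eq_square flip: hom_add_scl)
      \<comment> \<open>The endomorphism ring is not commutative. The facts that scalar multiples of
        the identity commute with h are therefore inserted by hand between normalizations by
        \<open>algebra\<close>.\<close>
      have "(h \<ominus>\<^bsub>end_ring A x\<^esub> Z) \<otimes>\<^bsub>end_ring A x\<^esub> (h \<ominus>\<^bsub>end_ring A x\<^esub> Z')
          = h \<otimes>\<^bsub>end_ring A x\<^esub> h \<ominus>\<^bsub>end_ring A x\<^esub> (Z \<otimes>\<^bsub>end_ring A x\<^esub> h \<oplus>\<^bsub>end_ring A x\<^esub> h \<otimes>\<^bsub>end_ring A x\<^esub> Z')
            \<oplus>\<^bsub>end_ring A x\<^esub> Z \<otimes>\<^bsub>end_ring A x\<^esub> Z'"
        using h(1) Z unfolding end_ring_simps(1)[symmetric] by algebra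
      also have "Z \<otimes>\<^bsub>end_ring A x\<^esub> h = h \<otimes>\<^bsub>end_ring A x\<^esub> Z" by (simp add: cZ)
      also have "h \<otimes>\<^bsub>end_ring A x\<^esub> Z \<oplus>\<^bsub>end_ring A x\<^esub> h \<otimes>\<^bsub>end_ring A x\<^esub> Z'
          = h \<otimes>\<^bsub>end_ring A x\<^esub> (Z \<oplus>\<^bsub>end_ring A x\<^esub> Z')"
        using h(1) Z unfolding end_ring_simps(1)[symmetric] by algebra
      also have "Z \<oplus>\<^bsub>end_ring A x\<^esub> Z' = scalar A x u \<oplus>\<^bsub>end_ring A x\<^esub> scalar A x u"
        by (simp only: end_ring_simps sZ R.sc_add[simplified])
      also have "Z \<otimes>\<^bsub>end_ring A x\<^esub> Z' = scalar A x u \<otimes>\<^bsub>end_ring A x\<^esub> scalar A x u \<oplus>\<^bsub>end_ring A x\<^esub> scalar A x (v\<^sup>2)"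
        by (simp only: end_ring_simps sZ R.sc_add[simplified] R.sc_mult[simplified])
      also have "h \<otimes>\<^bsub>end_ring A x\<^esub> h \<ominus>\<^bsub>end_ring A x\<^esub> h \<otimes>\<^bsub>end_ring A x\<^esub> (scalar A x u \<oplus>\<^bsub>end_ring A x\<^esub> scalar A x u)
          \<oplus>\<^bsub>end_ring A x\<^esub> (scalar A x u \<otimes>\<^bsub>end_ring A x\<^esub> scalar A x u \<oplus>\<^bsub>end_ring A x\<^esub> scalar A x (v\<^sup>2))
        = h \<otimes>\<^bsub>end_ring A x\<^esub> h \<ominus>\<^bsub>end_ring A x\<^esub> (h \<otimes>\<^bsub>end_ring A x\<^esub> scalar A x u \<oplus>\<^bsub>end_ring A x\<^esub> h \<otimes>\<^bsub>end_ring A x\<^esub> scalar A x u)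
          \<oplus>\<^bsub>end_ring A x\<^esub> (scalar A x u \<otimes>\<^bsub>end_ring A x\<^esub> scalar A x u \<oplus>\<^bsub>end_ring A x\<^esub> scalar A x (v\<^sup>2))"
        using h(1) R.sc_closed[of u] R.sc_closed[of "v\<^sup>2"] unfolding end_ring_simps(1)[symmetric] by algebra
      also have "h \<otimes>\<^bsub>end_ring A x\<^esub> scalar A x u \<oplus>\<^bsub>end_ring A x\<^esub> h \<otimes>\<^bsub>end_ring A x\<^esub> scalar A x u
          = scalar A x u \<otimes>\<^bsub>end_ring A x\<^esub> h \<oplus>\<^bsub>end_ring A x\<^esub> h \<otimes>\<^bsub>end_ring A x\<^esub> scalar A x u"
        using R.sc_commute[of h u] h by simp
      also have "h \<otimes>\<^bsub>end_ring A x\<^esub> h \<ominus>\<^bsub>end_ring A x\<^esub> (scalar A x u \<otimes>\<^bsub>end_ring A x\<^esub> h \<oplus>\<^bsub>end_ring A x\<^esub> h \<otimes>\<^bsub>end_ring A x\<^esub> scalar A x u)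
          \<oplus>\<^bsub>end_ring A x\<^esub> (scalar A x u \<otimes>\<^bsub>end_ring A x\<^esub> scalar A x u \<oplus>\<^bsub>end_ring A x\<^esub> scalar A x (v\<^sup>2))
        = k \<otimes>\<^bsub>end_ring A x\<^esub> k \<oplus>\<^bsub>end_ring A x\<^esub> scalar A x (v\<^sup>2)"
        unfolding k_def using h(1) R.sc_closed[of u] R.sc_closed[of "v\<^sup>2"]
        unfolding end_ring_simps(1)[symmetric] by algebra
      finally have prod: "(h \<ominus>\<^bsub>end_ring A x\<^esub> Z) \<otimes>\<^bsub>end_ring A x\<^esub> (h \<ominus>\<^bsub>end_ring A x\<^esub> Z')
          = k \<otimes>\<^bsub>end_ring A x\<^esub> k \<oplus>\<^bsub>end_ring A x\<^esub> scalar A x (v\<^sup>2)" .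
      \<comment> \<open>\<open>pos\<close> is applied to the endomorphism k in place of a; k is
        self-adjoint, so \<open>k\<^sup>* k\<close> is the square of k.\<close>
      have "Add A x x (Cmp A x x x (Str A x x k) k) (scalar A x (v\<^sup>2)) \<in> Units (end_ring A x)"
        using ob k 2(1) by (intro pos) auto
      then have u: "(h \<ominus>\<^bsub>end_ring A x\<^esub> Z) \<otimes>\<^bsub>end_ring A x\<^esub> (h \<ominus>\<^bsub>end_ring A x\<^esub> Z') \<in> Units (end_ring A x)"
        unfolding prod using k(2) by simp
      have "(h \<ominus>\<^bsub>end_ring A x\<^esub> Z) \<otimes>\<^bsub>end_ring A x\<^esub> (h \<ominus>\<^bsub>end_ring A x\<^esub> Z')
          = (h \<ominus>\<^bsub>end_ring A x\<^esub> Z') \<otimes>\<^bsub>end_ring A x\<^esub> (h \<ominus>\<^bsub>end_ring A x\<^esub> Z)"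
        using ob h Z by (simp add: end_ring_minus comp_sub_left comp_sub_right hom_closed cZ)
          (simp add: Sub_def hom_scl_add hom_scl_scl hom_scl_one hom_closed hom_add_assoc
            hom_add_commute[of x x "Scl A x x (- 1) (Cmp A x x x h Z)"])
      then have "h \<ominus>\<^bsub>end_ring A x\<^esub> Z \<in> Units (end_ring A x)"
        using h Z R.minus_closed[of h Z] R.minus_closed[of h Z'] by (intro R.Units_commuting_factor[OF _ _ _ u]) auto
      then show False using nU by simp
    qed
  qed
qed (auto intro: Nrm_eq_0 N_add N_comp simp: N_zero N_scl N_star_comp dest: ex_limit[unfolded tends_def])

end

context cstar_category begin

lemma star_comp_plus_Units:
  assumes ob: "x \<in> Ob A" "y \<in> Ob A" and a: "a \<in> Hom A x y" and t: "t > 0"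
  shows "Add A x x (Cmp A x y x (Str A x y a) a) (scalar A x t) \<in> Units (end_ring A x)"
proof -
  have "of_real (- t) \<notin> spectrum A x (Cmp A x y x (Str A x y a) a)"
    using star_comp_positive[OF ob a] t by (force simp del: of_real_minus)
  then have "\<exists>b. is_inverse A x x (Sub A x x (Cmp A x y x (Str A x y a) a)
      (Scl A x x (of_real (- t)) (Idt A x))) b"
    by (simp add: spectrum_def)
  moreover have "Sub A x x (Cmp A x y x (Str A x y a) a) (Scl A x x (of_real (- t)) (Idt A x))
      = Add A x x (Cmp A x y x (Str A x y a) a) (scalar A x t)"
    using ob a by (simp add: Sub_def scalar_def hom_scl_scl hom_closed)
  ultimately show ?thesis using ob a by (subst Units_end_ring) (auto simp: scalar_def hom_closed)
qed

lemma positive_star_ring_end_ring: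
  assumes x: "x \<in> Ob A"
  shows "positive_star_ring (end_ring A x) (Nrm A x x) (scalar A x) (Str A x x)"
  using star_comp_plus_Units[OF x x]
  by (intro positive_star_ring.intro normed_star_ring_end_ring x positive_star_ring_axioms.intro) fastforce

text \<open>Converse of \<open>cstar_categoryI\<close>, for every r above |a|^2. The freedom in r is
  essential for suprema of norms: there r is the square of the supremum, which a single functor need
  not attain.\<close>

lemma Nrm_scalar_minus_star_comp_le:
  assumes ob: "x \<in> Ob A" "y \<in> Ob A" and a: "a \<in> Hom A x y" and r: "(Nrm A x y a)\<^sup>2 \<le> r"
  shows "Nrm A x x (Sub A x x (scalar A x r) (Cmp A x y x (Str A x y a) a)) \<le> r"
proof -
  interpret R: positive_star_ring "end_ring A x" "Nrm A x x" "scalar A x" "Str A x x"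
    by (rule positive_star_ring_end_ring[OF ob(1)])
  have "Nrm A x x (scalar A x r \<ominus>\<^bsub>end_ring A x\<^esub> Cmp A x y x (Str A x y a) a) \<le> r"
    using ob a r star_comp_plus_Units[OF ob a]
    by (intro R.nm_sc_minus_le) (auto simp: hom_closed star_comp star_star N_star_comp)
  then show ?thesis using ob a R.sc_closed by (simp add: end_ring_minus hom_closed)
qed

end

section \<open>Contractivity of *-functors\<close>

lemma star_functorD:
  assumes "star_functor A B F"
  shows "is_functor A B F"
    and "x \<in> Ob A \<Longrightarrow> FOb F x \<in> Ob B"
    and "\<lbrakk>x \<in> Ob A; y \<in> Ob A; a \<in> Hom A x y\<rbrakk> \<Longrightarrow> FArr F x y a \<in> Hom B (FOb F x) (FOb F y)"
    and "x \<in> Ob A \<Longrightarrow> FArr F x x (Idt A x) = Idt B (FOb F x)"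
    and "\<lbrakk>x \<in> Ob A; y \<in> Ob A; z \<in> Ob A; a \<in> Hom A x y; b \<in> Hom A y z\<rbrakk> \<Longrightarrow> FArr F x z (Cmp A x y z b a) =
      Cmp B (FOb F x) (FOb F y) (FOb F z) (FArr F y z b) (FArr F x y a)"
    and "\<lbrakk>x \<in> Ob A; y \<in> Ob A; a \<in> Hom A x y; a' \<in> Hom A x y\<rbrakk> \<Longrightarrow> FArr F x y (Add A x y a a') =
      Add B (FOb F x) (FOb F y) (FArr F x y a) (FArr F x y a')"
    and "\<lbrakk>x \<in> Ob A; y \<in> Ob A; a \<in> Hom A x y\<rbrakk> \<Longrightarrow>
      FArr F x y (Scl A x y c a) = Scl B (FOb F x) (FOb F y) c (FArr F x y a)"
    and "\<lbrakk>x \<in> Ob A; y \<in> Ob A; a \<in> Hom A x y\<rbrakk> \<Longrightarrow>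
      FArr F y x (Str A x y a) = Str B (FOb F x) (FOb F y) (FArr F x y a)"
  using assms unfolding star_functor_def is_functor_def by auto

lemma star_functor_sub:
  assumes "star_category A" "star_functor A B F" "x \<in> Ob A" "y \<in> Ob A" "a \<in> Hom A x y" "a' \<in> Hom A x y"
  shows "FArr F x y (Sub A x y a a') = Sub B (FOb F x) (FOb F y) (FArr F x y a) (FArr F x y a')"
  using assms star_functorD[OF assms(2)] by (simp add: Sub_def star_category.hom_closed)

text \<open>The C*-identity in both categories reduces the claim to the self-adjoint endomorphism
  \<open>a\<^sup>* a\<close>, to which \<open>selfadjoint_hom_contractive\<close> applies.\<close>

theorem star_functor_contractive:
  assumes A: "cstar_category A" and B: "cstar_category B" and F: "star_functor A B F"
    and ob: "x \<in> Ob A" "y \<in> Ob A" and a: "a \<in> Hom A x y"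
  shows "Nrm B (FOb F x) (FOb F y) (FArr F x y a) \<le> Nrm A x y a"
proof -
  interpret A: cstar_category A by (rule A)
  interpret B: cstar_category B by (rule B)
  note FD = star_functorD[OF F]
  have h: "Cmp A x y x (Str A x y a) a \<in> Hom A x x" using ob a by (simp add: A.hom_closed)
  have Fh: "FArr F x x (Cmp A x y x (Str A x y a) a)
      = Cmp B (FOb F x) (FOb F y) (FOb F x) (Str B (FOb F x) (FOb F y) (FArr F x y a)) (FArr F x y a)"
    using ob a by (simp add: FD A.hom_closed)
  have "Nrm B (FOb F x) (FOb F x) (FArr F x x (Cmp A x y x (Str A x y a) a))
      \<le> Nrm A x x (Cmp A x y x (Str A x y a) a)"
  proof (rule selfadjoint_hom_contractive[OF A.normed_star_ring_end_ring B.positive_star_ring_end_ring])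
    show "Str B (FOb F x) (FOb F x) (FArr F x x (Cmp A x y x (Str A x y a) a))
        = FArr F x x (Cmp A x y x (Str A x y a) a)"
      using ob h a by (simp add: A.star_comp A.star_star A.hom_closed flip: FD(8))
  qed (use ob h FD in \<open>auto simp: scalar_def A.hom_closed\<close>)
  then have "(Nrm B (FOb F x) (FOb F y) (FArr F x y a))\<^sup>2 \<le> (Nrm A x y a)\<^sup>2"
    unfolding Fh using ob a FD by (simp add: A.N_star_comp B.N_star_comp)
  then show ?thesis using A.N_ge_0[OF ob a] by (rule power2_le_imp_le)
qed

section \<open>Completions\<close>

text \<open>All axioms of a *-category other than closure are equations, apart from the existence of
  negatives; they pass along surjections of Hom sets that commute with the operations. The lemma is
  applied to the completion and to the algebraic tensor product, where \<pi> is the map to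
  classes.\<close>

lemma star_category_image:
  fixes A :: "('o, 'a, 'f::real_or_complex, 'y) star_cat_scheme"
    and Q :: "('o, 'b, 'f, 'z) star_cat_scheme"
  assumes A: "star_category A" and Ob: "Ob Q = Ob A"
    and Hom: "\<And>x y. \<lbrakk>x \<in> Ob A; y \<in> Ob A\<rbrakk> \<Longrightarrow> Hom Q x y = \<pi> x y ` Hom A x y"
    and Idt: "\<And>x. x \<in> Ob A \<Longrightarrow> Idt Q x = \<pi> x x (Idt A x)"
    and Cmp: "\<And>x y z a b. \<lbrakk>x \<in> Ob A; y \<in> Ob A; z \<in> Ob A; a \<in> Hom A x y; b \<in> Hom A y z\<rbrakk>
      \<Longrightarrow> Cmp Q x y z (\<pi> y z b) (\<pi> x y a) = \<pi> x z (Cmp A x y z b a)"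
    and Zer: "\<And>x y. \<lbrakk>x \<in> Ob A; y \<in> Ob A\<rbrakk> \<Longrightarrow> Zer Q x y = \<pi> x y (Zer A x y)"
    and Add: "\<And>x y a b. \<lbrakk>x \<in> Ob A; y \<in> Ob A; a \<in> Hom A x y; b \<in> Hom A x y\<rbrakk>
      \<Longrightarrow> Add Q x y (\<pi> x y a) (\<pi> x y b) = \<pi> x y (Add A x y a b)"
    and Scl: "\<And>x y a c. \<lbrakk>x \<in> Ob A; y \<in> Ob A; a \<in> Hom A x y\<rbrakk>
      \<Longrightarrow> Scl Q x y c (\<pi> x y a) = \<pi> x y (Scl A x y c a)"
    and Str: "\<And>x y a. \<lbrakk>x \<in> Ob A; y \<in> Ob A; a \<in> Hom A x y\<rbrakk>
      \<Longrightarrow> Str Q x y (\<pi> x y a) = \<pi> y x (Str A x y a)"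
  shows "star_category Q" and "star_functor A Q \<lparr>FOb = (\<lambda>x. x), FArr = \<pi>\<rparr>"
proof -
  interpret star_category A by (rule A)
  note ops = Ob Hom Idt Cmp Zer Add Scl Str hom_closed
  have V: "vect_space (\<pi> x y ` Hom A x y) (Add Q x y) (\<pi> x y (Zer A x y)) (Scl Q x y)" if ob: "x \<in> Ob A" "y \<in> Ob A" for x y
  proof (unfold_locales, goal_cases)
    case (7 u)
    then obtain a where a: "a \<in> Hom A x y" "u = \<pi> x y a" using ob by (auto simp: ops)
    then obtain b where "b \<in> Hom A x y" "Add A x y a b = Zer A x y"
      using vect_space.ex_neg[OF hom_vect_space] ob by blast
    then show ?case using a ob by (intro bexI[of _ "\<pi> x y b"]) (auto simp: ops)
  next
    case (5 u v)
    then show ?case using ob by (auto simp: ops) (metis hom_add_commute)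
  qed (use ob in \<open>auto simp: ops hom_add_assoc hom_add_zero hom_scl_add hom_add_scl
      hom_scl_scl hom_scl_one\<close>)
  show "star_category Q"
    by (intro star_category.intro category.intro star_category_axioms.intro)
      (auto simp: ops V comp_id_left comp_id_right comp_assoc comp_add_left comp_add_right comp_scl_left
        comp_scl_right star_add star_scl star_comp star_star)
  show "star_functor A Q \<lparr>FOb = (\<lambda>x. x), FArr = \<pi>\<rparr>"
    by (auto simp: star_functor_def is_functor_def ops)
qed

section \<open>Cauchy sequences modulo null sequences\<close>

context star_seminorm begin

abbreviation Cauchy_seq :: "'o \<Rightarrow> 'o \<Rightarrow> (nat \<Rightarrow> 'a) \<Rightarrow> bool" where
  "Cauchy_seq \<equiv> hom_Cauchy A N"

abbreviation cls :: "'o \<Rightarrow> 'o \<Rightarrow> (nat \<Rightarrow> 'a) \<Rightarrow> (nat \<Rightarrow> 'a) set" where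
  "cls \<equiv> cauchy_class A N"

lemma CauchyD: "Cauchy_seq x y s \<Longrightarrow> s n \<in> Hom A x y"
  by (simp add: hom_Cauchy_def)

lemma Cauchy_const: "\<lbrakk>x \<in> Ob A; y \<in> Ob A; a \<in> Hom A x y\<rbrakk> \<Longrightarrow> Cauchy_seq x y (\<lambda>_. a)"
  by (simp add: hom_Cauchy_def hom_sub_self N_zero)

text \<open>Each operation is Lipschitz in its arguments along the sequences at hand; t1 and t2 are
  those arguments, equal for a unary operation.\<close>

lemma CauchyI:
  assumes s: "\<And>n. s n \<in> Hom A x y" and t: "Cauchy_seq x1 y1 t1" "Cauchy_seq x2 y2 t2"
    and le: "\<And>m n. N x y (Sub A x y (s m) (s n))
      \<le> K * (N x1 y1 (Sub A x1 y1 (t1 m) (t1 n)) + N x2 y2 (Sub A x2 y2 (t2 m) (t2 n)))"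
    and K: "K \<ge> 0"
  shows "Cauchy_seq x y s"
  unfolding hom_Cauchy_def
proof (intro conjI allI impI s)
  fix e :: real assume e: "e > 0"
  \<comment> \<open>K + 1 instead of K, so that K = 0 needs no separate case.\<close>
  define d where "d = e / (2 * (K + 1))"
  have "K + 1 \<noteq> 0" using K by simp
  then have d: "d > 0" "(K + 1) * (2 * d) = e" using e K by (simp_all add: d_def del: distrib_left_numeral)
  obtain M1 M2 where M1: "\<forall>m\<ge>M1. \<forall>n\<ge>M1. N x1 y1 (Sub A x1 y1 (t1 m) (t1 n)) < d"
    and M2: "\<forall>m\<ge>M2. \<forall>n\<ge>M2. N x2 y2 (Sub A x2 y2 (t2 m) (t2 n)) < d"
    using t d(1) unfolding hom_Cauchy_def by blast
  show "\<exists>M. \<forall>m\<ge>M. \<forall>n\<ge>M. N x y (Sub A x y (s m) (s n)) < e"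
  proof (intro exI[of _ "max M1 M2"] allI impI)
    fix m n assume mn: "m \<ge> max M1 M2" "n \<ge> max M1 M2"
    have "N x y (Sub A x y (s m) (s n)) \<le> K * (2 * d)"
      using le[of m n] mult_left_mono[OF _ K, of "N x1 y1 (Sub A x1 y1 (t1 m) (t1 n)) + N x2 y2 (Sub A x2 y2 (t2 m) (t2 n))" "2 * d"]
        M1 M2 mn by fastforce
    also have "\<dots> < (K + 1) * (2 * d)" using d by (simp add: distrib_right)
    finally show "N x y (Sub A x y (s m) (s n)) < e" by (simp add: d)
  qed
qed

lemma Cauchy_N:
  assumes ob: "x \<in> Ob A" "y \<in> Ob A" and s: "Cauchy_seq x y s"
  shows "convergent (\<lambda>n. N x y (s n))" and "\<exists>B. \<forall>n. N x y (s n) \<le> B"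
proof -
  have "Cauchy (\<lambda>n. N x y (s n))"
    unfolding Cauchy_def dist_real_def
    using s N_diff_le[OF ob CauchyD[OF s] CauchyD[OF s]] le_less_trans unfolding hom_Cauchy_def by meson
  then show c: "convergent (\<lambda>n. N x y (s n))" by (rule Cauchy_convergent)
  then show "\<exists>B. \<forall>n. N x y (s n) \<le> B"
    using convergent_imp_Bseq Bseq_def by (metis abs_le_D1 real_norm_def)
qed

lemma Cauchy_add: "\<lbrakk>x \<in> Ob A; y \<in> Ob A; Cauchy_seq x y s; Cauchy_seq x y t\<rbrakk>
    \<Longrightarrow> Cauchy_seq x y (\<lambda>n. Add A x y (s n) (t n))"
  by (rule CauchyI[where K = 1 and ?t1.0 = s and ?t2.0 = t]) (auto simp: hom_sub_add CauchyD intro!: N_add hom_closed)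

lemma Cauchy_scl: "\<lbrakk>x \<in> Ob A; y \<in> Ob A; Cauchy_seq x y s\<rbrakk> \<Longrightarrow> Cauchy_seq x y (\<lambda>n. Scl A x y c (s n))"
  by (rule CauchyI[where K = "norm c" and ?t1.0 = s and ?t2.0 = s])
    (auto simp: hom_sub_scl N_scl CauchyD hom_closed N_ge_0 distrib_left)

lemma Cauchy_star: "\<lbrakk>x \<in> Ob A; y \<in> Ob A; Cauchy_seq x y s\<rbrakk> \<Longrightarrow> Cauchy_seq y x (\<lambda>n. Str A x y (s n))"
  by (rule CauchyI[where K = 1 and ?t1.0 = s and ?t2.0 = s])
    (auto simp: N_star CauchyD hom_closed N_ge_0 simp flip: star_sub)

text \<open>Composition is Lipschitz only on bounded sets. The constant is a common bound of the two
  sequences, which exists because their norms converge.\<close>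

lemma Cauchy_comp:
  assumes ob: "x \<in> Ob A" "y \<in> Ob A" "z \<in> Ob A" and s: "Cauchy_seq x y s" and t: "Cauchy_seq y z t"
  shows "Cauchy_seq x z (\<lambda>n. Cmp A x y z (t n) (s n))"
proof -
  obtain B C where B: "\<forall>n. N x y (s n) \<le> B" and C: "\<forall>n. N y z (t n) \<le> C"
    using Cauchy_N(2)[OF ob(1,2) s] Cauchy_N(2)[OF ob(2,3) t] by blast
  have sB: "N x y (s n) \<le> max 0 (max B C)" and tC: "N y z (t n) \<le> max 0 (max B C)" for n
    using B C by (auto simp: le_max_iff_disj)
  show ?thesis
  proof (rule CauchyI[where ?t1.0 = s and ?t2.0 = t and K = "max 0 (max B C)", OF _ s t])
    fix m n
    note h = CauchyD[OF s] CauchyD[OF t]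
    have "N x z (Sub A x z (Cmp A x y z (t m) (s m)) (Cmp A x y z (t n) (s n)))
      \<le> N y z (t m) * N x y (Sub A x y (s m) (s n)) + N y z (Sub A y z (t m) (t n)) * N x y (s n)"
      by (rule N_comp_sub_le) (use ob h in auto)
    also have "\<dots> \<le> max 0 (max B C) * N x y (Sub A x y (s m) (s n)) + N y z (Sub A y z (t m) (t n)) * max 0 (max B C)"
      by (intro add_mono mult_right_mono mult_left_mono sB tC N_ge_0 ob hom_closed h)
    finally show "N x z (Sub A x z (Cmp A x y z (t m) (s m)) (Cmp A x y z (t n) (s n)))
      \<le> max 0 (max B C) * (N x y (Sub A x y (s m) (s n)) + N y z (Sub A y z (t m) (t n)))"
      by (simp add: algebra_simps)
  qed (use ob CauchyD[OF s] CauchyD[OF t] in \<open>auto intro: hom_closed\<close>)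
qed

text \<open>The *-category whose quotient by null sequences is the completion. Its laws hold
  pointwise and descend by \<open>star_category_image\<close>.\<close>

definition seq_cat :: "('o, nat \<Rightarrow> 'a, 'f) star_cat" where
  "seq_cat = \<lparr>Ob = Ob A, Hom = (\<lambda>x y. {s. Cauchy_seq x y s}), Idt = (\<lambda>x _. Idt A x),
     Cmp = (\<lambda>x y z t s n. Cmp A x y z (t n) (s n)), Add = (\<lambda>x y s t n. Add A x y (s n) (t n)),
     Zer = (\<lambda>x y _. Zer A x y), Scl = (\<lambda>x y c s n. Scl A x y c (s n)), Str = (\<lambda>x y s n. Str A x y (s n))\<rparr>"

lemma star_category_seq_cat: "star_category seq_cat"
proof -
  have V: "vect_space {s. Cauchy_seq x y s} (\<lambda>s t n. Add A x y (s n) (t n)) (\<lambda>_. Zer A x y) (\<lambda>c s n. Scl A x y c (s n))"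
    if ob: "x \<in> Ob A" "y \<in> Ob A" for x y
  proof (unfold_locales, goal_cases)
    case (7 s)
    have "Add A x y (s n) (Scl A x y (- 1) (s n)) = Zer A x y" for n
      using hom_sub_self[unfolded Sub_def] ob 7 CauchyD by blast
    then show ?case using ob 7 by (intro bexI[of _ "\<lambda>n. Scl A x y (- 1) (s n)"]) (auto intro: Cauchy_scl)
  qed (use ob in \<open>auto simp: hom_add_assoc hom_add_commute hom_add_zero hom_scl_add hom_add_scl
      hom_scl_scl hom_scl_one CauchyD intro: Cauchy_add Cauchy_scl Cauchy_const hom_closed\<close>)
  show ?thesis
    by (intro star_category.intro category.intro star_category_axioms.intro)
      (auto simp: seq_cat_def V comp_id_left comp_id_right comp_assoc comp_add_left comp_add_right comp_scl_left
        comp_scl_right star_add star_scl star_comp star_star CauchyD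
        intro: Cauchy_comp Cauchy_star Cauchy_const hom_closed)
qed

abbreviation null_diff :: "'o \<Rightarrow> 'o \<Rightarrow> (nat \<Rightarrow> 'a) \<Rightarrow> (nat \<Rightarrow> 'a) \<Rightarrow> bool" where
  "null_diff x y s t \<equiv> (\<lambda>n. N x y (Sub A x y (s n) (t n))) \<longlonglongrightarrow> 0"

lemma null_diff_trans:
  assumes ob: "x \<in> Ob A" "y \<in> Ob A" and "\<And>n. s n \<in> Hom A x y" "\<And>n. t n \<in> Hom A x y" "\<And>n. u n \<in> Hom A x y"
    and "null_diff x y s t" "null_diff x y t u"
  shows "null_diff x y s u"
  by (rule tendsto_sandwich[of "\<lambda>_. 0" _ _ "\<lambda>n. N x y (Sub A x y (s n) (t n)) + N x y (Sub A x y (t n) (u n))"])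
    (use assms in \<open>auto intro!: always_eventually N_sub_triangle N_ge_0 tendsto_add_zero hom_closed\<close>)

lemma cls_eq_iff:
  assumes ob: "x \<in> Ob A" "y \<in> Ob A" and s: "Cauchy_seq x y s" and t: "Cauchy_seq x y t"
  shows "cls x y s = cls x y t \<longleftrightarrow> null_diff x y s t"
proof
  have "t \<in> cls x y t" using t ob by (simp add: cauchy_class_def hom_sub_self CauchyD N_zero)
  then show "cls x y s = cls x y t \<Longrightarrow> null_diff x y s t" by (auto simp: cauchy_class_def)
next
  assume st: "null_diff x y s t"
  then have ts: "null_diff x y t s" by (simp add: N_sub_swap[OF ob CauchyD[OF s] CauchyD[OF t]])
  show "cls x y s = cls x y t"
    using null_diff_trans[OF ob _ _ _ st] null_diff_trans[OF ob _ _ _ ts] s t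
    by (auto simp: cauchy_class_def CauchyD)
qed

lemma rep_cls:
  assumes ob: "x \<in> Ob A" "y \<in> Ob A" and s: "Cauchy_seq x y s"
  shows "Cauchy_seq x y (rep (cls x y s))" and "null_diff x y s (rep (cls x y s))"
    and "null_diff x y (rep (cls x y s)) s"
proof -
  have "s \<in> cls x y s" using s ob by (simp add: cauchy_class_def hom_sub_self CauchyD N_zero)
  then have "rep (cls x y s) \<in> cls x y s" unfolding rep_def by (rule someI[where P = "\<lambda>u. u \<in> cls x y s"])
  then show *: "Cauchy_seq x y (rep (cls x y s))" "null_diff x y s (rep (cls x y s))"
    by (auto simp: cauchy_class_def)
  then show "null_diff x y (rep (cls x y s)) s" by (simp add: N_sub_swap[OF ob CauchyD[OF s] CauchyD])
qed

abbreviation Q :: "('o, (nat \<Rightarrow> 'a) set, 'f) cstar_cat" where "Q \<equiv> completion A N"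

lemma completion_Ob: "Ob Q = Ob A" and completion_Hom: "Hom Q x y = cls x y ` {s. Cauchy_seq x y s}"
  by (simp_all add: completion_def)

lemma completion_Idt: "Idt Q x = cls x x (\<lambda>_. Idt A x)" and completion_Zer: "Zer Q x y = cls x y (\<lambda>_. Zer A x y)"
  by (simp_all add: completion_def)

text \<open>The operations of \<open>completion\<close> are computed on representatives chosen by
  \<open>rep\<close>. This lemma and its companions free them from that choice.\<close>

lemma completion_Add:
  assumes ob: "x \<in> Ob A" "y \<in> Ob A" and s: "Cauchy_seq x y s" and t: "Cauchy_seq x y t"
  shows "Add Q x y (cls x y s) (cls x y t) = cls x y (\<lambda>n. Add A x y (s n) (t n))"
proof -
  note r = rep_cls[OF ob s] rep_cls[OF ob t]
  have "null_diff x y (\<lambda>n. Add A x y (rep (cls x y s) n) (rep (cls x y t) n)) (\<lambda>n. Add A x y (s n) (t n))"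
    by (rule tendsto_sandwich[of "\<lambda>_. 0" _ _ "\<lambda>n. N x y (Sub A x y (rep (cls x y s) n) (s n))
        + N x y (Sub A x y (rep (cls x y t) n) (t n))"])
      (use ob r CauchyD[OF s] CauchyD[OF t] in \<open>auto simp: CauchyD hom_sub_add
        intro!: always_eventually N_ge_0 N_add tendsto_add_zero hom_closed\<close>)
  then show ?thesis using ob r s t by (simp add: completion_def cls_eq_iff Cauchy_add)
qed

lemma completion_Scl:
  assumes ob: "x \<in> Ob A" "y \<in> Ob A" and s: "Cauchy_seq x y s"
  shows "Scl Q x y c (cls x y s) = cls x y (\<lambda>n. Scl A x y c (s n))"
proof -
  note r = rep_cls[OF ob s]
  have "null_diff x y (\<lambda>n. Scl A x y c (rep (cls x y s) n)) (\<lambda>n. Scl A x y c (s n))"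
    using ob r s by (auto simp: hom_sub_scl N_scl CauchyD hom_closed intro: tendsto_mult_right_zero)
  then show ?thesis using ob r s by (simp add: completion_def cls_eq_iff Cauchy_scl)
qed

lemma completion_Str:
  assumes ob: "x \<in> Ob A" "y \<in> Ob A" and s: "Cauchy_seq x y s"
  shows "Str Q x y (cls x y s) = cls y x (\<lambda>n. Str A x y (s n))"
proof -
  note r = rep_cls[OF ob s]
  have "null_diff y x (\<lambda>n. Str A x y (rep (cls x y s) n)) (\<lambda>n. Str A x y (s n))"
    using ob r s by (simp add: N_star CauchyD hom_closed flip: star_sub)
  then show ?thesis using ob r s by (simp add: completion_def cls_eq_iff Cauchy_star)
qed

lemma completion_Cmp:
  assumes ob: "x \<in> Ob A" "y \<in> Ob A" "z \<in> Ob A" and s: "Cauchy_seq x y s" and t: "Cauchy_seq y z t"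
  shows "Cmp Q x y z (cls y z t) (cls x y s) = cls x z (\<lambda>n. Cmp A x y z (t n) (s n))"
proof -
  note r = rep_cls[OF ob(1,2) s] rep_cls[OF ob(2,3) t]
  define s' where "s' = rep (cls x y s)"
  define t' where "t' = rep (cls y z t)"
  have st': "Cauchy_seq x y s'" "Cauchy_seq y z t'" "null_diff x y s' s" "null_diff y z t' t"
    using r by (auto simp: s'_def t'_def)
  obtain L where L: "(\<lambda>n. N y z (t' n)) \<longlonglongrightarrow> L" using Cauchy_N(1)[OF ob(2,3) st'(2)] by (auto simp: convergent_def)
  obtain M where M: "(\<lambda>n. N x y (s n)) \<longlonglongrightarrow> M" using Cauchy_N(1)[OF ob(1,2) s] by (auto simp: convergent_def)
  have "(\<lambda>n. N y z (t' n) * N x y (Sub A x y (s' n) (s n)) + N y z (Sub A y z (t' n) (t n)) * N x y (s n))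
      \<longlonglongrightarrow> L * 0 + 0 * M"
    by (intro tendsto_intros L M st')
  note lim = this
  have "null_diff x z (\<lambda>n. Cmp A x y z (t' n) (s' n)) (\<lambda>n. Cmp A x y z (t n) (s n))"
    by (rule tendsto_sandwich[of "\<lambda>_. 0" _ _ "\<lambda>n. N y z (t' n) * N x y (Sub A x y (s' n) (s n))
        + N y z (Sub A y z (t' n) (t n)) * N x y (s n)"])
      (use lim ob st' CauchyD[OF s] CauchyD[OF t] in \<open>auto simp: CauchyD
        intro!: always_eventually N_ge_0 N_comp_sub_le hom_closed\<close>)
  then have "cls x z (\<lambda>n. Cmp A x y z (t' n) (s' n)) = cls x z (\<lambda>n. Cmp A x y z (t n) (s n))"
    using ob st' s t by (simp add: cls_eq_iff Cauchy_comp)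
  then show ?thesis by (simp add: completion_def s'_def t'_def)
qed

lemma star_category_completion: "star_category Q"
  by (rule star_category_image(1)[OF star_category_seq_cat, where \<pi> = cls])
    (auto simp: seq_cat_def completion_Ob completion_Hom completion_Add completion_Scl completion_Str
      completion_Cmp completion_Idt completion_Zer)

lemma star_functor_to_completion: "star_functor A Q (to_completion A N)"
  unfolding star_functor_def is_functor_def to_completion_def
  by (auto simp: completion_Ob completion_Hom completion_Add completion_Scl completion_Str completion_Cmp
      completion_Idt Cauchy_const hom_closed)

lemma completion_Nrm:
  assumes ob: "x \<in> Ob A" "y \<in> Ob A" and s: "Cauchy_seq x y s"
  shows "(\<lambda>n. N x y (s n)) \<longlonglongrightarrow> Nrm Q x y (cls x y s)"
proof -
  note r = rep_cls[OF ob s]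
  have "(\<lambda>n. N x y (s n) - N x y (rep (cls x y s) n)) \<longlonglongrightarrow> 0"
    by (rule tendsto_rabs_zero_cancel, rule tendsto_sandwich[of "\<lambda>_. 0" _ _ "\<lambda>n. N x y (Sub A x y (s n) (rep (cls x y s) n))"])
      (use ob r s in \<open>auto simp: CauchyD intro!: always_eventually N_diff_le\<close>)
  moreover have "(\<lambda>n. N x y (rep (cls x y s) n)) \<longlonglongrightarrow> Nrm Q x y (cls x y s)"
    using Cauchy_N(1)[OF ob r(1)] by (simp add: completion_def convergent_LIMSEQ_iff)
  ultimately have "(\<lambda>n. N x y (s n) - N x y (rep (cls x y s) n) + N x y (rep (cls x y s) n))
      \<longlonglongrightarrow> 0 + Nrm Q x y (cls x y s)"
    by (rule tendsto_add)
  then show ?thesis by simp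
qed

lemma completion_Nrm_eq: "\<lbrakk>x \<in> Ob A; y \<in> Ob A; Cauchy_seq x y s; (\<lambda>n. N x y (s n)) \<longlonglongrightarrow> L\<rbrakk>
    \<Longrightarrow> Nrm Q x y (cls x y s) = L"
  using completion_Nrm LIMSEQ_unique by blast

lemma Nrm_to_completion: "\<lbrakk>x \<in> Ob A; y \<in> Ob A; a \<in> Hom A x y\<rbrakk>
    \<Longrightarrow> Nrm Q x y (FArr (to_completion A N) x y a) = N x y a"
  by (simp add: to_completion_def, rule completion_Nrm_eq) (auto intro: Cauchy_const)

lemma completion_HomE:
  assumes "X \<in> Hom Q x y" obtains s where "Cauchy_seq x y s" "X = cls x y s"
  using assms by (auto simp: completion_Hom)

lemma star_seminorm_completion: "star_seminorm Q (Nrm Q)"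
proof (intro star_seminorm.intro star_category_completion star_seminorm_axioms.intro)
  fix x y X c assume ob: "x \<in> Ob Q" "y \<in> Ob Q" and X: "X \<in> Hom Q x y"
  obtain s where s: "Cauchy_seq x y s" "X = cls x y s" using X by (rule completion_HomE)
  note ob = ob[unfolded completion_Ob]
  show "Nrm Q x y (Scl Q x y c X) = norm c * Nrm Q x y X"
    unfolding s(2) completion_Scl[OF ob s(1)]
    by (rule completion_Nrm_eq[OF ob Cauchy_scl[OF ob s(1)]])
       (use ob s in \<open>auto simp: N_scl CauchyD intro!: tendsto_intros completion_Nrm\<close>)
  have "(\<lambda>n. (N x y (s n))\<^sup>2) \<longlonglongrightarrow> (Nrm Q x y X)\<^sup>2"
    unfolding s(2) by (intro tendsto_intros completion_Nrm ob s)
  then show "Nrm Q x x (Cmp Q x y x (Str Q x y X) X) = (Nrm Q x y X)\<^sup>2"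
    unfolding s(2) completion_Str[OF ob s(1)] completion_Cmp[OF ob ob(1) s(1) Cauchy_star[OF ob s(1)]]
    using ob s by (intro completion_Nrm_eq Cauchy_comp Cauchy_star) (auto simp: N_star_comp CauchyD)
next
  fix x y X Y assume ob: "x \<in> Ob Q" "y \<in> Ob Q" and X: "X \<in> Hom Q x y" and Y: "Y \<in> Hom Q x y"
  obtain s where s: "Cauchy_seq x y s" "X = cls x y s" using X by (rule completion_HomE)
  obtain t where t: "Cauchy_seq x y t" "Y = cls x y t" using Y by (rule completion_HomE)
  note ob = ob[unfolded completion_Ob]
  show "Nrm Q x y (Add Q x y X Y) \<le> Nrm Q x y X + Nrm Q x y Y"
    unfolding s(2) t(2) completion_Add[OF ob s(1) t(1)]
    by (rule LIMSEQ_le[OF completion_Nrm[OF ob Cauchy_add[OF ob s(1) t(1)]]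
          tendsto_add[OF completion_Nrm[OF ob s(1)] completion_Nrm[OF ob t(1)]]])
       (use ob s t in \<open>auto simp: CauchyD intro!: N_add\<close>)
next
  fix x y z X Y assume ob: "x \<in> Ob Q" "y \<in> Ob Q" "z \<in> Ob Q" and X: "X \<in> Hom Q x y" and Y: "Y \<in> Hom Q y z"
  obtain s where s: "Cauchy_seq x y s" "X = cls x y s" using X by (rule completion_HomE)
  obtain t where t: "Cauchy_seq y z t" "Y = cls y z t" using Y by (rule completion_HomE)
  note ob = ob[unfolded completion_Ob]
  show "Nrm Q x z (Cmp Q x y z Y X) \<le> Nrm Q y z Y * Nrm Q x y X"
    unfolding s(2) t(2) completion_Cmp[OF ob s(1) t(1)]
    by (rule LIMSEQ_le[OF completion_Nrm[OF ob(1,3) Cauchy_comp[OF ob s(1) t(1)]]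
          tendsto_mult[OF completion_Nrm[OF ob(2,3) t(1)] completion_Nrm[OF ob(1,2) s(1)]]])
       (use ob s t in \<open>auto simp: CauchyD intro!: N_comp\<close>)
qed

interpretation Q: star_seminorm Q "Nrm Q" by (rule star_seminorm_completion)

abbreviation \<iota> :: "'o \<Rightarrow> 'o \<Rightarrow> 'a \<Rightarrow> (nat \<Rightarrow> 'a) set" where "\<iota> \<equiv> FArr (to_completion A N)"

lemma FOb_to_completion [simp]: "FOb (to_completion A N) x = x"
  by (simp add: to_completion_def)

lemmas to_completionD = star_functorD[OF star_functor_to_completion, unfolded FOb_to_completion]

lemma completion_Sub:
  assumes ob: "x \<in> Ob A" "y \<in> Ob A" and s: "Cauchy_seq x y s" and t: "Cauchy_seq x y t"
  shows "Sub Q x y (cls x y s) (cls x y t) = cls x y (\<lambda>n. Sub A x y (s n) (t n))"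
  using ob s t by (simp add: Sub_def completion_Add completion_Scl Cauchy_scl)

text \<open>The distance from the constant class of \<open>s n\<close> to the class of s is the
  limit over i of the distances from \<open>s n\<close> to \<open>s i\<close>, which is at most e /
  2 once n is past the Cauchy index.\<close>

lemma Cauchy_tends:
  assumes ob: "x \<in> Ob A" "y \<in> Ob A" and s: "Cauchy_seq x y s"
  shows "Q.tends x y (\<lambda>n. \<iota> x y (s n)) (cls x y s)"
  unfolding Q.tends_def
proof (rule LIMSEQ_I)
  fix e :: real assume e: "e > 0"
  obtain M where M: "\<forall>m\<ge>M. \<forall>n\<ge>M. N x y (Sub A x y (s m) (s n)) < e / 2"
    using s e unfolding hom_Cauchy_def by (meson half_gt_zero)
  note Cd = CauchyD[OF s]
  have "norm (Nrm Q x y (Sub Q x y (\<iota> x y (s n)) (cls x y s)) - 0) < e" if n: "n \<ge> M" for n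
  proof -
    have "Nrm Q x y (Sub Q x y (cls x y (\<lambda>_. s n)) (cls x y s)) \<le> e / 2"
      unfolding completion_Sub[OF ob Cauchy_const[OF ob Cd] s]
    proof (rule LIMSEQ_le_const2[OF completion_Nrm[OF ob]])
      show "Cauchy_seq x y (\<lambda>i. Sub A x y (s n) (s i))"
        unfolding Sub_def by (intro Cauchy_add Cauchy_const Cauchy_scl ob s Cd)
      show "\<exists>M. \<forall>i\<ge>M. N x y (Sub A x y (s n) (s i)) \<le> e / 2" using M n by (meson less_imp_le)
    qed
    moreover have "0 \<le> Nrm Q x y (Sub Q x y (cls x y (\<lambda>_. s n)) (cls x y s))"
      using ob s Cd by (intro Q.N_ge_0 Q.hom_closed) (auto simp: completion_Ob completion_Hom Cauchy_const)
    ultimately show ?thesis using e by (simp add: to_completion_def)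
  qed
  then show "\<exists>M. \<forall>n\<ge>M. norm (Nrm Q x y (Sub Q x y (\<iota> x y (s n)) (cls x y s)) - 0) < e" by blast
qed

lemma completion_dense:
  assumes ob: "x \<in> Ob A" "y \<in> Ob A" and X: "X \<in> Hom Q x y" and e: "e > 0"
  shows "\<exists>a\<in>Hom A x y. Nrm Q x y (Sub Q x y (\<iota> x y a) X) < e"
proof -
  obtain s where s: "Cauchy_seq x y s" "X = cls x y s" using X by (rule completion_HomE)
  have "eventually (\<lambda>n. Nrm Q x y (Sub Q x y (\<iota> x y (s n)) X) < e) sequentially"
    using Cauchy_tends[OF ob s(1)] e unfolding Q.tends_def s(2) by (rule order_tendstoD)
  then show ?thesis using CauchyD[OF s(1)] by (auto simp: eventually_sequentially)
qed

text \<open>For completeness, approximate the j-th class within 1 / (j + 1) by an arrow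
  \<open>a j\<close> of A. The sequence a is Cauchy by an argument with thirds, and its class is the
  limit.\<close>

lemma banach_star_category_completion: "banach_star_category Q"
proof unfold_locales
  fix x y X assume ob: "x \<in> Ob Q" "y \<in> Ob Q" and X: "X \<in> Hom Q x y" "Nrm Q x y X = 0"
  obtain s where s: "Cauchy_seq x y s" "X = cls x y s" using X(1) by (rule completion_HomE)
  note ob = ob[unfolded completion_Ob]
  have "null_diff x y s (\<lambda>_. Zer A x y)"
    using completion_Nrm[OF ob s(1)] X(2) s ob
    by (simp add: CauchyD Sub_def hom_scl_zero hom_add_zero)
  then show "X = Zer Q x y" using ob s by (simp add: completion_def cls_eq_iff Cauchy_const hom_closed)
next
  fix x y X assume ob: "x \<in> Ob Q" "y \<in> Ob Q" and X: "hom_Cauchy Q (Nrm Q) x y X"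
  note obA = ob[unfolded completion_Ob]
  have XH: "X j \<in> Hom Q x y" for j using X by (simp add: hom_Cauchy_def)
  have "\<exists>a\<in>Hom A x y. Nrm Q x y (Sub Q x y (\<iota> x y a) (X j)) < inverse (Suc j)" for j
    using completion_dense[OF obA XH] by simp
  then obtain a where a: "\<And>j. a j \<in> Hom A x y"
      "\<And>j. Nrm Q x y (Sub Q x y (\<iota> x y (a j)) (X j)) < inverse (Suc j)" by metis
  have aQ: "\<iota> x y (a j) \<in> Hom Q x y" for j using to_completionD(3) obA a(1) by simp
  have "Cauchy_seq x y a"
    unfolding hom_Cauchy_def
  proof (intro conjI allI impI a)
    fix e :: real assume e: "e > 0"
    obtain M where M: "\<forall>m\<ge>M. \<forall>n\<ge>M. Nrm Q x y (Sub Q x y (X m) (X n)) < e / 3"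
      using X e unfolding hom_Cauchy_def by (metis divide_pos_pos zero_less_numeral)
    obtain L where L: "inverse (Suc L) < e / 3" using reals_Archimedean[of "e / 3"] e by auto
    show "\<exists>M. \<forall>m\<ge>M. \<forall>n\<ge>M. N x y (Sub A x y (a m) (a n)) < e"
    proof (intro exI[of _ "max M L"] allI impI)
      fix m n assume mn: "m \<ge> max M L" "n \<ge> max M L"
      have i: "inverse (real (Suc k)) < e / 3" if "k \<ge> L" for k
        using that by (intro le_less_trans[OF _ L] le_imp_inverse_le) auto
      have "N x y (Sub A x y (a m) (a n)) = Nrm Q x y (Sub Q x y (\<iota> x y (a m)) (\<iota> x y (a n)))"
        using obA a(1) star_functor_sub[OF star_category_axioms star_functor_to_completion]
        by (simp add: hom_closed flip: Nrm_to_completion)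
      also have "\<dots> \<le> Nrm Q x y (Sub Q x y (\<iota> x y (a m)) (X m)) + Nrm Q x y (Sub Q x y (X m) (\<iota> x y (a n)))"
        by (intro Q.N_sub_triangle ob aQ XH)
      also have "Nrm Q x y (Sub Q x y (X m) (\<iota> x y (a n)))
          \<le> Nrm Q x y (Sub Q x y (X m) (X n)) + Nrm Q x y (Sub Q x y (X n) (\<iota> x y (a n)))"
        by (intro Q.N_sub_triangle ob aQ XH)
      also have "Nrm Q x y (Sub Q x y (X n) (\<iota> x y (a n))) = Nrm Q x y (Sub Q x y (\<iota> x y (a n)) (X n))"
        by (intro Q.N_sub_swap ob aQ XH)
      finally have "N x y (Sub A x y (a m) (a n)) \<le> Nrm Q x y (Sub Q x y (\<iota> x y (a m)) (X m))
          + (Nrm Q x y (Sub Q x y (X m) (X n)) + Nrm Q x y (Sub Q x y (\<iota> x y (a n)) (X n)))" by simp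
      moreover have "Nrm Q x y (Sub Q x y (X m) (X n)) < e / 3" using M mn by simp
      moreover have "inverse (real (Suc m)) < e / 3" "inverse (real (Suc n)) < e / 3"
        using i[of m] i[of n] mn by simp_all
      ultimately show "N x y (Sub A x y (a m) (a n)) < e"
        using a(2)[of m] a(2)[of n] by linarith
    qed
  qed
  note C = this
  define Z where "Z = cls x y a"
  have Z: "Z \<in> Hom Q x y" using C by (simp add: Z_def completion_Hom)
  have "(\<lambda>j. inverse (Suc j) + Nrm Q x y (Sub Q x y (\<iota> x y (a j)) Z)) \<longlonglongrightarrow> 0"
    using tendsto_add[OF LIMSEQ_inverse_real_of_nat Cauchy_tends[OF obA C, unfolded Q.tends_def]]
    by (simp add: Z_def)
  note lim = this
  have le: "Nrm Q x y (Sub Q x y (X j) Z) \<le> inverse (Suc j) + Nrm Q x y (Sub Q x y (\<iota> x y (a j)) Z)" for j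
    using Q.N_sub_triangle[OF ob XH[of j] aQ[of j] Z] a(2)[of j] Q.N_sub_swap[OF ob XH[of j] aQ[of j]] by simp
  have "Q.tends x y X Z"
    unfolding Q.tends_def
    by (rule tendsto_sandwich[of "\<lambda>_. 0" _ _ "\<lambda>j. inverse (Suc j) + Nrm Q x y (Sub Q x y (\<iota> x y (a j)) Z)"])
      (use lim le XH Z ob in \<open>auto intro!: always_eventually Q.N_ge_0 Q.hom_closed\<close>)
  then show "\<exists>Z\<in>Hom Q x y. Q.tends x y X Z" using Z by blast
qed

end

text \<open>Stated through N and not through spectra, because A is not complete and its own spectra
  can be too large: in the group ring of the integers only nonzero multiples of group elements are
  invertible.\<close>

locale positive_star_seminorm = star_seminorm +
  assumes N_scalar_minus: "\<lbrakk>x \<in> Ob A; y \<in> Ob A; a \<in> Hom A x y\<rbrakk>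
    \<Longrightarrow> N x x (Sub A x x (scalar A x ((N x y a)\<^sup>2)) (Cmp A x y x (Str A x y a) a)) \<le> (N x y a)\<^sup>2"
begin

theorem cstar_category_completion: "cstar_category Q"
proof (rule banach_star_category.cstar_categoryI[OF banach_star_category_completion])
  fix x y X assume ob: "x \<in> Ob Q" "y \<in> Ob Q" and X: "X \<in> Hom Q x y"
  obtain s where s: "Cauchy_seq x y s" "X = cls x y s" using X by (rule completion_HomE)
  note ob = ob[unfolded completion_Ob] and Cd = CauchyD[OF s(1)]
  define r where "r = (Nrm Q x y X)\<^sup>2"
  have r: "(\<lambda>n. (N x y (s n))\<^sup>2) \<longlonglongrightarrow> r"
    unfolding r_def s(2) by (intro tendsto_intros completion_Nrm ob s)
  have sc: "scalar Q x r = cls x x (\<lambda>_. scalar A x r)"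
    using ob completion_Scl[OF ob(1,1) Cauchy_const[OF ob(1,1) id_closed[OF ob(1)]]]
    by (simp add: scalar_def completion_def)
  have C1: "Cauchy_seq x x (\<lambda>_. scalar A x r)"
    using ob by (intro Cauchy_const) (auto simp: scalar_def hom_closed)
  have C2: "Cauchy_seq x x (\<lambda>n. Cmp A x y x (Str A x y (s n)) (s n))"
    by (intro Cauchy_comp Cauchy_star ob s)
  have C3: "Cauchy_seq x x (\<lambda>n. Sub A x x (scalar A x r) (Cmp A x y x (Str A x y (s n)) (s n)))"
    unfolding Sub_def by (intro Cauchy_add Cauchy_scl C1 C2 ob)
  have "Sub Q x x (scalar Q x r) (Cmp Q x y x (Str Q x y X) X)
      = cls x x (\<lambda>n. Sub A x x (scalar A x r) (Cmp A x y x (Str A x y (s n)) (s n)))"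
    unfolding s(2) sc using ob s C1 C2 by (simp add: completion_Str completion_Cmp Cauchy_star completion_Sub)
  moreover have "Nrm Q x x (cls x x (\<lambda>n. Sub A x x (scalar A x r) (Cmp A x y x (Str A x y (s n)) (s n)))) \<le> r"
  proof (rule LIMSEQ_le[OF completion_Nrm[OF ob(1,1) C3]])
    show "(\<lambda>n. \<bar>r - (N x y (s n))\<^sup>2\<bar> + (N x y (s n))\<^sup>2) \<longlonglongrightarrow> r"
      using tendsto_add[OF tendsto_rabs[OF tendsto_diff[OF tendsto_const[of r] r]] r] by simp
    \<comment> \<open>The assumption has radius \<open>N(s n)\<^sup>2\<close>, the claim has its
      limit r. Changing the radius costs the first summand on the right, which tends to 0.\<close>
    have "N x x (Sub A x x (scalar A x r) (Cmp A x y x (Str A x y (s n)) (s n)))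
        \<le> \<bar>r - (N x y (s n))\<^sup>2\<bar> + (N x y (s n))\<^sup>2" for n
    proof -
      have h: "scalar A x u \<in> Hom A x x" for u using ob by (simp add: scalar_def hom_closed)
      have "Sub A x x (scalar A x r) (scalar A x ((N x y (s n))\<^sup>2)) = scalar A x (r - (N x y (s n))\<^sup>2)"
        using ob by (simp add: scalar_def Sub_def hom_scl_scl id_closed flip: hom_add_scl)
      then have "N x x (Sub A x x (scalar A x r) (scalar A x ((N x y (s n))\<^sup>2))) \<le> \<bar>r - (N x y (s n))\<^sup>2\<bar>"
        using ob mult_left_mono[OF N_id_le[OF ob(1)], of "\<bar>r - (N x y (s n))\<^sup>2\<bar>"]
        by (simp add: scalar_def N_scl id_closed del: of_real_diff)
      then show ?thesis
        using N_sub_triangle[OF ob(1,1) h[of r] h, of "Cmp A x y x (Str A x y (s n)) (s n)" "(N x y (s n))\<^sup>2"]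
          N_scalar_minus[OF ob Cd[of n]] ob Cd[of n] by (simp add: hom_closed)
    qed
    then show "\<exists>M. \<forall>n\<ge>M. N x x (Sub A x x (scalar A x r) (Cmp A x y x (Str A x y (s n)) (s n)))
        \<le> \<bar>r - (N x y (s n))\<^sup>2\<bar> + (N x y (s n))\<^sup>2" by blast
  qed
  ultimately show "Nrm Q x x (Sub Q x x (scalar Q x ((Nrm Q x y X)\<^sup>2)) (Cmp Q x y x (Str Q x y X) X))
      \<le> (Nrm Q x y X)\<^sup>2" by (simp add: r_def)
qed

end

section \<open>The maximal norm and its completion\<close>

lemma FOb_fcomp [simp]: "FOb (G \<circ>\<^sub>F F) x = FOb G (FOb F x)"
  and FArr_fcomp [simp]: "FArr (G \<circ>\<^sub>F F) x y a = FArr G (FOb F x) (FOb F y) (FArr F x y a)"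
  by (simp_all add: fcomp_def)

lemma FOb_fid [simp]: "FOb fid x = x" and FArr_fid [simp]: "FArr fid x y a = a"
  by (simp_all add: fid_def)

lemma star_functor_fcomp: "\<lbrakk>star_functor A B F; star_functor B C G\<rbrakk> \<Longrightarrow> star_functor A C (G \<circ>\<^sub>F F)"
  unfolding star_functor_def is_functor_def by simp

lemma star_functor_fid: "star_functor A A fid"
  unfolding star_functor_def is_functor_def by simp

lemma fun_eqD:
  assumes "fun_eq C F G"
  shows "x \<in> Ob C \<Longrightarrow> FOb F x = FOb G x"
    and "\<lbrakk>x \<in> Ob C; y \<in> Ob C; a \<in> Hom C x y\<rbrakk> \<Longrightarrow> FArr F x y a = FArr G x y a"
  using assms unfolding fun_eq_def by auto

lemma positive_star_seminorm_pullback: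
  assumes A: "star_category A" and B: "cstar_category B" and F: "star_functor A B F"
  shows "positive_star_seminorm A (\<lambda>x y a. Nrm B (FOb F x) (FOb F y) (FArr F x y a))"
proof -
  interpret A: star_category A by (rule A)
  interpret B: cstar_category B by (rule B)
  note FD = star_functorD[OF F]
  show ?thesis
  proof (intro positive_star_seminorm.intro star_seminorm.intro A star_seminorm_axioms.intro
      positive_star_seminorm_axioms.intro)
    fix x y a assume "x \<in> Ob A" "y \<in> Ob A" "a \<in> Hom A x y"
    then show "Nrm B (FOb F x) (FOb F x) (FArr F x x (Sub A x x
        (scalar A x ((Nrm B (FOb F x) (FOb F y) (FArr F x y a))\<^sup>2)) (Cmp A x y x (Str A x y a) a)))
      \<le> (Nrm B (FOb F x) (FOb F y) (FArr F x y a))\<^sup>2"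
      using B.Nrm_scalar_minus_star_comp_le[of "FOb F x" "FOb F y" "FArr F x y a"]
      by (simp add: star_functor_sub[OF A F] FD A.hom_closed scalar_def del: of_real_power)
  qed (simp_all add: FD A.hom_closed B.N_scl B.N_add B.N_comp B.N_star_comp)
qed

text \<open>Its completion is a C*-category in which all norms vanish. It shows that the supremum in
  \<open>max_norm\<close> is taken over a nonempty set and is nonnegative.\<close>

lemma positive_star_seminorm_zero:
  assumes A: "star_category A" shows "positive_star_seminorm A (\<lambda>_ _ _. 0)"
  by (intro positive_star_seminorm.intro star_seminorm.intro A star_seminorm_axioms.intro
      positive_star_seminorm_axioms.intro) auto

text \<open>Finiteness of the supremum in \<open>max_norm\<close>, whence the type of B, which is
  the one used there.\<close>

definition cstar_bounded :: "('o, 'a, 'f::real_or_complex, 'z) star_cat_scheme \<Rightarrow> bool" where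
  "cstar_bounded A \<longleftrightarrow> (\<forall>x\<in>Ob A. \<forall>y\<in>Ob A. \<forall>a\<in>Hom A x y. \<exists>M.
     \<forall>(B :: ('o, (nat \<Rightarrow> 'a) set, 'f) cstar_cat) F. cstar_category B \<longrightarrow> star_functor A B F \<longrightarrow>
       Nrm B (FOb F x) (FOb F y) (FArr F x y a) \<le> M)"

locale bounded_star_category = star_category +
  assumes cstar_bounded: "cstar_bounded A"
begin

lemma Nrm_le_max_norm':
  fixes B :: "('a, (nat \<Rightarrow> 'b) set, 'c) cstar_cat"
  assumes "cstar_category B" "star_functor A B F" "x \<in> Ob A" "y \<in> Ob A" "a \<in> Hom A x y"
  shows "Nrm B (FOb F x) (FOb F y) (FArr F x y a) \<le> max_norm A x y a"
proof -
  obtain M where "\<forall>(B :: ('a, (nat \<Rightarrow> 'b) set, 'c) cstar_cat) F. cstar_category B \<longrightarrow> star_functor A B F \<longrightarrow>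
       Nrm B (FOb F x) (FOb F y) (FArr F x y a) \<le> M"
    using cstar_bounded assms(3-5) unfolding cstar_bounded_def by blast
  then have "bdd_above ((\<lambda>(B, F). Nrm B (FOb F x) (FOb F y) (FArr F x y a)) `
      {(B :: ('a, (nat \<Rightarrow> 'b) set, 'c) cstar_cat, F). cstar_category B \<and> star_functor A B F})"
    by (intro bdd_aboveI[of _ M]) auto
  then show ?thesis
    unfolding max_norm_def using assms(1,2) by (intro cSUP_upper2[of _ _ "(B, F)"]) auto
qed

lemma max_norm_le:
  assumes "\<And>(B :: ('a, (nat \<Rightarrow> 'b) set, 'c) cstar_cat) F. \<lbrakk>cstar_category B; star_functor A B F\<rbrakk>
    \<Longrightarrow> Nrm B (FOb F x) (FOb F y) (FArr F x y a) \<le> M"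
  shows "max_norm A x y a \<le> M"
  unfolding max_norm_def
proof (rule cSUP_least)
  interpret Z: positive_star_seminorm A "\<lambda>_ _ _. 0" by (rule positive_star_seminorm_zero) unfold_locales
  show "{(B :: ('a, (nat \<Rightarrow> 'b) set, 'c) cstar_cat, F). cstar_category B \<and> star_functor A B F} \<noteq> {}"
    using Z.cstar_category_completion Z.star_functor_to_completion by blast
qed (use assms in auto)

lemma max_norm_ge_0: "\<lbrakk>x \<in> Ob A; y \<in> Ob A; a \<in> Hom A x y\<rbrakk> \<Longrightarrow> 0 \<le> max_norm A x y a"
proof -
  assume *: "x \<in> Ob A" "y \<in> Ob A" "a \<in> Hom A x y"
  interpret Z: positive_star_seminorm A "\<lambda>_ _ _. 0" by (rule positive_star_seminorm_zero) unfold_locales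
  show ?thesis
    using Nrm_le_max_norm'[OF Z.cstar_category_completion Z.star_functor_to_completion *]
      Z.Nrm_to_completion[OF *] by simp
qed

lemma max_norm_scl_le:
  assumes "x \<in> Ob A" "y \<in> Ob A" "a \<in> Hom A x y"
  shows "max_norm A x y (Scl A x y c a) \<le> norm c * max_norm A x y a"
proof (rule max_norm_le)
  fix B :: "('a, (nat \<Rightarrow> 'b) set, 'c) cstar_cat" and F assume B: "cstar_category B" and F: "star_functor A B F"
  interpret B: cstar_category B by (rule B)
  show "Nrm B (FOb F x) (FOb F y) (FArr F x y (Scl A x y c a)) \<le> norm c * max_norm A x y a"
    using assms star_functorD[OF F] Nrm_le_max_norm'[OF B F]
    by (simp add: B.N_scl mult_left_mono)
qed

text \<open>Every upper bound for the supremum is checked functor by functor. The two reverse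
  inequalities come from scaling by \<open>inverse c\<close> and from a square root. The positivity
  estimate uses \<open>Nrm_scalar_minus_star_comp_le\<close> with the square of the supremum as
  radius.\<close>

lemma positive_star_seminorm_max_norm: "positive_star_seminorm A (max_norm A)"
proof (intro positive_star_seminorm.intro star_seminorm.intro star_category_axioms star_seminorm_axioms.intro
      positive_star_seminorm_axioms.intro)
  fix x y a assume *: "x \<in> Ob A" "y \<in> Ob A" "a \<in> Hom A x y"
  show "max_norm A x y (Scl A x y c a) = norm c * max_norm A x y a" for c
  proof (rule antisym[OF max_norm_scl_le[OF *]])
    show "norm c * max_norm A x y a \<le> max_norm A x y (Scl A x y c a)"
    proof (cases "c = 0")
      case False
      then have "max_norm A x y (Scl A x y (inverse c) (Scl A x y c a)) \<le> inverse (norm c) * max_norm A x y (Scl A x y c a)"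
        using max_norm_scl_le[of x y "Scl A x y c a" "inverse c"] * by (simp add: hom_closed norm_inverse)
      then show ?thesis using False * by (simp add: hom_scl_scl hom_scl_one field_simps)
    qed (use * max_norm_ge_0[of x y "Scl A x y c a"] in \<open>simp add: hom_closed\<close>)
  qed
  show "max_norm A x x (Cmp A x y x (Str A x y a) a) = (max_norm A x y a)\<^sup>2"
  proof (rule antisym)
    show "max_norm A x x (Cmp A x y x (Str A x y a) a) \<le> (max_norm A x y a)\<^sup>2"
    proof (rule max_norm_le)
      fix B :: "('a, (nat \<Rightarrow> 'b) set, 'c) cstar_cat" and F
      assume B: "cstar_category B" and F: "star_functor A B F"
      interpret B: cstar_category B by (rule B)
      show "Nrm B (FOb F x) (FOb F x) (FArr F x x (Cmp A x y x (Str A x y a) a)) \<le> (max_norm A x y a)\<^sup>2"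
        using * Nrm_le_max_norm'[OF B F *]
        by (simp add: star_functorD[OF F] B.N_star_comp hom_closed power_mono B.N_ge_0)
    qed
    have "max_norm A x y a \<le> sqrt (max_norm A x x (Cmp A x y x (Str A x y a) a))"
    proof (rule max_norm_le)
      fix B :: "('a, (nat \<Rightarrow> 'b) set, 'c) cstar_cat" and F
      assume B: "cstar_category B" and F: "star_functor A B F"
      interpret B: cstar_category B by (rule B)
      show "Nrm B (FOb F x) (FOb F y) (FArr F x y a) \<le> sqrt (max_norm A x x (Cmp A x y x (Str A x y a) a))"
        using * Nrm_le_max_norm'[OF B F, of x x "Cmp A x y x (Str A x y a) a"]
        by (intro real_le_rsqrt) (simp add: star_functorD[OF F] B.N_star_comp hom_closed)
    qed
    then have "(max_norm A x y a)\<^sup>2 \<le> (sqrt (max_norm A x x (Cmp A x y x (Str A x y a) a)))\<^sup>2"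
      using max_norm_ge_0[OF *] by (rule power_mono)
    then show "(max_norm A x y a)\<^sup>2 \<le> max_norm A x x (Cmp A x y x (Str A x y a) a)"
      using * by (simp add: max_norm_ge_0 hom_closed)
  qed
  show "max_norm A x x (Sub A x x (scalar A x ((max_norm A x y a)\<^sup>2)) (Cmp A x y x (Str A x y a) a))
      \<le> (max_norm A x y a)\<^sup>2"
  proof (rule max_norm_le)
    fix B :: "('a, (nat \<Rightarrow> 'b) set, 'c) cstar_cat" and F
    assume B: "cstar_category B" and F: "star_functor A B F"
    interpret B: cstar_category B by (rule B)
    note FD = star_functorD[OF F]
    have "(Nrm B (FOb F x) (FOb F y) (FArr F x y a))\<^sup>2 \<le> (max_norm A x y a)\<^sup>2"
      using * Nrm_le_max_norm'[OF B F *] by (simp add: power_mono B.N_ge_0 FD)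
    then show "Nrm B (FOb F x) (FOb F x) (FArr F x x
        (Sub A x x (scalar A x ((max_norm A x y a)\<^sup>2)) (Cmp A x y x (Str A x y a) a))) \<le> (max_norm A x y a)\<^sup>2"
      using B.Nrm_scalar_minus_star_comp_le[of "FOb F x" "FOb F y" "FArr F x y a"] *
      by (simp add: star_functor_sub[OF star_category_axioms F]
          FD hom_closed scalar_def del: of_real_power)
  qed
next
  fix x y a b assume *: "x \<in> Ob A" "y \<in> Ob A" "a \<in> Hom A x y" "b \<in> Hom A x y"
  show "max_norm A x y (Add A x y a b) \<le> max_norm A x y a + max_norm A x y b"
  proof (rule max_norm_le)
    fix B :: "('a, (nat \<Rightarrow> 'b) set, 'c) cstar_cat" and F
    assume B: "cstar_category B" and F: "star_functor A B F"
    interpret B: cstar_category B by (rule B)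
    note FD = star_functorD[OF F]
    have "Nrm B (FOb F x) (FOb F y) (FArr F x y (Add A x y a b))
        \<le> Nrm B (FOb F x) (FOb F y) (FArr F x y a) + Nrm B (FOb F x) (FOb F y) (FArr F x y b)"
      using * by (simp add: FD B.N_add)
    also have "\<dots> \<le> max_norm A x y a + max_norm A x y b"
      using * by (intro add_mono Nrm_le_max_norm'[OF B F])
    finally show "Nrm B (FOb F x) (FOb F y) (FArr F x y (Add A x y a b)) \<le> max_norm A x y a + max_norm A x y b" .
  qed
next
  fix x y z a b assume *: "x \<in> Ob A" "y \<in> Ob A" "z \<in> Ob A" "a \<in> Hom A x y" "b \<in> Hom A y z"
  show "max_norm A x z (Cmp A x y z b a) \<le> max_norm A y z b * max_norm A x y a"
  proof (rule max_norm_le)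
    fix B :: "('a, (nat \<Rightarrow> 'b) set, 'c) cstar_cat" and F
    assume B: "cstar_category B" and F: "star_functor A B F"
    interpret B: cstar_category B by (rule B)
    note FD = star_functorD[OF F]
    have "Nrm B (FOb F x) (FOb F z) (FArr F x z (Cmp A x y z b a))
        \<le> Nrm B (FOb F y) (FOb F z) (FArr F y z b) * Nrm B (FOb F x) (FOb F y) (FArr F x y a)"
      using * by (simp add: FD B.N_comp)
    also have "\<dots> \<le> max_norm A y z b * max_norm A x y a"
      using * by (intro mult_mono Nrm_le_max_norm'[OF B F] B.N_ge_0 FD max_norm_ge_0)
    finally show "Nrm B (FOb F x) (FOb F z) (FArr F x z (Cmp A x y z b a)) \<le> max_norm A y z b * max_norm A x y a" .
  qed
qed

text \<open>The maximal norm is defined by $*$-functors to C*-categories of one type; a $*$-functor to a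
  C*-category of another type factors through the completion for the norm it induces.\<close>

lemma Nrm_le_max_norm:
  assumes B: "cstar_category B" and F: "star_functor A B F"
    and a: "x \<in> Ob A" "y \<in> Ob A" "a \<in> Hom A x y"
  shows "Nrm B (FOb F x) (FOb F y) (FArr F x y a) \<le> max_norm A x y a"
proof -
  interpret P: positive_star_seminorm A "\<lambda>x y a. Nrm B (FOb F x) (FOb F y) (FArr F x y a)"
    by (rule positive_star_seminorm_pullback[OF star_category_axioms B F])
  show ?thesis
    using Nrm_le_max_norm'[OF P.cstar_category_completion P.star_functor_to_completion a]
      P.Nrm_to_completion[OF a] by simp
qed

end

text \<open>Continuous extension. The limit is chosen by \<open>SOME\<close> along a chosen
  representative; the following lemma shows that it exists and depends on neither choice.\<close>

definition completion_extend :: "('o, 'a, 'f::real_or_complex, 'y) star_cat_scheme \<Rightarrow> ('p, 'b, 'f) cstar_cat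
    \<Rightarrow> ('o, 'a, 'p, 'b) fnct \<Rightarrow> ('o, (nat \<Rightarrow> 'a) set, 'p, 'b) fnct" where
  "completion_extend A B F = \<lparr>FOb = FOb F, FArr = (\<lambda>x y X. SOME b. b \<in> Hom B (FOb F x) (FOb F y) \<and>
     star_seminorm.tends B (Nrm B) (FOb F x) (FOb F y) (\<lambda>n. FArr F x y (rep X n)) b)\<rparr>"

context star_seminorm begin

lemma completion_extend:
  assumes B: "cstar_category B" and F: "star_functor A B F"
    and le: "\<And>x y a. \<lbrakk>x \<in> Ob A; y \<in> Ob A; a \<in> Hom A x y\<rbrakk> \<Longrightarrow> Nrm B (FOb F x) (FOb F y) (FArr F x y a) \<le> N x y a"
  shows "star_functor Q B (completion_extend A B F)"
    and "fun_eq A (completion_extend A B F \<circ>\<^sub>F to_completion A N) F"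
proof -
  interpret B: cstar_category B by (rule B)
  note FD = star_functorD[OF F] and sub = star_functor_sub[OF star_category_axioms F]
  define E where "E = FArr (completion_extend A B F)"
  have FOb: "FOb (completion_extend A B F) x = FOb F x" for x by (simp add: completion_extend_def)
  have ex: "\<exists>b\<in>Hom B (FOb F x) (FOb F y). B.tends (FOb F x) (FOb F y) (\<lambda>n. FArr F x y (s n)) b"
    if ob: "x \<in> Ob A" "y \<in> Ob A" and s: "Cauchy_seq x y s" for x y s
  proof (rule B.ex_limit)
    show "hom_Cauchy B (Nrm B) (FOb F x) (FOb F y) (\<lambda>n. FArr F x y (s n))"
      unfolding hom_Cauchy_def
    proof (intro conjI allI impI)
      fix e :: real assume "e > 0"
      then obtain M where M: "\<forall>m\<ge>M. \<forall>n\<ge>M. N x y (Sub A x y (s m) (s n)) < e"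
        using s unfolding hom_Cauchy_def by blast
      have "Nrm B (FOb F x) (FOb F y) (Sub B (FOb F x) (FOb F y) (FArr F x y (s m)) (FArr F x y (s n)))
          \<le> N x y (Sub A x y (s m) (s n))" for m n
        using le[OF ob hom_sub_closed[OF ob CauchyD[OF s] CauchyD[OF s]], of m n] ob CauchyD[OF s]
        by (simp add: sub)
      then show "\<exists>M. \<forall>m\<ge>M. \<forall>n\<ge>M. Nrm B (FOb F x) (FOb F y)
          (Sub B (FOb F x) (FOb F y) (FArr F x y (s m)) (FArr F x y (s n))) < e"
        using M le_less_trans by blast
    qed (use ob CauchyD[OF s] FD in auto)
  qed (use ob FD in auto)
  \<comment> \<open>Any limit along any representing sequence is the value. With this, each law for
    \<open>E\<close> reduces to exhibiting one limit.\<close>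
  have E: "E x y (cls x y s) = b"
    if ob: "x \<in> Ob A" "y \<in> Ob A" and s: "Cauchy_seq x y s"
      and b: "b \<in> Hom B (FOb F x) (FOb F y)" "B.tends (FOb F x) (FOb F y) (\<lambda>n. FArr F x y (s n)) b" for x y s b
  proof -
    note r = rep_cls[OF ob s]
    define b' where "b' = E x y (cls x y s)"
    have b': "b' \<in> Hom B (FOb F x) (FOb F y)"
        "B.tends (FOb F x) (FOb F y) (\<lambda>n. FArr F x y (rep (cls x y s) n)) b'"
      using someI_ex[OF ex[OF ob r(1), unfolded Bex_def]] by (simp_all add: b'_def E_def completion_extend_def)
    have "B.tends (FOb F x) (FOb F y) (\<lambda>n. FArr F x y (rep (cls x y s) n)) b"
      unfolding B.tends_def
    proof (rule tendsto_sandwich[of "\<lambda>_. 0" _ _ "\<lambda>n. N x y (Sub A x y (rep (cls x y s) n) (s n))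
        + Nrm B (FOb F x) (FOb F y) (Sub B (FOb F x) (FOb F y) (FArr F x y (s n)) b)"])
      have "Nrm B (FOb F x) (FOb F y) (Sub B (FOb F x) (FOb F y) (FArr F x y (rep (cls x y s) n)) b)
        \<le> N x y (Sub A x y (rep (cls x y s) n) (s n))
        + Nrm B (FOb F x) (FOb F y) (Sub B (FOb F x) (FOb F y) (FArr F x y (s n)) b)" for n
        using B.N_sub_triangle[of "FOb F x" "FOb F y" "FArr F x y (rep (cls x y s) n)" "FArr F x y (s n)" b]
          le[OF ob hom_sub_closed[OF ob CauchyD[OF r(1)] CauchyD[OF s]], of n n] ob b CauchyD[OF s] CauchyD[OF r(1)]
        by (simp add: FD sub)
      then show "eventually (\<lambda>n. Nrm B (FOb F x) (FOb F y) (Sub B (FOb F x) (FOb F y) (FArr F x y (rep (cls x y s) n)) b)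
        \<le> N x y (Sub A x y (rep (cls x y s) n) (s n))
        + Nrm B (FOb F x) (FOb F y) (Sub B (FOb F x) (FOb F y) (FArr F x y (s n)) b)) sequentially" by simp
    qed (use ob b r CauchyD[OF r(1)] in \<open>auto simp: B.tends_def FD
        intro!: always_eventually B.N_ge_0 B.hom_closed tendsto_add_zero\<close>)
    then show ?thesis
      using B.tends_unique[OF _ _ _ b'(1) b(1) b'(2)] ob CauchyD[OF r(1)] by (simp add: FD b'_def)
  qed
  have lim: "E x y (cls x y s) \<in> Hom B (FOb F x) (FOb F y)"
      "B.tends (FOb F x) (FOb F y) (\<lambda>n. FArr F x y (s n)) (E x y (cls x y s))"
    if ob: "x \<in> Ob A" "y \<in> Ob A" and s: "Cauchy_seq x y s" for x y s
    using ex[OF ob s] E[OF ob s] by auto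
  have const: "E x y (cls x y (\<lambda>_. a)) = FArr F x y a" if "x \<in> Ob A" "y \<in> Ob A" "a \<in> Hom A x y" for x y a
    using that by (intro E B.tends_const Cauchy_const) (auto simp: FD)
  show "fun_eq A (completion_extend A B F \<circ>\<^sub>F to_completion A N) F"
    using const by (auto simp: fun_eq_def FOb to_completion_def E_def[symmetric])
  show "star_functor Q B (completion_extend A B F)"
    unfolding star_functor_def is_functor_def FOb E_def[symmetric] completion_Ob
  proof (intro conjI ballI allI)
    fix x y X assume ob: "x \<in> Ob A" "y \<in> Ob A" and "X \<in> Hom Q x y"
    then obtain s where s: "Cauchy_seq x y s" "X = cls x y s" by (auto elim: completion_HomE)
    show "E x y X \<in> Hom B (FOb F x) (FOb F y)" using lim ob s by simp
    show "E x y (Scl Q x y c X) = Scl B (FOb F x) (FOb F y) c (E x y X)" for c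
      unfolding s(2) completion_Scl[OF ob s(1)]
      using ob s(1) lim[OF ob s(1)] CauchyD[OF s(1)]
      by (intro E Cauchy_scl) (auto simp: FD intro!: B.hom_closed B.tends_scl)
    show "E y x (Str Q x y X) = Str B (FOb F x) (FOb F y) (E x y X)"
      unfolding s(2) completion_Str[OF ob s(1)]
      using ob s(1) lim[OF ob s(1)] CauchyD[OF s(1)]
      by (intro E Cauchy_star) (auto simp: FD intro!: B.hom_closed B.tends_star)
    fix Y assume "Y \<in> Hom Q x y"
    then obtain t where t: "Cauchy_seq x y t" "Y = cls x y t" by (auto elim: completion_HomE)
    show "E x y (Add Q x y X Y) = Add B (FOb F x) (FOb F y) (E x y X) (E x y Y)"
      unfolding s(2) t(2) completion_Add[OF ob s(1) t(1)]
      using ob s(1) t(1) lim[OF ob s(1)] lim[OF ob t(1)] CauchyD[OF s(1)] CauchyD[OF t(1)]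
      by (intro E Cauchy_add) (auto simp: FD intro!: B.hom_closed B.tends_add)
  next
    fix x y z X Y assume ob: "x \<in> Ob A" "y \<in> Ob A" "z \<in> Ob A" and "X \<in> Hom Q x y" "Y \<in> Hom Q y z"
    then obtain s t where s: "Cauchy_seq x y s" "X = cls x y s" and t: "Cauchy_seq y z t" "Y = cls y z t"
      by (auto elim!: completion_HomE)
    show "E x z (Cmp Q x y z Y X) = Cmp B (FOb F x) (FOb F y) (FOb F z) (E y z Y) (E x y X)"
      unfolding s(2) t(2) completion_Cmp[OF ob s(1) t(1)]
      using ob s(1) t(1) lim[OF ob(1,2) s(1)] lim[OF ob(2,3) t(1)] CauchyD[OF s(1)] CauchyD[OF t(1)]
      by (intro E Cauchy_comp) (auto simp: FD intro!: B.hom_closed B.tends_comp)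
  qed (use const in \<open>auto simp: FD completion_Idt hom_closed\<close>)
qed

end


section \<open>Total families of arrows\<close>

definition closed_subspace :: "('o, 'a, 'f::real_or_complex) cstar_cat \<Rightarrow> 'o \<Rightarrow> 'o \<Rightarrow> 'a set \<Rightarrow> bool" where
  "closed_subspace A x y V \<longleftrightarrow> V \<subseteq> Hom A x y \<and> Zer A x y \<in> V \<and> (\<forall>a\<in>V. \<forall>b\<in>V. Add A x y a b \<in> V) \<and>
     (\<forall>c. \<forall>a\<in>V. Scl A x y c a \<in> V) \<and>
     (\<forall>s. \<forall>a\<in>Hom A x y. (\<forall>n. s n \<in> V) \<longrightarrow> (\<lambda>n. Nrm A x y (Sub A x y (s n) a)) \<longlonglongrightarrow> 0 \<longrightarrow> a \<in> V)"

text \<open>S spans a dense subspace of each Hom space. The wording by closed subspaces makes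
  density an induction rule: it suffices that the arrows with the desired property form a closed
  subspace.\<close>

definition total :: "('o, 'a, 'f::real_or_complex) cstar_cat \<Rightarrow> ('o \<Rightarrow> 'o \<Rightarrow> 'a set) \<Rightarrow> bool" where
  "total A S \<longleftrightarrow> (\<forall>x\<in>Ob A. \<forall>y\<in>Ob A. S x y \<subseteq> Hom A x y \<and>
     (\<forall>V. closed_subspace A x y V \<longrightarrow> S x y \<subseteq> V \<longrightarrow> Hom A x y \<subseteq> V))"

lemma totalD:
  assumes "total A S" "x \<in> Ob A" "y \<in> Ob A"
  shows "g \<in> S x y \<Longrightarrow> g \<in> Hom A x y"
    and "\<lbrakk>closed_subspace A x y V; \<And>g. g \<in> S x y \<Longrightarrow> g \<in> V; a \<in> Hom A x y\<rbrakk> \<Longrightarrow> a \<in> V"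
  using assms unfolding total_def by blast+

text \<open>Made for expressions in one varying arrow, such as composition with a fixed arrow, a
  *-functor on a Hom space or one slot of a bifunctor. Equations between such expressions then need
  checking on generators only.\<close>

definition bounded_linear_hom :: "('o, 'a, 'f::real_or_complex) cstar_cat \<Rightarrow> 'o \<Rightarrow> 'o \<Rightarrow>
    ('p, 'b, 'f) cstar_cat \<Rightarrow> 'p \<Rightarrow> 'p \<Rightarrow> ('a \<Rightarrow> 'b) \<Rightarrow> bool" where
  "bounded_linear_hom A x y B u v \<phi> \<longleftrightarrow>
     (\<forall>a\<in>Hom A x y. \<phi> a \<in> Hom B u v \<and> (\<forall>b\<in>Hom A x y. \<phi> (Add A x y a b) = Add B u v (\<phi> a) (\<phi> b)) \<and>
       (\<forall>c. \<phi> (Scl A x y c a) = Scl B u v c (\<phi> a))) \<and>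
     (\<exists>M. \<forall>a\<in>Hom A x y. Nrm B u v (\<phi> a) \<le> M * Nrm A x y a)"

lemma bounded_linear_homD:
  assumes "bounded_linear_hom A x y B u v \<phi>"
  shows "a \<in> Hom A x y \<Longrightarrow> \<phi> a \<in> Hom B u v"
    and "\<lbrakk>a \<in> Hom A x y; b \<in> Hom A x y\<rbrakk> \<Longrightarrow> \<phi> (Add A x y a b) = Add B u v (\<phi> a) (\<phi> b)"
    and "a \<in> Hom A x y \<Longrightarrow> \<phi> (Scl A x y c a) = Scl B u v c (\<phi> a)"
  using assms unfolding bounded_linear_hom_def by auto

lemma bounded_linear_hom_bound:
  assumes A: "cstar_category A" "x \<in> Ob A" "y \<in> Ob A" and \<phi>: "bounded_linear_hom A x y B u v \<phi>"
  obtains M where "M \<ge> 0" "\<And>a. a \<in> Hom A x y \<Longrightarrow> Nrm B u v (\<phi> a) \<le> M * Nrm A x y a"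
proof -
  interpret A: cstar_category A by (rule A)
  obtain M where M: "\<forall>a\<in>Hom A x y. Nrm B u v (\<phi> a) \<le> M * Nrm A x y a"
    using \<phi> unfolding bounded_linear_hom_def by blast
  \<comment> \<open>The constant in the definition may be negative when all norms on the Hom space
    vanish, hence the maximum with 0.\<close>
  have "Nrm B u v (\<phi> a) \<le> max 0 M * Nrm A x y a" if "a \<in> Hom A x y" for a
    using M that A.N_ge_0[OF A(2,3) that] mult_right_mono[of M "max 0 M" "Nrm A x y a"] by fastforce
  then show ?thesis using that[of "max 0 M"] by simp
qed

lemma bounded_linear_hom_tends:
  assumes A: "cstar_category A" "x \<in> Ob A" "y \<in> Ob A" and B: "cstar_category B" "u \<in> Ob B" "v \<in> Ob B"
    and \<phi>: "bounded_linear_hom A x y B u v \<phi>"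
    and s: "\<And>n. s n \<in> Hom A x y" "a \<in> Hom A x y" "(\<lambda>n. Nrm A x y (Sub A x y (s n) a)) \<longlonglongrightarrow> 0"
  shows "(\<lambda>n. Nrm B u v (Sub B u v (\<phi> (s n)) (\<phi> a))) \<longlonglongrightarrow> 0"
proof -
  interpret A: cstar_category A by (rule A)
  interpret B: cstar_category B by (rule B)
  obtain M where M: "M \<ge> 0" "\<And>a. a \<in> Hom A x y \<Longrightarrow> Nrm B u v (\<phi> a) \<le> M * Nrm A x y a"
    using bounded_linear_hom_bound[OF A \<phi>] by blast
  have sub: "Sub B u v (\<phi> (s n)) (\<phi> a) = \<phi> (Sub A x y (s n) a)" for n
    using A s by (simp add: Sub_def bounded_linear_homD[OF \<phi>] A.hom_closed)
  have "(\<lambda>n. M * Nrm A x y (Sub A x y (s n) a)) \<longlonglongrightarrow> M * 0"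
    by (rule tendsto_mult[OF tendsto_const s(3)])
  then have lim: "(\<lambda>n. M * Nrm A x y (Sub A x y (s n) a)) \<longlonglongrightarrow> 0" by simp
  show ?thesis
    unfolding sub
    by (rule tendsto_sandwich[of "\<lambda>_. 0" _ _ "\<lambda>n. M * Nrm A x y (Sub A x y (s n) a)"])
      (use lim A B s(1,2) M bounded_linear_homD(1)[OF \<phi> A.hom_sub_closed[OF A(2,3) s(1,2)]] in \<open>auto intro!: always_eventually B.N_ge_0 A.hom_closed\<close>)
qed

lemma bounded_linear_hom_zero:
  assumes "cstar_category A" "x \<in> Ob A" "y \<in> Ob A" "cstar_category B" "u \<in> Ob B" "v \<in> Ob B"
    and "bounded_linear_hom A x y B u v \<phi>"
  shows "\<phi> (Zer A x y) = Zer B u v"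
proof -
  interpret A: cstar_category A by (rule assms)
  interpret B: cstar_category B by (rule assms)
  have "\<phi> (Scl A x y 0 (Zer A x y)) = Scl B u v 0 (\<phi> (Zer A x y))"
    by (rule bounded_linear_homD(3)[OF assms(7) A.hom_zero_closed[OF assms(2,3)]])
  then show ?thesis
    using assms bounded_linear_homD(1)[OF assms(7) A.hom_zero_closed]
    by (simp add: A.hom_scl_zero B.hom_scl_0)
qed

text \<open>With \<phi> one slot of the elementary tensor, this carries a density question in a
  tensor product back to a single factor.\<close>

lemma closed_subspace_vimage:
  assumes A: "cstar_category A" "x \<in> Ob A" "y \<in> Ob A" and B: "cstar_category B" "u \<in> Ob B" "v \<in> Ob B"
    and \<phi>: "bounded_linear_hom A x y B u v \<phi>" and V: "closed_subspace B u v V"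
  shows "closed_subspace A x y {a \<in> Hom A x y. \<phi> a \<in> V}"
proof -
  interpret A: cstar_category A by (rule A)
  show ?thesis
    unfolding closed_subspace_def
  proof (intro conjI allI ballI impI)
    fix s a assume s: "\<forall>n. s n \<in> {a \<in> Hom A x y. \<phi> a \<in> V}" "a \<in> Hom A x y"
      "(\<lambda>n. Nrm A x y (Sub A x y (s n) a)) \<longlonglongrightarrow> 0"
    then have "(\<lambda>n. Nrm B u v (Sub B u v (\<phi> (s n)) (\<phi> a))) \<longlonglongrightarrow> 0"
      by (intro bounded_linear_hom_tends[OF A B \<phi>]) auto
    then have "\<phi> a \<in> V"
      using V[unfolded closed_subspace_def, THEN conjunct2, THEN conjunct2, THEN conjunct2, THEN conjunct2,
          rule_format, of "\<phi> a" "\<lambda>n. \<phi> (s n)"] s bounded_linear_homD(1)[OF \<phi>] by simp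
    then show "a \<in> {a \<in> Hom A x y. \<phi> a \<in> V}" using s by simp
  qed (use A bounded_linear_homD[OF \<phi>] V bounded_linear_hom_zero[OF A B \<phi>] in
      \<open>auto simp: A.hom_closed closed_subspace_def\<close>)
qed

lemma closed_subspace_equalizer:
  assumes A: "cstar_category A" "x \<in> Ob A" "y \<in> Ob A" and B: "cstar_category B" "u \<in> Ob B" "v \<in> Ob B"
    and \<phi>: "bounded_linear_hom A x y B u v \<phi>" and \<psi>: "bounded_linear_hom A x y B u v \<psi>"
  shows "closed_subspace A x y {a \<in> Hom A x y. \<phi> a = \<psi> a}"
  unfolding closed_subspace_def
proof (intro conjI allI ballI impI)
  interpret A: cstar_category A by (rule A)
  interpret B: cstar_category B by (rule B)
  fix s a assume s: "\<forall>n. s n \<in> {a \<in> Hom A x y. \<phi> a = \<psi> a}" "a \<in> Hom A x y"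
      "(\<lambda>n. Nrm A x y (Sub A x y (s n) a)) \<longlonglongrightarrow> 0"
  have "\<phi> a = \<psi> a"
    using bounded_linear_hom_tends[OF A B \<phi>, of s a] bounded_linear_hom_tends[OF A B \<psi>, of s a] s
    by (intro B.tends_unique[OF B(2,3), of "\<lambda>n. \<phi> (s n)"]) (auto simp: B.tends_def bounded_linear_homD[OF \<phi>] bounded_linear_homD[OF \<psi>])
  then show "a \<in> {a \<in> Hom A x y. \<phi> a = \<psi> a}" using s by simp
qed (use A bounded_linear_homD[OF \<phi>] bounded_linear_homD[OF \<psi>] bounded_linear_hom_zero[OF A B \<phi>]
    bounded_linear_hom_zero[OF A B \<psi>] in \<open>auto intro: star_category.hom_closed simp: cstar_category_def\<close>)

lemma bounded_linear_hom_eqI: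
  assumes "cstar_category A" "x \<in> Ob A" "y \<in> Ob A" "cstar_category B" "u \<in> Ob B" "v \<in> Ob B"
    and "bounded_linear_hom A x y B u v \<phi>" "bounded_linear_hom A x y B u v \<psi>"
    and "total A S" and "\<And>g. g \<in> S x y \<Longrightarrow> \<phi> g = \<psi> g" and "a \<in> Hom A x y"
  shows "\<phi> a = \<psi> a"
  using totalD(2)[OF assms(9,2,3) closed_subspace_equalizer[OF assms(1-8)] _ assms(11)]
    totalD(1)[OF assms(9,2,3)] assms(10) by auto

lemma bounded_linear_hom_star_functor:
  assumes A: "cstar_category A" and B: "cstar_category B" and F: "star_functor A B F"
    and ob: "x \<in> Ob A" "y \<in> Ob A"
  shows "bounded_linear_hom A x y B (FOb F x) (FOb F y) (FArr F x y)"
  unfolding bounded_linear_hom_def using star_functorD[OF F] star_functor_contractive[OF A B F] ob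
  by (auto intro!: exI[of _ 1])

lemma bounded_linear_hom_compose:
  assumes B: "cstar_category B" "u \<in> Ob B" "v \<in> Ob B"
    and \<phi>: "bounded_linear_hom A x y B u v \<phi>" and \<psi>: "bounded_linear_hom B u v C p q \<psi>"
  shows "bounded_linear_hom A x y C p q (\<lambda>a. \<psi> (\<phi> a))"
proof -
  obtain M where M: "M \<ge> 0" "\<And>a. a \<in> Hom B u v \<Longrightarrow> Nrm C p q (\<psi> a) \<le> M * Nrm B u v a"
    using bounded_linear_hom_bound[OF B \<psi>] by blast
  obtain L where L: "\<forall>a\<in>Hom A x y. Nrm B u v (\<phi> a) \<le> L * Nrm A x y a"
    using \<phi> unfolding bounded_linear_hom_def by blast
  have "Nrm C p q (\<psi> (\<phi> a)) \<le> (M * L) * Nrm A x y a" if a: "a \<in> Hom A x y" for a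
    using M(2)[OF bounded_linear_homD(1)[OF \<phi> a]] mult_left_mono[OF bspec[OF L a] M(1)] by (simp add: mult.assoc)
  then show ?thesis
    unfolding bounded_linear_hom_def using bounded_linear_homD[OF \<phi>] bounded_linear_homD[OF \<psi>]
    by (auto intro!: exI[of _ "M * L"])
qed

lemma bounded_linear_hom_comp_left:
  assumes A: "cstar_category A" and "x \<in> Ob A" "y \<in> Ob A" "z \<in> Ob A" "b \<in> Hom A y z"
  shows "bounded_linear_hom A x y A x z (Cmp A x y z b)"
proof -
  interpret A: cstar_category A by (rule A)
  show ?thesis
    unfolding bounded_linear_hom_def using assms
    by (auto simp: A.hom_closed A.comp_add_right A.comp_scl_right intro!: exI[of _ "Nrm A y z b"] A.N_comp)
qed

lemma bounded_linear_hom_comp_right: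
  assumes A: "cstar_category A" and "x \<in> Ob A" "y \<in> Ob A" "z \<in> Ob A" "a \<in> Hom A x y"
  shows "bounded_linear_hom A y z A x z (\<lambda>b. Cmp A x y z b a)"
proof -
  interpret A: cstar_category A by (rule A)
  show ?thesis
    unfolding bounded_linear_hom_def using assms A.N_comp[of x y z a]
    by (auto simp: A.hom_closed A.comp_add_left A.comp_scl_left mult.commute intro!: exI[of _ "Nrm A x y a"])
qed

text \<open>By \<open>star_functor_contractive\<close> both functors are bounded on Hom spaces, so
  the arrows on which they agree form a closed subspace. The coherence identities are proved through
  this theorem.\<close>

theorem star_functor_eqI:
  fixes A :: "('o, 'a, 'f::real_or_complex) cstar_cat" and B :: "('p, 'b, 'f) cstar_cat"
  assumes A: "cstar_category A" and B: "cstar_category B" and F: "star_functor A B F" and G: "star_functor A B G"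
    and S: "total A S" and ob: "\<And>x. x \<in> Ob A \<Longrightarrow> FOb F x = FOb G x"
    and eq: "\<And>x y g. \<lbrakk>x \<in> Ob A; y \<in> Ob A; g \<in> S x y\<rbrakk> \<Longrightarrow> FArr F x y g = FArr G x y g"
  shows "fun_eq A F G"
  unfolding fun_eq_def
proof (intro conjI ballI ob)
  fix x y a assume *: "x \<in> Ob A" "y \<in> Ob A" and a: "a \<in> Hom A x y"
  show "FArr F x y a = FArr G x y a"
    using * ob[OF *(1)] ob[OF *(2)] star_functorD(2)[OF G] bounded_linear_hom_star_functor[OF A B F *]
      bounded_linear_hom_star_functor[OF A B G *]
    by (intro bounded_linear_hom_eqI[OF A * B _ _ _ _ S eq a, of "FOb F x" "FOb F y"]) auto
qed

lemma (in positive_star_seminorm) total_completion: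
  "total Q (\<lambda>x y. FArr (to_completion A N) x y ` Hom A x y)"
  unfolding total_def
proof (intro ballI conjI allI impI)
  interpret QQ: star_seminorm Q "Nrm Q" by (rule star_seminorm_completion)
  fix x y assume "x \<in> Ob Q" "y \<in> Ob Q"
  then have ob: "x \<in> Ob A" "y \<in> Ob A" by (simp_all add: completion_Ob)
  show "FArr (to_completion A N) x y ` Hom A x y \<subseteq> Hom Q x y" using to_completionD(3) ob by auto
  fix V assume V: "closed_subspace Q x y V" "FArr (to_completion A N) x y ` Hom A x y \<subseteq> V"
  show "Hom Q x y \<subseteq> V"
  proof
    fix X assume X: "X \<in> Hom Q x y"
    then obtain s where s: "Cauchy_seq x y s" "X = cls x y s" by (rule completion_HomE)
    have "\<iota> x y (s n) \<in> V" for n using V(2) CauchyD[OF s(1)] by blast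
    moreover have "(\<lambda>n. Nrm Q x y (Sub Q x y (\<iota> x y (s n)) X)) \<longlonglongrightarrow> 0"
      using Cauchy_tends[OF ob s(1)] unfolding QQ.tends_def s(2) .
    ultimately show "X \<in> V"
      using V(1)[unfolded closed_subspace_def, THEN conjunct2, THEN conjunct2, THEN conjunct2, THEN conjunct2,
          rule_format, OF X, of "\<lambda>n. \<iota> x y (s n)"] by simp
  qed
qed

section \<open>Free vector spaces\<close>

abbreviation "keys \<equiv> Poly_Mapping.keys"
abbreviation "lookup \<equiv> Poly_Mapping.lookup"
abbreviation "single \<equiv> Poly_Mapping.single"

lemma lookup_pm_scale [simp]: "lookup (pm_scale c u) k = c * lookup u k"
  unfolding pm_scale_def by (simp add: Poly_Mapping.map.rep_eq when_def)

lemma keys_pm_scale: "keys (pm_scale c u) \<subseteq> keys u"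
  by (auto simp: in_keys_iff)

lemma pm_scale_single [simp]: "pm_scale c (single k d) = single k (c * d)"
  by (rule poly_mapping_eqI) (simp add: lookup_single when_def)

lemma vector_space_pm_scale: "vector_space (pm_scale :: 'f::field \<Rightarrow> ('k \<Rightarrow>\<^sub>0 'f) \<Rightarrow> _)"
  by unfold_locales (auto intro!: poly_mapping_eqI simp: lookup_add algebra_simps)

interpretation pm: vector_space "pm_scale :: 'f::field \<Rightarrow> ('k \<Rightarrow>\<^sub>0 'f) \<Rightarrow> _"
  by (rule vector_space_pm_scale)

lemma sum_single: "(\<Sum>k\<in>keys u. single k (lookup u k)) = (u :: 'k \<Rightarrow>\<^sub>0 'f::comm_monoid_add)"
proof (rule poly_mapping_eqI)
  fix k show "lookup (\<Sum>k\<in>keys u. single k (lookup u k)) k = lookup u k"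
    by (simp add: lookup_sum lookup_single when_def in_keys_iff)
qed

lemma pm_induct [consumes 1, case_names zero single add]:
  fixes u :: "'k \<Rightarrow>\<^sub>0 'f::comm_monoid_add"
  assumes u: "keys u \<subseteq> S" and zero: "P 0" and single: "\<And>k c. k \<in> S \<Longrightarrow> P (single k c)"
    and add: "\<And>v w. \<lbrakk>keys v \<subseteq> S; keys w \<subseteq> S; P v; P w\<rbrakk> \<Longrightarrow> P (v + w)"
  shows "P u"
proof -
  have "keys (\<Sum>k\<in>T. single k (lookup u k)) \<subseteq> S \<and> P (\<Sum>k\<in>T. single k (lookup u k))"
    if "finite T" "T \<subseteq> S" for T
    using that
  proof (induction T)
    case (insert k T)
    have "keys (single k (lookup u k)) \<subseteq> S" using insert by simp
    then show ?case using insert add[of "single k (lookup u k)" "\<Sum>k\<in>T. single k (lookup u k)"] single[of k]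
        keys_add[of "single k (lookup u k)" "\<Sum>k\<in>T. single k (lookup u k)"] by auto
  qed (simp add: zero)
  from this[of "keys u"] u show ?thesis by (simp add: sum_single)
qed

text \<open>The coefficient is an argument of f so that conjugate-linear extensions, needed for
  involutions, are covered as well.\<close>

definition lext :: "('k \<Rightarrow> 'f::zero \<Rightarrow> 'm::comm_monoid_add) \<Rightarrow> ('k \<Rightarrow>\<^sub>0 'f) \<Rightarrow> 'm" where
  "lext f u = (\<Sum>k\<in>keys u. f k (lookup u k))"

lemma lext_zero [simp]: "lext f 0 = 0"
  by (simp add: lext_def)

lemma lext_fun_zero [simp]: "lext (\<lambda>k c. 0) u = 0"
  by (simp add: lext_def)

lemma lext_single [simp]: "f k 0 = 0 \<Longrightarrow> lext f (single k c) = f k c"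
  by (simp add: lext_def)

lemma lext_add:
  assumes "\<And>k. f k 0 = 0" and "\<And>k a b. f k (a + b) = f k a + f k b"
  shows "lext f (u + v) = lext f u + lext f v"
  unfolding lext_def by (rule setsum_keys_plus_distrib[where f = f]) (simp_all add: assms)

lemma lext_fun_add: "lext (\<lambda>k c. f k c + g k c) u = lext f u + lext g u"
  by (simp add: lext_def sum.distrib)

text \<open>There are two scalars because d is the conjugate of c for an involution. The case c = 0
  is separate because scaling then shrinks the set of keys.\<close>

lemma lext_pm_scale:
  assumes "\<And>k. f k 0 = 0" and "\<And>k a. f k (c * a) = pm_scale d (f k a)"
  shows "lext f (pm_scale c u) = pm_scale d (lext f u)"
proof -
  have "keys u \<subseteq> UNIV" by simp
  then show ?thesis
  proof (cases "c = 0")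
    case True
    have "lext f u' = 0" if "u' = 0" for u' using that by simp
    moreover have "pm_scale d (lext f u) = (\<Sum>k\<in>keys u. f k (c * lookup u k))"
      by (simp add: lext_def pm.scale_sum_right assms(2))
    ultimately show ?thesis using True assms(1) by simp
  next
    case False
    then have "keys (pm_scale c u) = keys u" by (auto simp: in_keys_iff)
    then show ?thesis by (simp add: lext_def pm.scale_sum_right assms(2))
  qed
qed

section \<open>Linear combinations in a vector space given by a carrier set\<close>

context vect_space begin

text \<open>Packs the additive group into a ring record so that \<open>finsum\<close> can add up
  elements of the carrier set V, which is not a type with its own addition.\<close>

definition abgrp :: "'a ring" where
  "abgrp = \<lparr>carrier = V, mult = undefined, one = undefined, zero = zero, add = add\<rparr>"

lemma abgrp_simps [simp]:
  "carrier abgrp = V" "ring.zero abgrp = zero" "ring.add abgrp = add"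
  by (simp_all add: abgrp_def)

lemma abelian_group_abgrp: "abelian_group abgrp"
proof (rule abelian_groupI)
  fix x assume x: "x \<in> carrier abgrp"
  then obtain y where "y \<in> V" "add x y = zero" using ex_neg by (auto simp: abgrp_def)
  then show "\<exists>y\<in>carrier abgrp. y \<oplus>\<^bsub>abgrp\<^esub> x = \<zero>\<^bsub>abgrp\<^esub>"
    using x by (intro bexI[of _ y]) (simp_all add: abgrp_def add_commute[of y])
qed (simp_all add: abgrp_def zero_closed add_closed add_assoc zero_add, rule add_commute)

definition lcomb :: "('k \<Rightarrow> 'a) \<Rightarrow> ('k \<Rightarrow>\<^sub>0 'f) \<Rightarrow> 'a" where
  "lcomb \<phi> u = finsum abgrp (\<lambda>k. scl (lookup u k) (\<phi> k)) (keys u)"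

interpretation G: abelian_group abgrp by (rule abelian_group_abgrp)

lemma lcomb_superset:
  assumes "finite T" "keys u \<subseteq> T" "\<And>k. k \<in> T \<Longrightarrow> \<phi> k \<in> V"
  shows "lcomb \<phi> u = finsum abgrp (\<lambda>k. scl (lookup u k) (\<phi> k)) T"
  unfolding lcomb_def
  by (rule G.add.finprod_mono_neutral_cong_left)
    (use assms in \<open>auto simp: in_keys_iff scl_0 scl_closed\<close>)

lemma lcomb_closed:
  assumes "keys u \<subseteq> S" "\<And>k. k \<in> S \<Longrightarrow> \<phi> k \<in> V" shows "lcomb \<phi> u \<in> V"
proof -
  have "(\<lambda>k. scl (lookup u k) (\<phi> k)) \<in> keys u \<rightarrow> carrier abgrp" using assms by (auto simp: scl_closed)
  from G.finsum_closed[OF this] show ?thesis by (simp add: lcomb_def)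
qed

lemma lcomb_zero: "lcomb \<phi> 0 = zero"
  using G.finsum_empty by (simp add: lcomb_def)

lemma lcomb_add:
  assumes "keys u \<subseteq> S" "keys v \<subseteq> S" and \<phi>: "\<And>k. k \<in> S \<Longrightarrow> \<phi> k \<in> V"
  shows "lcomb \<phi> (u + v) = add (lcomb \<phi> u) (lcomb \<phi> v)"
proof -
  let ?T = "keys u \<union> keys v"
  have T: "finite ?T" "?T \<subseteq> S" "keys (u + v) \<subseteq> ?T" using assms keys_add[of u v] by auto
  then have \<phi>T: "\<And>k. k \<in> ?T \<Longrightarrow> \<phi> k \<in> V" using \<phi> by blast
  have "lcomb \<phi> (u + v) = finsum abgrp (\<lambda>k. scl (lookup u k) (\<phi> k) \<oplus>\<^bsub>abgrp\<^esub> scl (lookup v k) (\<phi> k)) ?T"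
    using T \<phi> by (subst lcomb_superset[OF T(1,3)])
      (auto simp: lookup_add add_scl scl_closed add_closed intro!: G.add.finprod_cong')
  also have "\<dots> = lcomb \<phi> u \<oplus>\<^bsub>abgrp\<^esub> lcomb \<phi> v"
    using lcomb_superset[OF T(1) _ \<phi>T, of u] lcomb_superset[OF T(1) _ \<phi>T, of v] \<phi>T
    by (subst G.finsum_addf) (auto simp: scl_closed)
  finally show ?thesis by simp
qed

lemma lcomb_single: "\<phi> k \<in> V \<Longrightarrow> lcomb \<phi> (single k c) = scl c (\<phi> k)"
  using G.finsum_insert[of "{}" k "\<lambda>j. scl (lookup (single k c) j) (\<phi> j)"] G.finsum_empty
  by (auto simp: lcomb_def scl_closed add_zero scl_0)

lemma lcomb_scale:
  assumes u: "keys u \<subseteq> S" and \<phi>: "\<And>k. k \<in> S \<Longrightarrow> \<phi> k \<in> V"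
  shows "lcomb \<phi> (pm_scale c u) = scl c (lcomb \<phi> u)"
  using u
proof (induction u rule: pm_induct)
  case (add v w)
  have "keys (pm_scale c v) \<subseteq> S" "keys (pm_scale c w) \<subseteq> S"
    by (rule subset_trans[OF keys_pm_scale add(1)], rule subset_trans[OF keys_pm_scale add(2)])
  then show ?case
    using add \<phi> by (simp add: pm.scale_right_distrib lcomb_add[where S = S] scl_add lcomb_closed[where S = S])
qed (simp_all add: lcomb_zero scl_zero lcomb_single \<phi> scl_scl)

end


context star_category begin

lemma star_zero: "\<lbrakk>x \<in> Ob A; y \<in> Ob A\<rbrakk> \<Longrightarrow> Str A x y (Zer A x y) = Zer A y x"
  using star_scl[of x y "Zer A x y" 0] by (simp add: hom_scl_zero hom_scl_0 hom_closed)

lemma comp_zero_right: "\<lbrakk>x \<in> Ob A; y \<in> Ob A; z \<in> Ob A; b \<in> Hom A y z\<rbrakk> \<Longrightarrow> Cmp A x y z b (Zer A x y) = Zer A x z"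
  using comp_scl_right[of x y z "Zer A x y" b 0] by (simp add: hom_scl_zero hom_scl_0 hom_closed)

lemma comp_zero_left: "\<lbrakk>x \<in> Ob A; y \<in> Ob A; z \<in> Ob A; a \<in> Hom A x y\<rbrakk> \<Longrightarrow> Cmp A x y z (Zer A y z) a = Zer A x z"
  using comp_scl_left[of x y z a "Zer A y z" 0] by (simp add: hom_scl_zero hom_scl_0 hom_closed)

end


section \<open>The free $*$-category on a category with involution\<close>

text \<open>With J the inversion of a groupoid this is \<open>gpd_star_cat\<close>. With J the
  componentwise star on a product category it is the tensor product before bilinearity is
  imposed.\<close>

definition free_cat :: "('o, 'a, 'y) cat_scheme \<Rightarrow> ('o \<Rightarrow> 'o \<Rightarrow> 'a \<Rightarrow> 'a)
    \<Rightarrow> ('o, 'a \<Rightarrow>\<^sub>0 'f::real_or_complex, 'f) star_cat" where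
  "free_cat C J = \<lparr>Ob = Ob C, Hom = (\<lambda>x y. {u. keys u \<subseteq> Hom C x y}), Idt = (\<lambda>x. single (Idt C x) 1),
     Cmp = (\<lambda>x y z v u. lext (\<lambda>h c. lext (\<lambda>g d. single (Cmp C x y z h g) (c * d)) u) v),
     Add = (\<lambda>x y. (+)), Zer = (\<lambda>x y. 0), Scl = (\<lambda>x y. pm_scale),
     Str = (\<lambda>x y. lext (\<lambda>g c. single (J x y g) (conjg c)))\<rparr>"

lemma free_cat_simps [simp]:
  "Ob (free_cat C J) = Ob C" "u \<in> Hom (free_cat C J) x y \<longleftrightarrow> keys u \<subseteq> Hom C x y"
  "Idt (free_cat C J) x = single (Idt C x) 1" "Add (free_cat C J) x y u v = u + v"
  "Zer (free_cat C J) x y = 0" "Scl (free_cat C J) x y = pm_scale"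
  by (simp_all add: free_cat_def)

lemma free_cat_Cmp_single [simp]:
  "Cmp (free_cat C J) x y z (single h c) (single g d) = single (Cmp C x y z h g) (c * d)"
  by (simp add: free_cat_def)

lemma free_cat_Cmp_add_left:
  "Cmp (free_cat C J) x y z (v + w) u = Cmp (free_cat C J) x y z v u + Cmp (free_cat C J) x y z w u"
  unfolding free_cat_def
  by (simp, subst lext_add) (simp_all add: distrib_right single_add lext_fun_add)

lemma free_cat_Cmp_add_right:
  "Cmp (free_cat C J) x y z v (u + w) = Cmp (free_cat C J) x y z v u + Cmp (free_cat C J) x y z v w"
  unfolding free_cat_def by (simp add: lext_add distrib_left single_add lext_fun_add)

lemma free_cat_Cmp_zero [simp]:
  "Cmp (free_cat C J) x y z 0 u = 0" "Cmp (free_cat C J) x y z v 0 = 0"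
  by (simp_all add: free_cat_def lext_def)

lemma free_cat_Cmp_scale_left:
  "Cmp (free_cat C J) x y z (pm_scale c v) u = pm_scale c (Cmp (free_cat C J) x y z v u)"
  unfolding free_cat_def by (simp add: lext_pm_scale) (rule lext_pm_scale; simp add: lext_def pm.scale_sum_right mult.assoc)

lemma free_cat_Cmp_scale_right:
  "Cmp (free_cat C J) x y z v (pm_scale c u) = pm_scale c (Cmp (free_cat C J) x y z v u)"
proof -
  have "lext (\<lambda>g d. single (Cmp C x y z h g) (b * d)) (pm_scale c u)
      = pm_scale c (lext (\<lambda>g d. single (Cmp C x y z h g) (b * d)) u)" for h b
    by (rule lext_pm_scale) (simp_all add: mult.left_commute)
  then show ?thesis by (simp add: free_cat_def lext_def[of _ v] pm.scale_sum_right)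
qed

lemma free_cat_Str_single [simp]: "Str (free_cat C J) x y (single g c) = single (J x y g) (conjg c)"
  by (simp add: free_cat_def)

lemma free_cat_Str_zero [simp]: "Str (free_cat C J) x y 0 = 0"
  by (simp add: free_cat_def)

lemma free_cat_Str_add: "Str (free_cat C J) x y (u + v) = Str (free_cat C J) x y u + Str (free_cat C J) x y v"
  by (simp add: free_cat_def lext_add conjg_add single_add)

lemma free_cat_Str_scale: "Str (free_cat C J) x y (pm_scale c u) = pm_scale (conjg c) (Str (free_cat C J) x y u)"
  unfolding free_cat_def by simp (rule lext_pm_scale; simp add: conjg_mult)

locale involutive_category = category C for C :: "('o, 'a, 'y) cat_scheme" +
  fixes J :: "'o \<Rightarrow> 'o \<Rightarrow> 'a \<Rightarrow> 'a"
  assumes J_closed: "\<lbrakk>x \<in> Ob C; y \<in> Ob C; g \<in> Hom C x y\<rbrakk> \<Longrightarrow> J x y g \<in> Hom C y x"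
    and J_comp: "\<lbrakk>x \<in> Ob C; y \<in> Ob C; z \<in> Ob C; g \<in> Hom C x y; h \<in> Hom C y z\<rbrakk>
      \<Longrightarrow> J x z (Cmp C x y z h g) = Cmp C z y x (J x y g) (J y z h)"
    and J_J: "\<lbrakk>x \<in> Ob C; y \<in> Ob C; g \<in> Hom C x y\<rbrakk> \<Longrightarrow> J y x (J x y g) = g"
begin

lemma free_cat_Cmp_closed:
  assumes ob: "x \<in> Ob C" "y \<in> Ob C" "z \<in> Ob C" and u: "keys u \<subseteq> Hom C x y" and v: "keys v \<subseteq> Hom C y z"
  shows "keys (Cmp (free_cat C J) x y z v u) \<subseteq> Hom C x z"
  using v
proof (induction v rule: pm_induct)
  case (single h c)
  show ?case using u
  proof (induction u rule: pm_induct)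
    case (add u w)
    then show ?case by (simp add: free_cat_Cmp_add_right) (meson Un_least keys_add order_trans)
  qed (use ob single in \<open>auto simp: comp_closed\<close>)
next
  case (add v w)
  then show ?case by (simp add: free_cat_Cmp_add_left) (meson Un_least keys_add order_trans)
qed simp

lemma free_cat_Str_closed:
  assumes ob: "x \<in> Ob C" "y \<in> Ob C" and u: "keys u \<subseteq> Hom C x y"
  shows "keys (Str (free_cat C J) x y u) \<subseteq> Hom C y x"
  using u
proof (induction u rule: pm_induct)
  case (add u w)
  then show ?case by (simp add: free_cat_Str_add) (meson Un_least keys_add order_trans)
qed (use ob in \<open>auto simp: J_closed\<close>)

lemma keys_add_subset: "\<lbrakk>keys u \<subseteq> S; keys v \<subseteq> S\<rbrakk> \<Longrightarrow> keys (u + v) \<subseteq> S"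
  using keys_add by fastforce

lemma free_cat_assoc:
  assumes ob: "w \<in> Ob C" "x \<in> Ob C" "y \<in> Ob C" "z \<in> Ob C"
    and u: "keys u \<subseteq> Hom C w x" and v: "keys v \<subseteq> Hom C x y" and t: "keys t \<subseteq> Hom C y z"
  shows "Cmp (free_cat C J) w y z t (Cmp (free_cat C J) w x y v u)
    = Cmp (free_cat C J) w x z (Cmp (free_cat C J) x y z t v) u"
  using t
proof (induction t rule: pm_induct)
  case (single l a)
  note l = single
  show ?case using v
  proof (induction v rule: pm_induct)
    case (single h b)
    note h = single
    show ?case using u
      by (induction u rule: pm_induct)
        (simp_all add: free_cat_Cmp_add_right comp_assoc[OF ob _ h l] mult.assoc)
  qed (simp_all add: free_cat_Cmp_add_left free_cat_Cmp_add_right)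
qed (simp_all add: free_cat_Cmp_add_left)

lemma free_cat_star_comp:
  assumes ob: "x \<in> Ob C" "y \<in> Ob C" "z \<in> Ob C" and u: "keys u \<subseteq> Hom C x y" and v: "keys v \<subseteq> Hom C y z"
  shows "Str (free_cat C J) x z (Cmp (free_cat C J) x y z v u)
    = Cmp (free_cat C J) z y x (Str (free_cat C J) x y u) (Str (free_cat C J) y z v)"
  using v
proof (induction v rule: pm_induct)
  case (single h b)
  note h = single
  show ?case using u
    by (induction u rule: pm_induct)
      (simp_all add: free_cat_Cmp_add_right free_cat_Cmp_add_left free_cat_Str_add J_comp[OF ob _ h]
        conjg_mult mult.commute)
qed (simp_all add: free_cat_Cmp_add_left free_cat_Cmp_add_right free_cat_Str_add)

lemma vect_space_free_cat:
  "vect_space (Hom (free_cat C J) x y) (Add (free_cat C J) x y) (Zer (free_cat C J) x y)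
     (Scl (free_cat C J) x y :: 'f::real_or_complex \<Rightarrow> _)"
proof unfold_locales
  fix u :: "'a \<Rightarrow>\<^sub>0 'f" assume "u \<in> Hom (free_cat C J) x y"
  then show "\<exists>v\<in>Hom (free_cat C J) x y. Add (free_cat C J) x y u v = Zer (free_cat C J) x y"
    by (intro bexI[of _ "- u"]) auto
next
  fix u :: "'a \<Rightarrow>\<^sub>0 'f" and c assume "u \<in> Hom (free_cat C J) x y"
  then show "Scl (free_cat C J) x y c u \<in> Hom (free_cat C J) x y"
    using keys_pm_scale[of c u] by simp
qed (auto simp: keys_add_subset pm.scale_right_distrib pm.scale_left_distrib add.assoc add.commute)

lemma free_cat_id:
  assumes ob: "x \<in> Ob C" "y \<in> Ob C" and u: "keys u \<subseteq> Hom C x y"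
  shows "Cmp (free_cat C J) x x y u (single (Idt C x) 1) = u"
    and "Cmp (free_cat C J) x y y (single (Idt C y) 1) u = u"
    and "Str (free_cat C J) y x (Str (free_cat C J) x y u) = u"
  using u by (induction u rule: pm_induct)
    (simp_all add: free_cat_Cmp_add_left free_cat_Cmp_add_right free_cat_Str_add
      comp_id_right[OF ob] comp_id_left[OF ob] J_J[OF ob])

lemma star_category_free_cat: "star_category (free_cat C J :: ('o, 'a \<Rightarrow>\<^sub>0 'f::real_or_complex, 'f) star_cat)"
  by (intro star_category.intro category.intro star_category_axioms.intro vect_space_free_cat)
    (simp_all add: free_cat_Cmp_closed free_cat_Str_closed free_cat_assoc free_cat_star_comp
      free_cat_Cmp_add_left free_cat_Cmp_add_right free_cat_Cmp_scale_left free_cat_Cmp_scale_right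
      free_cat_Str_add free_cat_Str_scale id_closed free_cat_id)

end

section \<open>Linear extension of functors to the free *-category\<close>

definition free_extend :: "('p, 'b, 'f::real_or_complex, 'z) star_cat_scheme \<Rightarrow> ('o, 'a, 'p, 'b) fnct
    \<Rightarrow> ('o, 'a \<Rightarrow>\<^sub>0 'f, 'p, 'b) fnct" where
  "free_extend B F = \<lparr>FOb = FOb F, FArr = (\<lambda>x y. vect_space.lcomb (Hom B (FOb F x) (FOb F y))
     (Add B (FOb F x) (FOb F y)) (Zer B (FOb F x) (FOb F y)) (Scl B (FOb F x) (FOb F y)) (FArr F x y))\<rparr>"

locale involutive_functor = C: involutive_category C J + B: star_category B
  for C :: "('o, 'a, 'y) cat_scheme" and J and B :: "('p, 'b, 'f::real_or_complex, 'z) star_cat_scheme" +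
  fixes F :: "('o, 'a, 'p, 'b) fnct"
  assumes F: "is_functor C B F"
    and F_J: "\<lbrakk>x \<in> Ob C; y \<in> Ob C; g \<in> Hom C x y\<rbrakk>
      \<Longrightarrow> FArr F y x (J x y g) = Str B (FOb F x) (FOb F y) (FArr F x y g)"
begin

lemma FD:
  shows "x \<in> Ob C \<Longrightarrow> FOb F x \<in> Ob B"
    and "\<lbrakk>x \<in> Ob C; y \<in> Ob C; a \<in> Hom C x y\<rbrakk> \<Longrightarrow> FArr F x y a \<in> Hom B (FOb F x) (FOb F y)"
    and "x \<in> Ob C \<Longrightarrow> FArr F x x (Idt C x) = Idt B (FOb F x)"
    and "\<lbrakk>x \<in> Ob C; y \<in> Ob C; z \<in> Ob C; a \<in> Hom C x y; b \<in> Hom C y z\<rbrakk> \<Longrightarrow> FArr F x z (Cmp C x y z b a) =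
      Cmp B (FOb F x) (FOb F y) (FOb F z) (FArr F y z b) (FArr F x y a)"
  using F unfolding is_functor_def by auto

abbreviation L where "L \<equiv> FArr (free_extend B F)"

lemma FOb_free_extend [simp]: "FOb (free_extend B F) = FOb F"
  by (simp add: free_extend_def)

lemma L_zero: "\<lbrakk>x \<in> Ob C; y \<in> Ob C\<rbrakk> \<Longrightarrow> L x y 0 = Zer B (FOb F x) (FOb F y)"
  unfolding free_extend_def by (simp add: vect_space.lcomb_zero[OF B.hom_vect_space] FD)

lemma L_closed: "\<lbrakk>x \<in> Ob C; y \<in> Ob C; keys u \<subseteq> Hom C x y\<rbrakk> \<Longrightarrow> L x y u \<in> Hom B (FOb F x) (FOb F y)"
  unfolding free_extend_def by (simp, rule vect_space.lcomb_closed[OF B.hom_vect_space]) (auto simp: FD)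

lemma L_add: "\<lbrakk>x \<in> Ob C; y \<in> Ob C; keys u \<subseteq> Hom C x y; keys v \<subseteq> Hom C x y\<rbrakk>
    \<Longrightarrow> L x y (u + v) = Add B (FOb F x) (FOb F y) (L x y u) (L x y v)"
  unfolding free_extend_def by (simp, rule vect_space.lcomb_add[OF B.hom_vect_space]) (auto simp: FD)

lemma L_scale: "\<lbrakk>x \<in> Ob C; y \<in> Ob C; keys u \<subseteq> Hom C x y\<rbrakk>
    \<Longrightarrow> L x y (pm_scale c u) = Scl B (FOb F x) (FOb F y) c (L x y u)"
  unfolding free_extend_def by (simp, rule vect_space.lcomb_scale[OF B.hom_vect_space]) (auto simp: FD)

lemma L_single: "\<lbrakk>x \<in> Ob C; y \<in> Ob C; g \<in> Hom C x y\<rbrakk>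
    \<Longrightarrow> L x y (single g c) = Scl B (FOb F x) (FOb F y) c (FArr F x y g)"
  unfolding free_extend_def by (simp add: vect_space.lcomb_single[OF B.hom_vect_space] FD)

lemma L_single_1: "\<lbrakk>x \<in> Ob C; y \<in> Ob C; g \<in> Hom C x y\<rbrakk> \<Longrightarrow> L x y (single g 1) = FArr F x y g"
  by (simp add: L_single B.hom_scl_one FD)

lemma L_comp:
  assumes ob: "x \<in> Ob C" "y \<in> Ob C" "z \<in> Ob C" and u: "keys u \<subseteq> Hom C x y" and v: "keys v \<subseteq> Hom C y z"
  shows "L x z (Cmp (free_cat C J) x y z v u) = Cmp B (FOb F x) (FOb F y) (FOb F z) (L y z v) (L x y u)"
proof -
  interpret FC: star_category "free_cat C J :: ('o, 'a \<Rightarrow>\<^sub>0 'f, 'f) star_cat" by (rule C.star_category_free_cat)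
  note obB = FD(1)[OF ob(1)] FD(1)[OF ob(2)] FD(1)[OF ob(3)]
  show ?thesis using v
  proof (induction v rule: pm_induct)
    case (single h c)
    note h = single
    show ?case using u
    proof (induction u rule: pm_induct)
      case (single g d)
      then show ?case using ob h obB
        by (simp add: L_single FD C.comp_closed B.comp_scl_left B.comp_scl_right B.hom_closed B.hom_scl_scl mult.commute)
    next
      case (add u w)
      have "keys (single h c) \<subseteq> Hom C y z" using h by simp
      then show ?case using ob h obB add
        by (simp add: free_cat_Cmp_add_right L_add C.free_cat_Cmp_closed B.comp_add_right L_closed)
    qed (use ob h in \<open>simp add: L_zero B.comp_zero_right obB L_closed\<close>)
  next
    case (add v w)
    then show ?case using ob u obB
      by (simp add: free_cat_Cmp_add_left L_add C.free_cat_Cmp_closed B.comp_add_left L_closed)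
  qed (use ob u in \<open>simp add: L_zero B.comp_zero_left obB L_closed\<close>)
qed

lemma L_star:
  assumes ob: "x \<in> Ob C" "y \<in> Ob C" and u: "keys u \<subseteq> Hom C x y"
  shows "L y x (Str (free_cat C J) x y u) = Str B (FOb F x) (FOb F y) (L x y u)"
  using u
proof (induction u rule: pm_induct)
  case zero
  then show ?case using ob by (simp add: L_zero B.star_zero FD)
next
  case (single g c)
  then show ?case using ob by (simp add: L_single C.J_closed F_J B.star_scl FD)
next
  case (add u v)
  then show ?case using ob
    by (simp add: free_cat_Str_add L_add C.free_cat_Str_closed B.star_add FD L_closed)
qed

lemma star_functor_free_extend: "star_functor (free_cat C J) B (free_extend B F)"
  unfolding star_functor_def is_functor_def
  by (auto simp: FD L_closed L_comp L_add L_scale L_star L_single_1 C.id_closed)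

end

text \<open>Bounds on generators add up along finite sums. The predicate R selects the functors
  under consideration: all of them for a groupoid, but only those respecting the tensor relations
  for a tensor product.\<close>

lemma (in involutive_category) free_bound:
  fixes R :: "('p, 'b, 'f::real_or_complex) cstar_cat \<Rightarrow> ('o, 'a \<Rightarrow>\<^sub>0 'f, 'p, 'b) fnct \<Rightarrow> bool"
  assumes R: "\<And>B F. R B F \<Longrightarrow> cstar_category B \<and> star_functor (free_cat C J) B F"
    and gen: "\<And>g. g \<in> Hom C x y \<Longrightarrow> \<exists>M. \<forall>B F. R B F \<longrightarrow> Nrm B (FOb F x) (FOb F y) (FArr F x y (single g 1)) \<le> M"
    and ob: "x \<in> Ob C" "y \<in> Ob C" and u: "keys u \<subseteq> Hom C x y"
  shows "\<exists>M. \<forall>B F. R B F \<longrightarrow> Nrm B (FOb F x) (FOb F y) (FArr F x y u) \<le> M"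
proof -
  interpret FC: star_category "free_cat C J :: ('o, 'a \<Rightarrow>\<^sub>0 'f, 'f) star_cat" by (rule star_category_free_cat)
  have scl: "Nrm B (FOb F x) (FOb F y) (FArr F x y (pm_scale c v)) = norm c * Nrm B (FOb F x) (FOb F y) (FArr F x y v)"
    if "R B F" "keys v \<subseteq> Hom C x y" for B F c v
  proof -
    interpret B: cstar_category B using R[OF that(1)] by simp
    have F: "star_functor (free_cat C J) B F" using R[OF that(1)] by simp
    show ?thesis
      using star_functorD(2,3)[OF F] star_functorD(7)[OF F, of x y v c] ob that(2) by (simp add: B.N_scl)
  qed
  show ?thesis using u
  proof (induction u rule: pm_induct)
    case zero
    have "Nrm B (FOb F x) (FOb F y) (FArr F x y 0) \<le> 0" if "R B F" for B F
      using scl[OF that, of 0 0] by simp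
    then show ?case by blast
  next
    case (single g c)
    obtain M where M: "\<forall>B F. R B F \<longrightarrow> Nrm B (FOb F x) (FOb F y) (FArr F x y (single g 1)) \<le> M"
      using gen[OF single] by blast
    have "Nrm B (FOb F x) (FOb F y) (FArr F x y (single g c)) \<le> norm c * M" if "R B F" for B F
      using scl[OF that, of "single g 1" c] single mult_left_mono[OF M[rule_format, OF that], of "norm c"] by simp
    then show ?case by blast
  next
    case (add v w)
    then obtain L M where LM: "\<forall>B F. R B F \<longrightarrow> Nrm B (FOb F x) (FOb F y) (FArr F x y v) \<le> L"
      "\<forall>B F. R B F \<longrightarrow> Nrm B (FOb F x) (FOb F y) (FArr F x y w) \<le> M" by blast
    have "Nrm B (FOb F x) (FOb F y) (FArr F x y (v + w)) \<le> L + M" if r: "R B F" for B F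
    proof -
      interpret B: cstar_category B using R[OF r] by simp
      have F: "star_functor (free_cat C J) B F" using R[OF r] by simp
      have "Nrm B (FOb F x) (FOb F y) (FArr F x y (v + w))
          \<le> Nrm B (FOb F x) (FOb F y) (FArr F x y v) + Nrm B (FOb F x) (FOb F y) (FArr F x y w)"
        using star_functorD(2,3)[OF F] star_functorD(6)[OF F, of x y v w] ob add(1,2) by (simp add: B.N_add)
      then show ?thesis using LM[THEN spec, THEN spec, THEN mp, OF r] by linarith
    qed
    then show ?case by blast
  qed
qed

lemma (in involutive_category) free_total:
  assumes D: "cstar_category D" and F: "star_functor (free_cat C J) D F"
    and ob: "x \<in> Ob C" "y \<in> Ob C" and V: "closed_subspace D (FOb F x) (FOb F y) V"
    and gen: "\<And>g. g \<in> Hom C x y \<Longrightarrow> FArr F x y (single g 1) \<in> V" and u: "keys u \<subseteq> Hom C x y"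
  shows "FArr F x y u \<in> V"
proof -
  interpret D: cstar_category D by (rule D)
  note FD = star_functorD[OF F, simplified]
  have scl: "FArr F x y (pm_scale c v) \<in> V" if "keys v \<subseteq> Hom C x y" "FArr F x y v \<in> V" for c v
    using FD(7)[OF ob that(1), of c] that V by (simp add: closed_subspace_def)
  show ?thesis using u
  proof (induction u rule: pm_induct)
    case zero
    have "FArr F x y (pm_scale 0 0) = Scl D (FOb F x) (FOb F y) 0 (FArr F x y 0)" using FD(7)[OF ob, of 0 0] by simp
    then show ?case using V FD(2,3) ob by (simp add: D.hom_scl_0 closed_subspace_def)
  next
    case (single g c)
    then show ?case using scl[of "single g 1" c] gen by simp
  next
    case (add v w)
    then show ?case using FD(6)[OF ob, of v w] V by (simp add: closed_subspace_def)
  qed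
qed


section \<open>Maximal groupoid C*-categories\<close>

lemma (in category) inverse_unique:
  assumes "x \<in> Ob C" "y \<in> Ob C" "f \<in> Hom C x y" "is_inverse C x y f g" "is_inverse C x y f h"
  shows "g = h"
proof -
  have gh: "g \<in> Hom C y x" "h \<in> Hom C y x" using assms by (auto simp: is_inverse_def)
  have "g = Cmp C y y x g (Cmp C y x y f h)" using assms gh by (simp add: is_inverse_def comp_id_right)
  also have "\<dots> = Cmp C y x x (Cmp C x y x g f) h" using assms gh by (intro comp_assoc) auto
  also have "\<dots> = h" using assms gh by (simp add: is_inverse_def comp_id_left)
  finally show ?thesis .
qed

context groupoid begin

lemma inverse_arr_eqI:
  assumes "x \<in> Ob G" "y \<in> Ob G" "f \<in> Hom G x y" "is_inverse G x y f g"
  shows "inverse_arr G x y f = g"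
  unfolding inverse_arr_def using assms inverse_unique by blast

lemma is_inverse_inverse_arr:
  assumes "x \<in> Ob G" "y \<in> Ob G" "f \<in> Hom G x y"
  shows "is_inverse G x y f (inverse_arr G x y f)"
  using ex_inverse[OF assms] inverse_arr_eqI[OF assms] by blast

lemma inverse_arr_props:
  assumes "x \<in> Ob G" "y \<in> Ob G" "f \<in> Hom G x y"
  shows "inverse_arr G x y f \<in> Hom G y x" "Cmp G x y x (inverse_arr G x y f) f = Idt G x"
    "Cmp G y x y f (inverse_arr G x y f) = Idt G y"
  using is_inverse_inverse_arr[OF assms] by (auto simp: is_inverse_def)

sublocale involutive_category G "inverse_arr G"
proof
  fix x y f assume *: "x \<in> Ob G" "y \<in> Ob G" "f \<in> Hom G x y"
  then show "inverse_arr G x y f \<in> Hom G y x" by (rule inverse_arr_props)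
  show "inverse_arr G y x (inverse_arr G x y f) = f"
    using * by (intro inverse_arr_eqI) (auto simp: inverse_arr_props is_inverse_def)
next
  fix x y z g h assume *: "x \<in> Ob G" "y \<in> Ob G" "z \<in> Ob G" "g \<in> Hom G x y" "h \<in> Hom G y z"
  note i = inverse_arr_props[OF *(1,2,4)] inverse_arr_props[OF *(2,3,5)]
  have "Cmp G x z x (Cmp G z y x (inverse_arr G x y g) (inverse_arr G y z h)) (Cmp G x y z h g)
      = Cmp G x y x (inverse_arr G x y g) (Cmp G x y y (Cmp G y z y (inverse_arr G y z h) h) g)"
    using * i(1,4) by (simp add: comp_assoc comp_closed)
  also have "\<dots> = Idt G x" using * i by (simp add: comp_id_left)
  finally have 1: "Cmp G x z x (Cmp G z y x (inverse_arr G x y g) (inverse_arr G y z h)) (Cmp G x y z h g) = Idt G x" .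
  have "Cmp G z x z (Cmp G x y z h g) (Cmp G z y x (inverse_arr G x y g) (inverse_arr G y z h))
      = Cmp G z y z h (Cmp G z y y (Cmp G y x y g (inverse_arr G x y g)) (inverse_arr G y z h))"
    using * i(1,4) by (simp add: comp_assoc[symmetric] comp_closed)
  also have "\<dots> = Idt G z" using * i by (simp add: comp_id_left)
  finally have 2: "Cmp G z x z (Cmp G x y z h g) (Cmp G z y x (inverse_arr G x y g) (inverse_arr G y z h)) = Idt G z" .
  show "inverse_arr G x z (Cmp G x y z h g) = Cmp G z y x (inverse_arr G x y g) (inverse_arr G y z h)"
    using * i 1 2 by (intro inverse_arr_eqI) (auto simp: is_inverse_def comp_closed)
qed

end

lemma gpd_star_cat_eq: "gpd_star_cat K G = free_cat G (inverse_arr G)"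
  by (simp add: gpd_star_cat_def free_cat_def lext_def[abs_def])

lemma gpd_star_cat_simps [simp]:
  "Ob (gpd_star_cat K G) = Ob G" "u \<in> Hom (gpd_star_cat K G) x y \<longleftrightarrow> keys u \<subseteq> Hom G x y"
  by (simp_all add: gpd_star_cat_eq)

lemma unitary_star_functor:
  assumes F: "star_functor A B F" and ob: "x \<in> Ob A" "y \<in> Ob A" and A: "star_category A" and a: "unitary A x y a"
  shows "unitary B (FOb F x) (FOb F y) (FArr F x y a)"
proof -
  interpret A: star_category A by (rule A)
  have "a \<in> Hom A x y" "Str A x y a \<in> Hom A y x" using a ob by (auto simp: unitary_def A.hom_closed)
  then show ?thesis
    using a ob unfolding unitary_def by (simp add: star_functorD[OF F] flip: star_functorD(5,8)[OF F])
qed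

lemma unitary_functor_star_functor:
  assumes G: "category G" and A: "star_category A" and B: "star_category B"
    and T: "unitary_functor G A T" and F: "star_functor A B F"
  shows "unitary_functor G B (F \<circ>\<^sub>F T)"
  using T unitary_star_functor[OF F _ _ A] star_functorD[OF F] category.id_closed[OF G] category.comp_closed[OF G]
  unfolding unitary_functor_def is_functor_def by auto

context groupoid begin

lemma unitary_single:
  assumes "x \<in> Ob G" "y \<in> Ob G" "g \<in> Hom G x y"
  shows "unitary (free_cat G (inverse_arr G)) x y (single g 1)"
  using assms by (simp add: unitary_def inverse_arr_props)

text \<open>Arrows of the groupoid go to unitaries, whose norm is at most 1 in every C*-category;
  \<open>free_bound\<close> does the rest.\<close>

lemma bounded_star_category_gpd_star_cat: "bounded_star_category (gpd_star_cat (K :: 'f::real_or_complex itself) G)"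
proof (intro bounded_star_category.intro bounded_star_category_axioms.intro)
  show "star_category (gpd_star_cat K G)" unfolding gpd_star_cat_eq by (rule star_category_free_cat)
  show "cstar_bounded (gpd_star_cat K G)"
    unfolding cstar_bounded_def gpd_star_cat_eq
  proof (intro ballI)
    fix x y and u :: "'a \<Rightarrow>\<^sub>0 'f"
    assume *: "x \<in> Ob (free_cat G (inverse_arr G) :: ('o, 'a \<Rightarrow>\<^sub>0 'f, 'f) star_cat)"
      "y \<in> Ob (free_cat G (inverse_arr G) :: ('o, 'a \<Rightarrow>\<^sub>0 'f, 'f) star_cat)" "u \<in> Hom (free_cat G (inverse_arr G)) x y"
    have "\<exists>M. \<forall>(B :: ('o, (nat \<Rightarrow> 'a \<Rightarrow>\<^sub>0 'f) set, 'f) cstar_cat) F.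
        cstar_category B \<and> star_functor (free_cat G (inverse_arr G)) B F \<longrightarrow>
        Nrm B (FOb F x) (FOb F y) (FArr F x y u) \<le> M"
    proof (rule free_bound)
      fix g assume g: "g \<in> Hom G x y"
      have "Nrm B (FOb F x) (FOb F y) (FArr F x y (single g 1)) \<le> 1"
        if "cstar_category B \<and> star_functor (free_cat G (inverse_arr G)) B F"
        for B :: "('o, (nat \<Rightarrow> 'a \<Rightarrow>\<^sub>0 'f) set, 'f) cstar_cat" and F
      proof -
        interpret B: cstar_category B using that by simp
        have F: "star_functor (free_cat G (inverse_arr G)) B F" using that by simp
        show ?thesis
          using * g star_functorD(2)[OF F] unitary_star_functor[OF F _ _ star_category_free_cat unitary_single]
          by (intro B.N_unitary_le) auto
      qed
      then show "\<exists>M. \<forall>(B :: ('o, (nat \<Rightarrow> 'a \<Rightarrow>\<^sub>0 'f) set, 'f) cstar_cat) F.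
        cstar_category B \<and> star_functor (free_cat G (inverse_arr G)) B F \<longrightarrow>
        Nrm B (FOb F x) (FOb F y) (FArr F x y (single g 1)) \<le> M" by blast
    qed (use * in auto)
    then show "\<exists>M. \<forall>(B :: ('o, (nat \<Rightarrow> 'a \<Rightarrow>\<^sub>0 'f) set, 'f) cstar_cat) F. cstar_category B \<longrightarrow>
        star_functor (free_cat G (inverse_arr G)) B F \<longrightarrow> Nrm B (FOb F x) (FOb F y) (FArr F x y u) \<le> M" by blast
  qed
qed

lemma positive_star_seminorm_gpd: "positive_star_seminorm (gpd_star_cat K G) (max_norm (gpd_star_cat K G))"
  by (rule bounded_star_category.positive_star_seminorm_max_norm[OF bounded_star_category_gpd_star_cat])

lemma cstar_category_Cmax: "cstar_category (Cmax K G)"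
  unfolding Cmax_def by (rule positive_star_seminorm.cstar_category_completion[OF positive_star_seminorm_gpd])

lemma star_functor_to_Cmax:
  "star_functor (free_cat G (inverse_arr G)) (Cmax K G) (to_completion (gpd_star_cat K G) (max_norm (gpd_star_cat K G)))"
  using star_seminorm.star_functor_to_completion
    [OF positive_star_seminorm.axioms(1)[OF positive_star_seminorm_gpd[of K]]]
  unfolding Cmax_def gpd_star_cat_eq .

lemma Ob_Cmax [simp]: "Ob (Cmax K G) = Ob G"
  by (simp add: Cmax_def completion_def gpd_star_cat_def)

lemma FOb_gpd_rho [simp]: "FOb (gpd_rho K G) x = x"
  by (simp add: gpd_rho_def to_completion_def)

lemma gpd_rho_eq: "FArr (gpd_rho K G) x y g
    = FArr (to_completion (gpd_star_cat K G) (max_norm (gpd_star_cat K G))) x y (single g 1)"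
  by (simp add: gpd_rho_def)

lemma unitary_functor_gpd_rho: "unitary_functor G (Cmax K G) (gpd_rho K G)"
proof -
  have "unitary_functor G (free_cat G (inverse_arr G)) \<lparr>FOb = (\<lambda>x. x), FArr = (\<lambda>x y g. single g (1::'f::real_or_complex))\<rparr>"
    using id_closed comp_closed by (auto simp: unitary_functor_def is_functor_def unitary_single)
  from unitary_functor_star_functor[OF category_axioms star_category_free_cat _ this star_functor_to_Cmax]
  show ?thesis using cstar_category_Cmax[of K] unfolding gpd_rho_def cstar_category_def by blast
qed

lemma total_Cmax: "total (Cmax K G) (\<lambda>x y. FArr (gpd_rho K G) x y ` Hom G x y)"
proof -
  interpret P: positive_star_seminorm "gpd_star_cat K G" "max_norm (gpd_star_cat K G)"
    by (rule positive_star_seminorm_gpd)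
  let ?\<iota> = "to_completion (gpd_star_cat K G) (max_norm (gpd_star_cat K G))"
  show ?thesis
    unfolding total_def
  proof (intro ballI conjI allI impI)
    fix x y assume "x \<in> Ob (Cmax K G)" "y \<in> Ob (Cmax K G)"
    then have ob: "x \<in> Ob G" "y \<in> Ob G" by simp_all
    show "FArr (gpd_rho K G) x y ` Hom G x y \<subseteq> Hom (Cmax K G) x y"
      using unitary_functor_gpd_rho[of K] ob by (auto simp: unitary_functor_def is_functor_def)
    fix V assume V: "closed_subspace (Cmax K G) x y V" "FArr (gpd_rho K G) x y ` Hom G x y \<subseteq> V"
    have V': "closed_subspace (Cmax K G) (FOb ?\<iota> x) (FOb ?\<iota> y) V" using V by simp
    have "FArr ?\<iota> x y u \<in> V" if "u \<in> Hom (gpd_star_cat K G) x y" for u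
      by (rule free_total[OF cstar_category_Cmax star_functor_to_Cmax ob V'])
        (use V(2) that in \<open>auto simp: gpd_rho_eq\<close>)
    note V'' = this
    show "Hom (Cmax K G) x y \<subseteq> V"
    proof
      fix X assume X: "X \<in> Hom (Cmax K G) x y"
      show "X \<in> V"
      proof (rule totalD(2)[OF P.total_completion[folded Cmax_def] _ _ V(1) _ X])
        fix h assume "h \<in> FArr ?\<iota> x y ` Hom (gpd_star_cat K G) x y"
        then show "h \<in> V" using V'' by blast
      qed (simp_all add: ob)
    qed
  qed
qed

text \<open>The witness behind the \<open>SOME\<close> is the linear extension of F to formal sums,
  followed by continuous extension to the completion.\<close>

lemma Cmax_extend:
  assumes B: "cstar_category B" and F: "unitary_functor G B F"
  shows "star_functor (Cmax K G) B (Cmax_extend K G B F)"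
    and "fun_eq G (Cmax_extend K G B F \<circ>\<^sub>F gpd_rho K G) F"
proof -
  interpret B: cstar_category B by (rule B)
  interpret P: bounded_star_category "gpd_star_cat K G" by (rule bounded_star_category_gpd_star_cat)
  have Fu: "is_functor G B F" "\<And>x y g. \<lbrakk>x \<in> Ob G; y \<in> Ob G; g \<in> Hom G x y\<rbrakk> \<Longrightarrow> unitary B (FOb F x) (FOb F y) (FArr F x y g)"
    using F by (auto simp: unitary_functor_def)
  \<comment> \<open>F g is unitary, so its star and the image of the inverse arrow are both inverse
    to F g and therefore agree.\<close>
  interpret I: involutive_functor G "inverse_arr G" B F
  proof
    fix x y g assume *: "x \<in> Ob G" "y \<in> Ob G" "g \<in> Hom G x y"
    note i = inverse_arr_props[OF *]
    have "is_inverse B (FOb F x) (FOb F y) (FArr F x y g) (FArr F y x (inverse_arr G x y g))"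
      using Fu(1) * i unfolding is_functor_def is_inverse_def by metis
    moreover have "is_inverse B (FOb F x) (FOb F y) (FArr F x y g) (Str B (FOb F x) (FOb F y) (FArr F x y g))"
      using Fu * by (auto simp: unitary_def is_inverse_def is_functor_def intro: B.hom_closed)
    ultimately show "FArr F y x (inverse_arr G x y g) = Str B (FOb F x) (FOb F y) (FArr F x y g)"
      using Fu(1) * by (intro B.inverse_unique[of "FOb F x" "FOb F y" "FArr F x y g"]) (auto simp: is_functor_def)
  qed (rule Fu)
  interpret S: star_seminorm "gpd_star_cat K G" "max_norm (gpd_star_cat K G)"
    by (rule positive_star_seminorm.axioms(1)[OF positive_star_seminorm_gpd])
  have L: "star_functor (gpd_star_cat K G) B (free_extend B F)"
    unfolding gpd_star_cat_eq by (rule I.star_functor_free_extend)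
  note E = S.completion_extend[OF B L P.Nrm_le_max_norm[OF B L]]
  have "star_functor (Cmax K G) B (completion_extend (gpd_star_cat K G) B (free_extend B F)) \<and>
      fun_eq G (completion_extend (gpd_star_cat K G) B (free_extend B F) \<circ>\<^sub>F gpd_rho K G) F"
  proof
    show "star_functor (Cmax K G) B (completion_extend (gpd_star_cat K G) B (free_extend B F))"
      unfolding Cmax_def by (rule E(1))
    show "fun_eq G (completion_extend (gpd_star_cat K G) B (free_extend B F) \<circ>\<^sub>F gpd_rho K G) F"
      using E(2) unfolding fun_eq_def by (simp add: gpd_rho_eq I.L_single_1)
  qed
  then have "star_functor (Cmax K G) B (Cmax_extend K G B F) \<and> fun_eq G (Cmax_extend K G B F \<circ>\<^sub>F gpd_rho K G) F"
    unfolding Cmax_extend_def by (rule someI[where P = "\<lambda>\<Phi>. star_functor (Cmax K G) B \<Phi> \<and> fun_eq G (\<Phi> \<circ>\<^sub>F gpd_rho K G) F"])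
  then show "star_functor (Cmax K G) B (Cmax_extend K G B F)" "fun_eq G (Cmax_extend K G B F \<circ>\<^sub>F gpd_rho K G) F"
    by auto
qed

end

section \<open>Algebraic tensor products\<close>

lemma prod_cat_simps [simp]:
  "Ob (C \<times>\<^sub>C D) = Ob C \<times> Ob D" "Hom (C \<times>\<^sub>C D) p q = Hom C (fst p) (fst q) \<times> Hom D (snd p) (snd q)"
  "Idt (C \<times>\<^sub>C D) p = (Idt C (fst p), Idt D (snd p))"
  "Cmp (C \<times>\<^sub>C D) p q r g f =
    (Cmp C (fst p) (fst q) (fst r) (fst g) (fst f), Cmp D (snd p) (snd q) (snd r) (snd g) (snd f))"
  by (simp_all add: prod_cat_def case_prod_beta)

lemma category_prod: "\<lbrakk>category C; category D\<rbrakk> \<Longrightarrow> category (C \<times>\<^sub>C D)"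
  unfolding category_def by auto

lemma tensor_rels_intros:
  shows "\<lbrakk>a \<in> Hom A (fst p) (fst q); a' \<in> Hom A (fst p) (fst q); b \<in> Hom B (snd p) (snd q)\<rbrakk> \<Longrightarrow>
      single (Add A (fst p) (fst q) a a', b) 1 - single (a, b) 1 - single (a', b) 1 \<in> tensor_rels A B p q"
    and "\<lbrakk>a \<in> Hom A (fst p) (fst q); b \<in> Hom B (snd p) (snd q); b' \<in> Hom B (snd p) (snd q)\<rbrakk> \<Longrightarrow>
      single (a, Add B (snd p) (snd q) b b') 1 - single (a, b) 1 - single (a, b') 1 \<in> tensor_rels A B p q"
    and "\<lbrakk>a \<in> Hom A (fst p) (fst q); b \<in> Hom B (snd p) (snd q)\<rbrakk> \<Longrightarrow>
      single (Scl A (fst p) (fst q) c a, b) 1 - pm_scale c (single (a, b) 1) \<in> tensor_rels A B p q"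
    and "\<lbrakk>a \<in> Hom A (fst p) (fst q); b \<in> Hom B (snd p) (snd q)\<rbrakk> \<Longrightarrow>
      single (a, Scl B (snd p) (snd q) c b) 1 - pm_scale c (single (a, b) 1) \<in> tensor_rels A B p q"
  unfolding tensor_rels_def Let_def by blast+

lemma tensor_rels_cases [consumes 1, case_names add_left add_right scale_left scale_right]:
  assumes "u \<in> tensor_rels A B p q"
  obtains a a' b where "a \<in> Hom A (fst p) (fst q)" "a' \<in> Hom A (fst p) (fst q)" "b \<in> Hom B (snd p) (snd q)"
      "u = single (Add A (fst p) (fst q) a a', b) 1 - single (a, b) 1 - single (a', b) 1"
  | a b b' where "a \<in> Hom A (fst p) (fst q)" "b \<in> Hom B (snd p) (snd q)" "b' \<in> Hom B (snd p) (snd q)"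
      "u = single (a, Add B (snd p) (snd q) b b') 1 - single (a, b) 1 - single (a, b') 1"
  | c a b where "a \<in> Hom A (fst p) (fst q)" "b \<in> Hom B (snd p) (snd q)"
      "u = single (Scl A (fst p) (fst q) c a, b) 1 - pm_scale c (single (a, b) 1)"
  | c a b where "a \<in> Hom A (fst p) (fst q)" "b \<in> Hom B (snd p) (snd q)"
      "u = single (a, Scl B (snd p) (snd q) c b) 1 - pm_scale c (single (a, b) 1)"
  using assms unfolding tensor_rels_def Let_def by blast

abbreviation tensor_ideal where "tensor_ideal A B p q \<equiv> pm.span (tensor_rels A B p q)"

text \<open>One lemma for the three operations that must respect classes: composition on either
  side, where \<sigma> is the identity and d is the coefficient of the fixed factor, and the
  involution, where \<sigma> is conjugation and d = 1. In each case T turns a bilinearity relation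
  into d times a relation.\<close>

lemma tensor_ideal_map:
  fixes A :: "('o, 'a, 'f::real_or_complex, 'y) star_cat_scheme" and B :: "('p, 'b, 'f, 'z) star_cat_scheme"
  assumes T_add: "\<And>u v. T (u + v) = T u + T v" and T_scale: "\<And>c u. T (pm_scale c u) = pm_scale (\<sigma> c) (T u)"
    and T_single: "\<And>a b. \<lbrakk>a \<in> Hom A (fst p) (fst q); b \<in> Hom B (snd p) (snd q)\<rbrakk>
      \<Longrightarrow> T (single (a, b) 1) = pm_scale d (single (\<alpha> a, \<beta> b) 1)"
    and \<alpha>: "\<And>a. a \<in> Hom A (fst p) (fst q) \<Longrightarrow> \<alpha> a \<in> Hom A (fst p') (fst q')"
      "\<And>a a'. \<lbrakk>a \<in> Hom A (fst p) (fst q); a' \<in> Hom A (fst p) (fst q)\<rbrakk>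
        \<Longrightarrow> \<alpha> (Add A (fst p) (fst q) a a') = Add A (fst p') (fst q') (\<alpha> a) (\<alpha> a')"
      "\<And>c a. a \<in> Hom A (fst p) (fst q) \<Longrightarrow> \<alpha> (Scl A (fst p) (fst q) c a) = Scl A (fst p') (fst q') (\<sigma> c) (\<alpha> a)"
    and \<beta>: "\<And>b. b \<in> Hom B (snd p) (snd q) \<Longrightarrow> \<beta> b \<in> Hom B (snd p') (snd q')"
      "\<And>b b'. \<lbrakk>b \<in> Hom B (snd p) (snd q); b' \<in> Hom B (snd p) (snd q)\<rbrakk>
        \<Longrightarrow> \<beta> (Add B (snd p) (snd q) b b') = Add B (snd p') (snd q') (\<beta> b) (\<beta> b')"
      "\<And>c b. b \<in> Hom B (snd p) (snd q) \<Longrightarrow> \<beta> (Scl B (snd p) (snd q) c b) = Scl B (snd p') (snd q') (\<sigma> c) (\<beta> b)"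
    and closed: "\<And>a a'. \<lbrakk>a \<in> Hom A (fst p) (fst q); a' \<in> Hom A (fst p) (fst q)\<rbrakk> \<Longrightarrow> Add A (fst p) (fst q) a a' \<in> Hom A (fst p) (fst q)"
      "\<And>c a. a \<in> Hom A (fst p) (fst q) \<Longrightarrow> Scl A (fst p) (fst q) c a \<in> Hom A (fst p) (fst q)"
      "\<And>b b'. \<lbrakk>b \<in> Hom B (snd p) (snd q); b' \<in> Hom B (snd p) (snd q)\<rbrakk> \<Longrightarrow> Add B (snd p) (snd q) b b' \<in> Hom B (snd p) (snd q)"
      "\<And>c b. b \<in> Hom B (snd p) (snd q) \<Longrightarrow> Scl B (snd p) (snd q) c b \<in> Hom B (snd p) (snd q)"
    and w: "w \<in> tensor_ideal A B p q"
  shows "T w \<in> tensor_ideal A B p' q'"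
proof -
  have T_diff: "T (u - v) = T u - T v" for u v
    using T_add[of "u - v" v] by simp
  have T_0: "T 0 = 0" using T_diff[of 0 0] by simp
  have sc: "pm_scale d r \<in> tensor_ideal A B p' q'" if "r \<in> tensor_rels A B p' q'" for r
    using that by (intro pm.span_scale pm.span_base)
  have "tensor_rels A B p q \<subseteq> {w. T w \<in> tensor_ideal A B p' q'}"
  proof
    fix u assume "u \<in> tensor_rels A B p q"
    then have "T u \<in> tensor_ideal A B p' q'"
    proof (cases rule: tensor_rels_cases)
      case (add_left a a' b)
      have "T u = pm_scale d (single (Add A (fst p') (fst q') (\<alpha> a) (\<alpha> a'), \<beta> b) 1 - single (\<alpha> a, \<beta> b) 1 - single (\<alpha> a', \<beta> b) 1)"
        using add_left by (simp add: T_diff T_single closed \<alpha> pm.scale_right_diff_distrib)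
      then show ?thesis using sc[OF tensor_rels_intros(1)] add_left \<alpha> \<beta> by simp
    next
      case (add_right a b b')
      have "T u = pm_scale d (single (\<alpha> a, Add B (snd p') (snd q') (\<beta> b) (\<beta> b')) 1 - single (\<alpha> a, \<beta> b) 1 - single (\<alpha> a, \<beta> b') 1)"
        using add_right by (simp add: T_diff T_single closed \<beta> pm.scale_right_diff_distrib)
      then show ?thesis using sc[OF tensor_rels_intros(2)] add_right \<alpha> \<beta> by simp
    next
      case (scale_left c a b)
      have "T u = pm_scale d (single (Scl A (fst p') (fst q') (\<sigma> c) (\<alpha> a), \<beta> b) 1 - pm_scale (\<sigma> c) (single (\<alpha> a, \<beta> b) 1))"
        using scale_left
        by (simp add: T_diff T_scale T_single closed \<alpha> pm.scale_right_diff_distrib mult.commute del: pm_scale_single)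
      then show ?thesis using sc[OF tensor_rels_intros(3)] scale_left \<alpha> \<beta> by simp
    next
      case (scale_right c a b)
      have "T u = pm_scale d (single (\<alpha> a, Scl B (snd p') (snd q') (\<sigma> c) (\<beta> b)) 1 - pm_scale (\<sigma> c) (single (\<alpha> a, \<beta> b) 1))"
        using scale_right
        by (simp add: T_diff T_scale T_single closed \<beta> pm.scale_right_diff_distrib mult.commute del: pm_scale_single)
      then show ?thesis using sc[OF tensor_rels_intros(4)] scale_right \<alpha> \<beta> by simp
    qed
    then show "u \<in> {w. T w \<in> tensor_ideal A B p' q'}" by simp
  qed
  moreover have "pm.subspace {w. T w \<in> tensor_ideal A B p' q'}"
    by (rule pm.subspaceI) (auto simp: T_0 T_add T_scale intro: pm.span_zero pm.span_add pm.span_scale)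
  ultimately have "tensor_ideal A B p q \<subseteq> {w. T w \<in> tensor_ideal A B p' q'}" by (rule pm.span_minimal)
  then show ?thesis using w by auto
qed

definition tensor_star :: "('o, 'a, 'f, 'y) star_cat_scheme \<Rightarrow> ('p, 'b, 'f, 'z) star_cat_scheme
    \<Rightarrow> 'o \<times> 'p \<Rightarrow> 'o \<times> 'p \<Rightarrow> 'a \<times> 'b \<Rightarrow> 'a \<times> 'b" where
  "tensor_star A B p q g = (Str A (fst p) (fst q) (fst g), Str B (snd p) (snd q) (snd g))"

text \<open>It allows \<Phi> to be defined on classes through representatives while all laws are
  checked on the free category above.\<close>

lemma star_functor_factor:
  assumes A: "star_category A" and P: "star_functor A Q P" and Ob: "Ob Q = Ob A" "\<And>x. FOb P x = x"
    and surj: "\<And>x y. \<lbrakk>x \<in> Ob A; y \<in> Ob A\<rbrakk> \<Longrightarrow> Hom Q x y = FArr P x y ` Hom A x y"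
    and L: "star_functor A D L" and eq: "fun_eq A (\<Phi> \<circ>\<^sub>F P) L"
  shows "star_functor Q D \<Phi>"
proof -
  interpret A: star_category A by (rule A)
  have eq': "FOb \<Phi> x = FOb L x" "\<lbrakk>y \<in> Ob A; a \<in> Hom A x y\<rbrakk> \<Longrightarrow> FArr \<Phi> x y (FArr P x y a) = FArr L x y a"
    if "x \<in> Ob A" for x y a
    using fun_eqD[OF eq] that by (auto simp: Ob)
  note PD = star_functorD[OF P, unfolded Ob] and LD = star_functorD[OF L]
  show ?thesis
    unfolding star_functor_def is_functor_def Ob
  proof (intro conjI ballI allI)
    fix x y X assume ob: "x \<in> Ob A" "y \<in> Ob A" and "X \<in> Hom Q x y"
    then obtain a where a: "a \<in> Hom A x y" "X = FArr P x y a" by (auto simp: surj)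
    show "FArr \<Phi> x y X \<in> Hom D (FOb \<Phi> x) (FOb \<Phi> y)" using a ob by (simp add: eq' LD)
    show "FArr \<Phi> x y (Scl Q x y c X) = Scl D (FOb \<Phi> x) (FOb \<Phi> y) c (FArr \<Phi> x y X)" for c
      using a ob by (simp add: eq' LD A.hom_closed flip: PD(4-8))
    show "FArr \<Phi> y x (Str Q x y X) = Str D (FOb \<Phi> x) (FOb \<Phi> y) (FArr \<Phi> x y X)"
      using a ob by (simp add: eq' LD A.hom_closed flip: PD(4-8))
    fix Y assume "Y \<in> Hom Q x y"
    then obtain b where "b \<in> Hom A x y" "Y = FArr P x y b" using ob by (auto simp: surj)
    then show "FArr \<Phi> x y (Add Q x y X Y) = Add D (FOb \<Phi> x) (FOb \<Phi> y) (FArr \<Phi> x y X) (FArr \<Phi> x y Y)"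
      using a ob by (simp add: eq' LD A.hom_closed flip: PD(4-8))
  next
    fix x y z X Y assume ob: "x \<in> Ob A" "y \<in> Ob A" "z \<in> Ob A" and "X \<in> Hom Q x y" "Y \<in> Hom Q y z"
    then obtain a b where "a \<in> Hom A x y" "X = FArr P x y a" "b \<in> Hom A y z" "Y = FArr P y z b" by (auto simp: surj)
    then show "FArr \<Phi> x z (Cmp Q x y z Y X) = Cmp D (FOb \<Phi> x) (FOb \<Phi> y) (FOb \<Phi> z) (FArr \<Phi> y z Y) (FArr \<Phi> x y X)"
      using ob by (simp add: eq' LD A.hom_closed flip: PD(4-8))
  qed (simp_all add: eq' LD A.hom_closed flip: PD(4-8))
qed

text \<open>The structure that a *-functor on a tensor product induces on elementary tensors, and
  from which it can be recovered.\<close>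

definition star_bifunctor :: "('o, 'a, 'f::real_or_complex, 'y) star_cat_scheme \<Rightarrow> ('p, 'b, 'f, 'z) star_cat_scheme
    \<Rightarrow> ('q, 'c, 'f, 'w) star_cat_scheme \<Rightarrow> ('o \<times> 'p, 'a \<times> 'b, 'q, 'c) fnct \<Rightarrow> bool" where
  "star_bifunctor A B D T \<longleftrightarrow> is_functor (A \<times>\<^sub>C B) D T \<and>
     (\<forall>x\<in>Ob A. \<forall>y\<in>Ob B. \<forall>x'\<in>Ob A. \<forall>y'\<in>Ob B. \<forall>a\<in>Hom A x x'. \<forall>b\<in>Hom B y y'.
        (\<forall>a'\<in>Hom A x x'. FArr T (x, y) (x', y') (Add A x x' a a', b) =
          Add D (FOb T (x, y)) (FOb T (x', y')) (FArr T (x, y) (x', y') (a, b)) (FArr T (x, y) (x', y') (a', b))) \<and>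
        (\<forall>b'\<in>Hom B y y'. FArr T (x, y) (x', y') (a, Add B y y' b b') =
          Add D (FOb T (x, y)) (FOb T (x', y')) (FArr T (x, y) (x', y') (a, b)) (FArr T (x, y) (x', y') (a, b'))) \<and>
        (\<forall>c. FArr T (x, y) (x', y') (Scl A x x' c a, b) =
          Scl D (FOb T (x, y)) (FOb T (x', y')) c (FArr T (x, y) (x', y') (a, b))) \<and>
        (\<forall>c. FArr T (x, y) (x', y') (a, Scl B y y' c b) =
          Scl D (FOb T (x, y)) (FOb T (x', y')) c (FArr T (x, y) (x', y') (a, b))) \<and>
        FArr T (x', y') (x, y) (Str A x x' a, Str B y y' b) =
          Str D (FOb T (x, y)) (FOb T (x', y')) (FArr T (x, y) (x', y') (a, b)))"

lemma star_bifunctorD: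
  assumes "star_bifunctor A B D T"
  shows "is_functor (A \<times>\<^sub>C B) D T"
    and "\<lbrakk>x \<in> Ob A; y \<in> Ob B\<rbrakk> \<Longrightarrow> FOb T (x, y) \<in> Ob D"
    and "\<lbrakk>x \<in> Ob A; y \<in> Ob B; x' \<in> Ob A; y' \<in> Ob B; a \<in> Hom A x x'; b \<in> Hom B y y'\<rbrakk>
      \<Longrightarrow> FArr T (x, y) (x', y') (a, b) \<in> Hom D (FOb T (x, y)) (FOb T (x', y'))"
    and "\<lbrakk>x \<in> Ob A; y \<in> Ob B\<rbrakk> \<Longrightarrow> FArr T (x, y) (x, y) (Idt A x, Idt B y) = Idt D (FOb T (x, y))"
    and "\<lbrakk>x \<in> Ob A; y \<in> Ob B; x' \<in> Ob A; y' \<in> Ob B; x'' \<in> Ob A; y'' \<in> Ob B;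
        a \<in> Hom A x x'; b \<in> Hom B y y'; a' \<in> Hom A x' x''; b' \<in> Hom B y' y''\<rbrakk>
      \<Longrightarrow> FArr T (x, y) (x'', y'') (Cmp A x x' x'' a' a, Cmp B y y' y'' b' b) =
        Cmp D (FOb T (x, y)) (FOb T (x', y')) (FOb T (x'', y'')) (FArr T (x', y') (x'', y'') (a', b'))
          (FArr T (x, y) (x', y') (a, b))"
    and "\<lbrakk>x \<in> Ob A; y \<in> Ob B; x' \<in> Ob A; y' \<in> Ob B; a \<in> Hom A x x'; b \<in> Hom B y y'; a' \<in> Hom A x x'\<rbrakk>
      \<Longrightarrow> FArr T (x, y) (x', y') (Add A x x' a a', b) =
          Add D (FOb T (x, y)) (FOb T (x', y')) (FArr T (x, y) (x', y') (a, b)) (FArr T (x, y) (x', y') (a', b))"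
    and "\<lbrakk>x \<in> Ob A; y \<in> Ob B; x' \<in> Ob A; y' \<in> Ob B; a \<in> Hom A x x'; b \<in> Hom B y y'; b' \<in> Hom B y y'\<rbrakk>
      \<Longrightarrow> FArr T (x, y) (x', y') (a, Add B y y' b b') =
          Add D (FOb T (x, y)) (FOb T (x', y')) (FArr T (x, y) (x', y') (a, b)) (FArr T (x, y) (x', y') (a, b'))"
    and "\<lbrakk>x \<in> Ob A; y \<in> Ob B; x' \<in> Ob A; y' \<in> Ob B; a \<in> Hom A x x'; b \<in> Hom B y y'\<rbrakk>
      \<Longrightarrow> FArr T (x, y) (x', y') (Scl A x x' c a, b) =
          Scl D (FOb T (x, y)) (FOb T (x', y')) c (FArr T (x, y) (x', y') (a, b))"
    and "\<lbrakk>x \<in> Ob A; y \<in> Ob B; x' \<in> Ob A; y' \<in> Ob B; a \<in> Hom A x x'; b \<in> Hom B y y'\<rbrakk>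
      \<Longrightarrow> FArr T (x, y) (x', y') (a, Scl B y y' c b) =
          Scl D (FOb T (x, y)) (FOb T (x', y')) c (FArr T (x, y) (x', y') (a, b))"
    and "\<lbrakk>x \<in> Ob A; y \<in> Ob B; x' \<in> Ob A; y' \<in> Ob B; a \<in> Hom A x x'; b \<in> Hom B y y'\<rbrakk>
      \<Longrightarrow> FArr T (x', y') (x, y) (Str A x x' a, Str B y y' b) =
          Str D (FOb T (x, y)) (FOb T (x', y')) (FArr T (x, y) (x', y') (a, b))"
proof -
  show F: "is_functor (A \<times>\<^sub>C B) D T" using assms by (simp add: star_bifunctor_def)
  show "\<lbrakk>x \<in> Ob A; y \<in> Ob B\<rbrakk> \<Longrightarrow> FOb T (x, y) \<in> Ob D"
    "\<lbrakk>x \<in> Ob A; y \<in> Ob B; x' \<in> Ob A; y' \<in> Ob B; a \<in> Hom A x x'; b \<in> Hom B y y'\<rbrakk>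
      \<Longrightarrow> FArr T (x, y) (x', y') (a, b) \<in> Hom D (FOb T (x, y)) (FOb T (x', y'))"
    "\<lbrakk>x \<in> Ob A; y \<in> Ob B\<rbrakk> \<Longrightarrow> FArr T (x, y) (x, y) (Idt A x, Idt B y) = Idt D (FOb T (x, y))"
    using F unfolding is_functor_def by force+
  show "\<lbrakk>x \<in> Ob A; y \<in> Ob B; x' \<in> Ob A; y' \<in> Ob B; x'' \<in> Ob A; y'' \<in> Ob B;
        a \<in> Hom A x x'; b \<in> Hom B y y'; a' \<in> Hom A x' x''; b' \<in> Hom B y' y''\<rbrakk>
      \<Longrightarrow> FArr T (x, y) (x'', y'') (Cmp A x x' x'' a' a, Cmp B y y' y'' b' b) =
        Cmp D (FOb T (x, y)) (FOb T (x', y')) (FOb T (x'', y'')) (FArr T (x', y') (x'', y'') (a', b'))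
          (FArr T (x, y) (x', y') (a, b))"
    using F[unfolded is_functor_def, THEN conjunct2, THEN conjunct2, THEN conjunct2,
        rule_format, of "(x, y)" "(x', y')" "(x'', y'')" "(a, b)" "(a', b')"] by simp
qed (use assms in \<open>simp_all add: star_bifunctor_def\<close>)

section \<open>The algebraic tensor product as a quotient of a free *-category\<close>

locale star_tensor = A: star_category A + B: star_category B
  for A :: "('o, 'a, 'f::real_or_complex, 'y) star_cat_scheme" and B :: "('p, 'b, 'f, 'z) star_cat_scheme"
begin

sublocale involutive_category "A \<times>\<^sub>C B" "tensor_star A B"
proof -
  interpret category "A \<times>\<^sub>C B" by (intro category_prod A.category_axioms B.category_axioms)
  show "involutive_category (A \<times>\<^sub>C B) (tensor_star A B)"
    by unfold_locales (auto simp: tensor_star_def A.star_closed B.star_closed A.star_comp B.star_comp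
        A.star_star B.star_star)
qed

abbreviation FT :: "('o \<times> 'p, 'a \<times> 'b \<Rightarrow>\<^sub>0 'f, 'f) star_cat" where "FT \<equiv> free_cat (A \<times>\<^sub>C B) (tensor_star A B)"
abbreviation cls where "cls \<equiv> tensor_class A B"
abbreviation I where "I \<equiv> tensor_ideal A B"

lemma cls_eq_iff: "cls p q u = cls p q v \<longleftrightarrow> u - v \<in> I p q"
proof
  have "u \<in> cls p q u" by (simp add: tensor_class_def pm.span_zero)
  then show "cls p q u = cls p q v \<Longrightarrow> u - v \<in> I p q" by (simp add: tensor_class_def)
  assume uv: "u - v \<in> I p q"
  have "w - u \<in> I p q \<longleftrightarrow> w - v \<in> I p q" for w
    using pm.span_add[OF _ uv, of "w - u"] pm.span_diff[OF _ uv, of "w - v"] by auto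
  then show "cls p q u = cls p q v" by (simp add: tensor_class_def)
qed

lemma rep_cls: "rep (cls p q u) - u \<in> I p q"
proof -
  have "u \<in> cls p q u" by (simp add: tensor_class_def pm.span_zero)
  then have "rep (cls p q u) \<in> cls p q u" unfolding rep_def by (rule someI[where P = "\<lambda>w. w \<in> cls p q u"])
  then show ?thesis by (simp add: tensor_class_def)
qed

lemma keys_diff_subset: "\<lbrakk>keys u \<subseteq> S; keys v \<subseteq> S\<rbrakk> \<Longrightarrow> keys (u - v :: _ \<Rightarrow>\<^sub>0 'f) \<subseteq> S"
  by (auto simp: in_keys_iff lookup_minus subset_iff) (metis diff_self)

lemma subspace_keys: "pm.subspace {w :: _ \<Rightarrow>\<^sub>0 'f. keys w \<subseteq> S}"
proof (rule pm.subspaceI, unfold mem_Collect_eq)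
  fix u :: "_ \<Rightarrow>\<^sub>0 'f" and c assume "keys u \<subseteq> S"
  then show "keys (pm_scale c u) \<subseteq> S" by (rule subset_trans[OF keys_pm_scale])
qed (simp, rule keys_add_subset)

text \<open>A representative chosen by \<open>rep\<close> differs from the given formal sum by an
  element of the ideal; this lemma keeps its keys inside the Hom sets.\<close>

lemma I_keys:
  assumes p: "p \<in> Ob A \<times> Ob B" "q \<in> Ob A \<times> Ob B" and w: "w \<in> I p q"
  shows "keys w \<subseteq> Hom (A \<times>\<^sub>C B) p q"
proof -
  note subspace_keys
  moreover have "tensor_rels A B p q \<subseteq> {w. keys w \<subseteq> Hom (A \<times>\<^sub>C B) p q}"
  proof
    fix u assume "u \<in> tensor_rels A B p q"
    then have "keys u \<subseteq> Hom (A \<times>\<^sub>C B) p q"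
      by (cases rule: tensor_rels_cases)
        (use p in \<open>hypsubst, intro keys_diff_subset; auto simp: A.hom_closed B.hom_closed split: if_splits\<close>)+
    then show "u \<in> {w. keys w \<subseteq> Hom (A \<times>\<^sub>C B) p q}" by simp
  qed
  ultimately have "I p q \<subseteq> {w. keys w \<subseteq> Hom (A \<times>\<^sub>C B) p q}" by (intro pm.span_minimal) auto
  then show ?thesis using w by auto
qed

lemma I_comp_right:
  assumes p: "p \<in> Ob A \<times> Ob B" "q \<in> Ob A \<times> Ob B" "r \<in> Ob A \<times> Ob B"
    and u: "keys u \<subseteq> Hom (A \<times>\<^sub>C B) p q" and w: "w \<in> I q r"
  shows "Cmp FT p q r w u \<in> I p r"
  using u
proof (induction u rule: pm_induct)
  case (single g c)
  show ?case
    by (rule tensor_ideal_map[where T = "\<lambda>w. Cmp FT p q r w (single g c)" and \<sigma> = "\<lambda>c. c" and d = c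
          and \<alpha> = "\<lambda>a. Cmp A (fst p) (fst q) (fst r) a (fst g)" and \<beta> = "\<lambda>b. Cmp B (snd p) (snd q) (snd r) b (snd g)",
          OF free_cat_Cmp_add_left free_cat_Cmp_scale_left _ _ _ _ _ _ _ _ _ _ _ w])
      (use p single in \<open>auto simp: A.hom_closed B.hom_closed A.comp_add_left A.comp_scl_left B.comp_add_left B.comp_scl_left\<close>)
qed (auto simp: free_cat_Cmp_add_right intro: pm.span_add pm.span_zero)

lemma I_comp_left:
  assumes p: "p \<in> Ob A \<times> Ob B" "q \<in> Ob A \<times> Ob B" "r \<in> Ob A \<times> Ob B"
    and u: "keys u \<subseteq> Hom (A \<times>\<^sub>C B) q r" and w: "w \<in> I p q"
  shows "Cmp FT p q r u w \<in> I p r"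
  using u
proof (induction u rule: pm_induct)
  case (single g c)
  show ?case
    by (rule tensor_ideal_map[where T = "\<lambda>w. Cmp FT p q r (single g c) w" and \<sigma> = "\<lambda>c. c" and d = c
          and \<alpha> = "\<lambda>a. Cmp A (fst p) (fst q) (fst r) (fst g) a" and \<beta> = "\<lambda>b. Cmp B (snd p) (snd q) (snd r) (snd g) b",
          OF free_cat_Cmp_add_right free_cat_Cmp_scale_right _ _ _ _ _ _ _ _ _ _ _ w])
      (use p single in \<open>auto simp: A.hom_closed B.hom_closed A.comp_add_right A.comp_scl_right B.comp_add_right B.comp_scl_right\<close>)
qed (auto simp: free_cat_Cmp_add_left intro: pm.span_add pm.span_zero)

lemma I_star:
  assumes p: "p \<in> Ob A \<times> Ob B" "q \<in> Ob A \<times> Ob B" and w: "w \<in> I p q"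
  shows "Str FT p q w \<in> I q p"
  by (rule tensor_ideal_map[where T = "Str FT p q" and \<sigma> = conjg and d = 1
        and \<alpha> = "Str A (fst p) (fst q)" and \<beta> = "Str B (snd p) (snd q)",
        OF free_cat_Str_add free_cat_Str_scale _ _ _ _ _ _ _ _ _ _ _ w])
    (use p in \<open>auto simp: tensor_star_def A.hom_closed B.hom_closed A.star_add A.star_scl B.star_add B.star_scl\<close>)

definition proj :: "('o \<times> 'p, 'a \<times> 'b \<Rightarrow>\<^sub>0 'f, 'o \<times> 'p, ('a \<times> 'b \<Rightarrow>\<^sub>0 'f) set) fnct" where
  "proj = \<lparr>FOb = (\<lambda>x. x), FArr = cls\<rparr>"

lemma Ob_alg_tensor [simp]: "Ob (alg_tensor A B) = Ob A \<times> Ob B"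
  and Hom_alg_tensor: "Hom (alg_tensor A B) p q = cls p q ` {u. keys u \<subseteq> Hom (A \<times>\<^sub>C B) p q}"
  by (simp_all add: alg_tensor_def)

lemma alg_tensor_Idt: "Idt (alg_tensor A B) p = cls p p (single (Idt A (fst p), Idt B (snd p)) 1)"
  by (simp add: alg_tensor_def)

lemma alg_tensor_Cmp:
  assumes p: "p \<in> Ob A \<times> Ob B" "q \<in> Ob A \<times> Ob B" "r \<in> Ob A \<times> Ob B"
    and u: "keys u \<subseteq> Hom (A \<times>\<^sub>C B) p q" and v: "keys v \<subseteq> Hom (A \<times>\<^sub>C B) q r"
  shows "Cmp (alg_tensor A B) p q r (cls q r v) (cls p q u) = cls p r (Cmp FT p q r v u)"
proof -
  define v' where "v' = rep (cls q r v)"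
  define u' where "u' = rep (cls p q u)"
  have uv': "v' - v \<in> I q r" "u' - u \<in> I p q" by (auto simp: u'_def v'_def rep_cls)
  have ku: "keys u' \<subseteq> Hom (A \<times>\<^sub>C B) p q"
    using keys_add_subset[OF I_keys[OF p(1,2) uv'(2)] u] by simp
  have "Cmp (alg_tensor A B) p q r (cls q r v) (cls p q u) = cls p r (Cmp FT p q r v' u')"
    unfolding alg_tensor_def free_cat_def v'_def u'_def by (simp add: lext_def case_prod_beta)
  also have "\<dots> = cls p r (Cmp FT p q r v u)"
  proof -
    have "Cmp FT p q r ((v' - v) + v) u' - Cmp FT p q r v u = Cmp FT p q r (v' - v) u' + (Cmp FT p q r v ((u' - u) + u) - Cmp FT p q r v u)"
      by (subst free_cat_Cmp_add_left) simp
    also have "\<dots> = Cmp FT p q r (v' - v) u' + Cmp FT p q r v (u' - u)"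
      by (subst free_cat_Cmp_add_right) simp
    also have "\<dots> \<in> I p r" using I_comp_right[OF p ku uv'(1)] I_comp_left[OF p v uv'(2)] by (rule pm.span_add)
    finally show ?thesis by (simp add: cls_eq_iff)
  qed
  finally show ?thesis .
qed

lemma alg_tensor_Add: "Add (alg_tensor A B) p q (cls p q u) (cls p q v) = cls p q (u + v)"
proof -
  have "(rep (cls p q u) - u) + (rep (cls p q v) - v) \<in> I p q" by (intro pm.span_add rep_cls)
  then show ?thesis by (simp add: alg_tensor_def cls_eq_iff algebra_simps)
qed

lemma alg_tensor_Scl: "Scl (alg_tensor A B) p q c (cls p q u) = cls p q (pm_scale c u)"
  using pm.span_scale[OF rep_cls[of p q u], of c] by (simp add: alg_tensor_def cls_eq_iff pm.scale_right_diff_distrib)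

lemma alg_tensor_Str:
  assumes p: "p \<in> Ob A \<times> Ob B" "q \<in> Ob A \<times> Ob B"
  shows "Str (alg_tensor A B) p q (cls p q u) = cls q p (Str FT p q u)"
proof -
  have "Str FT p q (rep (cls p q u)) = Str FT p q (rep (cls p q u) - u) + Str FT p q u"
    by (simp flip: free_cat_Str_add)
  then have "Str FT p q (rep (cls p q u)) - Str FT p q u \<in> I q p" using I_star[OF p rep_cls[of p q u]] by simp
  then show ?thesis
    unfolding alg_tensor_def free_cat_def by (simp add: cls_eq_iff lext_def case_prod_beta tensor_star_def)
qed

lemma alg_tensor_props:
  shows "star_category (alg_tensor A B)" and "star_functor FT (alg_tensor A B) proj"
  unfolding proj_def
  by (rule star_category_image[OF star_category_free_cat, where \<pi> = cls];
      simp add: Hom_alg_tensor alg_tensor_Cmp alg_tensor_Add alg_tensor_Scl alg_tensor_Str;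
      (simp add: alg_tensor_def free_cat_def)?)+

definition elem :: "('o \<times> 'p, 'a \<times> 'b, 'o \<times> 'p, ('a \<times> 'b \<Rightarrow>\<^sub>0 'f) set) fnct" where
  "elem = \<lparr>FOb = (\<lambda>p. p), FArr = (\<lambda>p q ab. cls p q (single ab 1))\<rparr>"

lemma star_bifunctor_elem: "star_bifunctor A B (alg_tensor A B) elem"
  unfolding star_bifunctor_def
proof (intro conjI ballI allI)
  show "is_functor (A \<times>\<^sub>C B) (alg_tensor A B) elem"
    unfolding is_functor_def elem_def
    by (auto simp: Hom_alg_tensor alg_tensor_Cmp alg_tensor_Idt A.hom_closed B.hom_closed)
  fix x y x' y' a b assume ob: "x \<in> Ob A" "y \<in> Ob B" "x' \<in> Ob A" "y' \<in> Ob B" and ab: "a \<in> Hom A x x'" "b \<in> Hom B y y'"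
  show "FArr elem (x, y) (x', y') (Scl A x x' c a, b) =
          Scl (alg_tensor A B) (FOb elem (x, y)) (FOb elem (x', y')) c (FArr elem (x, y) (x', y') (a, b))" for c
    using tensor_rels_intros(3)[of a A "(x, y)" "(x', y')" b B c] ab
    by (simp add: elem_def alg_tensor_Scl cls_eq_iff pm.span_base)
  show "FArr elem (x, y) (x', y') (a, Scl B y y' c b) =
          Scl (alg_tensor A B) (FOb elem (x, y)) (FOb elem (x', y')) c (FArr elem (x, y) (x', y') (a, b))" for c
    using tensor_rels_intros(4)[of a A "(x, y)" "(x', y')" b B c] ab
    by (simp add: elem_def alg_tensor_Scl cls_eq_iff pm.span_base)
  show "FArr elem (x', y') (x, y) (Str A x x' a, Str B y y' b) =
          Str (alg_tensor A B) (FOb elem (x, y)) (FOb elem (x', y')) (FArr elem (x, y) (x', y') (a, b))"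
    using ob by (simp add: elem_def alg_tensor_Str tensor_star_def)
  show "FArr elem (x, y) (x', y') (Add A x x' a a', b) =
          Add (alg_tensor A B) (FOb elem (x, y)) (FOb elem (x', y')) (FArr elem (x, y) (x', y') (a, b)) (FArr elem (x, y) (x', y') (a', b))"
    if "a' \<in> Hom A x x'" for a'
    using tensor_rels_intros(1)[of a A "(x, y)" "(x', y')" a' b B] ab that
    by (simp add: elem_def alg_tensor_Add cls_eq_iff pm.span_base diff_diff_eq)
  show "FArr elem (x, y) (x', y') (a, Add B y y' b b') =
          Add (alg_tensor A B) (FOb elem (x, y)) (FOb elem (x', y')) (FArr elem (x, y) (x', y') (a, b)) (FArr elem (x, y) (x', y') (a, b'))"
    if "b' \<in> Hom B y y'" for b'
    using tensor_rels_intros(2)[of a A "(x, y)" "(x', y')" b B b'] ab that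
    by (simp add: elem_def alg_tensor_Add cls_eq_iff pm.span_base diff_diff_eq)
qed

text \<open>The linear extension of T vanishes on the bilinearity relations, hence on the ideal they
  span, and so takes the same value on all representatives of a class.\<close>

lemma ex_star_functor_alg_tensor:
  assumes D: "star_category D" and T: "star_bifunctor A B D T"
  shows "\<exists>\<Phi>. star_functor (alg_tensor A B) D \<Phi> \<and> fun_eq (A \<times>\<^sub>C B) (\<Phi> \<circ>\<^sub>F elem) T"
proof -
  interpret D: star_category D by (rule D)
  note TD = star_bifunctorD[OF T]
  interpret F: involutive_functor "A \<times>\<^sub>C B" "tensor_star A B" D T
    by unfold_locales (auto simp: TD tensor_star_def)
  let ?L = "FArr (free_extend D T)"
  have diff: "?L p q (u - v) = Sub D (FOb T p) (FOb T q) (?L p q u) (?L p q v)"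
    if "p \<in> Ob A \<times> Ob B" "q \<in> Ob A \<times> Ob B" "keys u \<subseteq> Hom (A \<times>\<^sub>C B) p q" "keys v \<subseteq> Hom (A \<times>\<^sub>C B) p q" for p q u v
  proof -
    have "u - v = u + pm_scale (- 1) v" by (simp add: pm.scale_minus_left)
    moreover have "keys (pm_scale (- 1) v) \<subseteq> Hom (A \<times>\<^sub>C B) p q" using that(4) keys_pm_scale[of "- 1" v] by (rule subset_trans[rotated])
    ultimately show ?thesis using that F.L_add[of p q u "pm_scale (- 1) v"] F.L_scale[of p q v "- 1"]
      by (simp add: Sub_def)
  qed
  have I0: "?L p q w = Zer D (FOb T p) (FOb T q)" if p: "p \<in> Ob A \<times> Ob B" "q \<in> Ob A \<times> Ob B" and w: "w \<in> I p q" for p q w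
  proof -
    obtain x y x' y' where pq: "p = (x, y)" "q = (x', y')" by (cases p, cases q)
    have ob: "x \<in> Ob A" "y \<in> Ob B" "x' \<in> Ob A" "y' \<in> Ob B" using p pq by auto
    let ?H = "Hom (A \<times>\<^sub>C B) p q" and ?Z = "Zer D (FOb T p) (FOb T q)"
    have obD: "FOb T p \<in> Ob D" "FOb T q \<in> Ob D" using TD(2) ob pq by auto
    \<comment> \<open>The condition on keys is carried along because additivity of \<open>?L\<close>
      holds only for formal sums supported in the Hom set.\<close>
    have "pm.subspace {w. keys w \<subseteq> ?H \<and> ?L p q w = ?Z}"
    proof (rule pm.subspaceI)
      fix u v c assume u: "u \<in> {w. keys w \<subseteq> ?H \<and> ?L p q w = ?Z}"
      have "keys (pm_scale c u) \<subseteq> ?H" using u keys_pm_scale[of c u] by auto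
      then show "pm_scale c u \<in> {w. keys w \<subseteq> ?H \<and> ?L p q w = ?Z}"
        using u F.L_scale[of p q u c] p by (simp add: D.hom_scl_zero obD)
      assume v: "v \<in> {w. keys w \<subseteq> ?H \<and> ?L p q w = ?Z}"
      have "keys (u + v) \<subseteq> ?H" using u v keys_add_subset by blast
      then show "u + v \<in> {w. keys w \<subseteq> ?H \<and> ?L p q w = ?Z}"
        using u v F.L_add[of p q u v] p by (simp add: D.hom_add_zero D.hom_closed obD)
    qed (use p F.L_zero in auto)
    moreover have "tensor_rels A B p q \<subseteq> {w. keys w \<subseteq> ?H \<and> ?L p q w = ?Z}"
    proof
      fix u assume u: "u \<in> tensor_rels A B p q"
      have k: "keys u \<subseteq> ?H" using I_keys[OF p] pm.span_base[OF u] by blast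
      have s1: "?L p q (single (a, b) 1) = FArr T (x, y) (x', y') (a, b)"
        "keys (single (a, b) (1::'f)) \<subseteq> ?H"
        if "a \<in> Hom A x x'" "b \<in> Hom B y y'" for a b
        using F.L_single_1[of p q "(a, b)"] that ob pq by auto
      have kd: "keys (r - s) \<subseteq> ?H" if "keys r \<subseteq> ?H" "keys s \<subseteq> ?H" for r s :: "'a \<times> 'b \<Rightarrow>\<^sub>0 'f"
        using that by (rule keys_diff_subset)
      \<comment> \<open>The value of a formal additivity relation under \<open>?L\<close>: (s + t) -
        s - t, bracketed as in \<open>tensor_rels\<close>.\<close>
      have add3: "Sub D (FOb T p) (FOb T q) (Sub D (FOb T p) (FOb T q) (Add D (FOb T p) (FOb T q) s t) s) t = ?Z"
        if "s \<in> Hom D (FOb T p) (FOb T q)" "t \<in> Hom D (FOb T p) (FOb T q)" for s t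
      proof -
        have "Sub D (FOb T p) (FOb T q) (Add D (FOb T p) (FOb T q) s t) (Add D (FOb T p) (FOb T q) s ?Z) = t"
          using that obD by (simp add: D.hom_sub_add D.hom_closed D.hom_sub_self) (simp add: Sub_def D.hom_scl_zero D.hom_add_zero D.hom_zero_add)
        then show ?thesis using that obD by (simp add: D.hom_add_zero D.hom_sub_self)
      qed
      from u have "?L p q u = ?Z"
      proof (cases rule: tensor_rels_cases)
        case (add_left a a' b)
        then show ?thesis
          using ob obD s1 kd TD(3,6) A.hom_add_closed[of x x' a a'] p
          by (simp add: pq diff[of "(x, y)" "(x', y')"] add3[unfolded pq] del: prod_cat_simps(2))
      next
        case (add_right a b b')
        then show ?thesis
          using ob obD s1 kd TD(3,7) B.hom_add_closed[of y y' b b'] p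
          by (simp add: pq diff[of "(x, y)" "(x', y')"] add3[unfolded pq] del: prod_cat_simps(2))
      next
        case (scale_left c a b)
        then show ?thesis
          using ob obD s1 kd TD(3,8) A.hom_scl_closed[of x x' a c] p F.L_scale[of p q "single (a, b) 1" c]
            keys_pm_scale[of c "single (a, b) 1"]
          by (simp add: pq diff[of "(x, y)" "(x', y')"] D.hom_sub_self D.hom_closed del: prod_cat_simps(2))
      next
        case (scale_right c a b)
        then show ?thesis
          using ob obD s1 kd TD(3,9) B.hom_scl_closed[of y y' b c] p F.L_scale[of p q "single (a, b) 1" c]
            keys_pm_scale[of c "single (a, b) 1"]
          by (simp add: pq diff[of "(x, y)" "(x', y')"] D.hom_sub_self D.hom_closed del: prod_cat_simps(2))
      qed
      then show "u \<in> {w. keys w \<subseteq> ?H \<and> ?L p q w = ?Z}" using k by simp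
    qed
    ultimately have "I p q \<subseteq> {w. keys w \<subseteq> ?H \<and> ?L p q w = ?Z}" by (intro pm.span_minimal)
    then show ?thesis using w by auto
  qed
  define \<Phi> where "\<Phi> = \<lparr>FOb = FOb T, FArr = (\<lambda>p q U. ?L p q (rep U))\<rparr>"
  have \<Phi>: "FArr \<Phi> p q (cls p q u) = ?L p q u"
    if p: "p \<in> Ob A \<times> Ob B" "q \<in> Ob A \<times> Ob B" and u: "keys u \<subseteq> Hom (A \<times>\<^sub>C B) p q" for p q u
  proof -
    have r: "rep (cls p q u) - u \<in> I p q" by (rule rep_cls)
    have "?L p q ((rep (cls p q u) - u) + u) = Add D (FOb T p) (FOb T q) (?L p q (rep (cls p q u) - u)) (?L p q u)"
      using p u I_keys[OF p r] by (intro F.L_add) auto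
    also have "\<dots> = ?L p q u"
      using p u I0[OF p r] F.L_closed[of p q u] F.FD(1)[of p] F.FD(1)[of q] by (simp add: D.hom_zero_add)
    finally show ?thesis by (simp add: \<Phi>_def)
  qed
  have "star_functor (alg_tensor A B) D \<Phi>"
  proof (rule star_functor_factor[OF star_category_free_cat alg_tensor_props(2) _ _ _ F.star_functor_free_extend])
    show "fun_eq FT (\<Phi> \<circ>\<^sub>F proj) (free_extend D T)"
      unfolding fun_eq_def by (auto simp: proj_def \<Phi> ) (auto simp: \<Phi>_def)
  qed (auto simp: proj_def Hom_alg_tensor)
  moreover have "fun_eq (A \<times>\<^sub>C B) (\<Phi> \<circ>\<^sub>F elem) T"
    unfolding fun_eq_def by (auto simp: elem_def \<Phi> F.L_single_1) (auto simp: \<Phi>_def)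
  ultimately show ?thesis by blast
qed

end

section \<open>Bifunctors and maximal tensor products\<close>

lemma prod_fun_simps [simp]:
  "FOb (F \<times>\<^sub>F G) (x, y) = (FOb F x, FOb G y)"
  "FArr (F \<times>\<^sub>F G) (x, y) (x', y') (a, b) = (FArr F x x' a, FArr G y y' b)"
  by (simp_all add: prod_fun_def)

lemma prod_swap_simps [simp]:
  "FOb prod_swap (x, y) = (y, x)" "FArr prod_swap p q (a, b) = (b, a)"
  by (simp_all add: prod_swap_def)

lemma star_bifunctorI:
  assumes "\<And>x y. \<lbrakk>x \<in> Ob A; y \<in> Ob B\<rbrakk> \<Longrightarrow> FOb T (x, y) \<in> Ob D"
    and "\<And>x y x' y' a b. \<lbrakk>x \<in> Ob A; y \<in> Ob B; x' \<in> Ob A; y' \<in> Ob B; a \<in> Hom A x x'; b \<in> Hom B y y'\<rbrakk>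
      \<Longrightarrow> FArr T (x, y) (x', y') (a, b) \<in> Hom D (FOb T (x, y)) (FOb T (x', y'))"
    and "\<And>x y. \<lbrakk>x \<in> Ob A; y \<in> Ob B\<rbrakk> \<Longrightarrow> FArr T (x, y) (x, y) (Idt A x, Idt B y) = Idt D (FOb T (x, y))"
    and "\<And>x y x' y' x'' y'' a b a' b'. \<lbrakk>x \<in> Ob A; y \<in> Ob B; x' \<in> Ob A; y' \<in> Ob B; x'' \<in> Ob A; y'' \<in> Ob B;
        a \<in> Hom A x x'; b \<in> Hom B y y'; a' \<in> Hom A x' x''; b' \<in> Hom B y' y''\<rbrakk>
      \<Longrightarrow> FArr T (x, y) (x'', y'') (Cmp A x x' x'' a' a, Cmp B y y' y'' b' b) =
        Cmp D (FOb T (x, y)) (FOb T (x', y')) (FOb T (x'', y'')) (FArr T (x', y') (x'', y'') (a', b'))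
          (FArr T (x, y) (x', y') (a, b))"
    and "\<And>x y x' y' a b a'. \<lbrakk>x \<in> Ob A; y \<in> Ob B; x' \<in> Ob A; y' \<in> Ob B; a \<in> Hom A x x'; b \<in> Hom B y y'; a' \<in> Hom A x x'\<rbrakk>
      \<Longrightarrow> FArr T (x, y) (x', y') (Add A x x' a a', b) =
          Add D (FOb T (x, y)) (FOb T (x', y')) (FArr T (x, y) (x', y') (a, b)) (FArr T (x, y) (x', y') (a', b))"
    and "\<And>x y x' y' a b b'. \<lbrakk>x \<in> Ob A; y \<in> Ob B; x' \<in> Ob A; y' \<in> Ob B; a \<in> Hom A x x'; b \<in> Hom B y y'; b' \<in> Hom B y y'\<rbrakk>
      \<Longrightarrow> FArr T (x, y) (x', y') (a, Add B y y' b b') =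
          Add D (FOb T (x, y)) (FOb T (x', y')) (FArr T (x, y) (x', y') (a, b)) (FArr T (x, y) (x', y') (a, b'))"
    and "\<And>x y x' y' a b c. \<lbrakk>x \<in> Ob A; y \<in> Ob B; x' \<in> Ob A; y' \<in> Ob B; a \<in> Hom A x x'; b \<in> Hom B y y'\<rbrakk>
      \<Longrightarrow> FArr T (x, y) (x', y') (Scl A x x' c a, b) =
          Scl D (FOb T (x, y)) (FOb T (x', y')) c (FArr T (x, y) (x', y') (a, b))"
    and "\<And>x y x' y' a b c. \<lbrakk>x \<in> Ob A; y \<in> Ob B; x' \<in> Ob A; y' \<in> Ob B; a \<in> Hom A x x'; b \<in> Hom B y y'\<rbrakk>
      \<Longrightarrow> FArr T (x, y) (x', y') (a, Scl B y y' c b) =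
          Scl D (FOb T (x, y)) (FOb T (x', y')) c (FArr T (x, y) (x', y') (a, b))"
    and "\<And>x y x' y' a b. \<lbrakk>x \<in> Ob A; y \<in> Ob B; x' \<in> Ob A; y' \<in> Ob B; a \<in> Hom A x x'; b \<in> Hom B y y'\<rbrakk>
      \<Longrightarrow> FArr T (x', y') (x, y) (Str A x x' a, Str B y y' b) =
          Str D (FOb T (x, y)) (FOb T (x', y')) (FArr T (x, y) (x', y') (a, b))"
  shows "star_bifunctor A B D T"
proof -
  have "is_functor (A \<times>\<^sub>C B) D T"
    unfolding is_functor_def using assms(1-4) by simp
  then show ?thesis unfolding star_bifunctor_def using assms(5-9) by simp
qed

lemma star_bifunctor_postcompose:
  assumes T: "star_bifunctor A B C T" and F: "star_functor C D F"
  shows "star_bifunctor A B D (F \<circ>\<^sub>F T)"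
  by (rule star_bifunctorI) (simp_all add: star_bifunctorD[OF T] star_functorD[OF F])

lemma star_bifunctor_precompose:
  assumes F: "star_functor A A' F" and G: "star_functor B B' G" and T: "star_bifunctor A' B' D T"
  shows "star_bifunctor A B D (T \<circ>\<^sub>F (F \<times>\<^sub>F G))"
  by (rule star_bifunctorI) (simp_all add: star_bifunctorD[OF T] star_functorD[OF F] star_functorD[OF G])

lemma star_bifunctor_swap:
  assumes T: "star_bifunctor B A D T"
  shows "star_bifunctor A B D (T \<circ>\<^sub>F prod_swap)"
  by (rule star_bifunctorI) (simp_all add: star_bifunctorD[OF T])


section \<open>Bifunctors with one variable fixed at an object\<close>

definition bifunctor_at_right :: "('p, 'b, 'z) cat_scheme \<Rightarrow> ('o \<times> 'p, 'a \<times> 'b, 'q, 'c) fnct \<Rightarrow> 'p \<Rightarrow> ('o, 'a, 'q, 'c) fnct" where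
  "bifunctor_at_right B T y = \<lparr>FOb = (\<lambda>x. FOb T (x, y)), FArr = (\<lambda>x x' a. FArr T (x, y) (x', y) (a, Idt B y))\<rparr>"

definition bifunctor_at_left :: "('o, 'a, 'z) cat_scheme \<Rightarrow> ('o \<times> 'p, 'a \<times> 'b, 'q, 'c) fnct \<Rightarrow> 'o \<Rightarrow> ('p, 'b, 'q, 'c) fnct" where
  "bifunctor_at_left A T x = \<lparr>FOb = (\<lambda>y. FOb T (x, y)), FArr = (\<lambda>y y' b. FArr T (x, y) (x, y') (Idt A x, b))\<rparr>"

lemma bifunctor_at_simps [simp]:
  "FOb (bifunctor_at_right B T y) x = FOb T (x, y)"
  "FArr (bifunctor_at_right B T y) x x' a = FArr T (x, y) (x', y) (a, Idt B y)"
  "FOb (bifunctor_at_left A T x) y = FOb T (x, y)"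
  "FArr (bifunctor_at_left A T x) y y' b = FArr T (x, y) (x, y') (Idt A x, b)"
  by (simp_all add: bifunctor_at_right_def bifunctor_at_left_def)

lemma star_functor_at_right:
  assumes B: "star_category B" and T: "star_bifunctor A B D T" and y: "y \<in> Ob B"
  shows "star_functor A D (bifunctor_at_right B T y)"
proof -
  interpret B: star_category B by (rule B)
  note TD = star_bifunctorD[OF T]
  have "FArr T (x, y) (x'', y) (Cmp A x x' x'' a' a, Idt B y) =
      Cmp D (FOb T (x, y)) (FOb T (x', y)) (FOb T (x'', y)) (FArr T (x', y) (x'', y) (a', Idt B y))
        (FArr T (x, y) (x', y) (a, Idt B y))"
    if "x \<in> Ob A" "x' \<in> Ob A" "x'' \<in> Ob A" "a \<in> Hom A x x'" "a' \<in> Hom A x' x''" for x x' x'' a a'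
    using TD(5)[of x y x' y x'' y a "Idt B y" a' "Idt B y"] that y by (simp add: B.comp_id_left B.id_closed)
  moreover have "FArr T (x', y) (x, y) (Str A x x' a, Idt B y) = Str D (FOb T (x, y)) (FOb T (x', y)) (FArr T (x, y) (x', y) (a, Idt B y))"
    if "x \<in> Ob A" "x' \<in> Ob A" "a \<in> Hom A x x'" for x x' a
    using TD(10)[of x y x' y a "Idt B y"] that y by (simp add: B.star_id B.id_closed)
  ultimately show ?thesis
    unfolding star_functor_def is_functor_def by (simp add: TD(2,3,4,6,8) y B.id_closed)
qed

lemma star_functor_at_left:
  assumes A: "star_category A" and T: "star_bifunctor A B D T" and x: "x \<in> Ob A"
  shows "star_functor B D (bifunctor_at_left A T x)"
proof -
  interpret A: star_category A by (rule A)
  note TD = star_bifunctorD[OF T]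
  have "FArr T (x, y) (x, y'') (Idt A x, Cmp B y y' y'' b' b) =
      Cmp D (FOb T (x, y)) (FOb T (x, y')) (FOb T (x, y'')) (FArr T (x, y') (x, y'') (Idt A x, b'))
        (FArr T (x, y) (x, y') (Idt A x, b))"
    if "y \<in> Ob B" "y' \<in> Ob B" "y'' \<in> Ob B" "b \<in> Hom B y y'" "b' \<in> Hom B y' y''" for y y' y'' b b'
    using TD(5)[of x y x y' x y'' "Idt A x" b "Idt A x" b'] that x by (simp add: A.comp_id_left A.id_closed)
  moreover have "FArr T (x, y') (x, y) (Idt A x, Str B y y' b) = Str D (FOb T (x, y)) (FOb T (x, y')) (FArr T (x, y) (x, y') (Idt A x, b))"
    if "y \<in> Ob B" "y' \<in> Ob B" "b \<in> Hom B y y'" for y y' b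
    using TD(10)[of x y x y' "Idt A x" b] that x by (simp add: A.star_id A.id_closed)
  ultimately show ?thesis
    unfolding star_functor_def is_functor_def by (simp add: TD(2,3,4,7,9) x A.id_closed)
qed

text \<open>T(a, b) = T(a, 1) T(1, b), and with one variable fixed at an identity T is a *-functor,
  hence contractive. The estimate makes the maximal norm on tensor products finite and T continuous
  in each variable.\<close>

lemma Nrm_star_bifunctor_le:
  assumes A: "cstar_category A" and B: "cstar_category B" and D: "cstar_category D" and T: "star_bifunctor A B D T"
    and ob: "x \<in> Ob A" "y \<in> Ob B" "x' \<in> Ob A" "y' \<in> Ob B" and ab: "a \<in> Hom A x x'" "b \<in> Hom B y y'"
  shows "Nrm D (FOb T (x, y)) (FOb T (x', y')) (FArr T (x, y) (x', y') (a, b)) \<le> Nrm A x x' a * Nrm B y y' b"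
proof -
  interpret A: cstar_category A by (rule A)
  interpret B: cstar_category B by (rule B)
  interpret D: cstar_category D by (rule D)
  note TD = star_bifunctorD[OF T]
  have "FArr T (x, y) (x', y') (a, b) = Cmp D (FOb T (x, y)) (FOb T (x, y')) (FOb T (x', y'))
      (FArr T (x, y') (x', y') (a, Idt B y')) (FArr T (x, y) (x, y') (Idt A x, b))"
    using TD(5)[of x y x y' x' y' "Idt A x" b a "Idt B y'"] ob ab
    by (simp add: A.id_closed B.id_closed A.comp_id_right B.comp_id_left)
  then have "Nrm D (FOb T (x, y)) (FOb T (x', y')) (FArr T (x, y) (x', y') (a, b))
      \<le> Nrm D (FOb T (x, y')) (FOb T (x', y')) (FArr T (x, y') (x', y') (a, Idt B y'))
        * Nrm D (FOb T (x, y)) (FOb T (x, y')) (FArr T (x, y) (x, y') (Idt A x, b))"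
    using ob ab by (simp add: D.N_comp TD A.id_closed B.id_closed)
  also have "\<dots> \<le> Nrm A x x' a * Nrm B y y' b"
    using star_functor_contractive[OF A D star_functor_at_right[OF B.star_category_axioms T ob(4)] ob(1,3) ab(1)]
      star_functor_contractive[OF B D star_functor_at_left[OF A.star_category_axioms T ob(1)] ob(2,4) ab(2)] ob ab
    by (intro mult_mono) (auto intro!: A.N_ge_0 D.N_ge_0 simp: TD A.id_closed)
  finally show ?thesis .
qed

lemma bounded_linear_hom_bifunctor:
  assumes A: "cstar_category A" and B: "cstar_category B" and D: "cstar_category D" and T: "star_bifunctor A B D T"
    and ob: "x \<in> Ob A" "y \<in> Ob B" "x' \<in> Ob A" "y' \<in> Ob B"
  shows "b \<in> Hom B y y' \<Longrightarrow> bounded_linear_hom A x x' D (FOb T (x, y)) (FOb T (x', y')) (\<lambda>a. FArr T (x, y) (x', y') (a, b))"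
    and "a \<in> Hom A x x' \<Longrightarrow> bounded_linear_hom B y y' D (FOb T (x, y)) (FOb T (x', y')) (\<lambda>b. FArr T (x, y) (x', y') (a, b))"
proof -
  note TD = star_bifunctorD(3,6-9)[OF T] and le = Nrm_star_bifunctor_le[OF assms]
  show "bounded_linear_hom A x x' D (FOb T (x, y)) (FOb T (x', y')) (\<lambda>a. FArr T (x, y) (x', y') (a, b))"
    if "b \<in> Hom B y y'"
    unfolding bounded_linear_hom_def using TD ob le that
    by (auto intro!: exI[of _ "Nrm B y y' b"] simp: mult.commute)
  show "bounded_linear_hom B y y' D (FOb T (x, y)) (FOb T (x', y')) (\<lambda>b. FArr T (x, y) (x', y') (a, b))"
    if "a \<in> Hom A x x'"
    unfolding bounded_linear_hom_def using TD ob le that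
    by (auto intro!: exI[of _ "Nrm A x x' a"])
qed

text \<open>This builds both the associator and the inverse of \<open>gpd_mu\<close>. Since the
  categories have many objects, each of the two commuting functors becomes a family indexed by the
  objects of the other factor.\<close>

lemma star_bifunctor_commuting_pair:
  assumes A: "star_category A" and B: "star_category B" and D: "star_category D"
    and \<alpha>: "\<And>y. y \<in> Ob B \<Longrightarrow> star_functor A D (\<alpha> y)" and \<beta>: "\<And>x. x \<in> Ob A \<Longrightarrow> star_functor B D (\<beta> x)"
    and P: "\<And>x y. \<lbrakk>x \<in> Ob A; y \<in> Ob B\<rbrakk> \<Longrightarrow> FOb (\<alpha> y) x = P x y" "\<And>x y. \<lbrakk>x \<in> Ob A; y \<in> Ob B\<rbrakk> \<Longrightarrow> FOb (\<beta> x) y = P x y"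
    and comm: "\<And>x x' y y' a b. \<lbrakk>x \<in> Ob A; y \<in> Ob B; x' \<in> Ob A; y' \<in> Ob B; a \<in> Hom A x x'; b \<in> Hom B y y'\<rbrakk>
      \<Longrightarrow> Cmp D (P x y) (P x y') (P x' y') (FArr (\<alpha> y') x x' a) (FArr (\<beta> x) y y' b)
        = Cmp D (P x y) (P x' y) (P x' y') (FArr (\<beta> x') y y' b) (FArr (\<alpha> y) x x' a)"
  shows "star_bifunctor A B D \<lparr>FOb = (\<lambda>(x, y). P x y), FArr = (\<lambda>(x, y) (x', y') (a, b).
      Cmp D (P x y) (P x y') (P x' y') (FArr (\<alpha> y') x x' a) (FArr (\<beta> x) y y' b))\<rparr>"
proof -
  interpret A: star_category A by (rule A)
  interpret B: star_category B by (rule B)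
  interpret D: star_category D by (rule D)
  have P_ob: "P x y \<in> Ob D" if "x \<in> Ob A" "y \<in> Ob B" for x y
    using star_functorD(2)[OF \<alpha>[OF that(2)] that(1)] P that by simp
  have a: "FArr (\<alpha> y) x x' a \<in> Hom D (P x y) (P x' y)" if "y \<in> Ob B" "x \<in> Ob A" "x' \<in> Ob A" "a \<in> Hom A x x'" for x x' y a
    using star_functorD(3)[OF \<alpha>[OF that(1)] that(2-)] P that by simp
  have b: "FArr (\<beta> x) y y' b \<in> Hom D (P x y) (P x y')" if "x \<in> Ob A" "y \<in> Ob B" "y' \<in> Ob B" "b \<in> Hom B y y'" for x y y' b
    using star_functorD(3)[OF \<beta>[OF that(1)] that(2-)] P that by simp
  note \<alpha>D = star_functorD(4-8)[OF \<alpha>] and \<beta>D = star_functorD(4-8)[OF \<beta>]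
  note simps = P_ob a b \<alpha>D \<beta>D P A.hom_closed B.hom_closed D.hom_closed
  show ?thesis
  proof (rule star_bifunctorI, goal_cases)
    case (3 x y)
    then show ?case by (simp add: simps D.comp_id_left)
  next
    case (4 x y x' y' x'' y'' a b a' b')
    \<comment> \<open>Interchange: after reassociating, only the two inner factors, coming from a
      and b', have to be swapped by \<open>comm\<close>.\<close>
    have "Cmp D (P x y) (P x y'') (P x'' y'')
        (Cmp D (P x y'') (P x' y'') (P x'' y'') (FArr (\<alpha> y'') x' x'' a') (FArr (\<alpha> y'') x x' a))
        (Cmp D (P x y) (P x y') (P x y'') (FArr (\<beta> x) y' y'' b') (FArr (\<beta> x) y y' b))
      = Cmp D (P x y) (P x' y'') (P x'' y'') (FArr (\<alpha> y'') x' x'' a')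
        (Cmp D (P x y) (P x y') (P x' y'') (Cmp D (P x y') (P x y'') (P x' y'') (FArr (\<alpha> y'') x x' a) (FArr (\<beta> x) y' y'' b'))
          (FArr (\<beta> x) y y' b))"
      using 4 by (simp add: simps D.comp_assoc)
    also have "\<dots> = Cmp D (P x y) (P x' y') (P x'' y'')
        (Cmp D (P x' y') (P x' y'') (P x'' y'') (FArr (\<alpha> y'') x' x'' a') (FArr (\<beta> x') y' y'' b'))
        (Cmp D (P x y) (P x y') (P x' y') (FArr (\<alpha> y') x x' a) (FArr (\<beta> x) y y' b))"
      unfolding comm[OF 4(1,4,3,6,7,10)] using 4 by (simp add: simps D.comp_assoc)
    finally show ?case using 4 by (simp add: simps)
  next
    case (9 x y x' y' a b)
    have "Cmp D (P x' y') (P x' y) (P x y) (FArr (\<alpha> y) x' x (Str A x x' a)) (FArr (\<beta> x') y' y (Str B y y' b))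
        = Str D (P x y) (P x' y') (Cmp D (P x y) (P x' y) (P x' y') (FArr (\<beta> x') y y' b) (FArr (\<alpha> y) x x' a))"
      using 9 by (simp add: simps D.star_comp)
    then show ?case using 9 comm[OF 9] by (simp add: simps)
  qed (simp_all add: simps D.comp_add_left D.comp_add_right D.comp_scl_left D.comp_scl_right)
qed

lemma elem_tensor_eq: "elem_tensor A B = to_completion (alg_tensor A B) (max_norm (alg_tensor A B)) \<circ>\<^sub>F star_tensor.elem A B"
  if "star_tensor A B"
  using that by (simp add: elem_tensor_def star_tensor.elem_def)

lemma FOb_elem_tensor [simp]: "FOb (elem_tensor A B) p = p"
  by (simp add: elem_tensor_def to_completion_def)

lemma Ob_max_tensor [simp]: "Ob (A \<otimes>\<^sub>m B) = Ob A \<times> Ob B"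
  by (simp add: max_tensor_def completion_def alg_tensor_def)

section \<open>The maximal tensor product and its universal property\<close>

locale cstar_tensor = A: cstar_category A + B: cstar_category B
  for A :: "('o, 'a, 'f::real_or_complex) cstar_cat" and B :: "('p, 'b, 'f) cstar_cat"
begin

sublocale star_tensor A B ..

lemma bounded_star_category_alg_tensor: "bounded_star_category (alg_tensor A B)"
proof (intro bounded_star_category.intro bounded_star_category_axioms.intro alg_tensor_props)
  show "cstar_bounded (alg_tensor A B)"
    unfolding cstar_bounded_def
  proof (intro ballI)
    fix p q U assume p: "p \<in> Ob (alg_tensor A B)" "q \<in> Ob (alg_tensor A B)" and U: "U \<in> Hom (alg_tensor A B) p q"
    obtain u where u: "keys u \<subseteq> Hom (A \<times>\<^sub>C B) p q" "U = cls p q u" using U by (auto simp: Hom_alg_tensor)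
    \<comment> \<open>An arbitrary functor on the free category need not be bilinear on pairs, so
      that \<open>Nrm_star_bifunctor_le\<close> would not apply. R therefore demands a factorization
      F' through the tensor product.\<close>
    let ?R = "\<lambda>(D :: ('o \<times> 'p, (nat \<Rightarrow> ('a \<times> 'b \<Rightarrow>\<^sub>0 'f) set) set, 'f) cstar_cat) F.
      \<exists>F'. cstar_category D \<and> star_functor (alg_tensor A B) D F' \<and> F = F' \<circ>\<^sub>F proj"
    have "\<exists>M. \<forall>D F. ?R D F \<longrightarrow> Nrm D (FOb F p) (FOb F q) (FArr F p q u) \<le> M"
    proof (rule free_bound)
      fix g assume g: "g \<in> Hom (A \<times>\<^sub>C B) p q"
      obtain x y x' y' a b where pq: "p = (x, y)" "q = (x', y')" "g = (a, b)" by (cases p, cases q, cases g)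
      have "Nrm D (FOb F p) (FOb F q) (FArr F p q (single g 1)) \<le> Nrm A x x' a * Nrm B y y' b"
        if R: "?R D F" for D F
      proof -
        obtain F' where F': "cstar_category D" "star_functor (alg_tensor A B) D F'" "F = F' \<circ>\<^sub>F proj" using R by blast
        show ?thesis
          using Nrm_star_bifunctor_le[OF A.cstar_category_axioms B.cstar_category_axioms F'(1)
              star_bifunctor_postcompose[OF star_bifunctor_elem F'(2)], of x y x' y' a b] p g
          by (simp add: F'(3) pq proj_def elem_def)
      qed
      then show "\<exists>M. \<forall>D F. ?R D F \<longrightarrow> Nrm D (FOb F p) (FOb F q) (FArr F p q (single g 1)) \<le> M" by blast
    next
      fix D F assume "?R D F"
      then show "cstar_category D \<and> star_functor (free_cat (A \<times>\<^sub>C B) (tensor_star A B)) D F"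
        using star_functor_fcomp[OF alg_tensor_props(2)] by blast
    qed (use p u in auto)
    then obtain M where M: "\<And>D F. ?R D F \<Longrightarrow> Nrm D (FOb F p) (FOb F q) (FArr F p q u) \<le> M" by blast
    show "\<exists>M. \<forall>(D :: ('o \<times> 'p, (nat \<Rightarrow> ('a \<times> 'b \<Rightarrow>\<^sub>0 'f) set) set, 'f) cstar_cat) F. cstar_category D \<longrightarrow>
        star_functor (alg_tensor A B) D F \<longrightarrow> Nrm D (FOb F p) (FOb F q) (FArr F p q U) \<le> M"
    proof (intro exI[of _ M] allI impI)
      fix D :: "('o \<times> 'p, (nat \<Rightarrow> ('a \<times> 'b \<Rightarrow>\<^sub>0 'f) set) set, 'f) cstar_cat" and F
      assume "cstar_category D" "star_functor (alg_tensor A B) D F"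
      then show "Nrm D (FOb F p) (FOb F q) (FArr F p q U) \<le> M"
        using M[of D "F \<circ>\<^sub>F proj"] by (auto simp: proj_def u(2))
    qed
  qed
qed

sublocale alg: bounded_star_category "alg_tensor A B" by (rule bounded_star_category_alg_tensor)
sublocale alg: positive_star_seminorm "alg_tensor A B" "max_norm (alg_tensor A B)"
  by (rule alg.positive_star_seminorm_max_norm)

lemma cstar_category_max_tensor: "cstar_category (A \<otimes>\<^sub>m B)"
  unfolding max_tensor_def by (rule alg.cstar_category_completion)

lemma star_bifunctor_elem_tensor: "star_bifunctor A B (A \<otimes>\<^sub>m B) (elem_tensor A B)"
  unfolding max_tensor_def elem_tensor_eq[OF star_tensor_axioms]
  by (rule star_bifunctor_postcompose[OF star_bifunctor_elem alg.star_functor_to_completion])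

lemma tensor_extend:
  assumes D: "cstar_category D" and T: "star_bifunctor A B D T"
  shows "star_functor (A \<otimes>\<^sub>m B) D (tensor_extend A B D T)"
    and "fun_eq (A \<times>\<^sub>C B) (tensor_extend A B D T \<circ>\<^sub>F elem_tensor A B) T"
proof -
  interpret D: cstar_category D by (rule D)
  obtain \<Phi> where \<Phi>: "star_functor (alg_tensor A B) D \<Phi>" "fun_eq (A \<times>\<^sub>C B) (\<Phi> \<circ>\<^sub>F elem) T"
    using ex_star_functor_alg_tensor[OF D.star_category_axioms T] by blast
  note E = alg.completion_extend[OF D \<Phi>(1) alg.Nrm_le_max_norm[OF D \<Phi>(1)]]
  have "star_functor (A \<otimes>\<^sub>m B) D (completion_extend (alg_tensor A B) D \<Phi>) \<and>
      fun_eq (A \<times>\<^sub>C B) (completion_extend (alg_tensor A B) D \<Phi> \<circ>\<^sub>F elem_tensor A B) T"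
  proof
    show "star_functor (A \<otimes>\<^sub>m B) D (completion_extend (alg_tensor A B) D \<Phi>)"
      unfolding max_tensor_def by (rule E(1))
    show "fun_eq (A \<times>\<^sub>C B) (completion_extend (alg_tensor A B) D \<Phi> \<circ>\<^sub>F elem_tensor A B) T"
      using \<Phi>(2) fun_eqD[OF E(2)] star_bifunctorD(3)[OF star_bifunctor_elem]
      unfolding elem_tensor_eq[OF star_tensor_axioms] fun_eq_def by (auto simp: elem_def)
  qed
  then have "star_functor (A \<otimes>\<^sub>m B) D (tensor_extend A B D T) \<and> fun_eq (A \<times>\<^sub>C B) (tensor_extend A B D T \<circ>\<^sub>F elem_tensor A B) T"
    unfolding tensor_extend_def
    by (rule someI[where P = "\<lambda>\<Phi>. star_functor (A \<otimes>\<^sub>m B) D \<Phi> \<and> fun_eq (A \<times>\<^sub>C B) (\<Phi> \<circ>\<^sub>F elem_tensor A B) T"])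
  then show "star_functor (A \<otimes>\<^sub>m B) D (tensor_extend A B D T)"
    "fun_eq (A \<times>\<^sub>C B) (tensor_extend A B D T \<circ>\<^sub>F elem_tensor A B) T" by auto
qed

text \<open>Density one variable at a time: first b is a generator and a is arbitrary, then b is
  arbitrary as well, then formal sums are reached by \<open>free_total\<close>, and finally
  limits.\<close>

lemma total_max_tensor:
  assumes S: "total A S" and S': "total B S'"
  shows "total (A \<otimes>\<^sub>m B) (\<lambda>p q. FArr (elem_tensor A B) p q ` (S (fst p) (fst q) \<times> S' (snd p) (snd q)))"
  unfolding total_def
proof (intro ballI conjI allI impI)
  fix p q assume p: "p \<in> Ob (A \<otimes>\<^sub>m B)" "q \<in> Ob (A \<otimes>\<^sub>m B)"
  obtain x y x' y' where pq: "p = (x, y)" "q = (x', y')" by (cases p, cases q)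
  have ob: "x \<in> Ob A" "y \<in> Ob B" "x' \<in> Ob A" "y' \<in> Ob B" using p by (auto simp: pq)
  note ED = star_bifunctorD[OF star_bifunctor_elem_tensor, simplified]
  note AB = A.cstar_category_axioms B.cstar_category_axioms cstar_category_max_tensor
  note lin = bounded_linear_hom_bifunctor[OF AB star_bifunctor_elem_tensor ob, simplified]
  note SD = totalD[OF S ob(1,3)] and SD' = totalD[OF S' ob(2,4)]
  have obm: "(x, y) \<in> Ob (A \<otimes>\<^sub>m B)" "(x', y') \<in> Ob (A \<otimes>\<^sub>m B)" using ob by simp_all
  show "FArr (elem_tensor A B) p q ` (S (fst p) (fst q) \<times> S' (snd p) (snd q)) \<subseteq> Hom (A \<otimes>\<^sub>m B) p q"
    using ob SD(1) SD'(1) by (auto simp: pq intro!: ED(3))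
  fix V assume V: "closed_subspace (A \<otimes>\<^sub>m B) p q V"
    and gen: "FArr (elem_tensor A B) p q ` (S (fst p) (fst q) \<times> S' (snd p) (snd q)) \<subseteq> V"
  note V = V[unfolded pq]
  have 1: "FArr (elem_tensor A B) p q (a, b) \<in> V" if "b \<in> S' y y'" "a \<in> Hom A x x'" for a b
  proof -
    have "a \<in> {a \<in> Hom A x x'. FArr (elem_tensor A B) (x, y) (x', y') (a, b) \<in> V}"
      by (rule SD(2)[OF closed_subspace_vimage[OF AB(1) ob(1,3) AB(3) obm lin(1)[OF SD'(1)[OF that(1)]] V]])
        (use gen that SD(1) in \<open>auto simp: pq\<close>)
    then show ?thesis by (simp add: pq)
  qed
  have 2: "FArr (elem_tensor A B) p q (a, b) \<in> V" if "b \<in> Hom B y y'" "a \<in> Hom A x x'" for a b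
  proof -
    have "b \<in> {b \<in> Hom B y y'. FArr (elem_tensor A B) (x, y) (x', y') (a, b) \<in> V}"
      by (rule SD'(2)[OF closed_subspace_vimage[OF AB(2) ob(2,4) AB(3) obm lin(2)[OF that(2)] V]])
        (use 1 that SD'(1) in \<open>auto simp: pq\<close>)
    then show ?thesis by (simp add: pq)
  qed
  let ?\<iota> = "to_completion (alg_tensor A B) (max_norm (alg_tensor A B))"
  have F: "star_functor FT (A \<otimes>\<^sub>m B) (?\<iota> \<circ>\<^sub>F proj)"
    unfolding max_tensor_def by (rule star_functor_fcomp[OF alg_tensor_props(2) alg.star_functor_to_completion])
  have 3: "FArr (?\<iota> \<circ>\<^sub>F proj) p q u \<in> V" if u: "keys u \<subseteq> Hom (A \<times>\<^sub>C B) p q" for u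
  proof (rule free_total[OF AB(3) F _ _ _ _ u])
    fix g assume "g \<in> Hom (A \<times>\<^sub>C B) p q"
    then show "FArr (?\<iota> \<circ>\<^sub>F proj) p q (single g 1) \<in> V"
      using 2[of "snd g" "fst g"] by (auto simp: pq elem_tensor_def proj_def)
  qed (use V ob in \<open>auto simp: pq proj_def\<close>)
  show "Hom (A \<otimes>\<^sub>m B) p q \<subseteq> V"
  proof
    fix X assume X: "X \<in> Hom (A \<otimes>\<^sub>m B) p q"
    show "X \<in> V"
    proof (rule totalD(2)[OF alg.total_completion[folded max_tensor_def] p V[folded pq] _ X])
      fix h assume "h \<in> FArr ?\<iota> p q ` Hom (alg_tensor A B) p q"
      then show "h \<in> V" using 3 by (auto simp: Hom_alg_tensor proj_def)
    qed
  qed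
qed

end

lemma tensor_extend_eval:
  assumes A: "cstar_category A" and B: "cstar_category B" and D: "cstar_category D" and T: "star_bifunctor A B D T"
  shows "\<lbrakk>x \<in> Ob A; y \<in> Ob B\<rbrakk> \<Longrightarrow> FOb (tensor_extend A B D T) (x, y) = FOb T (x, y)"
    and "\<lbrakk>x \<in> Ob A; y \<in> Ob B; x' \<in> Ob A; y' \<in> Ob B; a \<in> Hom A x x'; b \<in> Hom B y y'\<rbrakk>
      \<Longrightarrow> FArr (tensor_extend A B D T) (x, y) (x', y') (FArr (elem_tensor A B) (x, y) (x', y') (a, b))
        = FArr T (x, y) (x', y') (a, b)"
proof -
  interpret cstar_tensor A B using A B by (intro cstar_tensor.intro)
  note E = fun_eqD[OF tensor_extend(2)[OF D T]]
  show "\<lbrakk>x \<in> Ob A; y \<in> Ob B\<rbrakk> \<Longrightarrow> FOb (tensor_extend A B D T) (x, y) = FOb T (x, y)"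
    "\<lbrakk>x \<in> Ob A; y \<in> Ob B; x' \<in> Ob A; y' \<in> Ob B; a \<in> Hom A x x'; b \<in> Hom B y y'\<rbrakk>
      \<Longrightarrow> FArr (tensor_extend A B D T) (x, y) (x', y') (FArr (elem_tensor A B) (x, y) (x', y') (a, b))
        = FArr T (x, y) (x', y') (a, b)"
    using E(1)[of "(x, y)"] E(2)[of "(x, y)" "(x', y')" "(a, b)"] by simp_all
qed

lemmas star_functor_tensor_extend = cstar_tensor.tensor_extend(1)[OF cstar_tensor.intro]
  and cstar_category_max_tensor = cstar_tensor.cstar_category_max_tensor[OF cstar_tensor.intro]
  and star_bifunctor_elem_tensor = cstar_tensor.star_bifunctor_elem_tensor[OF cstar_tensor.intro]
  and total_max_tensor = cstar_tensor.total_max_tensor[OF cstar_tensor.intro]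

lemma tensor_fun:
  assumes A: "cstar_category A" and B: "cstar_category B" and A': "cstar_category A'" and B': "cstar_category B'"
    and F: "star_functor A A' F" and G: "star_functor B B' G"
  shows "star_functor (A \<otimes>\<^sub>m B) (A' \<otimes>\<^sub>m B') (tensor_fun A B A' B' F G)"
    and "\<lbrakk>x \<in> Ob A; y \<in> Ob B\<rbrakk> \<Longrightarrow> FOb (tensor_fun A B A' B' F G) (x, y) = (FOb F x, FOb G y)"
    and "\<lbrakk>x \<in> Ob A; y \<in> Ob B; x' \<in> Ob A; y' \<in> Ob B; a \<in> Hom A x x'; b \<in> Hom B y y'\<rbrakk>
      \<Longrightarrow> FArr (tensor_fun A B A' B' F G) (x, y) (x', y') (FArr (elem_tensor A B) (x, y) (x', y') (a, b))
        = FArr (elem_tensor A' B') (FOb F x, FOb G y) (FOb F x', FOb G y') (FArr F x x' a, FArr G y y' b)"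
proof -
  have T: "star_bifunctor A B (A' \<otimes>\<^sub>m B') (elem_tensor A' B' \<circ>\<^sub>F (F \<times>\<^sub>F G))"
    by (rule star_bifunctor_precompose[OF F G star_bifunctor_elem_tensor[OF A' B']])
  show "star_functor (A \<otimes>\<^sub>m B) (A' \<otimes>\<^sub>m B') (tensor_fun A B A' B' F G)"
    unfolding tensor_fun_def by (rule star_functor_tensor_extend[OF A B cstar_category_max_tensor[OF A' B'] T])
  note E = tensor_extend_eval[OF A B cstar_category_max_tensor[OF A' B'] T]
  show "\<lbrakk>x \<in> Ob A; y \<in> Ob B\<rbrakk> \<Longrightarrow> FOb (tensor_fun A B A' B' F G) (x, y) = (FOb F x, FOb G y)"
    "\<lbrakk>x \<in> Ob A; y \<in> Ob B; x' \<in> Ob A; y' \<in> Ob B; a \<in> Hom A x x'; b \<in> Hom B y y'\<rbrakk>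
      \<Longrightarrow> FArr (tensor_fun A B A' B' F G) (x, y) (x', y') (FArr (elem_tensor A B) (x, y) (x', y') (a, b))
        = FArr (elem_tensor A' B') (FOb F x, FOb G y) (FOb F x', FOb G y') (FArr F x x' a, FArr G y y' b)"
    unfolding tensor_fun_def using E by simp_all
qed

section \<open>The associator\<close>

lemma total_Hom: "total A (Hom A)"
  by (simp add: total_def)

lemma elem_tensor_comp:
  assumes "cstar_category A" "cstar_category B"
    and "x \<in> Ob A" "y \<in> Ob B" "x' \<in> Ob A" "y' \<in> Ob B" "x'' \<in> Ob A" "y'' \<in> Ob B"
    and "a \<in> Hom A x x'" "b \<in> Hom B y y'" "a' \<in> Hom A x' x''" "b' \<in> Hom B y' y''"
  shows "Cmp (A \<otimes>\<^sub>m B) (x, y) (x', y') (x'', y'') (FArr (elem_tensor A B) (x', y') (x'', y'') (a', b'))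
      (FArr (elem_tensor A B) (x, y) (x', y') (a, b))
    = FArr (elem_tensor A B) (x, y) (x'', y'') (Cmp A x x' x'' a' a, Cmp B y y' y'' b' b)"
  using star_bifunctorD(5)[OF star_bifunctor_elem_tensor[OF assms(1,2)] assms(3-)] by simp

text \<open>A witness for the \<open>SOME\<close> in \<open>tensor_assoc\<close>. For an object z,
  \<open>\<alpha> z\<close> sends a \<otimes> b to a \<otimes> (b \<otimes> 1), and for a pair of
  objects \<beta> sends c to 1 \<otimes> (1 \<otimes> c). The images commute on elementary tensors
  by direct computation and in general by density, so \<open>star_bifunctor_commuting_pair\<close>
  yields a bifunctor that extends to the tensor product.\<close>

lemma tensor_assoc:
  assumes A: "cstar_category A" and B: "cstar_category B" and C: "cstar_category C"
  shows "star_functor ((A \<otimes>\<^sub>m B) \<otimes>\<^sub>m C) (A \<otimes>\<^sub>m (B \<otimes>\<^sub>m C)) (tensor_assoc A B C)"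
    and "fun_eq ((A \<times>\<^sub>C B) \<times>\<^sub>C C) (tensor_assoc A B C \<circ>\<^sub>F elem_tensor (A \<otimes>\<^sub>m B) C \<circ>\<^sub>F (elem_tensor A B \<times>\<^sub>F fid))
          (elem_tensor A (B \<otimes>\<^sub>m C) \<circ>\<^sub>F (fid \<times>\<^sub>F elem_tensor B C) \<circ>\<^sub>F prod_assoc)"
proof -
  interpret A: cstar_category A by (rule A)
  interpret B: cstar_category B by (rule B)
  interpret C: cstar_category C by (rule C)
  define D where "D = A \<otimes>\<^sub>m (B \<otimes>\<^sub>m C)"
  have AB: "cstar_category (A \<otimes>\<^sub>m B)" and BC: "cstar_category (B \<otimes>\<^sub>m C)"
    by (rule cstar_category_max_tensor[OF A B], rule cstar_category_max_tensor[OF B C])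
  have D: "cstar_category D" unfolding D_def by (rule cstar_category_max_tensor[OF A BC])
  interpret BC: cstar_category "B \<otimes>\<^sub>m C" by (rule BC)
  interpret D: cstar_category D by (rule D)
  note eAB = star_bifunctor_elem_tensor[OF A B] and eBC = star_bifunctor_elem_tensor[OF B C]
  have eD: "star_bifunctor A (B \<otimes>\<^sub>m C) D (elem_tensor A (B \<otimes>\<^sub>m C))"
    unfolding D_def by (rule star_bifunctor_elem_tensor[OF A BC])
  define T where "T z = elem_tensor A (B \<otimes>\<^sub>m C) \<circ>\<^sub>F (fid \<times>\<^sub>F bifunctor_at_right C (elem_tensor B C) z)" for z
  define \<alpha> where "\<alpha> z = tensor_extend A B D (T z)" for z
  define \<beta> where "\<beta> p = bifunctor_at_left A (elem_tensor A (B \<otimes>\<^sub>m C)) (fst p)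
      \<circ>\<^sub>F bifunctor_at_left B (elem_tensor B C) (snd p)" for p
  define P where "P p z = (fst p, (snd p, z))" for p :: "'a \<times> 'd" and z :: 'f
  have T: "star_bifunctor A B D (T z)" if "z \<in> Ob C" for z
    unfolding T_def
    by (rule star_bifunctor_precompose[OF star_functor_fid star_functor_at_right[OF C.star_category_axioms eBC that] eD])
  have \<alpha>: "star_functor (A \<otimes>\<^sub>m B) D (\<alpha> z)" if "z \<in> Ob C" for z
    unfolding \<alpha>_def by (rule star_functor_tensor_extend[OF A B D T[OF that]])
  have \<alpha>_ob: "FOb (\<alpha> z) (x, y) = (x, (y, z))" if "x \<in> Ob A" "y \<in> Ob B" "z \<in> Ob C" for x y z
    unfolding \<alpha>_def using tensor_extend_eval(1)[OF A B D T] that by (simp add: T_def)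
  have \<alpha>_arr: "FArr (\<alpha> z) (x, y) (x', y') (FArr (elem_tensor A B) (x, y) (x', y') (a, b))
      = FArr (elem_tensor A (B \<otimes>\<^sub>m C)) (x, y, z) (x', y', z) (a, FArr (elem_tensor B C) (y, z) (y', z) (b, Idt C z))"
    if "x \<in> Ob A" "y \<in> Ob B" "z \<in> Ob C" "x' \<in> Ob A" "y' \<in> Ob B" "a \<in> Hom A x x'" "b \<in> Hom B y y'" for x y z x' y' a b
    unfolding \<alpha>_def using tensor_extend_eval(2)[OF A B D T] that by (simp add: T_def)
  have \<beta>: "star_functor C D (\<beta> p)" if "p \<in> Ob (A \<otimes>\<^sub>m B)" for p
    unfolding \<beta>_def using that
    by (intro star_functor_fcomp[OF star_functor_at_left[OF B.star_category_axioms eBC]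
          star_functor_at_left[OF A.star_category_axioms eD]]) auto
  have \<beta>_arr: "FArr (\<beta> (x, y)) z z' c = FArr (elem_tensor A (B \<otimes>\<^sub>m C)) (x, y, z) (x, y, z')
      (Idt A x, FArr (elem_tensor B C) (y, z) (y, z') (Idt B y, c))" for x y z z' c
    by (simp add: \<beta>_def)
  have eBC_closed: "FArr (elem_tensor B C) (y, z) (y', z') (b, c) \<in> Hom (B \<otimes>\<^sub>m C) (y, z) (y', z')"
    if "y \<in> Ob B" "z \<in> Ob C" "y' \<in> Ob B" "z' \<in> Ob C" "b \<in> Hom B y y'" "c \<in> Hom C z z'" for y z y' z' b c
    using star_bifunctorD(3)[OF eBC that] by simp
  have comp1: "Cmp D (x, y, z) (x, y, z') (x', y', z') (FArr (\<alpha> z') (x, y) (x', y') (FArr (elem_tensor A B) (x, y) (x', y') (a, b)))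
        (FArr (\<beta> (x, y)) z z' c)
      = FArr (elem_tensor A (B \<otimes>\<^sub>m C)) (x, y, z) (x', y', z') (a, FArr (elem_tensor B C) (y, z) (y', z') (b, c))"
    and comp2: "Cmp D (x, y, z) (x', y', z) (x', y', z') (FArr (\<beta> (x', y')) z z' c)
        (FArr (\<alpha> z) (x, y) (x', y') (FArr (elem_tensor A B) (x, y) (x', y') (a, b)))
      = FArr (elem_tensor A (B \<otimes>\<^sub>m C)) (x, y, z) (x', y', z') (a, FArr (elem_tensor B C) (y, z) (y', z') (b, c))"
    if "x \<in> Ob A" "y \<in> Ob B" "z \<in> Ob C" "x' \<in> Ob A" "y' \<in> Ob B" "z' \<in> Ob C"
      "a \<in> Hom A x x'" "b \<in> Hom B y y'" "c \<in> Hom C z z'" for x y z x' y' z' a b c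
    using that unfolding D_def
    by (simp_all add: \<alpha>_arr \<beta>_arr elem_tensor_comp[OF A BC] elem_tensor_comp[OF B C] eBC_closed
        A.id_closed B.id_closed C.id_closed A.comp_id_left A.comp_id_right B.comp_id_left B.comp_id_right
        C.comp_id_left C.comp_id_right)
  have bif: "star_bifunctor (A \<otimes>\<^sub>m B) C D \<lparr>FOb = (\<lambda>(p, z). P p z), FArr = (\<lambda>(p, z) (p', z') (w, c).
      Cmp D (P p z) (P p z') (P p' z') (FArr (\<alpha> z') p p' w) (FArr (\<beta> p) z z' c))\<rparr>"
  proof (rule star_bifunctor_commuting_pair)
    show "star_category (A \<otimes>\<^sub>m B)" "star_category C" "star_category D"
      using AB C D by (simp_all add: cstar_category_def)
    fix p p' z z' w c
    assume ob: "p \<in> Ob (A \<otimes>\<^sub>m B)" "z \<in> Ob C" "p' \<in> Ob (A \<otimes>\<^sub>m B)" "z' \<in> Ob C"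
      and w: "w \<in> Hom (A \<otimes>\<^sub>m B) p p'" and c: "c \<in> Hom C z z'"
    obtain x y x' y' where pp: "p = (x, y)" "p' = (x', y')" by (cases p, cases p')
    have o: "x \<in> Ob A" "y \<in> Ob B" "x' \<in> Ob A" "y' \<in> Ob B" using ob by (auto simp: pp)
    have obD: "(x, y, z) \<in> Ob D" "(x, y, z') \<in> Ob D" "(x', y', z) \<in> Ob D" "(x', y', z') \<in> Ob D"
      using o ob by (auto simp: D_def)
    have \<alpha>lin: "bounded_linear_hom (A \<otimes>\<^sub>m B) p p' D (x, y, z) (x', y', z) (FArr (\<alpha> z) p p')"
      "bounded_linear_hom (A \<otimes>\<^sub>m B) p p' D (x, y, z') (x', y', z') (FArr (\<alpha> z') p p')"
      using bounded_linear_hom_star_functor[OF AB D \<alpha> ob(1,3), of z] bounded_linear_hom_star_functor[OF AB D \<alpha> ob(1,3), of z']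
        o ob by (simp_all add: pp \<alpha>_ob)
    have \<beta>c: "FArr (\<beta> (x, y)) z z' c \<in> Hom D (x, y, z) (x, y, z')" "FArr (\<beta> (x', y')) z z' c \<in> Hom D (x', y', z) (x', y', z')"
      using star_functorD(3)[OF \<beta>[OF ob(1)] ob(2,4) c] star_functorD(3)[OF \<beta>[OF ob(3)] ob(2,4) c]
      by (simp_all add: pp \<beta>_def)
    have "Cmp D (x, y, z) (x, y, z') (x', y', z') (FArr (\<alpha> z') p p' w) (FArr (\<beta> (x, y)) z z' c)
        = Cmp D (x, y, z) (x', y', z) (x', y', z') (FArr (\<beta> (x', y')) z z' c) (FArr (\<alpha> z) p p' w)"
    proof (rule bounded_linear_hom_eqI[OF AB ob(1,3) D obD(1,4) _ _ total_max_tensor[OF A B total_Hom total_Hom] _ w])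
      show "bounded_linear_hom (A \<otimes>\<^sub>m B) p p' D (x, y, z) (x', y', z')
          (\<lambda>w. Cmp D (x, y, z) (x, y, z') (x', y', z') (FArr (\<alpha> z') p p' w) (FArr (\<beta> (x, y)) z z' c))"
        by (rule bounded_linear_hom_compose[OF D obD(2,4) \<alpha>lin(2) bounded_linear_hom_comp_right[OF D obD(1,2,4) \<beta>c(1)]])
      show "bounded_linear_hom (A \<otimes>\<^sub>m B) p p' D (x, y, z) (x', y', z')
          (\<lambda>w. Cmp D (x, y, z) (x', y', z) (x', y', z') (FArr (\<beta> (x', y')) z z' c) (FArr (\<alpha> z) p p' w))"
        by (rule bounded_linear_hom_compose[OF D obD(1,3) \<alpha>lin(1) bounded_linear_hom_comp_left[OF D obD(1,3,4) \<beta>c(2)]])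
    qed (use o ob c in \<open>auto simp: pp comp1 comp2\<close>)
    then show "Cmp D (P p z) (P p z') (P p' z') (FArr (\<alpha> z') p p' w) (FArr (\<beta> p) z z' c)
        = Cmp D (P p z) (P p' z) (P p' z') (FArr (\<beta> p') z z' c) (FArr (\<alpha> z) p p' w)"
      by (simp add: P_def pp)
  qed (use \<alpha> \<beta> in \<open>auto simp: P_def \<alpha>_ob \<beta>_def\<close>)
  define \<Phi> where "\<Phi> = tensor_extend (A \<otimes>\<^sub>m B) C D \<lparr>FOb = (\<lambda>(p, z). P p z), FArr = (\<lambda>(p, z) (p', z') (w, c).
      Cmp D (P p z) (P p z') (P p' z') (FArr (\<alpha> z') p p' w) (FArr (\<beta> p) z z' c))\<rparr>"
  note E = tensor_extend_eval[OF AB C D bif, folded \<Phi>_def]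
  have "fun_eq ((A \<times>\<^sub>C B) \<times>\<^sub>C C) (\<Phi> \<circ>\<^sub>F elem_tensor (A \<otimes>\<^sub>m B) C \<circ>\<^sub>F (elem_tensor A B \<times>\<^sub>F fid))
          (elem_tensor A (B \<otimes>\<^sub>m C) \<circ>\<^sub>F (fid \<times>\<^sub>F elem_tensor B C) \<circ>\<^sub>F prod_assoc)"
    using star_bifunctorD(3)[OF eAB]
    unfolding fun_eq_def by (auto simp: E comp1 P_def prod_assoc_def)
  moreover have "star_functor ((A \<otimes>\<^sub>m B) \<otimes>\<^sub>m C) D \<Phi>"
    unfolding \<Phi>_def by (rule star_functor_tensor_extend[OF AB C D bif])
  ultimately have "star_functor ((A \<otimes>\<^sub>m B) \<otimes>\<^sub>m C) (A \<otimes>\<^sub>m (B \<otimes>\<^sub>m C)) (tensor_assoc A B C) \<and>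
    fun_eq ((A \<times>\<^sub>C B) \<times>\<^sub>C C) (tensor_assoc A B C \<circ>\<^sub>F elem_tensor (A \<otimes>\<^sub>m B) C \<circ>\<^sub>F (elem_tensor A B \<times>\<^sub>F fid))
          (elem_tensor A (B \<otimes>\<^sub>m C) \<circ>\<^sub>F (fid \<times>\<^sub>F elem_tensor B C) \<circ>\<^sub>F prod_assoc)"
    unfolding tensor_assoc_def D_def
    by (intro someI[where P = "\<lambda>\<Phi>. star_functor ((A \<otimes>\<^sub>m B) \<otimes>\<^sub>m C) (A \<otimes>\<^sub>m (B \<otimes>\<^sub>m C)) \<Phi> \<and>
        fun_eq ((A \<times>\<^sub>C B) \<times>\<^sub>C C) (\<Phi> \<circ>\<^sub>F elem_tensor (A \<otimes>\<^sub>m B) C \<circ>\<^sub>F (elem_tensor A B \<times>\<^sub>F fid))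
          (elem_tensor A (B \<otimes>\<^sub>m C) \<circ>\<^sub>F (fid \<times>\<^sub>F elem_tensor B C) \<circ>\<^sub>F prod_assoc)"] conjI)
  then show "star_functor ((A \<otimes>\<^sub>m B) \<otimes>\<^sub>m C) (A \<otimes>\<^sub>m (B \<otimes>\<^sub>m C)) (tensor_assoc A B C)"
    "fun_eq ((A \<times>\<^sub>C B) \<times>\<^sub>C C) (tensor_assoc A B C \<circ>\<^sub>F elem_tensor (A \<otimes>\<^sub>m B) C \<circ>\<^sub>F (elem_tensor A B \<times>\<^sub>F fid))
          (elem_tensor A (B \<otimes>\<^sub>m C) \<circ>\<^sub>F (fid \<times>\<^sub>F elem_tensor B C) \<circ>\<^sub>F prod_assoc)" by auto
qed

lemma tensor_assoc_eval:
  assumes A: "cstar_category A" and B: "cstar_category B" and C: "cstar_category C"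
    and ob: "x \<in> Ob A" "y \<in> Ob B" "z \<in> Ob C"
  shows "FOb (tensor_assoc A B C) ((x, y), z) = (x, (y, z))"
    and "\<lbrakk>x' \<in> Ob A; y' \<in> Ob B; z' \<in> Ob C; a \<in> Hom A x x'; b \<in> Hom B y y'; c \<in> Hom C z z'\<rbrakk> \<Longrightarrow>
      FArr (tensor_assoc A B C) ((x, y), z) ((x', y'), z')
        (FArr (elem_tensor (A \<otimes>\<^sub>m B) C) ((x, y), z) ((x', y'), z') (FArr (elem_tensor A B) (x, y) (x', y') (a, b), c))
      = FArr (elem_tensor A (B \<otimes>\<^sub>m C)) (x, (y, z)) (x', (y', z')) (a, FArr (elem_tensor B C) (y, z) (y', z') (b, c))"
  using fun_eqD(1)[OF tensor_assoc(2)[OF A B C], of "((x, y), z)"]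
    fun_eqD(2)[OF tensor_assoc(2)[OF A B C], of "((x, y), z)" "((x', y'), z')" "((a, b), c)"] ob
  by (simp_all add: prod_assoc_def)


section \<open>The unit\<close>

text \<open>Completeness is not among the class axioms; it comes from the reals through the
  coordinates in a + b i, whose absolute values are bounded by the norm of the scalar.\<close>

lemma scalar_complete:
  fixes s :: "nat \<Rightarrow> 'f::real_or_complex"
  assumes "Cauchy s" shows "convergent s"
  using real_or_complex[where 'a = 'f]
proof (elim disjE exE conjE)
  assume "\<forall>x::'f. \<exists>a. x = a *\<^sub>R 1"
  then have "\<forall>n. \<exists>a. s n = a *\<^sub>R 1" by blast
  from choice[OF this] obtain a where a: "\<And>n. s n = a n *\<^sub>R 1" by blast
  have "norm (s m - s n) = \<bar>a m - a n\<bar>" for m n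
    unfolding a by (simp flip: scaleR_left_diff_distrib)
  then have "Cauchy a" using assms by (simp add: Cauchy_def dist_norm)
  then obtain l where "a \<longlonglongrightarrow> l" using Cauchy_convergent convergent_def by blast
  then have "(\<lambda>n. a n *\<^sub>R (1::'f)) \<longlonglongrightarrow> l *\<^sub>R 1" by (intro tendsto_intros)
  then show ?thesis unfolding convergent_def using a by (intro exI[of _ "l *\<^sub>R 1"]) presburger
next
  fix i :: 'f assume i: "i * i = - 1" "conjg i = - i" and "\<forall>x. \<exists>a b. x = a *\<^sub>R 1 + b *\<^sub>R i"
  then have "\<forall>n. \<exists>p. s n = fst p *\<^sub>R 1 + snd p *\<^sub>R i" by fastforce
  from choice[OF this] obtain p where p: "\<And>n. s n = fst (p n) *\<^sub>R 1 + snd (p n) *\<^sub>R i" by blast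
  define a where "a n = fst (p n)" for n
  define b where "b n = snd (p n)" for n
  have ab: "s n = a n *\<^sub>R 1 + b n *\<^sub>R i" for n by (simp add: p a_def b_def)
  have n: "(norm (c *\<^sub>R 1 + d *\<^sub>R i))\<^sup>2 = c\<^sup>2 + d\<^sup>2" for c d
  proof -
    have "conjg (c *\<^sub>R 1 + d *\<^sub>R i) = c *\<^sub>R 1 - d *\<^sub>R i"
      using conjg_mult[of "d *\<^sub>R 1" i] i by (simp add: conjg_add conjg_real)
    then have "(norm (c *\<^sub>R 1 + d *\<^sub>R i))\<^sup>2 *\<^sub>R (1::'f) = (c *\<^sub>R 1 + d *\<^sub>R i) * (c *\<^sub>R 1 - d *\<^sub>R i)"
      using mult_conjg[of "c *\<^sub>R 1 + d *\<^sub>R i"] by simp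
    also have "\<dots> = (c\<^sup>2 + d\<^sup>2) *\<^sub>R 1"
      using i by (simp add: algebra_simps power2_eq_square)
    finally show ?thesis by (simp only: scaleR_cancel_right) simp
  qed
  have le: "\<bar>c\<bar> \<le> norm (c *\<^sub>R 1 + d *\<^sub>R i)" "\<bar>d\<bar> \<le> norm (c *\<^sub>R 1 + d *\<^sub>R i)" for c d
    by (rule power2_le_imp_le; simp add: n)+
  have diff: "s m - s n = (a m - a n) *\<^sub>R 1 + (b m - b n) *\<^sub>R i" for m n
    unfolding ab by (simp add: algebra_simps)
  have "\<bar>a m - a n\<bar> \<le> norm (s m - s n)" "\<bar>b m - b n\<bar> \<le> norm (s m - s n)" for m n
    unfolding diff by (rule le)+
  then have "Cauchy a" "Cauchy b"
    using assms unfolding Cauchy_def dist_norm real_norm_def by (meson le_less_trans)+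
  then obtain l k where "a \<longlonglongrightarrow> l" "b \<longlonglongrightarrow> k" using Cauchy_convergent convergent_def by metis
  then have "(\<lambda>n. a n *\<^sub>R 1 + b n *\<^sub>R i) \<longlonglongrightarrow> l *\<^sub>R 1 + k *\<^sub>R i" by (intro tendsto_intros)
  then show ?thesis unfolding convergent_def using ab by (intro exI[of _ "l *\<^sub>R 1 + k *\<^sub>R i"]) presburger
qed

lemma unit_cstar_simps [simp]:
  "Ob (unit_cstar K) = {()}" "Hom (unit_cstar K) x y = UNIV" "Idt (unit_cstar K) x = 1"
  "Cmp (unit_cstar K) x y z = (*)" "Add (unit_cstar K) x y = (+)" "Zer (unit_cstar K) x y = 0"
  "Scl (unit_cstar K) x y = (*)" "Str (unit_cstar K) x y = conjg" "Nrm (unit_cstar K) x y = norm"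
  by (simp_all add: unit_cstar_def)

lemma cstar_category_unit_cstar: "cstar_category (unit_cstar (K :: 'f::real_or_complex itself))"
proof (intro cstar_category.intro star_category.intro category.intro star_category_axioms.intro
    cstar_category_axioms.intro)
  fix x y :: unit
  have "\<exists>b. a + b = 0" for a :: 'f by (rule exI[of _ "- a"]) simp
  then show "vect_space (Hom (unit_cstar K) x y) (Add (unit_cstar K) x y) (Zer (unit_cstar K) x y) (Scl (unit_cstar K) x y)"
    by unfold_locales (auto simp: algebra_simps)
  fix s :: "nat \<Rightarrow> 'f" assume "hom_Cauchy (unit_cstar K) (Nrm (unit_cstar K)) x y s"
  then have "Cauchy s" by (simp add: hom_Cauchy_def Cauchy_def dist_norm Sub_def)
  then obtain a where "s \<longlonglongrightarrow> a" using scalar_complete convergent_def by blast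
  then have "(\<lambda>n. norm (s n - a)) \<longlonglongrightarrow> 0" by (simp add: LIM_zero_iff tendsto_norm_zero_iff)
  then show "\<exists>a\<in>Hom (unit_cstar K) x y. (\<lambda>n. Nrm (unit_cstar K) x y (Sub (unit_cstar K) x y (s n) a)) \<longlonglongrightarrow> 0"
    by (intro bexI[of _ a]) (auto simp: Sub_def)
next
  fix x y :: unit and a :: 'f
  show "spectrum (unit_cstar K) x (Cmp (unit_cstar K) x y x (Str (unit_cstar K) x y a) a) \<subseteq> of_real ` {0..}"
  proof
    fix z assume z: "z \<in> spectrum (unit_cstar K) x (Cmp (unit_cstar K) x y x (Str (unit_cstar K) x y a) a)"
    have "conjg a * a - z = 0"
    proof (rule ccontr)
      assume "conjg a * a - z \<noteq> 0"
      then have "is_inverse (unit_cstar K) x x (conjg a * a - z) (inverse (conjg a * a - z))"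
        by (simp add: is_inverse_def)
      then show False using z by (auto simp: spectrum_def Sub_def)
    qed
    then show "z \<in> of_real ` {0..}" using conjg_mult_self[of a] by (auto intro!: image_eqI[of _ _ "(norm a)\<^sup>2"])
  qed
qed (auto simp: algebra_simps conjg_add conjg_mult norm_mult norm_triangle_ineq power2_eq_square)

lemma total_unit_cstar: "total (unit_cstar (K :: 'f::real_or_complex itself)) (\<lambda>_ _. {1})"
  unfolding total_def closed_subspace_def by simp (metis mult.right_neutral subsetI)

lemma star_bifunctor_scalar_left:
  assumes A: "cstar_category (A :: ('o, 'a, 'f::real_or_complex) cstar_cat)"
  shows "star_bifunctor (unit_cstar TYPE('f)) A A \<lparr>FOb = snd, FArr = (\<lambda>p q (z, a). Scl A (snd p) (snd q) z a)\<rparr>"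
proof -
  interpret A: cstar_category A by (rule A)
  show ?thesis
    by (rule star_bifunctorI)
      (simp_all add: A.hom_closed A.hom_scl_one A.comp_scl_left A.comp_scl_right A.hom_scl_scl A.hom_add_scl
        A.hom_scl_add A.star_scl mult.commute)
qed

lemma star_bifunctor_scalar_right:
  assumes A: "cstar_category (A :: ('o, 'a, 'f::real_or_complex) cstar_cat)"
  shows "star_bifunctor A (unit_cstar TYPE('f)) A \<lparr>FOb = fst, FArr = (\<lambda>p q (a, z). Scl A (fst p) (fst q) z a)\<rparr>"
proof -
  interpret A: cstar_category A by (rule A)
  show ?thesis
    by (rule star_bifunctorI)
      (simp_all add: A.hom_closed A.hom_scl_one A.comp_scl_left A.comp_scl_right A.hom_scl_scl A.hom_add_scl
        A.hom_scl_add A.star_scl mult.commute)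
qed


section \<open>The monoidal structure of the maximal groupoid C*-category\<close>

lemma groupoid_prod:
  assumes G: "groupoid G" and H: "groupoid H" shows "groupoid (G \<times>\<^sub>C H)"
proof (intro groupoid.intro category_prod groupoid_axioms.intro)
  interpret G: groupoid G by (rule G)
  interpret H: groupoid H by (rule H)
  show "category G" "category H" by (rule G.category_axioms, rule H.category_axioms)
  fix p q f assume "p \<in> Ob (G \<times>\<^sub>C H)" "q \<in> Ob (G \<times>\<^sub>C H)" "f \<in> Hom (G \<times>\<^sub>C H) p q"
  then have "is_inverse (G \<times>\<^sub>C H) p q f
      (inverse_arr G (fst p) (fst q) (fst f), inverse_arr H (snd p) (snd q) (snd f))"
    by (auto simp: is_inverse_def G.inverse_arr_props H.inverse_arr_props)
  then show "\<exists>g. is_inverse (G \<times>\<^sub>C H) p q f g" by blast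
qed

lemma one_gpd_simps [simp]:
  "Ob one_gpd = {()}" "Hom one_gpd x y = {()}" "Idt one_gpd x = ()" "Cmp one_gpd x y z g f = ()"
  by (simp_all add: one_gpd_def)

lemma groupoid_one_gpd: "groupoid one_gpd"
  by unfold_locales (auto simp: is_inverse_def)

lemma unitary_functor_precompose:
  assumes "unitary_functor H A F" "is_functor G H \<phi>"
  shows "unitary_functor G A (F \<circ>\<^sub>F \<phi>)"
  using assms unfolding unitary_functor_def is_functor_def by simp

lemma Cmax_extend_eval:
  assumes G: "groupoid G" and B: "cstar_category B" and F: "unitary_functor G B F"
  shows "star_functor (Cmax K G) B (Cmax_extend K G B F)"
    and "x \<in> Ob G \<Longrightarrow> FOb (Cmax_extend K G B F) x = FOb F x"
    and "\<lbrakk>x \<in> Ob G; y \<in> Ob G; g \<in> Hom G x y\<rbrakk> \<Longrightarrow> FArr (Cmax_extend K G B F) x y (FArr (gpd_rho K G) x y g) = FArr F x y g"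
  using groupoid.Cmax_extend(1)[OF G B F] fun_eqD[OF groupoid.Cmax_extend(2)[OF G B F]]
  by (simp_all add: groupoid.FOb_gpd_rho[OF G])

lemma Cmax_fun:
  assumes G: "groupoid G" and H: "groupoid H" and \<phi>: "is_functor G H \<phi>"
  shows "star_functor (Cmax K G) (Cmax K H) (Cmax_fun K G H \<phi>)"
    and "x \<in> Ob G \<Longrightarrow> FOb (Cmax_fun K G H \<phi>) x = FOb \<phi> x"
    and "\<lbrakk>x \<in> Ob G; y \<in> Ob G; g \<in> Hom G x y\<rbrakk> \<Longrightarrow> FArr (Cmax_fun K G H \<phi>) x y (FArr (gpd_rho K G) x y g)
      = FArr (gpd_rho K H) (FOb \<phi> x) (FOb \<phi> y) (FArr \<phi> x y g)"
  using Cmax_extend_eval[OF G groupoid.cstar_category_Cmax[OF H]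
      unitary_functor_precompose[OF groupoid.unitary_functor_gpd_rho[OF H] \<phi>], where K = K]
  unfolding Cmax_fun_def by (simp_all add: groupoid.FOb_gpd_rho[OF H])

lemma gpd_rhoD:
  assumes G: "groupoid G"
  shows "\<lbrakk>x \<in> Ob G; y \<in> Ob G; g \<in> Hom G x y\<rbrakk> \<Longrightarrow> FArr (gpd_rho K G) x y g \<in> Hom (Cmax K G) x y"
    and "x \<in> Ob G \<Longrightarrow> FArr (gpd_rho K G) x x (Idt G x) = Idt (Cmax K G) x"
    and "\<lbrakk>x \<in> Ob G; y \<in> Ob G; z \<in> Ob G; g \<in> Hom G x y; h \<in> Hom G y z\<rbrakk> \<Longrightarrow>
      Cmp (Cmax K G) x y z (FArr (gpd_rho K G) y z h) (FArr (gpd_rho K G) x y g) = FArr (gpd_rho K G) x z (Cmp G x y z h g)"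
    and "\<lbrakk>x \<in> Ob G; y \<in> Ob G; g \<in> Hom G x y\<rbrakk> \<Longrightarrow> unitary (Cmax K G) x y (FArr (gpd_rho K G) x y g)"
  using groupoid.unitary_functor_gpd_rho[OF G, of K]
  unfolding unitary_functor_def is_functor_def by (simp_all add: groupoid.FOb_gpd_rho[OF G])

lemma Cmax_eqI:
  assumes G: "groupoid G" and B: "cstar_category (B :: ('p, 'b, 'f::real_or_complex) cstar_cat)"
    and "star_functor (Cmax K G) B \<Phi>" "star_functor (Cmax K G) B \<Psi>"
    and "\<And>x. x \<in> Ob G \<Longrightarrow> FOb \<Phi> x = FOb \<Psi> x"
    and "\<And>x y g. \<lbrakk>x \<in> Ob G; y \<in> Ob G; g \<in> Hom G x y\<rbrakk>
      \<Longrightarrow> FArr \<Phi> x y (FArr (gpd_rho K G) x y g) = FArr \<Psi> x y (FArr (gpd_rho K G) x y g)"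
  shows "fun_eq (Cmax K G) \<Phi> \<Psi>"
  using assms
  by (intro star_functor_eqI[OF groupoid.cstar_category_Cmax[OF G] B _ _ groupoid.total_Cmax[OF G]])
    (auto simp: groupoid.Ob_Cmax[OF G])

lemma unitary_functor_bifunctor:
  assumes A: "star_category A" and B: "star_category B" and T: "star_bifunctor A B D T"
    and F: "unitary_functor G A F" and F': "unitary_functor H B F'"
  shows "unitary_functor (G \<times>\<^sub>C H) D (T \<circ>\<^sub>F (F \<times>\<^sub>F F'))"
proof -
  interpret A: star_category A by (rule A)
  interpret B: star_category B by (rule B)
  note TD = star_bifunctorD[OF T]
  have Fu: "x \<in> Ob G \<Longrightarrow> FOb F x \<in> Ob A"
      "\<lbrakk>x \<in> Ob G; y \<in> Ob G; g \<in> Hom G x y\<rbrakk> \<Longrightarrow> FArr F x y g \<in> Hom A (FOb F x) (FOb F y)"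
      "x \<in> Ob G \<Longrightarrow> FArr F x x (Idt G x) = Idt A (FOb F x)"
      "\<lbrakk>x \<in> Ob G; y \<in> Ob G; z \<in> Ob G; g \<in> Hom G x y; h \<in> Hom G y z\<rbrakk> \<Longrightarrow>
        FArr F x z (Cmp G x y z h g) = Cmp A (FOb F x) (FOb F y) (FOb F z) (FArr F y z h) (FArr F x y g)"
      "\<lbrakk>x \<in> Ob G; y \<in> Ob G; g \<in> Hom G x y\<rbrakk> \<Longrightarrow> unitary A (FOb F x) (FOb F y) (FArr F x y g)" for x y z g h
    using F by (auto simp: unitary_functor_def is_functor_def)
  have Fu': "x \<in> Ob H \<Longrightarrow> FOb F' x \<in> Ob B"
      "\<lbrakk>x \<in> Ob H; y \<in> Ob H; g \<in> Hom H x y\<rbrakk> \<Longrightarrow> FArr F' x y g \<in> Hom B (FOb F' x) (FOb F' y)"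
      "x \<in> Ob H \<Longrightarrow> FArr F' x x (Idt H x) = Idt B (FOb F' x)"
      "\<lbrakk>x \<in> Ob H; y \<in> Ob H; z \<in> Ob H; g \<in> Hom H x y; h \<in> Hom H y z\<rbrakk> \<Longrightarrow>
        FArr F' x z (Cmp H x y z h g) = Cmp B (FOb F' x) (FOb F' y) (FOb F' z) (FArr F' y z h) (FArr F' x y g)"
      "\<lbrakk>x \<in> Ob H; y \<in> Ob H; g \<in> Hom H x y\<rbrakk> \<Longrightarrow> unitary B (FOb F' x) (FOb F' y) (FArr F' x y g)" for x y z g h
    using F' by (auto simp: unitary_functor_def is_functor_def)
  have u: "unitary D (FOb T (x, y)) (FOb T (x', y')) (FArr T (x, y) (x', y') (a, b))"
    if "x \<in> Ob A" "y \<in> Ob B" "x' \<in> Ob A" "y' \<in> Ob B" "unitary A x x' a" "unitary B y y' b" for x y x' y' a b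
    using that unfolding unitary_def
    by (simp add: TD(3,4) A.star_closed B.star_closed flip: TD(5,10))
  show ?thesis
    unfolding unitary_functor_def is_functor_def by (auto simp: TD(2,3,4,5) Fu Fu' intro!: u)
qed

section \<open>The comparison functor and its inverse\<close>

locale gpd_pair = G: groupoid G + H: groupoid H for G :: "('o, 'g) cat" and H :: "('p, 'h) cat" +
  fixes K :: "'f::real_or_complex itself"
begin

lemmas cG = G.cstar_category_Cmax[of K] and cH = H.cstar_category_Cmax[of K]
  and GH = groupoid_prod[OF G.groupoid_axioms H.groupoid_axioms]
lemmas cGH = groupoid.cstar_category_Cmax[OF GH, of K]
  and cT = cstar_category_max_tensor[OF cG cH]
  and eT = star_bifunctor_elem_tensor[OF cG cH]

abbreviation e where "e \<equiv> FArr (elem_tensor (Cmax K G) (Cmax K H))"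
abbreviation r where "r \<equiv> FArr (gpd_rho K G)"
abbreviation s where "s \<equiv> FArr (gpd_rho K H)"
abbreviation rs where "rs \<equiv> FArr (gpd_rho K (G \<times>\<^sub>C H))"

lemma unitary_functor_gpd_tensor: "unitary_functor (G \<times>\<^sub>C H) (Cmax K G \<otimes>\<^sub>m Cmax K H) (gpd_tensor K G H)"
  unfolding gpd_tensor_def using cG cH
  by (intro unitary_functor_bifunctor[OF _ _ eT] G.unitary_functor_gpd_rho H.unitary_functor_gpd_rho)
    (auto simp: cstar_category_def)

lemma gpd_mu:
  shows "star_functor (Cmax K (G \<times>\<^sub>C H)) (Cmax K G \<otimes>\<^sub>m Cmax K H) (gpd_mu K G H)"
    and "p \<in> Ob G \<times> Ob H \<Longrightarrow> FOb (gpd_mu K G H) p = p"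
    and "\<lbrakk>x \<in> Ob G; y \<in> Ob H; x' \<in> Ob G; y' \<in> Ob H; g \<in> Hom G x x'; h \<in> Hom H y y'\<rbrakk>
      \<Longrightarrow> FArr (gpd_mu K G H) (x, y) (x', y') (rs (x, y) (x', y') (g, h)) = e (x, y) (x', y') (r x x' g, s y y' h)"
  using Cmax_extend_eval[OF GH cT unitary_functor_gpd_tensor, where K = K, folded gpd_mu_def]
  by (auto simp: gpd_tensor_def)

text \<open>There is one inclusion for each object of the other factor, which gives the indexed
  family required by \<open>star_bifunctor_commuting_pair\<close>.\<close>

definition incl_left :: "'p \<Rightarrow> ('o, 'g, 'o \<times> 'p, 'g \<times> 'h) fnct" where
  "incl_left y = \<lparr>FOb = (\<lambda>x. (x, y)), FArr = (\<lambda>x x' g. (g, Idt H y))\<rparr>"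

definition incl_right :: "'o \<Rightarrow> ('p, 'h, 'o \<times> 'p, 'g \<times> 'h) fnct" where
  "incl_right x = \<lparr>FOb = (\<lambda>y. (x, y)), FArr = (\<lambda>y y' h. (Idt G x, h))\<rparr>"

lemma incl: "y \<in> Ob H \<Longrightarrow> is_functor G (G \<times>\<^sub>C H) (incl_left y)" "x \<in> Ob G \<Longrightarrow> is_functor H (G \<times>\<^sub>C H) (incl_right x)"
  by (simp_all add: is_functor_def incl_left_def incl_right_def G.id_closed H.id_closed G.comp_id_left H.comp_id_left)

abbreviation \<alpha> where "\<alpha> y \<equiv> Cmax_fun K G (G \<times>\<^sub>C H) (incl_left y)"
abbreviation \<beta> where "\<beta> x \<equiv> Cmax_fun K H (G \<times>\<^sub>C H) (incl_right x)"

lemma \<alpha>: "y \<in> Ob H \<Longrightarrow> star_functor (Cmax K G) (Cmax K (G \<times>\<^sub>C H)) (\<alpha> y)"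
    "\<lbrakk>y \<in> Ob H; x \<in> Ob G\<rbrakk> \<Longrightarrow> FOb (\<alpha> y) x = (x, y)"
    "\<lbrakk>y \<in> Ob H; x \<in> Ob G; x' \<in> Ob G; g \<in> Hom G x x'\<rbrakk> \<Longrightarrow> FArr (\<alpha> y) x x' (r x x' g) = rs (x, y) (x', y) (g, Idt H y)"
  using Cmax_fun[OF G.groupoid_axioms GH incl(1)[of y], where K = K] by (simp_all add: incl_left_def)

lemma \<beta>: "x \<in> Ob G \<Longrightarrow> star_functor (Cmax K H) (Cmax K (G \<times>\<^sub>C H)) (\<beta> x)"
    "\<lbrakk>x \<in> Ob G; y \<in> Ob H\<rbrakk> \<Longrightarrow> FOb (\<beta> x) y = (x, y)"
    "\<lbrakk>x \<in> Ob G; y \<in> Ob H; y' \<in> Ob H; h \<in> Hom H y y'\<rbrakk> \<Longrightarrow> FArr (\<beta> x) y y' (s y y' h) = rs (x, y) (x, y') (Idt G x, h)"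
  using Cmax_fun[OF H.groupoid_axioms GH incl(2)[of x], where K = K] by (simp_all add: incl_right_def)

text \<open>For group elements both sides are the image of (g, h), because (g, 1)(1, h) = (1, h)(g,
  1) in the product groupoid. Density then frees a while b is still a generator, and afterwards
  b.\<close>

lemma \<alpha>_\<beta>_commute:
  assumes ob: "x \<in> Ob G" "y \<in> Ob H" "x' \<in> Ob G" "y' \<in> Ob H"
    and a: "a \<in> Hom (Cmax K G) x x'" and b: "b \<in> Hom (Cmax K H) y y'"
  shows "Cmp (Cmax K (G \<times>\<^sub>C H)) (x, y) (x, y') (x', y') (FArr (\<alpha> y') x x' a) (FArr (\<beta> x) y y' b)
    = Cmp (Cmax K (G \<times>\<^sub>C H)) (x, y) (x', y) (x', y') (FArr (\<beta> x') y y' b) (FArr (\<alpha> y) x x' a)"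
proof -
  let ?D = "Cmax K (G \<times>\<^sub>C H)"
  have obD: "(x, y) \<in> Ob ?D" "(x, y') \<in> Ob ?D" "(x', y) \<in> Ob ?D" "(x', y') \<in> Ob ?D"
    using ob by (simp_all add: groupoid.Ob_Cmax[OF GH])
  have obG: "x \<in> Ob (Cmax K G)" "x' \<in> Ob (Cmax K G)" and obH: "y \<in> Ob (Cmax K H)" "y' \<in> Ob (Cmax K H)"
    using ob by simp_all
  have \<alpha>lin: "bounded_linear_hom (Cmax K G) x x' ?D (x, v) (x', v) (FArr (\<alpha> v) x x')" if "v \<in> Ob H" for v
    using bounded_linear_hom_star_functor[OF cG cGH \<alpha>(1)[OF that] obG] ob that by (simp add: \<alpha>)
  have \<beta>lin: "bounded_linear_hom (Cmax K H) y y' ?D (u, y) (u, y') (FArr (\<beta> u) y y')" if "u \<in> Ob G" for u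
    using bounded_linear_hom_star_functor[OF cH cGH \<beta>(1)[OF that] obH] ob that by (simp add: \<beta>)
  note \<alpha>c = bounded_linear_homD(1)[OF \<alpha>lin] and \<beta>c = bounded_linear_homD(1)[OF \<beta>lin]
  have 1: "Cmp ?D (x, y) (x, y') (x', y') (FArr (\<alpha> y') x x' (r x x' g)) (FArr (\<beta> x) y y' (s y y' h))
    = Cmp ?D (x, y) (x', y) (x', y') (FArr (\<beta> x') y y' (s y y' h)) (FArr (\<alpha> y) x x' (r x x' g))"
    if "g \<in> Hom G x x'" "h \<in> Hom H y y'" for g h
    using ob that by (simp add: \<alpha> \<beta> gpd_rhoD(3)[OF GH] G.id_closed H.id_closed G.comp_id_left G.comp_id_right
        H.comp_id_left H.comp_id_right)
  have 2: "Cmp ?D (x, y) (x, y') (x', y') (FArr (\<alpha> y') x x' a) (FArr (\<beta> x) y y' (s y y' h))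
    = Cmp ?D (x, y) (x', y) (x', y') (FArr (\<beta> x') y y' (s y y' h)) (FArr (\<alpha> y) x x' a)"
    if h: "h \<in> Hom H y y'" for h
  proof (rule bounded_linear_hom_eqI[OF cG obG cGH obD(1,4) _ _ G.total_Cmax _ a])
    have sh: "s y y' h \<in> Hom (Cmax K H) y y'" using gpd_rhoD(1)[OF H.groupoid_axioms ob(2,4) h] .
    show "bounded_linear_hom (Cmax K G) x x' ?D (x, y) (x', y')
        (\<lambda>a. Cmp ?D (x, y) (x, y') (x', y') (FArr (\<alpha> y') x x' a) (FArr (\<beta> x) y y' (s y y' h)))"
      by (rule bounded_linear_hom_compose[OF cGH obD(2,4) \<alpha>lin[OF ob(4)]
            bounded_linear_hom_comp_right[OF cGH obD(1,2,4) \<beta>c[OF ob(1) sh]]])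
    show "bounded_linear_hom (Cmax K G) x x' ?D (x, y) (x', y')
        (\<lambda>a. Cmp ?D (x, y) (x', y) (x', y') (FArr (\<beta> x') y y' (s y y' h)) (FArr (\<alpha> y) x x' a))"
      by (rule bounded_linear_hom_compose[OF cGH obD(1,3) \<alpha>lin[OF ob(2)]
            bounded_linear_hom_comp_left[OF cGH obD(1,3,4) \<beta>c[OF ob(3) sh]]])
  qed (use 1 h in auto)
  show ?thesis
  proof (rule bounded_linear_hom_eqI[OF cH obH cGH obD(1,4) _ _ H.total_Cmax _ b])
    show "bounded_linear_hom (Cmax K H) y y' ?D (x, y) (x', y')
        (\<lambda>b. Cmp ?D (x, y) (x, y') (x', y') (FArr (\<alpha> y') x x' a) (FArr (\<beta> x) y y' b))"
      by (rule bounded_linear_hom_compose[OF cGH obD(1,2) \<beta>lin[OF ob(1)]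
            bounded_linear_hom_comp_left[OF cGH obD(1,2,4) \<alpha>c[OF ob(4) a]]])
    show "bounded_linear_hom (Cmax K H) y y' ?D (x, y) (x', y')
        (\<lambda>b. Cmp ?D (x, y) (x', y) (x', y') (FArr (\<beta> x') y y' b) (FArr (\<alpha> y) x x' a))"
      by (rule bounded_linear_hom_compose[OF cGH obD(3,4) \<beta>lin[OF ob(3)]
            bounded_linear_hom_comp_right[OF cGH obD(1,3,4) \<alpha>c[OF ob(2) a]]])
  qed (use 2 in auto)
qed

text \<open>The candidate \<nu> sends the elementary tensor of g and h to the image of (g, 1)(1, h)
  = (g, h). Both composites with \<open>gpd_mu\<close> therefore fix a total family.\<close>

lemma ex_inverse_gpd_mu:
  "\<exists>\<nu>. is_inverse_functor (Cmax K (G \<times>\<^sub>C H)) (Cmax K G \<otimes>\<^sub>m Cmax K H) (gpd_mu K G H) \<nu>"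
proof -
  let ?D = "Cmax K (G \<times>\<^sub>C H)" and ?T = "Cmax K G \<otimes>\<^sub>m Cmax K H"
  define T where "T = \<lparr>FOb = (\<lambda>(x, y). (x, y)), FArr = (\<lambda>(x, y) (x', y') (a, b).
      Cmp ?D (x, y) (x, y') (x', y') (FArr (\<alpha> y') x x' a) (FArr (\<beta> x) y y' b))\<rparr>"
  have T: "star_bifunctor (Cmax K G) (Cmax K H) ?D T"
    unfolding T_def using cG cH cGH \<alpha> \<beta> \<alpha>_\<beta>_commute
    by (intro star_bifunctor_commuting_pair) (auto simp: cstar_category_def)
  define \<nu> where "\<nu> = tensor_extend (Cmax K G) (Cmax K H) ?D T"
  have \<nu>: "star_functor ?T ?D \<nu>" unfolding \<nu>_def by (rule star_functor_tensor_extend[OF cG cH cGH T])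
  have \<nu>_ob: "FOb \<nu> (x, y) = (x, y)" if "x \<in> Ob G" "y \<in> Ob H" for x y
    using tensor_extend_eval(1)[OF cG cH cGH T, of x y] that by (simp add: \<nu>_def T_def)
  have \<nu>_e: "FArr \<nu> (x, y) (x', y') (e (x, y) (x', y') (r x x' g, s y y' h)) = rs (x, y) (x', y') (g, h)"
    if "x \<in> Ob G" "y \<in> Ob H" "x' \<in> Ob G" "y' \<in> Ob H" "g \<in> Hom G x x'" "h \<in> Hom H y y'" for x y x' y' g h
    using tensor_extend_eval(2)[OF cG cH cGH T, of x y x' y' "r x x' g" "s y y' h"] that
    by (simp add: \<nu>_def T_def gpd_rhoD(1)[OF G.groupoid_axioms] gpd_rhoD(1)[OF H.groupoid_axioms] \<alpha> \<beta>
        gpd_rhoD(3)[OF GH] G.id_closed H.id_closed G.comp_id_right H.comp_id_left)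
  have "fun_eq ?D (\<nu> \<circ>\<^sub>F gpd_mu K G H) fid"
    by (rule Cmax_eqI[OF GH cGH star_functor_fcomp[OF gpd_mu(1) \<nu>] star_functor_fid])
      (auto simp: gpd_mu \<nu>_ob \<nu>_e)
  moreover have "fun_eq ?T (gpd_mu K G H \<circ>\<^sub>F \<nu>) fid"
    by (rule star_functor_eqI[OF cT cT star_functor_fcomp[OF \<nu> gpd_mu(1)] star_functor_fid
          total_max_tensor[OF cG cH G.total_Cmax H.total_Cmax]])
      (auto simp: gpd_mu \<nu>_ob \<nu>_e)
  ultimately show ?thesis
    unfolding is_inverse_functor_def cstar_arrow_def using \<nu> cT cGH by blast
qed

lemma is_inverse_gpd_mu_inv:
  "is_inverse_functor (Cmax K (G \<times>\<^sub>C H)) (Cmax K G \<otimes>\<^sub>m Cmax K H) (gpd_mu K G H) (gpd_mu_inv K G H)"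
  unfolding gpd_mu_inv_def inverse_functor_def by (rule someI_ex[OF ex_inverse_gpd_mu])

text \<open>The inverse is chosen by \<open>SOME\<close>, so its values on generators are read off
  from the equation saying that it is a left inverse of \<open>gpd_mu\<close>.\<close>

lemma gpd_mu_inv:
  shows "star_functor (Cmax K G \<otimes>\<^sub>m Cmax K H) (Cmax K (G \<times>\<^sub>C H)) (gpd_mu_inv K G H)"
    and "p \<in> Ob G \<times> Ob H \<Longrightarrow> FOb (gpd_mu_inv K G H) p = p"
    and "\<lbrakk>x \<in> Ob G; y \<in> Ob H; x' \<in> Ob G; y' \<in> Ob H; g \<in> Hom G x x'; h \<in> Hom H y y'\<rbrakk>
      \<Longrightarrow> FArr (gpd_mu_inv K G H) (x, y) (x', y') (e (x, y) (x', y') (r x x' g, s y y' h)) = rs (x, y) (x', y') (g, h)"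
proof -
  note I = is_inverse_gpd_mu_inv[unfolded is_inverse_functor_def cstar_arrow_def]
  show "star_functor (Cmax K G \<otimes>\<^sub>m Cmax K H) (Cmax K (G \<times>\<^sub>C H)) (gpd_mu_inv K G H)" using I by blast
  note E = fun_eqD[OF I[THEN conjunct2, THEN conjunct1], unfolded groupoid.Ob_Cmax[OF GH] prod_cat_simps]
  show "p \<in> Ob G \<times> Ob H \<Longrightarrow> FOb (gpd_mu_inv K G H) p = p" using E(1)[of p] by (simp add: gpd_mu)
  show "\<lbrakk>x \<in> Ob G; y \<in> Ob H; x' \<in> Ob G; y' \<in> Ob H; g \<in> Hom G x x'; h \<in> Hom H y y'\<rbrakk>
      \<Longrightarrow> FArr (gpd_mu_inv K G H) (x, y) (x', y') (e (x, y) (x', y') (r x x' g, s y y' h)) = rs (x, y) (x', y') (g, h)"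
    using E(2)[of "(x, y)" "(x', y')" "rs (x, y) (x', y') (g, h)"] gpd_rhoD(1)[OF GH, of "(x, y)" "(x', y')" "(g, h)" K]
    by (simp add: gpd_mu)
qed

end

text \<open>The inverse is the extension of the functor that sends the only arrow of the trivial
  groupoid to 1. Each composite is compared with the identity on one generator.\<close>

lemma gpd_eps:
  fixes K :: "'f::real_or_complex itself"
  shows "star_functor (unit_cstar K) (Cmax K one_gpd) (gpd_eps K)"
    and "FOb (gpd_eps K) () = ()" and "FArr (gpd_eps K) () () 1 = FArr (gpd_rho K one_gpd) () () ()"
    and "cstar_iso (unit_cstar K) (Cmax K one_gpd) (gpd_eps K)"
proof -
  interpret O: groupoid one_gpd by (rule groupoid_one_gpd)
  interpret C: cstar_category "Cmax K one_gpd" by (rule O.cstar_category_Cmax)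
  note C = C.hom_closed C.star_id C.comp_id_left C.hom_scl_one C.comp_scl_left C.comp_scl_right
    C.hom_scl_scl C.hom_add_scl C.star_scl
  show eps: "star_functor (unit_cstar K) (Cmax K one_gpd) (gpd_eps K)"
    unfolding star_functor_def is_functor_def by (simp add: gpd_eps_def C mult.commute)
  show FOb: "FOb (gpd_eps K) () = ()" by simp
  show one: "FArr (gpd_eps K) () () 1 = FArr (gpd_rho K one_gpd) () () ()"
    using gpd_rhoD(2)[OF groupoid_one_gpd, of "()" K] by (simp add: gpd_eps_def C)
  define F :: "(unit, unit, unit, 'f) fnct" where "F = \<lparr>FOb = (\<lambda>_. ()), FArr = (\<lambda>_ _ _. 1)\<rparr>"
  have F: "unitary_functor one_gpd (unit_cstar K) F"
    by (simp add: F_def unitary_functor_def is_functor_def unitary_def)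
  define G where "G = Cmax_extend K one_gpd (unit_cstar K) F"
  note G = Cmax_extend_eval[OF groupoid_one_gpd cstar_category_unit_cstar F, where K = K, folded G_def]
  have "fun_eq (unit_cstar K) (G \<circ>\<^sub>F gpd_eps K) fid"
    by (rule star_functor_eqI[OF cstar_category_unit_cstar[of K] cstar_category_unit_cstar[of K]
          star_functor_fcomp[OF eps G(1)] star_functor_fid total_unit_cstar[of K]])
      (use G(3)[of "()" "()" "()"] in \<open>auto simp: one F_def\<close>)
  moreover have "fun_eq (Cmax K one_gpd) (gpd_eps K \<circ>\<^sub>F G) fid"
    by (rule Cmax_eqI[OF groupoid_one_gpd O.cstar_category_Cmax star_functor_fcomp[OF G(1) eps] star_functor_fid])
      (use G(3)[of "()" "()" "()"] in \<open>auto simp: one F_def\<close>)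
  ultimately show "cstar_iso (unit_cstar K) (Cmax K one_gpd) (gpd_eps K)"
    unfolding cstar_iso_def is_inverse_functor_def cstar_arrow_def
    using eps G(1) cstar_category_unit_cstar O.cstar_category_Cmax by blast
qed

section \<open>The coherence identities\<close>

lemma cstar_arrow_eqI:
  assumes "cstar_category A" "cstar_category B" "star_functor A B F" "star_functor A B G" "fun_eq A F G"
  shows "cstar_arrow_eq A B F G"
  using assms by (simp add: cstar_arrow_eq_def cstar_arrow_def)

lemma is_functor_prod_fun: "\<lbrakk>is_functor G H \<phi>; is_functor G' H' \<psi>\<rbrakk> \<Longrightarrow> is_functor (G \<times>\<^sub>C G') (H \<times>\<^sub>C H') (\<phi> \<times>\<^sub>F \<psi>)"
  unfolding is_functor_def by (auto simp: prod_fun_def)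

lemma is_functor_fcomp: "\<lbrakk>is_functor G H \<phi>; is_functor H L \<psi>\<rbrakk> \<Longrightarrow> is_functor G L (\<psi> \<circ>\<^sub>F \<phi>)"
  unfolding is_functor_def by simp

lemma prod_structural_simps [simp]:
  "FOb prod_assoc ((x, y), z) = (x, (y, z))" "FArr prod_assoc p q ((f, g), h) = (f, (g, h))"
  "FOb prod_lunit p' = snd p'" "FArr prod_lunit p' q' f' = snd f'"
  "FOb prod_runit p'' = fst p''" "FArr prod_runit p'' q'' f'' = fst f''"
  by (simp_all add: prod_assoc_def prod_lunit_def prod_runit_def)

lemma is_functor_structural:
  "is_functor C C fid"
  "is_functor ((C \<times>\<^sub>C D) \<times>\<^sub>C E) (C \<times>\<^sub>C (D \<times>\<^sub>C E)) prod_assoc"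
  "is_functor (one_gpd \<times>\<^sub>C C) C prod_lunit" "is_functor (C \<times>\<^sub>C one_gpd) C prod_runit"
  "is_functor (C \<times>\<^sub>C D) (D \<times>\<^sub>C C) prod_swap"
  unfolding is_functor_def
  by auto

theorem theorem3p21:
  fixes K :: "'f::real_or_complex itself"
    and G1 :: "('o1, 'g1) cat" and G2 :: "('o2, 'g2) cat" and G3 :: "('o3, 'g3) cat"
  assumes "groupoid G1" and "groupoid G2" and "groupoid G3"
  shows
    \<comment> \<open>\<open>Cmax\<close> is a functor\<close>
    "cstar_category (Cmax K G1)
     \<and> (\<forall>(H :: ('p1, 'h1) cat) \<phi>. groupoid H \<and> is_functor G1 H \<phi> \<longrightarrow>
          cstar_arrow (Cmax K G1) (Cmax K H) (Cmax_fun K G1 H \<phi>)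
          \<and> fun_eq G1 (Cmax_fun K G1 H \<phi> \<circ>\<^sub>F gpd_rho K G1) (gpd_rho K H \<circ>\<^sub>F \<phi>))
     \<and> cstar_arrow_eq (Cmax K G1) (Cmax K G1) (Cmax_fun K G1 G1 fid) fid
     \<and> (\<forall>(H :: ('p1, 'h1) cat) (L :: ('q1, 'l1) cat) \<phi> \<psi>.
          groupoid H \<and> groupoid L \<and> is_functor G1 H \<phi> \<and> is_functor H L \<psi> \<longrightarrow>
          cstar_arrow_eq (Cmax K G1) (Cmax K L)
            (Cmax_fun K G1 L (\<psi> \<circ>\<^sub>F \<phi>)) (Cmax_fun K H L \<psi> \<circ>\<^sub>F Cmax_fun K G1 H \<phi>))

     \<comment> \<open>\<open>gpd_mu\<close> is the unique $*$-functor with \<open>(g\<^sub>1, g\<^sub>2) \<mapsto> g\<^sub>1 \<otimes> g\<^sub>2\<close>\<close>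
     \<and> unitary_functor (G1 \<times>\<^sub>C G2) (Cmax K G1 \<otimes>\<^sub>m Cmax K G2) (gpd_tensor K G1 G2)
     \<and> cstar_arrow (Cmax K (G1 \<times>\<^sub>C G2)) (Cmax K G1 \<otimes>\<^sub>m Cmax K G2) (gpd_mu K G1 G2)
     \<and> fun_eq (G1 \<times>\<^sub>C G2) (gpd_mu K G1 G2 \<circ>\<^sub>F gpd_rho K (G1 \<times>\<^sub>C G2)) (gpd_tensor K G1 G2)
     \<and> (\<forall>\<Phi>. cstar_arrow (Cmax K (G1 \<times>\<^sub>C G2)) (Cmax K G1 \<otimes>\<^sub>m Cmax K G2) \<Phi>
             \<and> fun_eq (G1 \<times>\<^sub>C G2) (\<Phi> \<circ>\<^sub>F gpd_rho K (G1 \<times>\<^sub>C G2)) (gpd_tensor K G1 G2)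
          \<longrightarrow> fun_eq (Cmax K (G1 \<times>\<^sub>C G2)) \<Phi> (gpd_mu K G1 G2))

     \<comment> \<open>it is a natural isomorphism\<close>
     \<and> cstar_iso (Cmax K (G1 \<times>\<^sub>C G2)) (Cmax K G1 \<otimes>\<^sub>m Cmax K G2) (gpd_mu K G1 G2)
     \<and> (\<forall>(H1 :: ('p1, 'h1) cat) (H2 :: ('p2, 'h2) cat) \<phi>1 \<phi>2.
          groupoid H1 \<and> groupoid H2 \<and> is_functor G1 H1 \<phi>1 \<and> is_functor G2 H2 \<phi>2 \<longrightarrow>
          cstar_arrow_eq (Cmax K (G1 \<times>\<^sub>C G2)) (Cmax K H1 \<otimes>\<^sub>m Cmax K H2)
            (tensor_fun (Cmax K G1) (Cmax K G2) (Cmax K H1) (Cmax K H2)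
               (Cmax_fun K G1 H1 \<phi>1) (Cmax_fun K G2 H2 \<phi>2) \<circ>\<^sub>F gpd_mu K G1 G2)
            (gpd_mu K H1 H2 \<circ>\<^sub>F Cmax_fun K (G1 \<times>\<^sub>C G2) (H1 \<times>\<^sub>C H2) (\<phi>1 \<times>\<^sub>F \<phi>2)))

     \<comment> \<open>unit isomorphism\<close>
     \<and> cstar_iso (unit_cstar K) (Cmax K one_gpd) (gpd_eps K)

     \<comment> \<open>compatibility with the associators\<close>
     \<and> cstar_arrow_eq ((Cmax K G1 \<otimes>\<^sub>m Cmax K G2) \<otimes>\<^sub>m Cmax K G3) (Cmax K (G1 \<times>\<^sub>C (G2 \<times>\<^sub>C G3)))
         (Cmax_fun K ((G1 \<times>\<^sub>C G2) \<times>\<^sub>C G3) (G1 \<times>\<^sub>C (G2 \<times>\<^sub>C G3)) prod_assoc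
          \<circ>\<^sub>F gpd_mu_inv K (G1 \<times>\<^sub>C G2) G3
          \<circ>\<^sub>F tensor_fun (Cmax K G1 \<otimes>\<^sub>m Cmax K G2) (Cmax K G3) (Cmax K (G1 \<times>\<^sub>C G2)) (Cmax K G3)
                (gpd_mu_inv K G1 G2) fid)
         (gpd_mu_inv K G1 (G2 \<times>\<^sub>C G3)
          \<circ>\<^sub>F tensor_fun (Cmax K G1) (Cmax K G2 \<otimes>\<^sub>m Cmax K G3) (Cmax K G1) (Cmax K (G2 \<times>\<^sub>C G3))
                fid (gpd_mu_inv K G2 G3)
          \<circ>\<^sub>F tensor_assoc (Cmax K G1) (Cmax K G2) (Cmax K G3))

     \<comment> \<open>compatibility with the left and right unitors\<close>
     \<and> cstar_arrow_eq (unit_cstar K \<otimes>\<^sub>m Cmax K G1) (Cmax K G1)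
         (Cmax_fun K (one_gpd \<times>\<^sub>C G1) G1 prod_lunit
          \<circ>\<^sub>F gpd_mu_inv K one_gpd G1
          \<circ>\<^sub>F tensor_fun (unit_cstar K) (Cmax K G1) (Cmax K one_gpd) (Cmax K G1) (gpd_eps K) fid)
         (tensor_lunit (Cmax K G1))
     \<and> cstar_arrow_eq (Cmax K G1 \<otimes>\<^sub>m unit_cstar K) (Cmax K G1)
         (Cmax_fun K (G1 \<times>\<^sub>C one_gpd) G1 prod_runit
          \<circ>\<^sub>F gpd_mu_inv K G1 one_gpd
          \<circ>\<^sub>F tensor_fun (Cmax K G1) (unit_cstar K) (Cmax K G1) (Cmax K one_gpd) fid (gpd_eps K))
         (tensor_runit (Cmax K G1))

     \<comment> \<open>compatibility with the symmetries\<close>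
     \<and> cstar_arrow_eq (Cmax K G1 \<otimes>\<^sub>m Cmax K G2) (Cmax K (G2 \<times>\<^sub>C G1))
         (Cmax_fun K (G1 \<times>\<^sub>C G2) (G2 \<times>\<^sub>C G1) prod_swap \<circ>\<^sub>F gpd_mu_inv K G1 G2)
         (gpd_mu_inv K G2 G1 \<circ>\<^sub>F tensor_swap (Cmax K G1) (Cmax K G2))"
proof -
  interpret G1: groupoid G1 by (rule assms)
  interpret G2: groupoid G2 by (rule assms)
  interpret G3: groupoid G3 by (rule assms)
  interpret P12: gpd_pair G1 G2 K ..
  interpret P21: gpd_pair G2 G1 K ..
  interpret P23: gpd_pair G2 G3 K ..
  note O = groupoid_one_gpd
  interpret O: groupoid one_gpd by (rule O)
  interpret PO1: gpd_pair one_gpd G1 K ..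
  interpret P1O: gpd_pair G1 one_gpd K ..
  interpret P12_3: gpd_pair "G1 \<times>\<^sub>C G2" G3 K
    by (intro gpd_pair.intro P12.GH assms)
  interpret P1_23: gpd_pair G1 "G2 \<times>\<^sub>C G3" K
    by (intro gpd_pair.intro P23.GH assms)
  note c1 = G1.cstar_category_Cmax[of K] and c2 = G2.cstar_category_Cmax[of K] and c3 = G3.cstar_category_Cmax[of K]
    and cO = O.cstar_category_Cmax[of K] and cK = cstar_category_unit_cstar[of K]
  note t1 = G1.total_Cmax[of K] and t2 = G2.total_Cmax[of K] and t3 = G3.total_Cmax[of K]
  note r1 = gpd_rhoD(1)[OF assms(1)] and r2 = gpd_rhoD(1)[OF assms(2)] and r3 = gpd_rhoD(1)[OF assms(3)]
    and rO = gpd_rhoD(1)[OF O]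
  note fid1 = star_functor_fid[of "Cmax K G1"] and fid3 = star_functor_fid[of "Cmax K G3"]
  show ?thesis
  proof (intro conjI allI impI)
    show "cstar_category (Cmax K G1)" by (rule c1)
  next
    fix H :: "('p1, 'h1) cat" and \<phi> assume "groupoid H \<and> is_functor G1 H \<phi>"
    then have H: "groupoid H" "is_functor G1 H \<phi>" by auto
    note F = Cmax_fun[OF assms(1) H, where K = K]
    show "cstar_arrow (Cmax K G1) (Cmax K H) (Cmax_fun K G1 H \<phi>)"
      using F(1) c1 groupoid.cstar_category_Cmax[OF H(1)] by (simp add: cstar_arrow_def)
    show "fun_eq G1 (Cmax_fun K G1 H \<phi> \<circ>\<^sub>F gpd_rho K G1) (gpd_rho K H \<circ>\<^sub>F \<phi>)"
      by (simp add: fun_eq_def F groupoid.FOb_gpd_rho[OF H(1)])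
  next
    note F = Cmax_fun[OF assms(1,1) is_functor_structural(1), where K = K]
    show "cstar_arrow_eq (Cmax K G1) (Cmax K G1) (Cmax_fun K G1 G1 fid) fid"
      by (intro cstar_arrow_eqI c1 F(1) fid1 Cmax_eqI[OF assms(1) c1]) (simp_all add: F)
  next
    fix H :: "('p1, 'h1) cat" and L :: "('q1, 'l1) cat" and \<phi> \<psi>
    assume "groupoid H \<and> groupoid L \<and> is_functor G1 H \<phi> \<and> is_functor H L \<psi>"
    then have H: "groupoid H" "groupoid L" "is_functor G1 H \<phi>" "is_functor H L \<psi>" by auto
    note F = Cmax_fun[OF assms(1) H(1,3), where K = K] Cmax_fun[OF H(1,2,4), where K = K]
      Cmax_fun[OF assms(1) H(2) is_functor_fcomp[OF H(3,4)], where K = K]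
    have "\<lbrakk>x \<in> Ob G1; y \<in> Ob G1; g \<in> Hom G1 x y\<rbrakk> \<Longrightarrow> FArr \<phi> x y g \<in> Hom H (FOb \<phi> x) (FOb \<phi> y)"
      and "x \<in> Ob G1 \<Longrightarrow> FOb \<phi> x \<in> Ob H" for x y g
      using H(3) by (auto simp: is_functor_def)
    then show "cstar_arrow_eq (Cmax K G1) (Cmax K L)
        (Cmax_fun K G1 L (\<psi> \<circ>\<^sub>F \<phi>)) (Cmax_fun K H L \<psi> \<circ>\<^sub>F Cmax_fun K G1 H \<phi>)"
      by (intro cstar_arrow_eqI c1 groupoid.cstar_category_Cmax[OF H(2), of K] F(7) star_functor_fcomp[OF F(1,4)]
          Cmax_eqI[OF assms(1) groupoid.cstar_category_Cmax[OF H(2), of K]]) (simp_all add: F)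
  next
    show "unitary_functor (G1 \<times>\<^sub>C G2) (Cmax K G1 \<otimes>\<^sub>m Cmax K G2) (gpd_tensor K G1 G2)"
      by (rule P12.unitary_functor_gpd_tensor)
    show mu: "cstar_arrow (Cmax K (G1 \<times>\<^sub>C G2)) (Cmax K G1 \<otimes>\<^sub>m Cmax K G2) (gpd_mu K G1 G2)"
      using P12.gpd_mu(1) P12.cGH P12.cT by (simp add: cstar_arrow_def)
    show mu_rho: "fun_eq (G1 \<times>\<^sub>C G2) (gpd_mu K G1 G2 \<circ>\<^sub>F gpd_rho K (G1 \<times>\<^sub>C G2)) (gpd_tensor K G1 G2)"
      by (auto simp: fun_eq_def P12.gpd_mu groupoid.FOb_gpd_rho[OF P12.GH] gpd_tensor_def)
    {
      fix \<Phi> assume "cstar_arrow (Cmax K (G1 \<times>\<^sub>C G2)) (Cmax K G1 \<otimes>\<^sub>m Cmax K G2) \<Phi>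
        \<and> fun_eq (G1 \<times>\<^sub>C G2) (\<Phi> \<circ>\<^sub>F gpd_rho K (G1 \<times>\<^sub>C G2)) (gpd_tensor K G1 G2)"
      then show "fun_eq (Cmax K (G1 \<times>\<^sub>C G2)) \<Phi> (gpd_mu K G1 G2)"
        using mu mu_rho unfolding cstar_arrow_def
        by (intro Cmax_eqI[OF P12.GH P12.cT]) (auto simp: fun_eq_def groupoid.FOb_gpd_rho[OF P12.GH])
    }
    show "cstar_iso (Cmax K (G1 \<times>\<^sub>C G2)) (Cmax K G1 \<otimes>\<^sub>m Cmax K G2) (gpd_mu K G1 G2)"
      unfolding cstar_iso_def using mu P12.ex_inverse_gpd_mu by blast
  next
    fix H1 :: "('p1, 'h1) cat" and H2 :: "('p2, 'h2) cat" and \<phi>1 \<phi>2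
    assume "groupoid H1 \<and> groupoid H2 \<and> is_functor G1 H1 \<phi>1 \<and> is_functor G2 H2 \<phi>2"
    then have H: "groupoid H1" "groupoid H2" "is_functor G1 H1 \<phi>1" "is_functor G2 H2 \<phi>2" by auto
    interpret PH: gpd_pair H1 H2 K using H by (intro gpd_pair.intro)
    note F1 = Cmax_fun[OF assms(1) H(1,3), where K = K] and F2 = Cmax_fun[OF assms(2) H(2,4), where K = K]
    note F = Cmax_fun[OF P12.GH PH.GH is_functor_prod_fun[OF H(3,4)], where K = K]
    note T = tensor_fun[OF c1 c2 PH.cG PH.cH F1(1) F2(1)]
    have \<phi>1: "\<lbrakk>x \<in> Ob G1; y \<in> Ob G1; g \<in> Hom G1 x y\<rbrakk> \<Longrightarrow> FArr \<phi>1 x y g \<in> Hom H1 (FOb \<phi>1 x) (FOb \<phi>1 y)"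
        "x \<in> Ob G1 \<Longrightarrow> FOb \<phi>1 x \<in> Ob H1" for x y g
      using H(3) by (auto simp: is_functor_def)
    have \<phi>2: "\<lbrakk>x \<in> Ob G2; y \<in> Ob G2; g \<in> Hom G2 x y\<rbrakk> \<Longrightarrow> FArr \<phi>2 x y g \<in> Hom H2 (FOb \<phi>2 x) (FOb \<phi>2 y)"
        "x \<in> Ob G2 \<Longrightarrow> FOb \<phi>2 x \<in> Ob H2" for x y g
      using H(4) by (auto simp: is_functor_def)
    show "cstar_arrow_eq (Cmax K (G1 \<times>\<^sub>C G2)) (Cmax K H1 \<otimes>\<^sub>m Cmax K H2)
            (tensor_fun (Cmax K G1) (Cmax K G2) (Cmax K H1) (Cmax K H2)
               (Cmax_fun K G1 H1 \<phi>1) (Cmax_fun K G2 H2 \<phi>2) \<circ>\<^sub>F gpd_mu K G1 G2)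
            (gpd_mu K H1 H2 \<circ>\<^sub>F Cmax_fun K (G1 \<times>\<^sub>C G2) (H1 \<times>\<^sub>C H2) (\<phi>1 \<times>\<^sub>F \<phi>2))"
      by (intro cstar_arrow_eqI P12.cGH PH.cT star_functor_fcomp[OF P12.gpd_mu(1) T(1)]
          star_functor_fcomp[OF F(1) PH.gpd_mu(1)] Cmax_eqI[OF P12.GH PH.cT])
        (auto simp: P12.gpd_mu PH.gpd_mu T F F1 F2 r1 r2 \<phi>1 \<phi>2)
  next
    show "cstar_iso (unit_cstar K) (Cmax K one_gpd) (gpd_eps K)" by (rule gpd_eps)
  next
    note A = Cmax_fun[OF P12_3.GH P1_23.GH is_functor_structural(2), where K = K]
    note L = tensor_fun[OF P12.cT c3 P12.cGH c3 P12.gpd_mu_inv(1) fid3]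
    note R = tensor_fun[OF c1 P23.cT c1 P23.cGH fid1 P23.gpd_mu_inv(1)]
    note S = tensor_assoc[OF c1 c2 c3] and SE = tensor_assoc_eval[OF c1 c2 c3]
    note e12 = star_bifunctorD(3)[OF P12.eT, simplified] and e23 = star_bifunctorD(3)[OF P23.eT, simplified]
    show "cstar_arrow_eq ((Cmax K G1 \<otimes>\<^sub>m Cmax K G2) \<otimes>\<^sub>m Cmax K G3) (Cmax K (G1 \<times>\<^sub>C (G2 \<times>\<^sub>C G3)))
         (Cmax_fun K ((G1 \<times>\<^sub>C G2) \<times>\<^sub>C G3) (G1 \<times>\<^sub>C (G2 \<times>\<^sub>C G3)) prod_assoc
          \<circ>\<^sub>F gpd_mu_inv K (G1 \<times>\<^sub>C G2) G3
          \<circ>\<^sub>F tensor_fun (Cmax K G1 \<otimes>\<^sub>m Cmax K G2) (Cmax K G3) (Cmax K (G1 \<times>\<^sub>C G2)) (Cmax K G3)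
                (gpd_mu_inv K G1 G2) fid)
         (gpd_mu_inv K G1 (G2 \<times>\<^sub>C G3)
          \<circ>\<^sub>F tensor_fun (Cmax K G1) (Cmax K G2 \<otimes>\<^sub>m Cmax K G3) (Cmax K G1) (Cmax K (G2 \<times>\<^sub>C G3))
                fid (gpd_mu_inv K G2 G3)
          \<circ>\<^sub>F tensor_assoc (Cmax K G1) (Cmax K G2) (Cmax K G3))"
    proof (intro cstar_arrow_eqI)
      show s: "cstar_category ((Cmax K G1 \<otimes>\<^sub>m Cmax K G2) \<otimes>\<^sub>m Cmax K G3)" by (rule cstar_category_max_tensor[OF P12.cT c3])
      show t: "cstar_category (Cmax K (G1 \<times>\<^sub>C (G2 \<times>\<^sub>C G3)))" by (rule P1_23.cGH)
      show l: "star_functor ((Cmax K G1 \<otimes>\<^sub>m Cmax K G2) \<otimes>\<^sub>m Cmax K G3) (Cmax K (G1 \<times>\<^sub>C (G2 \<times>\<^sub>C G3)))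
         (Cmax_fun K ((G1 \<times>\<^sub>C G2) \<times>\<^sub>C G3) (G1 \<times>\<^sub>C (G2 \<times>\<^sub>C G3)) prod_assoc
          \<circ>\<^sub>F gpd_mu_inv K (G1 \<times>\<^sub>C G2) G3
          \<circ>\<^sub>F tensor_fun (Cmax K G1 \<otimes>\<^sub>m Cmax K G2) (Cmax K G3) (Cmax K (G1 \<times>\<^sub>C G2)) (Cmax K G3)
                (gpd_mu_inv K G1 G2) fid)"
        by (rule star_functor_fcomp[OF star_functor_fcomp[OF L(1) P12_3.gpd_mu_inv(1)] A(1)])
      show r: "star_functor ((Cmax K G1 \<otimes>\<^sub>m Cmax K G2) \<otimes>\<^sub>m Cmax K G3) (Cmax K (G1 \<times>\<^sub>C (G2 \<times>\<^sub>C G3)))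
         (gpd_mu_inv K G1 (G2 \<times>\<^sub>C G3)
          \<circ>\<^sub>F tensor_fun (Cmax K G1) (Cmax K G2 \<otimes>\<^sub>m Cmax K G3) (Cmax K G1) (Cmax K (G2 \<times>\<^sub>C G3))
                fid (gpd_mu_inv K G2 G3)
          \<circ>\<^sub>F tensor_assoc (Cmax K G1) (Cmax K G2) (Cmax K G3))"
        by (rule star_functor_fcomp[OF star_functor_fcomp[OF S(1) R(1)] P1_23.gpd_mu_inv(1)])
      \<comment> \<open>On the threefold elementary tensor of the images of g, h and k, both sides
        give the image of (g, (h, k)).\<close>
      show "fun_eq ((Cmax K G1 \<otimes>\<^sub>m Cmax K G2) \<otimes>\<^sub>m Cmax K G3)
         (Cmax_fun K ((G1 \<times>\<^sub>C G2) \<times>\<^sub>C G3) (G1 \<times>\<^sub>C (G2 \<times>\<^sub>C G3)) prod_assoc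
          \<circ>\<^sub>F gpd_mu_inv K (G1 \<times>\<^sub>C G2) G3
          \<circ>\<^sub>F tensor_fun (Cmax K G1 \<otimes>\<^sub>m Cmax K G2) (Cmax K G3) (Cmax K (G1 \<times>\<^sub>C G2)) (Cmax K G3)
                (gpd_mu_inv K G1 G2) fid)
         (gpd_mu_inv K G1 (G2 \<times>\<^sub>C G3)
          \<circ>\<^sub>F tensor_fun (Cmax K G1) (Cmax K G2 \<otimes>\<^sub>m Cmax K G3) (Cmax K G1) (Cmax K (G2 \<times>\<^sub>C G3))
                fid (gpd_mu_inv K G2 G3)
          \<circ>\<^sub>F tensor_assoc (Cmax K G1) (Cmax K G2) (Cmax K G3))"
        by (rule star_functor_eqI[OF s t l r total_max_tensor[OF P12.cT c3 total_max_tensor[OF c1 c2 t1 t2] t3]])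
          (auto simp: L R A SE P12.gpd_mu_inv P23.gpd_mu_inv P12_3.gpd_mu_inv P1_23.gpd_mu_inv
            r1 r2 r3 e12 e23)
    qed
  next
    note A = Cmax_fun[OF PO1.GH assms(1) is_functor_structural(3), where K = K]
    note L = tensor_fun[OF cK c1 cO c1 gpd_eps(1) fid1]
    note bif = star_bifunctor_scalar_left[OF c1]
    note S = tensor_extend_eval[OF cstar_category_unit_cstar c1 c1 bif, folded tensor_lunit_def]
    interpret C1: cstar_category "Cmax K G1" by (rule c1)
    show "cstar_arrow_eq (unit_cstar K \<otimes>\<^sub>m Cmax K G1) (Cmax K G1)
         (Cmax_fun K (one_gpd \<times>\<^sub>C G1) G1 prod_lunit
          \<circ>\<^sub>F gpd_mu_inv K one_gpd G1
          \<circ>\<^sub>F tensor_fun (unit_cstar K) (Cmax K G1) (Cmax K one_gpd) (Cmax K G1) (gpd_eps K) fid)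
         (tensor_lunit (Cmax K G1))"
    proof (intro cstar_arrow_eqI c1)
      show s: "cstar_category (unit_cstar K \<otimes>\<^sub>m Cmax K G1)" by (rule cstar_category_max_tensor[OF cK c1])
      show l: "star_functor (unit_cstar K \<otimes>\<^sub>m Cmax K G1) (Cmax K G1)
         (Cmax_fun K (one_gpd \<times>\<^sub>C G1) G1 prod_lunit \<circ>\<^sub>F gpd_mu_inv K one_gpd G1
          \<circ>\<^sub>F tensor_fun (unit_cstar K) (Cmax K G1) (Cmax K one_gpd) (Cmax K G1) (gpd_eps K) fid)"
        by (rule star_functor_fcomp[OF star_functor_fcomp[OF L(1) PO1.gpd_mu_inv(1)] A(1)])
      \<comment> \<open>\<open>tensor_lunit\<close> is formed with \<open>TYPE('f)\<close>, the
        statement with K. Unfolding \<open>unit_cstar_def\<close>, whose right-hand side does not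
        mention the token, identifies the two unit categories, here and in the simplification
        below.\<close>
      show r: "star_functor (unit_cstar K \<otimes>\<^sub>m Cmax K G1) (Cmax K G1) (tensor_lunit (Cmax K G1))"
        using star_functor_tensor_extend[OF cstar_category_unit_cstar c1 c1 bif] by (simp add: tensor_lunit_def unit_cstar_def)
      show "fun_eq (unit_cstar K \<otimes>\<^sub>m Cmax K G1)
         (Cmax_fun K (one_gpd \<times>\<^sub>C G1) G1 prod_lunit \<circ>\<^sub>F gpd_mu_inv K one_gpd G1
          \<circ>\<^sub>F tensor_fun (unit_cstar K) (Cmax K G1) (Cmax K one_gpd) (Cmax K G1) (gpd_eps K) fid)
         (tensor_lunit (Cmax K G1))"
        by (rule star_functor_eqI[OF s c1 l r total_max_tensor[OF cK c1 total_unit_cstar t1]])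
          (auto simp: L A PO1.gpd_mu_inv gpd_eps(3) r1 rO C1.hom_scl_one
            S[unfolded unit_cstar_def, folded unit_cstar_def[of K]])
    qed
  next
    note A = Cmax_fun[OF P1O.GH assms(1) is_functor_structural(4), where K = K]
    note L = tensor_fun[OF c1 cK c1 cO fid1 gpd_eps(1)]
    note bif = star_bifunctor_scalar_right[OF c1]
    note S = tensor_extend_eval[OF c1 cstar_category_unit_cstar c1 bif, folded tensor_runit_def]
    interpret C1: cstar_category "Cmax K G1" by (rule c1)
    show "cstar_arrow_eq (Cmax K G1 \<otimes>\<^sub>m unit_cstar K) (Cmax K G1)
         (Cmax_fun K (G1 \<times>\<^sub>C one_gpd) G1 prod_runit
          \<circ>\<^sub>F gpd_mu_inv K G1 one_gpd
          \<circ>\<^sub>F tensor_fun (Cmax K G1) (unit_cstar K) (Cmax K G1) (Cmax K one_gpd) fid (gpd_eps K))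
         (tensor_runit (Cmax K G1))"
    proof (intro cstar_arrow_eqI c1)
      show s: "cstar_category (Cmax K G1 \<otimes>\<^sub>m unit_cstar K)" by (rule cstar_category_max_tensor[OF c1 cK])
      show l: "star_functor (Cmax K G1 \<otimes>\<^sub>m unit_cstar K) (Cmax K G1)
         (Cmax_fun K (G1 \<times>\<^sub>C one_gpd) G1 prod_runit \<circ>\<^sub>F gpd_mu_inv K G1 one_gpd
          \<circ>\<^sub>F tensor_fun (Cmax K G1) (unit_cstar K) (Cmax K G1) (Cmax K one_gpd) fid (gpd_eps K))"
        by (rule star_functor_fcomp[OF star_functor_fcomp[OF L(1) P1O.gpd_mu_inv(1)] A(1)])
      show r: "star_functor (Cmax K G1 \<otimes>\<^sub>m unit_cstar K) (Cmax K G1) (tensor_runit (Cmax K G1))"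
        using star_functor_tensor_extend[OF c1 cstar_category_unit_cstar c1 bif] by (simp add: tensor_runit_def unit_cstar_def)
      show "fun_eq (Cmax K G1 \<otimes>\<^sub>m unit_cstar K)
         (Cmax_fun K (G1 \<times>\<^sub>C one_gpd) G1 prod_runit \<circ>\<^sub>F gpd_mu_inv K G1 one_gpd
          \<circ>\<^sub>F tensor_fun (Cmax K G1) (unit_cstar K) (Cmax K G1) (Cmax K one_gpd) fid (gpd_eps K))
         (tensor_runit (Cmax K G1))"
        by (rule star_functor_eqI[OF s c1 l r total_max_tensor[OF c1 cK t1 total_unit_cstar]])
          (auto simp: L A P1O.gpd_mu_inv gpd_eps(3) r1 rO C1.hom_scl_one
            S[unfolded unit_cstar_def, folded unit_cstar_def[of K]])
    qed
  next
    note A = Cmax_fun[OF P12.GH P21.GH is_functor_structural(5), where K = K]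
    note bif = star_bifunctor_swap[OF P21.eT]
    note S = tensor_extend_eval[OF c1 c2 P21.cT bif, folded tensor_swap_def]
    show "cstar_arrow_eq (Cmax K G1 \<otimes>\<^sub>m Cmax K G2) (Cmax K (G2 \<times>\<^sub>C G1))
         (Cmax_fun K (G1 \<times>\<^sub>C G2) (G2 \<times>\<^sub>C G1) prod_swap \<circ>\<^sub>F gpd_mu_inv K G1 G2)
         (gpd_mu_inv K G2 G1 \<circ>\<^sub>F tensor_swap (Cmax K G1) (Cmax K G2))"
    proof (intro cstar_arrow_eqI P12.cT P21.cGH)
      show l: "star_functor (Cmax K G1 \<otimes>\<^sub>m Cmax K G2) (Cmax K (G2 \<times>\<^sub>C G1))
          (Cmax_fun K (G1 \<times>\<^sub>C G2) (G2 \<times>\<^sub>C G1) prod_swap \<circ>\<^sub>F gpd_mu_inv K G1 G2)"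
        by (rule star_functor_fcomp[OF P12.gpd_mu_inv(1) A(1)])
      show r: "star_functor (Cmax K G1 \<otimes>\<^sub>m Cmax K G2) (Cmax K (G2 \<times>\<^sub>C G1))
          (gpd_mu_inv K G2 G1 \<circ>\<^sub>F tensor_swap (Cmax K G1) (Cmax K G2))"
        unfolding tensor_swap_def
        by (rule star_functor_fcomp[OF star_functor_tensor_extend[OF c1 c2 P21.cT bif] P21.gpd_mu_inv(1)])
      show "fun_eq (Cmax K G1 \<otimes>\<^sub>m Cmax K G2)
          (Cmax_fun K (G1 \<times>\<^sub>C G2) (G2 \<times>\<^sub>C G1) prod_swap \<circ>\<^sub>F gpd_mu_inv K G1 G2)
          (gpd_mu_inv K G2 G1 \<circ>\<^sub>F tensor_swap (Cmax K G1) (Cmax K G2))"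
        by (rule star_functor_eqI[OF P12.cT P21.cGH l r total_max_tensor[OF c1 c2 t1 t2]])
          (auto simp: A S P12.gpd_mu_inv P21.gpd_mu_inv r1 r2)
    qed
  qed
qed

end
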